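(* Let $K$ be a field, $n\ge 2$, and let $\mathbb{X}$ be a reduced $0$-dimensional scheme in $\mathbb{P}^n_K$ with $\deg(\mathbb{X})\ge 2$, where $\operatorname{char}(K)=0$ or $\operatorname{char}(K)>\deg(\mathbb{X})$ and no closed point of $\mathbb{X}$ lies on $\{X_0=0\}$. Let $\alpha_{\mathbb{X}}=\min\{i\in\mathbb{N}\mid(I_{\mathbb{X}})_i\neq 0\}$, let $r_{\mathbb{X}}$ be the regularity index of $\operatorname{HF}_{\mathbb{X}}$, let $\vartheta_{\mathbb{X}}$ be the Kähler different of $\mathbb{X}$, and let $\mathfrak{F}_{\widetilde{R}/R}$ be the conductor of $R$ in $\widetilde{R}$. Then the following conditions are equivalent: (a) $\mathbb{X}$ is in generic position with $\deg(\mathbb{X})=\binom{n+\alpha_{\mathbb{X}}-1}{n}$. (b) The Hilbert function of the Kähler different is given by $$\operatorname{HF}_{\vartheta_{\mathbb{X}}}(i)=\begin{cases}0&\text{if } i<nr_{\mathbb{X}},\\ \deg(\mathbb{X})&\text{if } i\ge nr_{\mathbb{X}}.\end{cases}$$ (c) $\mathbb{X}$ is a CB-scheme and $\vartheta_{\mathbb{X}}=\mathfrak{F}^n_{\widetilde{R}/R}$ (the $n$-th power of the ideal $\mathfrak{F}_{\widetilde{R}/R}$).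
   Context: Let $P=K[X_0,\dots,X_n]$ with the standard grading, $I_{\mathbb{X}}\subseteq P$ the (saturated) homogeneous vanishing ideal of $\mathbb{X}$, $R=P/I_{\mathbb{X}}$, and $x_i$ the image of $X_i$ in $R$; $x_0$ is a non-zerodivisor of $R$. $\operatorname{Supp}(\mathbb{X})=\{p_1,\dots,p_s\}$ is the set of closed points, $K(p_j)$ the residue field at $p_j$, $\kappa_j=\dim_K K(p_j)$, and $\mathcal{O}_{\mathbb{X},p_j}$ the local ring. With $S=R/\langle x_0-1\rangle$ we have $S\cong\prod_{j=1}^s\mathcal{O}_{\mathbb{X},p_j}$. For a finitely generated graded $R$-module $M$, $\operatorname{HF}_M(i)=\dim_K M_i$; $\operatorname{HF}_{\mathbb{X}}=\operatorname{HF}_R$; $r_{\mathbb{X}}=\min\{i\mid\operatorname{HF}_{\mathbb{X}}(j)=\deg(\mathbb{X})\text{ for all }j\ge i\}$. $\mathbb{X}$ is in generic position if $\operatorname{HF}_{\mathbb{X}}(i)=\min\{\deg(\mathbb{X}),\binom{n+i}{n}\}$ for all $i\in\mathbb{Z}$. The Kähler different $\vartheta_{\mathbb{X}}=F_0(\Omega^1_{R/K[x_0]})$ is the homogeneous ideal of $R$ generated by all $n\times n$ minors of $(\partial F_j/\partial x_i)_{i=1,\dots,n;\,j=1,\dots,r}$, where $F_1,\dots,F_r$ is any homogeneous system of generators of $I_{\mathbb{X}}$ and $\partial F_j/\partial x_i$ is the image of $\partial F_j/\partial X_i$ in $R$. Let $Q^h(R)\cong S[x_0,x_0^{-1}]$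 be the localization of $R$ at all homogeneous non-zerodivisors, let $\tilde{\imath}:R\to S[x_0]$ be the injection sending $f\in R_i$ to $f^{\rm deh}x_0^i$ ($f^{\rm deh}$ the image of $f$ in $S$), and view $R$ as a subring of $\widetilde{R}=S[x_0]$. The conductor is $\mathfrak{F}_{\widetilde{R}/R}=\{f\in Q^h(R)\mid f\cdot\widetilde{R}\subseteq R\}$, an ideal of both $R$ and $\widetilde{R}$. CB-scheme: A maximal $p_j$-subscheme of $\mathbb{X}$ is a (possibly empty) subscheme $\mathbb{Y}\subseteq\mathbb{X}$ with $\mathcal{O}_{\mathbb{Y},p_j}\ne\mathcal{O}_{\mathbb{X},p_j}$, $\mathcal{O}_{\mathbb{Y},p_k}=\mathcal{O}_{\mathbb{X},p_k}$ for $k\neq j$, and $\deg(\mathbb{Y})=\deg(\mathbb{X})-\kappa_j$. The kernel of $\mathcal{O}_{\mathbb{X},p_j}\to\mathcal{O}_{\mathbb{Y},p_j}$ is then $\langle s_j\rangle$ for a non-zero socle element $s_j$. For $a\in\mathcal{O}_{\mathbb{X},p_j}$ let $\mu(a)=\min\{i\in\mathbb{N}\mid(0,\dots,0,a,0,\dots,0)x_0^i\in\tilde{\imath}(R)\}$ ($a$ in position $j$). Let $e_{j1},\dots,e_{j\kappa_j}\in\mathcal{O}_{\mathbb{X},p_j}$ have residue classes forming a $K$-basis of $K(p_j)$, and put $\mu_{\mathbb{Y}/\mathbb{X}}=\max_k\mu(e_{jk}s_j)$ (independent of choices). Set $\deg_{\mathbb{X}}(p_j)=\min\{\mu_{\mathbb{Y}/\mathbb{X}}\mid\mathbb{Y}\text{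 a maximal }p_j\text{-subscheme of }\mathbb{X}\}$. $\mathbb{X}$ is a CB-scheme if $\deg_{\mathbb{X}}(p_j)=r_{\mathbb{X}}$ for all $j=1,\dots,s$. *)

theory Defs
  imports
    "HOL-Algebra.Algebra"
    "HOL-Library.Poly_Mapping"
    "Jordan_Normal_Form.Determinant"
begin

section \<open>The polynomial ring and its grading\<close>

text \<open>A polynomial in the indeterminates \<open>X\<^sub>0, X\<^sub>1, \<dots>\<close> is a finitely supported family of
  coefficients indexed by exponent vectors. Degrees are integers, so that the homogeneous
  component of negative degree is \<open>0\<close>.\<close>

type_synonym 'k mpoly = "(nat \<Rightarrow>\<^sub>0 nat) \<Rightarrow>\<^sub>0 'k"

definition mpoly_ring :: "nat \<Rightarrow> 'k::field mpoly ring" where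
  "mpoly_ring n = \<lparr>carrier = {f. \<forall>m\<in>Poly_Mapping.keys f. Poly_Mapping.keys m \<subseteq> {..n}},
     monoid.mult = (*), one = 1, ring.zero = 0, add = (+)\<rparr>"

definition Cst :: "'k::field \<Rightarrow> 'k mpoly" where
  "Cst c = Poly_Mapping.single 0 c"

definition indet :: "nat \<Rightarrow> 'k::field mpoly" where
  "indet i = Poly_Mapping.single (Poly_Mapping.single i 1) 1"

definition mdeg :: "(nat \<Rightarrow>\<^sub>0 nat) \<Rightarrow> nat" where
  "mdeg m = (\<Sum>i\<in>Poly_Mapping.keys m. Poly_Mapping.lookup m i)"

definition homog :: "int \<Rightarrow> 'k::field mpoly \<Rightarrow> bool" where
  "homog d f \<longleftrightarrow> (\<forall>m\<in>Poly_Mapping.keys f. int (mdeg m) = d)"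

definition hcomp :: "int \<Rightarrow> 'k::field mpoly \<Rightarrow> 'k mpoly" where
  "hcomp d f = (\<Sum>m | m \<in> Poly_Mapping.keys f \<and> int (mdeg m) = d.
     Poly_Mapping.single m (Poly_Mapping.lookup f m))"

text \<open>If \<open>X\<^sub>i\<close> does not divide \<open>m\<close>, the truncated exponent is harmless: the coefficient is \<open>0\<close>.\<close>

definition pdiff :: "nat \<Rightarrow> 'k::field mpoly \<Rightarrow> 'k mpoly" where
  "pdiff i f = (\<Sum>m\<in>Poly_Mapping.keys f. Poly_Mapping.single (m - Poly_Mapping.single i 1)
     (of_nat (Poly_Mapping.lookup m i) * Poly_Mapping.lookup f m))"

definition homogeneous_ideal :: "nat \<Rightarrow> 'k::field mpoly set \<Rightarrow> bool" where
  "homogeneous_ideal n I \<longleftrightarrow> ideal I (mpoly_ring n) \<and>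
     I = Idl\<^bsub>mpoly_ring n\<^esub> {f \<in> I. \<exists>d. homog d f}"

definition homogeneous_generators :: "nat \<Rightarrow> 'k::field mpoly list \<Rightarrow> 'k mpoly set \<Rightarrow> bool" where
  "homogeneous_generators n Fs I \<longleftrightarrow>
     set Fs \<subseteq> {f \<in> carrier (mpoly_ring n). \<exists>d. homog d f} \<and> I = Idl\<^bsub>mpoly_ring n\<^esub> (set Fs)"

text \<open>Dimension over \<open>K\<close> of a subspace \<open>V\<close> of a \<open>K\<close>-algebra \<open>A\<close> with structure map \<open>\<iota>\<close>.\<close>

definition kdim :: "('a, 'b) ring_scheme \<Rightarrow> ('k \<Rightarrow> 'a) \<Rightarrow> 'a set \<Rightarrow> nat" where
  "kdim A \<iota> V = ring.dim A (range \<iota>) V"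


section \<open>Subschemes of projective space and their local rings\<close>

text \<open>Closed subschemes of \<open>\<P>\<^sup>n\<close> over \<open>K\<close> correspond to saturated homogeneous ideals of
  \<open>K[X\<^sub>0,\<dots>,X\<^sub>n]\<close>; the empty scheme corresponds to the unit ideal. A scheme is represented by
  its ideal throughout, and inclusion of schemes is reverse inclusion of ideals.\<close>

definition proj_subscheme :: "nat \<Rightarrow> 'k::field mpoly set \<Rightarrow> bool" where
  "proj_subscheme n I \<longleftrightarrow> homogeneous_ideal n I \<and>
     (\<forall>f\<in>carrier (mpoly_ring n). (\<forall>i\<le>n. indet i * f \<in> I) \<longrightarrow> f \<in> I)"

definition points :: "nat \<Rightarrow> 'k::field mpoly set \<Rightarrow> 'k mpoly set set" where
  "points n I = {q. homogeneous_ideal n q \<and> primeideal q (mpoly_ring n) \<and>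
     \<not> indet ` {..n} \<subseteq> q \<and> I \<subseteq> q}"

definition closed_points :: "nat \<Rightarrow> 'k::field mpoly set \<Rightarrow> 'k mpoly set set" where
  "closed_points n I = {q \<in> points n I. \<forall>q'\<in>points n I. q \<subseteq> q' \<longrightarrow> q' = q}"

definition zero_dimensional :: "nat \<Rightarrow> 'k::field mpoly set \<Rightarrow> bool" where
  "zero_dimensional n I \<longleftrightarrow> points n I \<noteq> {} \<and> points n I = closed_points n I"

text \<open>The local ring at \<open>q\<close> is the degree-zero part of the localization of \<open>K[X\<^sub>0,\<dots>,X\<^sub>n]/I\<close> at
  the homogeneous elements outside \<open>q\<close>; its elements are classes of fractions with homogeneous
  numerator and denominator of the same degree. It is the zero ring if \<open>q\<close> is not a point of
  the scheme.\<close>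

definition hfracs :: "nat \<Rightarrow> 'k::field mpoly set \<Rightarrow> ('k mpoly \<times> 'k mpoly) set" where
  "hfracs n q = {(f, g). f \<in> carrier (mpoly_ring n) \<and> g \<in> carrier (mpoly_ring n) - q \<and>
     (\<exists>d. homog d f \<and> homog d g)}"

definition hfrac ::
  "nat \<Rightarrow> 'k::field mpoly set \<Rightarrow> 'k mpoly set \<Rightarrow> 'k mpoly \<Rightarrow> 'k mpoly \<Rightarrow> ('k mpoly \<times> 'k mpoly) set"
where
  "hfrac n I q f g = {(f', g') \<in> hfracs n q.
     \<exists>h\<in>carrier (mpoly_ring n) - q. (\<exists>d. homog d h) \<and> h * (f * g' - f' * g) \<in> I}"

definition local_ring ::
  "nat \<Rightarrow> 'k::field mpoly set \<Rightarrow> 'k mpoly set \<Rightarrow> ('k mpoly \<times> 'k mpoly) set ring" where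
  "local_ring n I q = \<lparr>
     carrier = {hfrac n I q f g |f g. (f, g) \<in> hfracs n q},
     monoid.mult = (\<lambda>a b. \<Union>(f, g)\<in>a. \<Union>(f', g')\<in>b. hfrac n I q (f * f') (g * g')),
     one = hfrac n I q 1 1,
     ring.zero = hfrac n I q 0 1,
     add = (\<lambda>a b. \<Union>(f, g)\<in>a. \<Union>(f', g')\<in>b. hfrac n I q (f * g' + f' * g) (g * g'))\<rparr>"

definition local_max :: "nat \<Rightarrow> 'k::field mpoly set \<Rightarrow> 'k mpoly set \<Rightarrow> ('k mpoly \<times> 'k mpoly) set set"
where
  "local_max n I q = {hfrac n I q f g |f g. (f, g) \<in> hfracs n q \<and> f \<in> q}"

definition residue_field ::
  "nat \<Rightarrow> 'k::field mpoly set \<Rightarrow> 'k mpoly set \<Rightarrow> ('k mpoly \<times> 'k mpoly) set set ring" where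
  "residue_field n I q = local_ring n I q Quot local_max n I q"

definition residue_class ::
  "nat \<Rightarrow> 'k::field mpoly set \<Rightarrow> 'k mpoly set \<Rightarrow>
    ('k mpoly \<times> 'k mpoly) set \<Rightarrow> ('k mpoly \<times> 'k mpoly) set set" where
  "residue_class n I q a = local_max n I q +>\<^bsub>local_ring n I q\<^esub> a"

definition local_const ::
  "nat \<Rightarrow> 'k::field mpoly set \<Rightarrow> 'k mpoly set \<Rightarrow> 'k \<Rightarrow> ('k mpoly \<times> 'k mpoly) set" where
  "local_const n I q c = hfrac n I q (Cst c) 1"

definition residue_const ::
  "nat \<Rightarrow> 'k::field mpoly set \<Rightarrow> 'k mpoly set \<Rightarrow> 'k \<Rightarrow> ('k mpoly \<times> 'k mpoly) set set" where
  "residue_const n I q c = residue_class n I q (local_const n I q c)"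

definition residue_degree :: "nat \<Rightarrow> 'k::field mpoly set \<Rightarrow> 'k mpoly set \<Rightarrow> nat" where
  "residue_degree n I q =
     kdim (residue_field n I q) (residue_const n I q) (carrier (residue_field n I q))"

definition reduced_scheme :: "nat \<Rightarrow> 'k::field mpoly set \<Rightarrow> bool" where
  "reduced_scheme n I \<longleftrightarrow> (\<forall>q\<in>points n I. \<forall>a\<in>carrier (local_ring n I q). \<forall>k::nat.
     a [^]\<^bsub>local_ring n I q\<^esub> k = \<zero>\<^bsub>local_ring n I q\<^esub> \<longrightarrow> a = \<zero>\<^bsub>local_ring n I q\<^esub>)"

definition scheme_degree :: "nat \<Rightarrow> 'k::field mpoly set \<Rightarrow> nat" where
  "scheme_degree n I = (\<Sum>q\<in>closed_points n I.
     kdim (local_ring n I q) (local_const n I q) (carrier (local_ring n I q)))"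


section \<open>The homogeneous coordinate ring and Hilbert functions\<close>

definition coord_ring :: "nat \<Rightarrow> 'k::field mpoly set \<Rightarrow> 'k mpoly set ring" where
  "coord_ring n I = mpoly_ring n Quot I"

definition coord :: "nat \<Rightarrow> 'k::field mpoly set \<Rightarrow> 'k mpoly \<Rightarrow> 'k mpoly set" where
  "coord n I f = I +>\<^bsub>mpoly_ring n\<^esub> f"

definition graded_part :: "nat \<Rightarrow> 'k::field mpoly set \<Rightarrow> int \<Rightarrow> 'k mpoly set set" where
  "graded_part n I i = coord n I ` {f \<in> carrier (mpoly_ring n). homog i f}"

text \<open>Hilbert function of a homogeneous ideal \<open>M\<close> of \<open>R\<close>.\<close>

definition HF :: "nat \<Rightarrow> 'k::field mpoly set \<Rightarrow> 'k mpoly set set \<Rightarrow> int \<Rightarrow> nat" where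
  "HF n I M i = kdim (coord_ring n I) (\<lambda>c. coord n I (Cst c)) (M \<inter> graded_part n I i)"

definition HFX :: "nat \<Rightarrow> 'k::field mpoly set \<Rightarrow> int \<Rightarrow> nat" where
  "HFX n I = HF n I (carrier (coord_ring n I))"

definition regularity_index :: "nat \<Rightarrow> 'k::field mpoly set \<Rightarrow> int" where
  "regularity_index n I = (LEAST i. \<forall>j\<ge>i. HFX n I j = scheme_degree n I)"

definition initial_degree :: "'k::field mpoly set \<Rightarrow> nat" where
  "initial_degree I = (LEAST i. \<exists>f\<in>I. f \<noteq> 0 \<and> homog (int i) f)"

text \<open>For \<open>i < 0\<close> the binomial coefficient \<open>(n + i) choose n\<close> is \<open>0\<close>; here \<open>nat\<close> truncates
  \<open>n + i\<close> to a natural number less than \<open>n\<close>, with the same effect (for \<open>n \<ge> 1\<close>).\<close>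

definition generic_position :: "nat \<Rightarrow> 'k::field mpoly set \<Rightarrow> bool" where
  "generic_position n I \<longleftrightarrow>
     (\<forall>i::int. HFX n I i = min (scheme_degree n I) (nat (int n + i) choose n))"


section \<open>The Kaehler different\<close>

text \<open>Row \<open>i\<close> and column \<open>k\<close> (counted from \<open>0\<close>) of the minor with columns \<open>js 0 < js 1 < \<dots>\<close>
  hold the derivative of \<open>F\<^bsub>js k\<^esub>\<close> by \<open>X\<^bsub>i+1\<^esub>\<close>; there is no row for \<open>X\<^sub>0\<close>. Minors are computed
  over \<open>K[X\<^sub>0,\<dots>,X\<^sub>n]\<close> and mapped to \<open>R\<close>, since \<^const>\<open>det\<close> lives over a type class.\<close>

definition jacobian_minors :: "nat \<Rightarrow> 'k::field mpoly list \<Rightarrow> 'k mpoly set" where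
  "jacobian_minors n Fs = {det (mat n n (\<lambda>(i, k). pdiff (Suc i) (Fs ! js k))) |js.
     strict_mono_on {..<n} js \<and> js ` {..<n} \<subseteq> {..<length Fs}}"

definition kaehler_different ::
  "nat \<Rightarrow> 'k::field mpoly set \<Rightarrow> 'k mpoly list \<Rightarrow> 'k mpoly set set" where
  "kaehler_different n I Fs = Idl\<^bsub>coord_ring n I\<^esub> (coord n I ` jacobian_minors n Fs)"


section \<open>The conductor\<close>

text \<open>\<open>S = R/\<langle>x\<^sub>0 - 1\<rangle>\<close>.\<close>

definition affine_ideal :: "nat \<Rightarrow> 'k::field mpoly set \<Rightarrow> 'k mpoly set set" where
  "affine_ideal n I = Idl\<^bsub>coord_ring n I\<^esub> {coord n I (indet 0) \<ominus>\<^bsub>coord_ring n I\<^esub> \<one>\<^bsub>coord_ring n I\<^esub>}"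

definition affine_ring :: "nat \<Rightarrow> 'k::field mpoly set \<Rightarrow> 'k mpoly set set ring" where
  "affine_ring n I = coord_ring n I Quot affine_ideal n I"

definition deh :: "nat \<Rightarrow> 'k::field mpoly set \<Rightarrow> 'k mpoly set \<Rightarrow> 'k mpoly set set" where
  "deh n I r = affine_ideal n I +>\<^bsub>coord_ring n I\<^esub> r"

text \<open>\<open>S[x\<^sub>0, x\<^sub>0\<^sup>-\<^sup>1]\<close>, with a Laurent polynomial given by its coefficient function.\<close>

definition laurent_ring :: "('a, 'b) ring_scheme \<Rightarrow> (int \<Rightarrow> 'a) ring" where
  "laurent_ring S = \<lparr>
     carrier = {\<phi>. range \<phi> \<subseteq> carrier S \<and> finite {i. \<phi> i \<noteq> \<zero>\<^bsub>S\<^esub>}},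
     monoid.mult = (\<lambda>\<phi> \<psi> k. finsum S (\<lambda>i. \<phi> i \<otimes>\<^bsub>S\<^esub> \<psi> (k - i)) {i. \<phi> i \<noteq> \<zero>\<^bsub>S\<^esub>}),
     one = (\<lambda>i. if i = 0 then \<one>\<^bsub>S\<^esub> else \<zero>\<^bsub>S\<^esub>),
     ring.zero = (\<lambda>i. \<zero>\<^bsub>S\<^esub>),
     add = (\<lambda>\<phi> \<psi> i. \<phi> i \<oplus>\<^bsub>S\<^esub> \<psi> i)\<rparr>"

definition laurent_monom :: "('a, 'b) ring_scheme \<Rightarrow> 'a \<Rightarrow> int \<Rightarrow> int \<Rightarrow> 'a" where
  "laurent_monom S s i = (\<lambda>j. if j = i then s else \<zero>\<^bsub>S\<^esub>)"

definition Qh :: "nat \<Rightarrow> 'k::field mpoly set \<Rightarrow> (int \<Rightarrow> 'k mpoly set set) ring" where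
  "Qh n I = laurent_ring (affine_ring n I)"

definition Rtilde :: "nat \<Rightarrow> 'k::field mpoly set \<Rightarrow> (int \<Rightarrow> 'k mpoly set set) set" where
  "Rtilde n I = {\<phi> \<in> carrier (Qh n I). \<forall>i<0. \<phi> i = \<zero>\<^bsub>affine_ring n I\<^esub>}"

text \<open>The injection of \<open>R\<close> into \<open>S[x\<^sub>0]\<close>: the class of \<open>f\<close> with homogeneous components \<open>f\<^sub>i\<close> is
  mapped to the sum of the \<open>f\<^sub>i\<^sup>d\<^sup>e\<^sup>h x\<^sub>0\<^sup>i\<close>. The value does not depend on the representative,
  because \<open>I\<close> is homogeneous.\<close>

definition emb :: "nat \<Rightarrow> 'k::field mpoly set \<Rightarrow> 'k mpoly set \<Rightarrow> int \<Rightarrow> 'k mpoly set set" where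
  "emb n I r = the_elem ((\<lambda>f i. deh n I (coord n I (hcomp i f))) ` r)"

definition Remb :: "nat \<Rightarrow> 'k::field mpoly set \<Rightarrow> (int \<Rightarrow> 'k mpoly set set) ring" where
  "Remb n I = Qh n I \<lparr>carrier := emb n I ` carrier (coord_ring n I)\<rparr>"

definition conductor :: "nat \<Rightarrow> 'k::field mpoly set \<Rightarrow> (int \<Rightarrow> 'k mpoly set set) set" where
  "conductor n I = {\<phi> \<in> carrier (Qh n I). \<forall>\<psi>\<in>Rtilde n I. \<phi> \<otimes>\<^bsub>Qh n I\<^esub> \<psi> \<in> carrier (Remb n I)}"

definition ideal_power :: "('a, 'b) ring_scheme \<Rightarrow> 'a set \<Rightarrow> nat \<Rightarrow> 'a set" where
  "ideal_power A J k = ((\<lambda>L. ideal_prod A J L) ^^ k) (carrier A)"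


section \<open>Cayley-Bacharach schemes\<close>

text \<open>Component at \<open>q\<close> of the isomorphism from \<open>S\<close> to the product of the local rings, which
  sends the class of \<open>f\<close> with homogeneous components \<open>f\<^sub>i\<close> to the sum of the \<open>f\<^sub>i/X\<^sub>0\<^sup>i\<close>.\<close>

definition germ ::
  "nat \<Rightarrow> 'k::field mpoly set \<Rightarrow> 'k mpoly set \<Rightarrow> 'k mpoly set set \<Rightarrow> ('k mpoly \<times> 'k mpoly) set"
where
  "germ n I q s = the_elem ((\<lambda>f. finsum (local_ring n I q)
     (\<lambda>i. hfrac n I q (hcomp (int i) f) (indet 0 ^ i)) (mdeg ` Poly_Mapping.keys f)) ` \<Union>s)"

definition mu :: "nat \<Rightarrow> 'k::field mpoly set \<Rightarrow> 'k mpoly set \<Rightarrow> ('k mpoly \<times> 'k mpoly) set \<Rightarrow> nat"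
where
  "mu n I q a = (LEAST i. \<exists>s\<in>carrier (affine_ring n I).
     (\<forall>q'\<in>closed_points n I. germ n I q' s = (if q' = q then a else \<zero>\<^bsub>local_ring n I q'\<^esub>)) \<and>
     laurent_monom (affine_ring n I) s (int i) \<in> carrier (Remb n I))"

text \<open>The canonical surjection of local rings for the subscheme defined by \<open>J \<supseteq> I\<close>.\<close>

definition restrict_germ ::
  "nat \<Rightarrow> 'k::field mpoly set \<Rightarrow> 'k mpoly set \<Rightarrow> ('k mpoly \<times> 'k mpoly) set \<Rightarrow> ('k mpoly \<times> 'k mpoly) set"
where
  "restrict_germ n J q a = (\<Union>(f, g)\<in>a. hfrac n J q f g)"

definition maximal_subscheme ::
  "nat \<Rightarrow> 'k::field mpoly set \<Rightarrow> 'k mpoly set \<Rightarrow> 'k mpoly set \<Rightarrow> bool" where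
  "maximal_subscheme n I q J \<longleftrightarrow> proj_subscheme n J \<and> I \<subseteq> J \<and>
     restrict_germ n J q \<notin> ring_iso (local_ring n I q) (local_ring n J q) \<and>
     (\<forall>q'\<in>closed_points n I. q' \<noteq> q \<longrightarrow>
        restrict_germ n J q' \<in> ring_iso (local_ring n I q') (local_ring n J q')) \<and>
     scheme_degree n J + residue_degree n I q = scheme_degree n I"

definition socle :: "nat \<Rightarrow> 'k::field mpoly set \<Rightarrow> 'k mpoly set \<Rightarrow> ('k mpoly \<times> 'k mpoly) set set" where
  "socle n I q = {a \<in> carrier (local_ring n I q).
     \<forall>t\<in>local_max n I q. t \<otimes>\<^bsub>local_ring n I q\<^esub> a = \<zero>\<^bsub>local_ring n I q\<^esub>}"

definition socle_generator ::
  "nat \<Rightarrow> 'k::field mpoly set \<Rightarrow> 'k mpoly set \<Rightarrow> 'k mpoly set \<Rightarrow> ('k mpoly \<times> 'k mpoly) set \<Rightarrow> bool"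
where
  "socle_generator n I q J s \<longleftrightarrow> s \<in> socle n I q \<and> s \<noteq> \<zero>\<^bsub>local_ring n I q\<^esub> \<and>
     a_kernel (local_ring n I q) (local_ring n J q) (restrict_germ n J q) = PIdl\<^bsub>local_ring n I q\<^esub> s"

definition residue_basis ::
  "nat \<Rightarrow> 'k::field mpoly set \<Rightarrow> 'k mpoly set \<Rightarrow> ('k mpoly \<times> 'k mpoly) set list \<Rightarrow> bool" where
  "residue_basis n I q es \<longleftrightarrow> set es \<subseteq> carrier (local_ring n I q) \<and>
     ring.independent (residue_field n I q) (range (residue_const n I q))
       (map (residue_class n I q) es) \<and>
     ring.Span (residue_field n I q) (range (residue_const n I q))
       (map (residue_class n I q) es) = carrier (residue_field n I q)"

text \<open>\<open>m\<close> is the number \<open>\<mu>\<^bsub>Y/X\<^esub>\<close>. It does not depend on the choice of \<open>s\<close> and \<open>es\<close>; it is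
  rendered as a relation so that no choice has to be made.\<close>

definition mu_subscheme ::
  "nat \<Rightarrow> 'k::field mpoly set \<Rightarrow> 'k mpoly set \<Rightarrow> 'k mpoly set \<Rightarrow> nat \<Rightarrow> bool" where
  "mu_subscheme n I q J m \<longleftrightarrow> (\<exists>s es. socle_generator n I q J s \<and> residue_basis n I q es \<and>
     m = Max ((\<lambda>e. mu n I q (e \<otimes>\<^bsub>local_ring n I q\<^esub> s)) ` set es))"

definition point_degree :: "nat \<Rightarrow> 'k::field mpoly set \<Rightarrow> 'k mpoly set \<Rightarrow> nat" where
  "point_degree n I q = (LEAST m. \<exists>J. maximal_subscheme n I q J \<and> mu_subscheme n I q J m)"

definition CB_scheme :: "nat \<Rightarrow> 'k::field mpoly set \<Rightarrow> bool" where
  "CB_scheme n I \<longleftrightarrow> (\<forall>q\<in>closed_points n I. int (point_degree n I q) = regularity_index n I)"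

end

(* All three conditions are equivalent to (A): no non-zero form of degree at most r = r_X vanishes on X.
   Let S = P/(I, X_0 - 1), let V_i be the image of the forms of degree i in S, and d = dim S = deg X.

   (a) iff (A): dim V_i is the Hilbert function, and it equals d exactly for i >= r.

   (A) implies (b): since the trace form of S is non-degenerate, S has a separability idempotent
   G = sum_b u_b (x) v_b for dual bases u, v, with (X_i - Y_i) G = 0 in the tensor square of S. Lifting
   the u_b to forms of degree r, the coefficients of (X_i - Y_i) G with respect to the v_b give elements
   h_ib of I of degree r + 1. The Jacobian determinant of the h_ib is congruent to G^n = G, and
   contracting it against Tr(c _) exhibits every c in S as a combination of n x n minors, all of degree
   n r; below that degree the minors vanish, because (A) forces generators of I to have degree > r.

   (b) implies (A): for a form f in I of minimal degree k <= r some partial derivative of f is not in I,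
   and replacing one h_ib by f yields a non-zero minor of degree less than n r.

   (c): X is a CB-scheme iff no component of S at a point is contained in V_(r-1). This follows from (A),
   and it implies that the conductor is x_0^r S[x_0], whose n-th power is x_0^(n r) S[x_0]. *)
theory Submission
  imports Defs
begin

section \<open>Polynomials, derivatives and homogeneous ideals, as subsets of a ring type\<close>

section \<open>Polynomials\<close>

text \<open>Think of the tensor square of S as functions on pairs of geometric points: G is 1 on the
  diagonal and 0 off it. The derivative of (X_i - Y_i) G by X_l is [l = i] G + (X_i - Y_i) Z_l,
  where Z_l is the derivative of G. On the diagonal this matrix is the identity; off it, it is the
  product of a column and a row, whose determinant vanishes because n >= 2. So the determinant is G
  although nothing is known about generators of I.

  The degree r + 1 of the relations comes from rewriting X_i u_b as X_0 times a form of degree r,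
  which is possible because V_r = S.

  The bound on the characteristic enters twice: the trace of an idempotent is its rank, a number
  from 1 to d, and exponents in forms of degree at most r < d must stay non-zero in K.

  In (c) the CB property is what computes the conductor; afterwards the equation with its n-th power
  is (b) in another form, since the different always fills S in degrees at least n r.

  Tensors modulo the ideal are compared through contractions with functionals that vanish on the
  ideal, so that determinants can be taken over polynomial types.\<close>

lemma pm_induct [case_names zero single add]:
  fixes f :: "'a \<Rightarrow>\<^sub>0 'b::comm_monoid_add"
  assumes "Q 0" "\<And>m c. Q (Poly_Mapping.single m c)" "\<And>f g. Q f \<Longrightarrow> Q g \<Longrightarrow> Q (f + g)"
  shows "Q f"
proof (induction f rule: update_induct)
  case const
  then show ?case using assms(1) by simp
next
  case (update f a b)
  have "Poly_Mapping.update a b f = f + Poly_Mapping.single a b"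
    using update by (intro poly_mapping_eqI)
      (auto simp: lookup_update lookup_add lookup_single when_def in_keys_iff)
  then show ?case using update assms by simp
qed

abbreviation lkp where "lkp \<equiv> Poly_Mapping.lookup"

lemma sum_singles: "f = (\<Sum>m\<in>Poly_Mapping.keys f. Poly_Mapping.single m (lkp f m))"
  by (intro poly_mapping_eqI) (auto simp: lookup_sum lookup_single when_def in_keys_iff sum.delta')

lemma mdeg_superset:
  "finite A \<Longrightarrow> Poly_Mapping.keys m \<subseteq> A \<Longrightarrow> mdeg m = (\<Sum>i\<in>A. lkp m i)"
  unfolding mdeg_def by (rule sum.mono_neutral_left) (auto simp: in_keys_iff)

lemma mdeg_add: "mdeg (m + m') = mdeg m + mdeg m'"
proof -
  let ?A = "Poly_Mapping.keys m \<union> Poly_Mapping.keys m'"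
  have "mdeg (m + m') = (\<Sum>i\<in>?A. lkp (m + m') i)"
    by (rule mdeg_superset) (simp_all add: keys_add)
  also have "\<dots> = (\<Sum>i\<in>?A. lkp m i) + (\<Sum>i\<in>?A. lkp m' i)"
    by (simp add: lookup_add sum.distrib)
  also have "(\<Sum>i\<in>?A. lkp m i) = mdeg m" by (rule mdeg_superset[symmetric]) auto
  also have "(\<Sum>i\<in>?A. lkp m' i) = mdeg m'" by (rule mdeg_superset[symmetric]) auto
  finally show ?thesis .
qed

lemma mdeg_single [simp]: "mdeg (Poly_Mapping.single i k) = k"
  by (simp add: mdeg_def)

lemma mdeg_zero [simp]: "mdeg 0 = 0"
  by (simp add: mdeg_def)

lemma lookup_le_mdeg: "lkp m i \<le> mdeg m"
  unfolding mdeg_def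
  by (cases "i \<in> Poly_Mapping.keys m") (auto simp: in_keys_iff intro: member_le_sum)

lemma lookup_hcomp: "lkp (hcomp d f) m = (if int (mdeg m) = d then lkp f m else 0)"
  unfolding hcomp_def lookup_sum lookup_single when_def
  by (auto simp: sum.delta' in_keys_iff)

lemma hcomp_add: "hcomp d (f + g) = hcomp d f + hcomp d g"
  by (intro poly_mapping_eqI) (simp add: lookup_hcomp lookup_add)

lemma hcomp_zero [simp]: "hcomp d 0 = 0"
  by (intro poly_mapping_eqI) (simp add: lookup_hcomp)

lemma hcomp_minus: "hcomp d (f - g) = hcomp d f - hcomp d g"
  by (intro poly_mapping_eqI) (simp add: lookup_hcomp lookup_minus)

lemma hcomp_sum: "hcomp d (sum F A) = (\<Sum>a\<in>A. hcomp d (F a))"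
  by (induction A rule: infinite_finite_induct) (auto simp: hcomp_add)

lemma homog_iff: "homog d f \<longleftrightarrow> (\<forall>m. lkp f m \<noteq> 0 \<longrightarrow> int (mdeg m) = d)"
  by (auto simp: homog_def in_keys_iff)

lemma homog_hcomp [simp]: "homog d (hcomp d f)"
  by (auto simp: homog_iff lookup_hcomp split: if_splits)

lemma hcomp_same: "homog d f \<Longrightarrow> hcomp d f = f"
  by (intro poly_mapping_eqI) (auto simp: lookup_hcomp homog_iff)

lemma hcomp_other: "homog d f \<Longrightarrow> d \<noteq> e \<Longrightarrow> hcomp e f = 0"
  by (intro poly_mapping_eqI) (auto simp: lookup_hcomp homog_iff)

lemma hcomp_homog: "homog d f \<Longrightarrow> hcomp e f = (if e = d then f else 0)"
  by (auto simp: hcomp_same hcomp_other)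

lemma homog_zero [simp]: "homog d 0" by (simp add: homog_def)
lemma homog_one [simp]: "homog 0 1" by (simp add: homog_def)
lemma homog_add: "homog d f \<Longrightarrow> homog d g \<Longrightarrow> homog d (f + g)"
  by (auto simp: homog_iff lookup_add) (metis add_0)
lemma homog_uminus: "homog d f \<Longrightarrow> homog d (- f)"
  by (auto simp: homog_iff)
lemma homog_diff: "homog d f \<Longrightarrow> homog d g \<Longrightarrow> homog d (f - g)"
  using homog_add[of d f "- g"] homog_uminus[of d g] by simp
lemma homog_sum: "(\<And>a. a \<in> A \<Longrightarrow> homog d (F a)) \<Longrightarrow> homog d (sum F A)"
  by (induction A rule: infinite_finite_induct) (auto simp: homog_add)
lemma homog_mult: "homog d f \<Longrightarrow> homog e g \<Longrightarrow> homog (d + e) (f * g)"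
  using keys_mult[of f g] by (fastforce simp: homog_def mdeg_add)
lemma homog_Cst [simp]: "homog 0 (Cst c)"
  by (auto simp: homog_iff Cst_def lookup_single when_def)
lemma homog_Cst_mult: "homog d f \<Longrightarrow> homog d (Cst c * f)"
  using homog_mult[of 0 "Cst c" d f] by simp
lemma homog_indet [simp]: "homog 1 (indet i)"
  by (auto simp: homog_iff indet_def lookup_single when_def)
lemma homog_power: "homog d f \<Longrightarrow> homog (int k * d) (f ^ k)"
proof (induction k)
  case (Suc k)
  then show ?case using homog_mult[of d f "int k * d" "f ^ k"] by (simp add: algebra_simps)
qed simp
lemma homog_indet_power [simp]: "homog (int k) (indet i ^ k)"
  using homog_power[OF homog_indet, of k i] by simp
lemma homog_prod: "(\<And>a. a \<in> A \<Longrightarrow> homog (D a) (F a)) \<Longrightarrow> homog (sum D A) (prod F A)"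
  by (induction A rule: infinite_finite_induct) (auto intro: homog_mult)
lemma homog_neg: "homog d f \<Longrightarrow> d < 0 \<Longrightarrow> f = 0"
  by (intro poly_mapping_eqI) (auto simp: homog_iff)

lemma sum_hcomp:
  assumes "finite A" "\<And>m. m \<in> Poly_Mapping.keys f \<Longrightarrow> int (mdeg m) \<in> A"
  shows "(\<Sum>i\<in>A. hcomp i f) = f"
  using assms by (intro poly_mapping_eqI) (auto simp: lookup_sum lookup_hcomp sum.delta' in_keys_iff)

definition hdegs where "hdegs f = (\<lambda>m. int (mdeg m)) ` Poly_Mapping.keys f"

lemma finite_hdegs [simp]: "finite (hdegs f)" by (simp add: hdegs_def)

lemma sum_hcomp': "(\<Sum>i\<in>hdegs f. hcomp i f) = f"
  by (rule sum_hcomp) (auto simp: hdegs_def)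

lemma hcomp_outside: "i \<notin> hdegs f \<Longrightarrow> hcomp i f = 0"
  by (intro poly_mapping_eqI) (auto simp: lookup_hcomp hdegs_def in_keys_iff)

lemma hdegs_nonneg: "i \<in> hdegs f \<Longrightarrow> 0 \<le> i"
  by (auto simp: hdegs_def)

lemma hcomp_neg: "i < 0 \<Longrightarrow> hcomp i f = 0"
  by (intro poly_mapping_eqI) (auto simp: lookup_hcomp)

text \<open>Integer degrees make the shift uniform: for \<open>i < d\<close> the component on the
  right has negative degree and is 0.\<close>

lemma hcomp_mult_homog:
  assumes "homog d g" shows "hcomp i (g * f) = g * hcomp (i - d) f"
proof -
  have "hcomp i (g * f) = (\<Sum>j\<in>hdegs f. hcomp i (g * hcomp j f))"
    by (subst (1) sum_hcomp'[of f, symmetric]) (simp add: sum_distrib_left hcomp_sum)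
  also have "\<dots> = (\<Sum>j\<in>hdegs f. if j = i - d then g * hcomp (i - d) f else 0)"
    by (rule sum.cong) (auto simp: hcomp_homog[OF homog_mult[OF assms homog_hcomp]])
  also have "\<dots> = g * hcomp (i - d) f"
    by (simp add: sum.delta hcomp_outside)
  finally show ?thesis .
qed

section \<open>Partial derivatives\<close>

lemma Cst_simps: "Cst 0 = 0" "Cst 1 = 1" "Cst (a + b) = Cst a + Cst b"
  "Cst (a * b) = Cst a * Cst b" "Cst (a - b) = Cst a - Cst b"
  by (simp_all add: Cst_def single_add mult_single single_diff)

lemma lookup_Cst_mult: "lkp (Cst c * f) m = c * lkp f m"
  unfolding Cst_def
proof (induction f rule: pm_induct)
  case (single k x) then show ?case by (auto simp: mult_single lookup_single when_def)
qed (auto simp: lookup_add algebra_simps)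

text \<open>The truncated subtraction in \<open>pdiff\<close> could merge monomials only where the
  exponent of X_i is 0, and there the factor is 0. With this coefficient formula, degrees and
  supports of derivatives become coefficient checks.\<close>

lemma lookup_pdiff:
  "lkp (pdiff i f) m = of_nat (lkp m i + 1) * lkp f (m + Poly_Mapping.single i 1)"
proof -
  let ?e = "Poly_Mapping.single i (1::nat)"
  have *: "(of_nat (lkp m' i) * lkp f m' when m' - ?e = m) =
      (if m' = m + ?e then of_nat (lkp m i + 1) * lkp f (m + ?e) else 0)" for m'
  proof (cases "lkp m' i = 0")
    case True
    moreover have "m' \<noteq> m + ?e" using True by (auto simp: lookup_add)
    ultimately show ?thesis by (simp add: when_def)
  next
    case False
    have "m' - ?e = m \<longleftrightarrow> m' = m + ?e"
    proof
      assume "m' - ?e = m"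
      then have "lkp m' j = lkp (m + ?e) j" for j
        using False by (auto simp: lookup_add lookup_minus lookup_single when_def)
      then show "m' = m + ?e" by (intro poly_mapping_eqI)
    qed simp
    then show ?thesis by (auto simp: when_def lookup_add)
  qed
  show ?thesis unfolding pdiff_def lookup_sum lookup_single *
    by (auto simp: sum.delta in_keys_iff)
qed

lemma pdiff_add: "pdiff i (f + g) = pdiff i f + pdiff i g"
  by (intro poly_mapping_eqI) (simp add: lookup_pdiff lookup_add algebra_simps)
lemma pdiff_diff: "pdiff i (f - g) = pdiff i f - pdiff i g"
  by (intro poly_mapping_eqI) (simp add: lookup_pdiff lookup_minus algebra_simps)
lemma pdiff_zero [simp]: "pdiff i 0 = 0"
  by (intro poly_mapping_eqI) (simp add: lookup_pdiff)
lemma pdiff_sum: "pdiff i (sum F A) = (\<Sum>a\<in>A. pdiff i (F a))"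
  by (induction A rule: infinite_finite_induct) (auto simp: pdiff_add)
lemma pdiff_single: "pdiff i (Poly_Mapping.single m c) =
   Poly_Mapping.single (m - Poly_Mapping.single i 1) (of_nat (lkp m i) * c)"
  by (cases "c = 0") (simp_all add: pdiff_def)

lemma pdiff_mult: "pdiff i (f * g) = f * pdiff i g + g * pdiff i f"
proof (induction f rule: pm_induct)
  case zero then show ?case by simp
next
  case (add f f') then show ?case by (simp add: algebra_simps pdiff_add)
next
  case (single m c)
  show ?case
  proof (induction g rule: pm_induct)
    case (single m' c')
    let ?e = "Poly_Mapping.single i (1::nat)"
    have 1: "lkp m i \<noteq> 0 \<Longrightarrow> m' + (m - ?e) = m + m' - ?e"
      by (intro poly_mapping_eqI) (auto simp: lookup_add lookup_minus lookup_single when_def)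
    have 2: "lkp m' i \<noteq> 0 \<Longrightarrow> m + (m' - ?e) = m + m' - ?e"
      by (intro poly_mapping_eqI) (auto simp: lookup_add lookup_minus lookup_single when_def)
    show ?case
      using 1 2 by (cases "lkp m i = 0"; cases "lkp m' i = 0")
        (simp_all add: pdiff_single mult_single lookup_add single_add[symmetric] algebra_simps)
  qed (auto simp: algebra_simps pdiff_add)
qed

lemma homog_pdiff: "homog d f \<Longrightarrow> homog (d - 1) (pdiff i f)"
  unfolding homog_iff lookup_pdiff
proof (intro allI impI)
  fix m assume a: "\<forall>m. lkp f m \<noteq> 0 \<longrightarrow> int (mdeg m) = d"
    "of_nat (lkp m i + 1) * lkp f (m + Poly_Mapping.single i 1) \<noteq> 0"
  then have "lkp f (m + Poly_Mapping.single i 1) \<noteq> 0" by auto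
  then have "int (mdeg (m + Poly_Mapping.single i 1)) = d" using a(1) by blast
  then show "int (mdeg m) = d - 1" by (simp add: mdeg_add)
qed

lemma pdiff_Cst_mult: "pdiff i (Cst c * f) = Cst c * pdiff i f"
  by (intro poly_mapping_eqI) (simp only: lookup_pdiff lookup_Cst_mult mult.left_commute)

lemma pdiff_indet: "pdiff i (indet j) = (if i = j then 1 else 0)"
  by (auto simp: indet_def pdiff_single lookup_single when_def)

section \<open>The polynomial ring\<close>

abbreviation P :: "nat \<Rightarrow> 'k::field mpoly set" where "P n \<equiv> carrier (mpoly_ring n)"

lemma P_iff: "f \<in> P n \<longleftrightarrow> (\<forall>m. lkp f m \<noteq> 0 \<longrightarrow> Poly_Mapping.keys m \<subseteq> {..n})"
  by (auto simp: mpoly_ring_def in_keys_iff)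

lemma P_zero [simp]: "0 \<in> P n" and P_one [simp]: "1 \<in> P n"
  by (auto simp: P_iff lookup_one when_def)
lemma P_add [simp]: "f \<in> P n \<Longrightarrow> g \<in> P n \<Longrightarrow> f + g \<in> P n"
  unfolding P_iff lookup_add by (metis add_0)
lemma P_uminus [simp]: "f \<in> P n \<Longrightarrow> - f \<in> P n"
  by (simp add: P_iff)
lemma P_diff [simp]: "f \<in> P n \<Longrightarrow> g \<in> P n \<Longrightarrow> f - g \<in> P n"
  using P_add[of f n "- g"] by simp
lemma P_sum: "(\<And>a. a \<in> A \<Longrightarrow> F a \<in> P n) \<Longrightarrow> sum F A \<in> P n"
  by (induction A rule: infinite_finite_induct) auto
lemma P_mult [simp]: "f \<in> P n \<Longrightarrow> g \<in> P n \<Longrightarrow> f * g \<in> P n"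
proof -
  assume a: "f \<in> P n" "g \<in> P n"
  { fix m assume "m \<in> Poly_Mapping.keys (f * g)"
    then obtain x y where "m = x + y" "x \<in> Poly_Mapping.keys f" "y \<in> Poly_Mapping.keys g"
      using keys_mult[of f g] by auto
    then have "Poly_Mapping.keys m \<subseteq> {..n}"
      using a keys_add[of x y] by (force simp: mpoly_ring_def) }
  then show ?thesis by (auto simp: mpoly_ring_def)
qed
lemma P_power [simp]: "f \<in> P n \<Longrightarrow> f ^ k \<in> P n" by (induction k) auto
lemma P_Cst [simp]: "Cst c \<in> P n"
  by (auto simp: P_iff Cst_def lookup_single when_def)
lemma P_indet [simp]: "i \<le> n \<Longrightarrow> indet i \<in> P n"
  by (auto simp: P_iff indet_def lookup_single when_def)
lemma P_hcomp [simp]: "f \<in> P n \<Longrightarrow> hcomp d f \<in> P n"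
  by (auto simp: P_iff lookup_hcomp)
lemma P_pdiff [simp]: "f \<in> P n \<Longrightarrow> pdiff i f \<in> P n"
  unfolding P_iff lookup_pdiff
proof (intro allI impI)
  fix m assume a: "\<forall>m. lkp f m \<noteq> 0 \<longrightarrow> Poly_Mapping.keys m \<subseteq> {..n}"
    "of_nat (lkp m i + 1) * lkp f (m + Poly_Mapping.single i 1) \<noteq> 0"
  then have "Poly_Mapping.keys (m + Poly_Mapping.single i 1) \<subseteq> {..n}" by auto
  moreover have "Poly_Mapping.keys m \<subseteq> Poly_Mapping.keys (m + Poly_Mapping.single i 1)"
    by (auto simp: in_keys_iff lookup_add)
  ultimately show "Poly_Mapping.keys m \<subseteq> {..n}" by blast
qed

lemma mpoly_ring_simps [simp]:
  "monoid.mult (mpoly_ring n) = (*)" "one (mpoly_ring n) = 1" "ring.zero (mpoly_ring n) = 0"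
  "add (mpoly_ring n) = (+)"
  by (simp_all add: mpoly_ring_def)

lemma cring_mpoly_ring: "cring (mpoly_ring n :: 'k::field mpoly ring)"
proof (rule cringI)
  show "abelian_group (mpoly_ring n :: 'k mpoly ring)"
  proof (rule abelian_groupI)
    fix x :: "'k mpoly" assume "x \<in> P n"
    then show "\<exists>y\<in>P n. y \<oplus>\<^bsub>mpoly_ring n\<^esub> x = \<zero>\<^bsub>mpoly_ring n\<^esub>"
      by (intro bexI[of _ "- x"]) auto
  qed (auto simp: algebra_simps)
  show "comm_monoid (mpoly_ring n :: 'k mpoly ring)"
    by (rule comm_monoidI) (simp_all only: mpoly_ring_simps P_mult P_one ac_simps mult_1_left mult_1_right)
qed (simp only: mpoly_ring_simps distrib_right)

lemma ring_mpoly_ring: "ring (mpoly_ring n)"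
  using cring_mpoly_ring cring.axioms(1) by blast

lemma a_inv_mpoly_ring [simp]: "f \<in> P n \<Longrightarrow> \<ominus>\<^bsub>mpoly_ring n\<^esub> f = - f"
  by (metis P_uminus abelian_group.minus_equality cring_mpoly_ring cring.axioms(1) left_minus
      mpoly_ring_simps(3,4) ring_def)

abbreviation pp where "pp m \<equiv> Poly_Mapping.single m 1"

lemma homog_pp: "homog (int (mdeg m)) (pp m)"
  by (auto simp: homog_iff lookup_single when_def)

lemma single_eq_Cst_pp: "Poly_Mapping.single m c = Cst c * pp m"
  by (simp add: Cst_def mult_single)

lemma P_pp: "Poly_Mapping.keys m \<subseteq> {..n} \<Longrightarrow> pp m \<in> P n"
  by (auto simp: P_iff lookup_single when_def)

lemma pp_decomp:
  assumes "f \<in> P n" "homog d f"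
  obtains F c where "f = (\<Sum>m\<in>F. Cst (c m) * pp m)" "finite F"
    "\<And>m. m \<in> F \<Longrightarrow> Poly_Mapping.keys m \<subseteq> {..n} \<and> int (mdeg m) = d"
proof
  show "f = (\<Sum>m\<in>Poly_Mapping.keys f. Cst (lkp f m) * pp m)"
    unfolding single_eq_Cst_pp[symmetric] by (rule sum_singles)
  show "Poly_Mapping.keys m \<subseteq> {..n} \<and> int (mdeg m) = d" if "m \<in> Poly_Mapping.keys f" for m
    using that assms by (auto simp: mpoly_ring_def homog_def)
qed simp

lemma pp_split:
  assumes "lkp m i \<noteq> 0"
  shows "pp m = (indet i * pp (m - Poly_Mapping.single i 1) :: 'k::field mpoly)"
    and "mdeg (m - Poly_Mapping.single i 1) = mdeg m - 1"
    and "Poly_Mapping.keys m \<subseteq> {..n} \<Longrightarrow> Poly_Mapping.keys (m - Poly_Mapping.single i 1) \<subseteq> {..n}"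
proof -
  have *: "m = Poly_Mapping.single i 1 + (m - Poly_Mapping.single i 1)"
    using assms by (intro poly_mapping_eqI) (auto simp: lookup_add lookup_minus lookup_single when_def)
  show "pp m = (indet i * pp (m - Poly_Mapping.single i 1) :: 'k mpoly)"
    by (subst (1) *) (simp add: indet_def mult_single)
  show "mdeg (m - Poly_Mapping.single i 1) = mdeg m - 1"
    using arg_cong[OF *, of mdeg] unfolding mdeg_add mdeg_single by simp
  show "Poly_Mapping.keys m \<subseteq> {..n} \<Longrightarrow> Poly_Mapping.keys (m - Poly_Mapping.single i 1) \<subseteq> {..n}"
    by (auto simp: in_keys_iff lookup_minus subset_iff)
qed

lemma pp_split_ex:
  assumes "mdeg m = Suc d" "Poly_Mapping.keys m \<subseteq> {..n}"
  obtains i m' where "i \<le> n" "pp m = (indet i * pp m' :: 'k::field mpoly)" "mdeg m' = d"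
    "Poly_Mapping.keys m' \<subseteq> {..n}"
proof -
  have "\<exists>i. lkp m i \<noteq> 0" using assms(1) unfolding mdeg_def by (metis nat.distinct(1) sum.neutral)
  then obtain i where i: "lkp m i \<noteq> 0" by blast
  then have "i \<le> n" using assms(2) by (auto simp: in_keys_iff subset_iff)
  then show thesis using that[OF _ pp_split(1)[OF i]] pp_split(2,3)[OF i] assms by simp
qed

section \<open>Ideals of the polynomial ring\<close>

text \<open>Ideals are handled as plain sets closed under the operations of the polynomial type,
  because \<open>det\<close>, finite sums and differences live on that type. Closure under negation
  comes from multiplication by -1.\<close>

definition pideal :: "nat \<Rightarrow> 'k::field mpoly set \<Rightarrow> bool" where
  "pideal n J \<longleftrightarrow> J \<subseteq> P n \<and> 0 \<in> J \<and> (\<forall>f\<in>J. \<forall>g\<in>J. f + g \<in> J) \<and> (\<forall>a\<in>P n. \<forall>f\<in>J. a * f \<in> J)"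

lemma pidealD:
  assumes "pideal n J"
  shows "f \<in> J \<Longrightarrow> f \<in> P n" "0 \<in> J" "f \<in> J \<Longrightarrow> g \<in> J \<Longrightarrow> f + g \<in> J"
    "a \<in> P n \<Longrightarrow> f \<in> J \<Longrightarrow> a * f \<in> J" "a \<in> P n \<Longrightarrow> f \<in> J \<Longrightarrow> f * a \<in> J"
    "f \<in> J \<Longrightarrow> - f \<in> J" "f \<in> J \<Longrightarrow> g \<in> J \<Longrightarrow> f - g \<in> J"
    "(\<And>x. x \<in> A \<Longrightarrow> h x \<in> J) \<Longrightarrow> sum h A \<in> J" "f \<in> J \<Longrightarrow> Cst c * f \<in> J"
proof -
  show 1: "f \<in> J \<Longrightarrow> f \<in> P n" for f using assms unfolding pideal_def by blast
  show 2: "0 \<in> J" using assms unfolding pideal_def by blast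
  show 3: "f \<in> J \<Longrightarrow> g \<in> J \<Longrightarrow> f + g \<in> J" for f g using assms unfolding pideal_def by blast
  show 4: "a \<in> P n \<Longrightarrow> f \<in> J \<Longrightarrow> a * f \<in> J" for a f using assms unfolding pideal_def by blast
  then show "a \<in> P n \<Longrightarrow> f \<in> J \<Longrightarrow> f * a \<in> J" by (simp add: mult.commute)
  show 5: "f \<in> J \<Longrightarrow> - f \<in> J" for f using 4[of "-1" f] by simp
  show "f \<in> J \<Longrightarrow> g \<in> J \<Longrightarrow> f - g \<in> J" using 3[of f "-g"] 5[of g] by simp
  show "(\<And>x. x \<in> A \<Longrightarrow> h x \<in> J) \<Longrightarrow> sum h A \<in> J"
    by (induction A rule: infinite_finite_induct) (auto simp: 2 3)
  show "f \<in> J \<Longrightarrow> Cst c * f \<in> J" using 4 by simp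
qed

lemma ideal_iff: "ideal J (mpoly_ring n) \<longleftrightarrow> pideal n J"
proof
  assume "ideal J (mpoly_ring n)"
  then interpret ideal J "mpoly_ring n" .
  show "pideal n J"
    unfolding pideal_def
    using a_subset additive_subgroup.zero_closed[OF is_additive_subgroup]
      additive_subgroup.a_closed[OF is_additive_subgroup] I_l_closed by auto
next
  assume J: "pideal n J"
  note d = pidealD[OF J]
  show "ideal J (mpoly_ring n)"
  proof (rule idealI[OF ring_mpoly_ring])
    show "subgroup J (add_monoid (mpoly_ring n))"
    proof (rule group.subgroupI)
      show "group (add_monoid (mpoly_ring n))"
        using abelian_group.a_group[of "mpoly_ring n"] ring_mpoly_ring by (metis ring_def)
      show "inv\<^bsub>add_monoid (mpoly_ring n)\<^esub> a \<in> J" if "a \<in> J" for a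
        using that d a_inv_mpoly_ring[of a n] by (simp add: a_inv_def)
    qed (use d in auto)
  qed (use d in auto)
qed

text \<open>From left to right: the elements of \<open>J\<close> with all components in
  \<open>J\<close> form an ideal, and it contains the homogeneous elements that generate
  \<open>J\<close>. From right to left, an element is the sum of its components.\<close>

lemma homogeneous_ideal_iff:
  "homogeneous_ideal n J \<longleftrightarrow> pideal n J \<and> (\<forall>f\<in>J. \<forall>i. hcomp i f \<in> J)"
proof safe
  assume h: "homogeneous_ideal n J"
  then show J: "pideal n J" by (simp add: homogeneous_ideal_def ideal_iff)
  note d = pidealD[OF J]
  fix f i assume f: "f \<in> J"
  let ?L = "{f \<in> J. \<forall>i. hcomp i f \<in> J}"
  have hm: "hcomp i (a * f) \<in> J" if "a \<in> P n" "\<forall>i. hcomp i f \<in> J" for a f i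
  proof -
    have "hcomp i (a * f) = (\<Sum>j\<in>hdegs a. hcomp j a * hcomp (i - j) f)"
      by (subst (1) sum_hcomp'[of a, symmetric])
        (simp add: sum_distrib_right hcomp_sum hcomp_mult_homog[OF homog_hcomp])
    then show ?thesis using that by (auto intro!: d(8) d(4))
  qed
  have L: "pideal n ?L"
    unfolding pideal_def using d hm by (auto simp: hcomp_add)
  have "Idl\<^bsub>mpoly_ring n\<^esub> {f \<in> J. \<exists>d. homog d f} \<subseteq> ?L"
    using L d by (intro ring.genideal_minimal[OF ring_mpoly_ring])
      (auto simp: ideal_iff hcomp_homog)
  then show "hcomp i f \<in> J" using f h unfolding homogeneous_ideal_def by blast
next
  assume J: "pideal n J" and h: "\<forall>f\<in>J. \<forall>i. hcomp i f \<in> J"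
  note d = pidealD[OF J]
  let ?H = "{f \<in> J. \<exists>d. homog d f}"
  have sub: "?H \<subseteq> P n" using d by auto
  have id: "pideal n (Idl\<^bsub>mpoly_ring n\<^esub> ?H)"
    using ring.genideal_ideal[OF ring_mpoly_ring sub] by (simp add: ideal_iff)
  have "f \<in> Idl\<^bsub>mpoly_ring n\<^esub> ?H" if "f \<in> J" for f
  proof -
    have "(\<Sum>i\<in>hdegs f. hcomp i f) \<in> Idl\<^bsub>mpoly_ring n\<^esub> ?H"
      using ring.genideal_self[OF ring_mpoly_ring sub] h that
      by (intro pidealD(8)[OF id]) (use homog_hcomp in blast)
    then show ?thesis by (simp add: sum_hcomp')
  qed
  moreover have "Idl\<^bsub>mpoly_ring n\<^esub> ?H \<subseteq> J"
    using J by (intro ring.genideal_minimal[OF ring_mpoly_ring]) (auto simp: ideal_iff)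
  ultimately show "homogeneous_ideal n J"
    unfolding homogeneous_ideal_def using J by (auto simp: ideal_iff)
qed

lemma homogeneous_idealD:
  assumes "homogeneous_ideal n J"
  shows "pideal n J" "f \<in> J \<Longrightarrow> hcomp i f \<in> J"
  using assms by (auto simp: homogeneous_ideal_iff)

lemma primeideal_iff:
  "primeideal J (mpoly_ring n) \<longleftrightarrow> pideal n J \<and> 1 \<notin> J \<and>
     (\<forall>f\<in>P n. \<forall>g\<in>P n. f * g \<in> J \<longrightarrow> f \<in> J \<or> g \<in> J)"
proof -
  have 1: "carrier (mpoly_ring n) = J \<longleftrightarrow> 1 \<in> J" if "pideal n J"
    using that pidealD[OF that] by (metis P_one mult.right_neutral subsetI subset_antisym)
  show ?thesis
    unfolding primeideal_def primeideal_axioms_def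
    using cring_mpoly_ring 1 by (auto simp: ideal_iff)
qed

lemma Idl_eq:
  assumes "A \<subseteq> P n" shows "pideal n (Idl\<^bsub>mpoly_ring n\<^esub> A)" "A \<subseteq> Idl\<^bsub>mpoly_ring n\<^esub> A"
    "pideal n J \<Longrightarrow> A \<subseteq> J \<Longrightarrow> Idl\<^bsub>mpoly_ring n\<^esub> A \<subseteq> J"
  using ring.genideal_ideal[OF ring_mpoly_ring assms] ring.genideal_self[OF ring_mpoly_ring assms]
    ring.genideal_minimal[OF ring_mpoly_ring, of J n A] by (simp_all add: ideal_iff)

section \<open>Homogeneous primes and localization at a point\<close>

section \<open>Homogeneous primes\<close>

lemma homogeneous_ideal_add_principal:
  fixes a :: "'k::field mpoly"
  assumes q: "homogeneous_ideal n q" and a: "a \<in> P n" "homog d a"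
  shows "homogeneous_ideal n {x + a * c |x c. x \<in> q \<and> c \<in> P n}"
    "q \<subseteq> {x + a * c |x c. x \<in> q \<and> c \<in> P n}" "a \<in> {x + a * c |x c. x \<in> q \<and> c \<in> P n}"
proof -
  define J where "J = {x + a * c |x c. x \<in> q \<and> c \<in> P n}"
  note d = pidealD[OF homogeneous_idealD(1)[OF q]]
  have I: "x \<in> q \<Longrightarrow> c \<in> P n \<Longrightarrow> x + a * c \<in> J" for x c unfolding J_def by blast
  have E: "\<exists>x c. f = x + a * c \<and> x \<in> q \<and> c \<in> P n" if "f \<in> J" for f using that unfolding J_def by blast
  show "q \<subseteq> {x + a * c |x c. x \<in> q \<and> c \<in> P n}" unfolding J_def[symmetric] using I[of _ 0] by auto
  show "a \<in> {x + a * c |x c. x \<in> q \<and> c \<in> P n}" unfolding J_def[symmetric] using I[of 0 1] d(2) by auto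
  show "homogeneous_ideal n {x + a * c |x c. x \<in> q \<and> c \<in> P n}"
    unfolding J_def[symmetric] homogeneous_ideal_iff pideal_def
  proof (intro conjI ballI allI)
    show "J \<subseteq> P n" using d(1) a E by fastforce
    show "0 \<in> J" using I[of 0 0] d(2) by auto
  next
    fix f g assume "f \<in> J" "g \<in> J"
    then obtain x c y e where *: "f = x + a * c" "g = y + a * e" "x \<in> q" "c \<in> P n" "y \<in> q" "e \<in> P n"
      using E by meson
    have "f + g = (x + y) + a * (c + e)" by (simp add: * algebra_simps)
    then show "f + g \<in> J" using I[of "x + y" "c + e"] *(3-) d(3) by simp
  next
    fix b f :: "'k mpoly" assume b: "b \<in> P n" and "f \<in> J"
    then obtain x c where *: "f = x + a * c" "x \<in> q" "c \<in> P n" using E by meson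
    have "b * f = b * x + a * (b * c)" by (simp add: * algebra_simps)
    then show "b * f \<in> J" using I[of "b * x" "b * c"] *(2-) b d(4) by simp
  next
    fix f i assume "f \<in> J"
    then obtain x c where *: "f = x + a * c" "x \<in> q" "c \<in> P n" using E by meson
    have "hcomp i f = hcomp i x + a * hcomp (i - d) c"
      by (simp add: * hcomp_add hcomp_mult_homog[OF a(2)])
    then show "hcomp i f \<in> J" using I[of "hcomp i x" "hcomp (i - d) c"] *(2-) homogeneous_idealD(2)[OF q] by simp
  qed
qed

text \<open>For f and g outside q, take their components of lowest degrees i and j not in q. In the
  component of f g of degree i + j every other summand has a factor in q, so the product of these
  two components lies in q as well.\<close>

lemma homogeneous_primeI:
  fixes q :: "'k::field mpoly set"
  assumes q: "homogeneous_ideal n q" and one: "1 \<notin> q"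
    and pr: "\<And>a b d e. a \<in> P n \<Longrightarrow> b \<in> P n \<Longrightarrow> homog d a \<Longrightarrow> homog e b \<Longrightarrow> a * b \<in> q \<Longrightarrow> a \<in> q \<or> b \<in> q"
  shows "primeideal q (mpoly_ring n)"
  unfolding primeideal_iff
proof (intro conjI ballI impI)
  note d = pidealD[OF homogeneous_idealD(1)[OF q]]
  show "pideal n q" using homogeneous_idealD(1)[OF q] .
  show "1 \<notin> q" by fact
  fix f g assume f: "f \<in> P n" and g: "g \<in> P n" and fg: "f * g \<in> q"
  show "f \<in> q \<or> g \<in> q"
  proof (rule ccontr)
    assume "\<not> ?thesis"
    then have nf: "f \<notin> q" and ng: "g \<notin> q" by auto
    have least: "\<exists>i. hcomp i f \<notin> q \<and> (\<forall>k<i. hcomp k f \<in> q)" if "f \<notin> q" for f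
    proof -
      let ?A = "{i \<in> hdegs f. hcomp i f \<notin> q}"
      have "?A \<noteq> {}" using that d(8)[of "hdegs f" "\<lambda>i. hcomp i f"] by (auto simp: sum_hcomp')
      then have m: "Min ?A \<in> ?A" by (intro Min_in) auto
      have "hcomp k f \<in> q" if k: "k < Min ?A" for k
      proof (rule ccontr)
        assume a: "hcomp k f \<notin> q"
        then have "k \<in> hdegs f" using hcomp_outside[of k f] d(2) by metis
        then have "Min ?A \<le> k" using a by (intro Min_le) auto
        then show False using k by linarith
      qed
      then show ?thesis using m by blast
    qed
    from least[OF nf] obtain i where i: "hcomp i f \<notin> q" "\<forall>k<i. hcomp k f \<in> q" by blast
    from least[OF ng] obtain j where j: "hcomp j g \<notin> q" "\<forall>k<j. hcomp k g \<in> q" by blast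
    let ?A = "insert i (hdegs f)"
    have "hcomp (i + j) (f * g) = (\<Sum>k\<in>?A. hcomp k f * hcomp (i + j - k) g)"
    proof -
      have "f = (\<Sum>k\<in>?A. hcomp k f)"
        by (rule sum_hcomp[symmetric]) (auto simp: hdegs_def)
      then have "hcomp (i + j) (f * g) = hcomp (i + j) ((\<Sum>k\<in>?A. hcomp k f) * g)" by simp
      then show ?thesis by (simp only: sum_distrib_right hcomp_sum hcomp_mult_homog[OF homog_hcomp])
    qed
    also have "\<dots> = hcomp i f * hcomp j g + (\<Sum>k\<in>?A - {i}. hcomp k f * hcomp (i + j - k) g)"
      by (subst sum.remove[of _ i]) auto
    finally have eq: "hcomp i f * hcomp j g =
        hcomp (i + j) (f * g) - (\<Sum>k\<in>?A - {i}. hcomp k f * hcomp (i + j - k) g)" by simp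
    have "hcomp k f * hcomp (i + j - k) g \<in> q" if "k \<in> ?A - {i}" for k
      using that i j d(4,5) f g by (cases "k < i") auto
    then have "hcomp i f * hcomp j g \<in> q"
      unfolding eq by (intro d(7) d(8) homogeneous_idealD(2)[OF q fg])
    then show False using pr[of "hcomp i f" "hcomp j g" i j] i(1) j(1) f g by auto
  qed
qed

text \<open>Zorn's lemma is applied to the homogeneous ideals avoiding \<open>M\<close>. Adjoining a
  homogeneous element stays within this class, and \<open>homogeneous_primeI\<close> asks for
  primality only on such elements.\<close>

lemma exists_homogeneous_prime:
  fixes J :: "'k::field mpoly set"
  assumes J: "homogeneous_ideal n J" and M: "M \<subseteq> P n" "1 \<in> M"
    "\<And>a b. a \<in> M \<Longrightarrow> b \<in> M \<Longrightarrow> a * b \<in> M" and disj: "J \<inter> M = {}"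
  obtains q where "homogeneous_ideal n q" "primeideal q (mpoly_ring n)" "J \<subseteq> q" "q \<inter> M = {}"
proof -
  define A where "A = {q. homogeneous_ideal n q \<and> J \<subseteq> q \<and> q \<inter> M = {}}"
  have "\<exists>Q\<in>A. (\<forall>Z\<in>A. Q \<subseteq> Z \<longrightarrow> Z = Q)"
  proof (rule subset_Zorn_nonempty)
    show "A \<noteq> {}" using J disj by (auto simp: A_def)
    fix C assume C: "C \<noteq> {}" "subset.chain A C"
    then have CA: "C \<subseteq> A" and lin: "\<And>Z W. Z \<in> C \<Longrightarrow> W \<in> C \<Longrightarrow> Z \<subseteq> W \<or> W \<subseteq> Z"
      unfolding subset_chain_def by auto
    have hC: "homogeneous_ideal n Z" if "Z \<in> C" for Z using CA that by (auto simp: A_def)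
    note pC = homogeneous_idealD(1)[OF hC]
    have "homogeneous_ideal n (\<Union>C)"
      unfolding homogeneous_ideal_iff pideal_def
    proof (intro conjI ballI allI)
      show "\<Union>C \<subseteq> P n" using pidealD(1)[OF pC] by blast
      show "0 \<in> \<Union>C" using pidealD(2)[OF pC] C(1) by blast
    next
      fix f g assume "f \<in> \<Union>C" "g \<in> \<Union>C"
      then obtain Z where "Z \<in> C" "f \<in> Z" "g \<in> Z" using lin by blast
      then show "f + g \<in> \<Union>C" using pidealD(3)[OF pC] by blast
    next
      fix a f :: "'k mpoly" assume "a \<in> P n" "f \<in> \<Union>C"
      then show "a * f \<in> \<Union>C" using pidealD(4)[OF pC] by blast
    next
      fix f i assume "f \<in> \<Union>C"
      then show "hcomp i f \<in> \<Union>C" using homogeneous_idealD(2)[OF hC] by blast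
    qed
    moreover have "J \<subseteq> \<Union>C" using C(1) CA by (auto simp: A_def)
    moreover have "\<Union>C \<inter> M = {}" using CA by (auto simp: A_def)
    ultimately show "\<Union>C \<in> A" by (simp add: A_def)
  qed
  then obtain q where q: "q \<in> A" and max: "\<And>Z. Z \<in> A \<Longrightarrow> q \<subseteq> Z \<Longrightarrow> Z = q" by blast
  have hq: "homogeneous_ideal n q" and Jq: "J \<subseteq> q" and qM: "q \<inter> M = {}" using q by (auto simp: A_def)
  note d = pidealD[OF homogeneous_idealD(1)[OF hq]]
  have "primeideal q (mpoly_ring n)"
  proof (rule homogeneous_primeI[OF hq])
    show "1 \<notin> q" using qM M(2) by blast
    fix a b d1 e1 assume ab: "a \<in> P n" "b \<in> P n" "homog d1 a" "homog e1 b" "a * b \<in> q"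
    have meets: "\<exists>x\<in>q. \<exists>c\<in>P n. x + a * c \<in> M" if "a \<in> P n" "homog d1 a" "a \<notin> q" for a d1
    proof (rule ccontr)
      let ?J = "{x + a * c |x c. x \<in> q \<and> c \<in> P n}"
      assume "\<not> ?thesis"
      then have "?J \<inter> M = {}" by blast
      then have "?J \<in> A" using homogeneous_ideal_add_principal(1,2)[OF hq that(1,2)] Jq by (auto simp: A_def)
      then have "?J = q" using max homogeneous_ideal_add_principal(2)[OF hq that(1,2)] by blast
      then show False using that(3) homogeneous_ideal_add_principal(3)[OF hq that(1,2)] by blast
    qed
    show "a \<in> q \<or> b \<in> q"
    proof (rule ccontr)
      assume "\<not> ?thesis"
      then obtain x c y e where *: "x \<in> q" "c \<in> P n" "x + a * c \<in> M" "y \<in> q" "e \<in> P n" "y + b * e \<in> M"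
        using meets[OF ab(1,3)] meets[OF ab(2,4)] by blast
      have "(x + a * c) * (y + b * e) = x * (y + b * e) + (a * c) * y + (c * e) * (a * b)"
        by (simp add: algebra_simps)
      moreover have "\<dots> \<in> q"
        by (intro d(3) d(5)[of "y + b * e" x] d(4)[of "a * c" y] d(4)[of "c * e" "a * b"])
          (use * ab d(1) in auto)
      ultimately show False using M(3)[OF *(3,6)] qM by auto
    qed
  qed
  then show thesis using that hq Jq qM by blast
qed

section \<open>Local rings\<close>

lemma pointsD:
  assumes "q \<in> points n I"
  shows "homogeneous_ideal n q" "pideal n q" "1 \<notin> q" "I \<subseteq> q"
    "f \<in> P n \<Longrightarrow> g \<in> P n \<Longrightarrow> f * g \<in> q \<Longrightarrow> f \<in> q \<or> g \<in> q" "\<not> indet ` {..n} \<subseteq> q"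
  using assms by (auto simp: points_def primeideal_iff homogeneous_ideal_iff)

text \<open>The operations of \<open>local_ring\<close> are unions over all representatives. Once
  the value is known not to depend on them, the union collapses, provided both classes are
  inhabited.\<close>

lemma UN_pair_const:
  assumes "(f, g) \<in> A" "(f', g') \<in> B"
    "\<And>a b a' b'. (a, b) \<in> A \<Longrightarrow> (a', b') \<in> B \<Longrightarrow> F a b a' b' = C"
  shows "(\<Union>(a, b)\<in>A. \<Union>(a', b')\<in>B. F a b a' b') = C"
proof
  show "(\<Union>(a, b)\<in>A. \<Union>(a', b')\<in>B. F a b a' b') \<subseteq> C"
    using assms(3) by auto
  have "F f g f' g' \<subseteq> (\<Union>(a, b)\<in>A. \<Union>(a', b')\<in>B. F a b a' b')" using assms(1,2) by blast
  then show "C \<subseteq> (\<Union>(a, b)\<in>A. \<Union>(a', b')\<in>B. F a b a' b')" using assms by metis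
qed

locale hprime =
  fixes n :: nat and I q :: "'k::field mpoly set"
  assumes I: "pideal n I" and q: "primeideal q (mpoly_ring n)"
begin

lemma q_id: "pideal n q" and q_one: "1 \<notin> q"
  and q_prime: "f \<in> P n \<Longrightarrow> g \<in> P n \<Longrightarrow> f * g \<in> q \<Longrightarrow> f \<in> q \<or> g \<in> q"
  using q by (auto simp: primeideal_iff)

definition dens where "dens = {h \<in> P n - q. \<exists>d. homog d h}"

lemma dens_mult: "a \<in> dens \<Longrightarrow> b \<in> dens \<Longrightarrow> a * b \<in> dens"
proof -
  assume "a \<in> dens" "b \<in> dens"
  then obtain d e where *: "a \<in> P n" "b \<in> P n" "a \<notin> q" "b \<notin> q" "homog d a" "homog e b"
    by (auto simp: dens_def)
  then have "a * b \<notin> q" using q_prime by metis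
  moreover have "homog (d + e) (a * b)" using * homog_mult by metis
  ultimately show ?thesis using * by (auto simp: dens_def)
qed
lemma dens_one: "1 \<in> dens" using q_one unfolding dens_def by (auto intro: homog_one)

definition eqv where "eqv f g f' g' \<longleftrightarrow> (\<exists>h\<in>dens. h * (f * g' - f' * g) \<in> I)"

lemma hfrac_eq: "hfrac n I q f g = {(f', g') \<in> hfracs n q. eqv f g f' g'}"
  by (auto simp: hfrac_def eqv_def dens_def)

lemma eqv_refl: "eqv f g f g"
  using dens_one pidealD(2)[OF I] by (auto simp: eqv_def)
lemma eqv_sym: "eqv f g f' g' \<Longrightarrow> eqv f' g' f g"
  unfolding eqv_def using pidealD(6)[OF I]
  by (metis (no_types, opaque_lifting) minus_diff_eq mult_minus_right)

lemma hfracsD: "(f, g) \<in> hfracs n q \<Longrightarrow> f \<in> P n" "(f, g) \<in> hfracs n q \<Longrightarrow> g \<in> P n"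
  "(f, g) \<in> hfracs n q \<Longrightarrow> g \<in> dens" "(f, g) \<in> hfracs n q \<Longrightarrow> g \<notin> q"
  by (auto simp: hfracs_def dens_def)

lemma eqv_trans:
  assumes "(f, g) \<in> hfracs n q" "(f', g') \<in> hfracs n q" "(f'', g'') \<in> hfracs n q"
    "eqv f g f' g'" "eqv f' g' f'' g''"
  shows "eqv f g f'' g''"
proof -
  from assms obtain h k where h: "h \<in> dens" "h * (f * g' - f' * g) \<in> I"
    and k: "k \<in> dens" "k * (f' * g'' - f'' * g') \<in> I" by (auto simp: eqv_def)
  \<comment> \<open>Multiplying also by the middle denominator \<open>g'\<close> expresses the outer
    difference through the two given ones.\<close>
  have "(h * k * g') * (f * g'' - f'' * g) =
      (k * g'') * (h * (f * g' - f' * g)) + (h * g) * (k * (f' * g'' - f'' * g'))"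
    by (simp add: algebra_simps)
  moreover have "\<dots> \<in> I"
    by (intro pidealD(3)[OF I] pidealD(4)[OF I, of _ "h * (f * g' - f' * g)"]
          pidealD(4)[OF I, of _ "k * (f' * g'' - f'' * g')"])
      (use h k hfracsD[OF assms(1)] hfracsD[OF assms(3)] in \<open>auto simp: dens_def\<close>)
  moreover have "h * k * g' \<in> dens" using h k hfracsD[OF assms(2)] dens_mult by blast
  ultimately show ?thesis unfolding eqv_def by metis
qed

lemma hfrac_eq_iff:
  assumes "(f, g) \<in> hfracs n q" "(f', g') \<in> hfracs n q"
  shows "hfrac n I q f g = hfrac n I q f' g' \<longleftrightarrow> eqv f g f' g'"
proof
  assume "hfrac n I q f g = hfrac n I q f' g'"
  then have "(f', g') \<in> hfrac n I q f g" using assms eqv_refl by (auto simp: hfrac_eq)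
  then show "eqv f g f' g'" by (simp add: hfrac_eq)
next
  assume "eqv f g f' g'"
  then show "hfrac n I q f g = hfrac n I q f' g'"
    unfolding hfrac_eq using eqv_trans assms eqv_sym by blast
qed

lemma hfracs_iff: "(f, g) \<in> hfracs n q \<longleftrightarrow> f \<in> P n \<and> g \<in> P n \<and> g \<notin> q \<and> (\<exists>d. homog d f \<and> homog d g)"
  by (auto simp: hfracs_def)

lemma hfracs_mult:
  assumes "(f, g) \<in> hfracs n q" "(f', g') \<in> hfracs n q"
  shows "(f * f', g * g') \<in> hfracs n q"
proof -
  from assms obtain d e where *: "homog d f" "homog d g" "homog e f'" "homog e g'"
    by (auto simp: hfracs_iff)
  have "g * g' \<notin> q" using q_prime[of g g'] assms by (auto simp: hfracs_iff)
  moreover have "homog (d + e) (f * f')" "homog (d + e) (g * g')" using * homog_mult by metis+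
  ultimately show ?thesis using assms by (auto simp: hfracs_iff)
qed

lemma hfracs_add:
  assumes "(f, g) \<in> hfracs n q" "(f', g') \<in> hfracs n q"
  shows "(f * g' + f' * g, g * g') \<in> hfracs n q"
proof -
  from assms obtain d e where *: "homog d f" "homog d g" "homog e f'" "homog e g'"
    by (auto simp: hfracs_iff)
  have "g * g' \<notin> q" using q_prime[of g g'] assms by (auto simp: hfracs_iff)
  moreover have "homog (d + e) (g * g')" using * homog_mult by metis
  moreover have "homog (d + e) (f * g' + f' * g)"
    using homog_add[OF homog_mult[OF *(1,4)] homog_mult[OF *(2,3), unfolded mult.commute[of g]]]
    by simp
  ultimately show ?thesis using assms by (auto simp: hfracs_iff)
qed

lemma eqv_mult:
  assumes "(f, g) \<in> hfracs n q" "(f', g') \<in> hfracs n q" "(a, b) \<in> hfracs n q" "(a', b') \<in> hfracs n q"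
    "eqv f g a b" "eqv f' g' a' b'"
  shows "eqv (f * f') (g * g') (a * a') (b * b')" "eqv (f * g' + f' * g) (g * g') (a * b' + a' * b) (b * b')"
proof -
  from assms obtain h k where h: "h \<in> dens" "h * (f * b - a * g) \<in> I"
    and k: "k \<in> dens" "k * (f' * b' - a' * g') \<in> I" by (auto simp: eqv_def)
  have P: "h \<in> P n" "k \<in> P n" using h k by (auto simp: dens_def)
  note p = hfracsD[OF assms(1)] hfracsD[OF assms(2)] hfracsD[OF assms(3)] hfracsD[OF assms(4)]
  have "(h * k) * ((f * f') * (b * b') - (a * a') * (g * g')) =
     (k * f' * b') * (h * (f * b - a * g)) + (h * a * g) * (k * (f' * b' - a' * g'))"
    by (simp add: algebra_simps)
  moreover have "\<dots> \<in> I"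
    by (intro pidealD(3)[OF I] pidealD(4)[OF I, of _ "h * (f * b - a * g)"]
          pidealD(4)[OF I, of _ "k * (f' * b' - a' * g')"]) (use h k p P in auto)
  ultimately show "eqv (f * f') (g * g') (a * a') (b * b')"
    unfolding eqv_def using dens_mult h k by metis
  have "(h * k) * ((f * g' + f' * g) * (b * b') - (a * b' + a' * b) * (g * g')) =
     (k * g' * b') * (h * (f * b - a * g)) + (h * b * g) * (k * (f' * b' - a' * g'))"
    by (simp add: algebra_simps)
  moreover have "\<dots> \<in> I"
    by (intro pidealD(3)[OF I] pidealD(4)[OF I, of _ "h * (f * b - a * g)"]
          pidealD(4)[OF I, of _ "k * (f' * b' - a' * g')"]) (use h k p P in auto)
  ultimately show "eqv (f * g' + f' * g) (g * g') (a * b' + a' * b) (b * b')"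
    unfolding eqv_def using dens_mult h k by metis
qed

lemma hfrac_self: "(f, g) \<in> hfracs n q \<Longrightarrow> (f, g) \<in> hfrac n I q f g"
  using eqv_refl by (auto simp: hfrac_eq)

lemma local_mult:
  assumes "(f, g) \<in> hfracs n q" "(f', g') \<in> hfracs n q"
  shows "hfrac n I q f g \<otimes>\<^bsub>local_ring n I q\<^esub> hfrac n I q f' g' = hfrac n I q (f * f') (g * g')"
proof -
  have "hfrac n I q (a * a') (b * b') = hfrac n I q (f * f') (g * g')"
    if ab: "(a, b) \<in> hfrac n I q f g" "(a', b') \<in> hfrac n I q f' g'" for a b a' b'
  proof -
    have *: "(a, b) \<in> hfracs n q" "(a', b') \<in> hfracs n q" "eqv a b f g" "eqv a' b' f' g'"
      using ab eqv_sym by (auto simp: hfrac_eq)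
    show ?thesis
      using hfrac_eq_iff[OF hfracs_mult[OF *(1,2)] hfracs_mult[OF assms]] eqv_mult(1)[OF *(1,2) assms *(3,4)]
      by blast
  qed
  then show ?thesis
    unfolding local_ring_def monoid.simps ring.simps
    by (intro UN_pair_const[OF hfrac_self hfrac_self] assms)
qed

lemma local_add:
  assumes "(f, g) \<in> hfracs n q" "(f', g') \<in> hfracs n q"
  shows "hfrac n I q f g \<oplus>\<^bsub>local_ring n I q\<^esub> hfrac n I q f' g' = hfrac n I q (f * g' + f' * g) (g * g')"
proof -
  have "hfrac n I q (a * b' + a' * b) (b * b') = hfrac n I q (f * g' + f' * g) (g * g')"
    if ab: "(a, b) \<in> hfrac n I q f g" "(a', b') \<in> hfrac n I q f' g'" for a b a' b'
  proof -
    have *: "(a, b) \<in> hfracs n q" "(a', b') \<in> hfracs n q" "eqv a b f g" "eqv a' b' f' g'"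
      using ab eqv_sym by (auto simp: hfrac_eq)
    show ?thesis
      using hfrac_eq_iff[OF hfracs_add[OF *(1,2)] hfracs_add[OF assms]] eqv_mult(2)[OF *(1,2) assms *(3,4)]
      by blast
  qed
  then show ?thesis
    unfolding local_ring_def monoid.simps ring.simps
    by (intro UN_pair_const[OF hfrac_self hfrac_self] assms)
qed

lemma hfracs_one: "(1, 1) \<in> hfracs n q" and hfracs_zero_one: "(0, 1) \<in> hfracs n q"
  using q_one by (auto simp: hfracs_iff intro: homog_one homog_zero exI[of _ 0])

lemma local_pow:
  assumes "(f, g) \<in> hfracs n q"
  shows "hfrac n I q f g [^]\<^bsub>local_ring n I q\<^esub> (k::nat) = hfrac n I q (f ^ k) (g ^ k) \<and> (f ^ k, g ^ k) \<in> hfracs n q"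
proof (induction k)
  case 0
  then show ?case using hfracs_one by (simp add: nat_pow_def) (simp add: local_ring_def)
next
  case (Suc k)
  have "hfrac n I q f g [^]\<^bsub>local_ring n I q\<^esub> Suc k =
      hfrac n I q f g [^]\<^bsub>local_ring n I q\<^esub> k \<otimes>\<^bsub>local_ring n I q\<^esub> hfrac n I q f g"
    by (simp add: nat_pow_def)
  then show ?case
    using Suc hfracs_mult[OF _ assms, of "f ^ k" "g ^ k"] local_mult[OF _ assms, of "f ^ k" "g ^ k"]
    by (simp add: mult.commute)
qed

lemma hfrac_zero_iff:
  "(f, g) \<in> hfracs n q \<Longrightarrow> hfrac n I q f g = \<zero>\<^bsub>local_ring n I q\<^esub> \<longleftrightarrow> (\<exists>h\<in>dens. h * f \<in> I)"
  using hfrac_eq_iff[OF _ hfracs_zero_one, of f g] by (simp add: local_ring_def eqv_def)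

end

section \<open>Reduced zero-dimensional schemes: the ideal as intersection of the points\<close>

section \<open>Reduced zero-dimensional schemes\<close>

lemma indet_power_eq: "indet i ^ k = pp (Poly_Mapping.single i k)"
proof (induction k)
  case (Suc k)
  then show ?case by (simp add: indet_def mult_single flip: single_add)
qed simp

lemma pp_split_power:
  assumes "k \<le> lkp m i"
  shows "pp m = (indet i ^ k * pp (m - Poly_Mapping.single i k) :: 'k::field mpoly)"
    and "mdeg (m - Poly_Mapping.single i k) = mdeg m - k"
    and "Poly_Mapping.keys m \<subseteq> {..n} \<Longrightarrow> Poly_Mapping.keys (m - Poly_Mapping.single i k) \<subseteq> {..n}"
proof -
  have *: "m = Poly_Mapping.single i k + (m - Poly_Mapping.single i k)"
    using assms by (intro poly_mapping_eqI) (auto simp: lookup_add lookup_minus lookup_single when_def)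
  show "pp m = (indet i ^ k * pp (m - Poly_Mapping.single i k) :: 'k mpoly)"
    unfolding indet_power_eq mult_single using * by simp
  show "mdeg (m - Poly_Mapping.single i k) = mdeg m - k"
    using arg_cong[OF *, of mdeg] unfolding mdeg_add mdeg_single by simp
  show "Poly_Mapping.keys m \<subseteq> {..n} \<Longrightarrow> Poly_Mapping.keys (m - Poly_Mapping.single i k) \<subseteq> {..n}"
    by (auto simp: in_keys_iff lookup_minus subset_iff)
qed

lemma exists_large_exponent:
  assumes "Poly_Mapping.keys m \<subseteq> {..n}" "Suc n * k \<le> mdeg m"
  obtains i where "i \<le> n" "k \<le> lkp m i"
proof (cases "k = 0")
  case False
  have "\<exists>i\<le>n. k \<le> lkp m i"
  proof (rule ccontr)
    assume "\<not> ?thesis"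
    then have "\<forall>i\<in>{..n}. lkp m i < k" by auto
    then have "(\<Sum>i\<le>n. lkp m i) < (\<Sum>i\<le>n. k)" by (intro sum_strict_mono) auto
    moreover have "mdeg m = (\<Sum>i\<le>n. lkp m i)" using assms by (intro mdeg_superset) auto
    ultimately show False using assms by simp
  qed
  then show ?thesis using that by blast
qed (use that in auto)

lemma exists_uniform_power:
  assumes Q: "pideal n Q" and "\<And>i. i \<le> n \<Longrightarrow> \<exists>k. indet i ^ k \<in> Q"
  obtains N where "\<And>i. i \<le> n \<Longrightarrow> indet i ^ N \<in> Q"
proof -
  from assms(2) obtain k where k: "\<And>i. i \<le> n \<Longrightarrow> indet i ^ k i \<in> Q" by metis
  define N where "N = Max (k ` {..n})"
  have "indet i ^ N \<in> Q" if "i \<le> n" for i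
  proof -
    have "k i \<le> N" unfolding N_def using that by (intro Max_ge) auto
    then have "indet i ^ N = (indet i ^ (N - k i) * indet i ^ k i :: 'a mpoly)"
      by (simp add: power_add[symmetric])
    then show ?thesis using k[OF that] that by (auto intro!: pidealD(4)[OF Q])
  qed
  then show thesis using that by blast
qed

text \<open>Finiteness of the set of points is an assumption here; in the theorem it comes from the
  bound on the degree.\<close>

locale zdim =
  fixes n :: nat and I :: "'k::field mpoly set"
  assumes scheme: "proj_subscheme n I"
    and dim_0: "zero_dimensional n I"
    and reduced: "reduced_scheme n I"
    and hyperplane: "\<forall>q\<in>closed_points n I. indet 0 \<notin> q"
    and fin: "finite (closed_points n I)"
begin

abbreviation "pts \<equiv> closed_points n I"

lemma pts_eq: "points n I = pts" and pts_ne: "pts \<noteq> {}"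
  using dim_0 by (auto simp: zero_dimensional_def)

lemma pts_max: "q \<in> pts \<Longrightarrow> q' \<in> pts \<Longrightarrow> q \<subseteq> q' \<Longrightarrow> q' = q"
  using pts_eq unfolding closed_points_def by blast

lemma ptsD:
  assumes "q \<in> pts"
  shows "homogeneous_ideal n q" "pideal n q" "1 \<notin> q" "I \<subseteq> q"
    "f \<in> P n \<Longrightarrow> g \<in> P n \<Longrightarrow> f * g \<in> q \<Longrightarrow> f \<in> q \<or> g \<in> q" "indet 0 \<notin> q" "primeideal q (mpoly_ring n)"
proof -
  have q: "q \<in> points n I" using assms pts_eq by simp
  show "homogeneous_ideal n q" "pideal n q" "1 \<notin> q" "I \<subseteq> q"
    "f \<in> P n \<Longrightarrow> g \<in> P n \<Longrightarrow> f * g \<in> q \<Longrightarrow> f \<in> q \<or> g \<in> q"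
    using pointsD(1-5)[OF q] by blast+
  show "indet 0 \<notin> q" using hyperplane assms by blast
  show "primeideal q (mpoly_ring n)" using q unfolding points_def by blast
qed

lemma ptsI:
  "homogeneous_ideal n q \<Longrightarrow> primeideal q (mpoly_ring n) \<Longrightarrow> I \<subseteq> q \<Longrightarrow> i \<le> n \<Longrightarrow> indet i \<notin> q \<Longrightarrow> q \<in> pts"
  unfolding pts_eq[symmetric] points_def by blast

lemma I_hom: "homogeneous_ideal n I" and
  I_sat: "f \<in> P n \<Longrightarrow> (\<And>i. i \<le> n \<Longrightarrow> indet i * f \<in> I) \<Longrightarrow> f \<in> I"
  using scheme by (auto simp: proj_subscheme_def)

lemmas I_id = homogeneous_idealD(1)[OF I_hom]
lemmas I_hc = homogeneous_idealD(2)[OF I_hom]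

lemma pt_power: "q \<in> pts \<Longrightarrow> f \<in> P n \<Longrightarrow> f ^ k \<in> q \<Longrightarrow> f \<in> q"
proof (induction k)
  case 0 then show ?case using ptsD(3) by auto
next
  case (Suc k) then show ?case using ptsD(5)[of q f "f ^ k"] by auto
qed

lemma X0_power_notin: "q \<in> pts \<Longrightarrow> indet 0 ^ k \<notin> q"
  using pt_power ptsD(6) by (metis P_indet le0)

lemma hom_colon:
  assumes f: "f \<in> P n" "homog d f"
  shows "homogeneous_ideal n {x \<in> P n. x * f \<in> I}"
proof -
  have "hcomp i x * f \<in> I" if "x \<in> P n" "x * f \<in> I" for x i
    using I_hc[OF that(2), of "i + d"] hcomp_mult_homog[OF f(2), of "i + d" x] by (simp add: mult.commute)
  moreover have "(x + y) * f \<in> I" if "x * f \<in> I" "y * f \<in> I" for x y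
    using pidealD(3)[OF I_id that] by (simp add: distrib_right)
  moreover have "(a * x) * f \<in> I" if "a \<in> P n" "x * f \<in> I" for x a
    using pidealD(4)[OF I_id that] by (simp add: mult.assoc)
  ultimately show ?thesis
    unfolding homogeneous_ideal_iff pideal_def using pidealD(2)[OF I_id] by auto
qed

text \<open>If no g f^k with g a denominator at q lay in I, a homogeneous prime over I avoiding all
  these products would be contained in q, hence equal to q by zero-dimensionality, although f is in
  q. So the fraction of f by a power of X_0 is nilpotent in the local ring, and reducedness makes it
  0.\<close>

lemma local_vanish:
  assumes f: "f \<in> P n" "homog d f" "\<And>q. q \<in> pts \<Longrightarrow> f \<in> q" and qp: "q \<in> pts"
  obtains h where "h \<in> P n" "h \<notin> q" "h * f \<in> I"
proof (cases "f = 0")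
  case True
  then show ?thesis using that[of 1] ptsD(3)[OF qp] pidealD(2)[OF I_id] by auto
next
  case False
  then have d: "d \<ge> 0" using f(2) homog_neg by (metis not_le)
  interpret hprime n I q using I_id ptsD(7)[OF qp] by (rule hprime.intro)
  define M where "M = {g * f ^ k |g k. g \<in> dens}"
  have MI: "g \<in> dens \<Longrightarrow> g * f ^ k \<in> M" for g k unfolding M_def by blast
  have MP: "M \<subseteq> P n" using f unfolding M_def dens_def by auto
  have "\<exists>g\<in>dens. \<exists>k. g * f ^ k \<in> I"
  proof (rule ccontr)
    assume "\<not> ?thesis"
    then have disj: "I \<inter> M = {}" unfolding M_def by blast
    have mult: "a * b \<in> M" if "a \<in> M" "b \<in> M" for a b
    proof -
      from that obtain g k g' k' where "a = g * f ^ k" "b = g' * f ^ k'" "g \<in> dens" "g' \<in> dens"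
        unfolding M_def by blast
      then have "a * b = (g * g') * f ^ (k + k')" "g * g' \<in> dens"
        using dens_mult by (auto simp: power_add algebra_simps)
      then show ?thesis using MI by metis
    qed
    have one: "1 \<in> M" using MI[OF dens_one, of 0] by simp
    obtain q' where q': "homogeneous_ideal n q'" "primeideal q' (mpoly_ring n)" "I \<subseteq> q'" "q' \<inter> M = {}"
      using exists_homogeneous_prime[OF I_hom MP one mult disj] by blast
    have sub: "q' \<subseteq> q"
    proof
      fix x assume x: "x \<in> q'"
      have "hcomp i x \<in> q" for i
      proof (rule ccontr)
        assume "hcomp i x \<notin> q"
        then have "hcomp i x \<in> dens"
          using pidealD(1)[OF homogeneous_idealD(1)[OF q'(1)] x] unfolding dens_def by (auto intro: homog_hcomp)
        then have "hcomp i x * f ^ 0 \<in> M" by (rule MI)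
        then show False using homogeneous_idealD(2)[OF q'(1) x, of i] q'(4) by auto
      qed
      then show "x \<in> q" using sum_hcomp'[of x] pidealD(8)[OF q_id, of "hdegs x" "\<lambda>i. hcomp i x"] by simp
    qed
    have "indet 0 \<notin> q'" using sub ptsD(6)[OF qp] by blast
    then have "q' \<in> pts" using ptsI[of q' 0] q' by auto
    then have "q = q'" using pts_max[OF _ qp sub] by simp
    then have "f \<in> q'" using f(3)[OF qp] by simp
    moreover have "f \<in> M" using MI[OF dens_one, of 1] by simp
    ultimately show False using q'(4) by blast
  qed
  then obtain g k where g: "g \<in> dens" "g * f ^ k \<in> I" by blast
  have fr: "(f, indet 0 ^ nat d) \<in> hfracs n q"
    unfolding hfracs_iff using f X0_power_notin[OF qp] d homog_indet_power[of "nat d" 0] by auto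
  have "hfrac n I q f (indet 0 ^ nat d) [^]\<^bsub>local_ring n I q\<^esub> k = \<zero>\<^bsub>local_ring n I q\<^esub>"
    using local_pow[OF fr, of k] hfrac_zero_iff g by auto
  moreover have "hfrac n I q f (indet 0 ^ nat d) \<in> carrier (local_ring n I q)"
    using fr unfolding local_ring_def by auto
  ultimately have "hfrac n I q f (indet 0 ^ nat d) = \<zero>\<^bsub>local_ring n I q\<^esub>"
    using reduced qp unfolding reduced_scheme_def pts_eq by blast
  then obtain h where "h \<in> dens" "h * f \<in> I" using hfrac_zero_iff[OF fr] by blast
  then show thesis using that unfolding dens_def by blast
qed

text \<open>By the pigeonhole principle each monomial of degree (n + 1) N is divisible by some X_i^N
  and so multiplies f into I. Saturatedness then lowers this degree one step at a time down to
  0.\<close>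

lemma saturation:
  assumes f: "f \<in> P n" and "\<And>i. i \<le> n \<Longrightarrow> indet i ^ N * f \<in> I"
  shows "f \<in> I"
proof -
  have *: "(\<And>m. Poly_Mapping.keys m \<subseteq> {..n} \<Longrightarrow> mdeg m = D \<Longrightarrow> pp m * f \<in> I) \<Longrightarrow> f \<in> I" for D
  proof (induction D)
    case 0 then show ?case using "0"[of 0] by simp
  next
    case (Suc D)
    show ?case
    proof (rule Suc.IH)
      fix m :: "nat \<Rightarrow>\<^sub>0 nat" assume m: "Poly_Mapping.keys m \<subseteq> {..n}" "mdeg m = D"
      show "pp m * f \<in> I"
      proof (rule I_sat)
        fix i assume i: "i \<le> n"
        have "pp (Poly_Mapping.single i 1 + m) * f \<in> I"
        proof (rule Suc.prems)
          show "Poly_Mapping.keys (Poly_Mapping.single i 1 + m) \<subseteq> {..n}"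
            using keys_add[of "Poly_Mapping.single i 1" m] m i by fastforce
          show "mdeg (Poly_Mapping.single i 1 + m) = Suc D" unfolding mdeg_add mdeg_single m by simp
        qed
        then show "indet i * (pp m * f) \<in> I" by (simp add: indet_def mult_single mult.assoc[symmetric])
      next
        have "pp m \<in> (P n :: 'k mpoly set)" by (rule P_pp[OF m(1)])
        then show "pp m * f \<in> P n" using f by simp
      qed
    qed
  qed
  show ?thesis
  proof (rule *[of "Suc n * N"])
    fix m :: "nat \<Rightarrow>\<^sub>0 nat" assume m: "Poly_Mapping.keys m \<subseteq> {..n}" "mdeg m = Suc n * N"
    obtain i where i: "i \<le> n" "N \<le> lkp m i" using exists_large_exponent[OF m(1)] m(2) by (metis order_refl)
    have "pp m * f = pp (m - Poly_Mapping.single i N) * (indet i ^ N * f)"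
      by (subst pp_split_power(1)[OF i(2)]) (simp add: ac_simps)
    moreover have "pp (m - Poly_Mapping.single i N) * (indet i ^ N * f) \<in> I"
      by (rule pidealD(4)[OF I_id P_pp[OF pp_split_power(3)[OF i(2) m(1)]] assms(2)[OF i(1)]])
    ultimately show "pp m * f \<in> I" by metis
  qed
qed

text \<open>No point contains the annihilator of f modulo I: at a point, \<open>local_vanish\<close>
  supplies a multiplier outside it. So no homogeneous prime over the annihilator misses an X_i, the
  annihilator contains a power of each X_i, and saturation applies.\<close>

lemma I_eq_homog:
  assumes f: "f \<in> P n" "homog d f" "\<And>q. q \<in> pts \<Longrightarrow> f \<in> q"
  shows "f \<in> I"
proof -
  let ?Q = "{x \<in> P n. x * f \<in> I}"
  have hQ: "homogeneous_ideal n ?Q" by (rule hom_colon[OF f(1,2)])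
  have "\<exists>k. indet i ^ k \<in> ?Q" if i: "i \<le> n" for i
  proof (rule ccontr)
    assume "\<not> ?thesis"
    then have M4: "?Q \<inter> range (\<lambda>k. indet i ^ k) = {}" by blast
    have M2: "(1::'k mpoly) \<in> range (\<lambda>k. indet i ^ k)" by (metis power_0 rangeI)
    have M1: "range (\<lambda>k. indet i ^ k) \<subseteq> (P n :: 'k mpoly set)" using i by auto
    have M3: "a * b \<in> range (\<lambda>k. indet i ^ k)"
      if "a \<in> range (\<lambda>k. indet i ^ k)" "b \<in> range (\<lambda>k. indet i ^ k)" for a b :: "'k mpoly"
      using that by (auto simp: power_add[symmetric])
    obtain q where q: "homogeneous_ideal n q" "primeideal q (mpoly_ring n)" "?Q \<subseteq> q"
      "q \<inter> range (\<lambda>k. indet i ^ k) = {}"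
      using exists_homogeneous_prime[OF hQ M1 M2 M3 M4] by blast
    have "I \<subseteq> ?Q" using pidealD(1,5)[OF I_id] f by auto
    moreover have "indet i \<notin> q" using q(4) by (metis disjoint_iff power_one_right rangeI)
    ultimately have "q \<in> pts" using ptsI[OF q(1,2) _ i] q(3) by blast
    then obtain h where "h \<in> P n" "h \<notin> q" "h * f \<in> I" using local_vanish[OF f] by blast
    then show False using q(3) by blast
  qed
  then obtain N where "\<And>i. i \<le> n \<Longrightarrow> indet i ^ N \<in> ?Q"
    using exists_uniform_power[OF homogeneous_idealD(1)[OF hQ]] by blast
  then show ?thesis using saturation[OF f(1)] by blast
qed

theorem I_eq: "f \<in> I \<longleftrightarrow> f \<in> P n \<and> (\<forall>q\<in>pts. f \<in> q)"
proof
  assume "f \<in> I" then show "f \<in> P n \<and> (\<forall>q\<in>pts. f \<in> q)" using pidealD(1)[OF I_id] ptsD(4) by blast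
next
  assume f: "f \<in> P n \<and> (\<forall>q\<in>pts. f \<in> q)"
  have "hcomp i f \<in> I" for i
    using f homogeneous_idealD(2)[OF ptsD(1)] by (intro I_eq_homog[OF _ homog_hcomp]) auto
  then show "f \<in> I" using sum_hcomp'[of f] pidealD(8)[OF I_id, of "hdegs f" "\<lambda>i. hcomp i f"] by simp
qed

lemma X0_nzd: "f \<in> P n \<Longrightarrow> indet 0 * f \<in> I \<Longrightarrow> f \<in> I"
  unfolding I_eq using ptsD(5)[OF _ P_indet[OF le0]] ptsD(6) by blast

lemma one_notin: "1 \<notin> I" using pts_ne ptsD(3) by (auto simp: I_eq)

text \<open>As no point lies on X_0 = 0, a homogeneous prime over I + (X_0) contains every X_i;
  hence so does the radical of I + (X_0).\<close>

lemma nilpotent_mod_X0: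
  obtains N where "\<And>i. i \<le> n \<Longrightarrow> \<exists>x\<in>I. \<exists>c\<in>P n. indet i ^ N = x + indet 0 * c"
proof -
  define Q where "Q = {x + indet 0 * c |x c. x \<in> I \<and> c \<in> P n}"
  note Q = homogeneous_ideal_add_principal[OF I_hom P_indet[OF le0] homog_indet, folded Q_def]
  have "\<exists>k. indet i ^ k \<in> Q" if i: "i \<le> n" for i
  proof (rule ccontr)
    assume "\<not> ?thesis"
    then have M4: "Q \<inter> range (\<lambda>k. indet i ^ k) = {}" by blast
    have M2: "(1::'k mpoly) \<in> range (\<lambda>k. indet i ^ k)" by (metis power_0 rangeI)
    have M1: "range (\<lambda>k. indet i ^ k) \<subseteq> (P n :: 'k mpoly set)" using i by auto
    have M3: "a * b \<in> range (\<lambda>k. indet i ^ k)"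
      if "a \<in> range (\<lambda>k. indet i ^ k)" "b \<in> range (\<lambda>k. indet i ^ k)" for a b :: "'k mpoly"
      using that by (auto simp: power_add[symmetric])
    obtain q where q: "homogeneous_ideal n q" "primeideal q (mpoly_ring n)" "Q \<subseteq> q"
      "q \<inter> range (\<lambda>k. indet i ^ k) = {}"
      using exists_homogeneous_prime[OF Q(1) M1 M2 M3 M4] by blast
    have "indet i \<notin> q" using q(4) by (metis disjoint_iff power_one_right rangeI)
    then have "q \<in> pts" using ptsI[OF q(1,2) _ i] q(3) Q(2) by blast
    then show False using ptsD(6) q(3) Q(3) by blast
  qed
  then obtain N where "\<And>i. i \<le> n \<Longrightarrow> indet i ^ N \<in> Q"
    using exists_uniform_power[OF homogeneous_idealD(1)[OF Q(1)]] by blast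
  then show thesis unfolding Q_def by (intro that[of N]) blast
qed

text \<open>In the coordinate ring this reads R_d = x_0 R_(d-1) for large d. A monomial of large
  degree contains some X_i^N, which is a multiple of X_0 modulo I; passing to the component of
  degree d makes the cofactor homogeneous.\<close>

lemma stabilization:
  obtains D where "\<And>f d. f \<in> P n \<Longrightarrow> homog (int d) f \<Longrightarrow> d > D \<Longrightarrow>
    \<exists>g\<in>P n. homog (int d - 1) g \<and> f - indet 0 * g \<in> I"
proof -
  obtain N where N: "\<And>i. i \<le> n \<Longrightarrow> \<exists>x\<in>I. \<exists>c\<in>P n. indet i ^ N = x + indet 0 * c"
    using nilpotent_mod_X0 by blast
  have mon: "\<exists>g\<in>P n. homog (int d - 1) g \<and> pp m - indet 0 * g \<in> I"
    if m: "Poly_Mapping.keys m \<subseteq> {..n}" "mdeg m = d" "d > Suc n * N" for m d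
  proof -
    obtain i where i: "i \<le> n" "N \<le> lkp m i" using exists_large_exponent[OF m(1)] m(2,3) by (metis less_imp_le)
    obtain x c where xc: "x \<in> I" "c \<in> P n" "indet i ^ N = x + indet 0 * c" using N[OF i(1)] by blast
    let ?m = "m - Poly_Mapping.single i N"
    have Pm: "pp ?m \<in> (P n :: 'k mpoly set)" using P_pp[OF pp_split_power(3)[OF i(2) m(1)]] .
    let ?g = "hcomp (int d - 1) (pp ?m * c)"
    have "pp m = pp ?m * x + indet 0 * (pp ?m * c)"
      unfolding pp_split_power(1)[OF i(2)] xc by (simp add: algebra_simps)
    then have "hcomp (int d) (pp m) = hcomp (int d) (pp ?m * x) + indet 0 * ?g"
      by (simp only: hcomp_add hcomp_mult_homog[OF homog_indet])
    moreover have "hcomp (int d) (pp m) = pp m" using hcomp_same[OF homog_pp] m(2) by metis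
    ultimately have "pp m - indet 0 * ?g = hcomp (int d) (pp ?m * x)"
      by (metis add_diff_cancel_right')
    moreover have "\<dots> \<in> I" using I_hc pidealD(4)[OF I_id Pm xc(1)] by blast
    moreover have "?g \<in> P n" using Pm xc by auto
    ultimately show ?thesis by (metis homog_hcomp)
  qed
  show thesis
  proof (rule that[of "Suc n * N"])
    fix f :: "'k mpoly" and d assume f: "f \<in> P n" "homog (int d) f" "d > Suc n * N"
    obtain F c where F: "f = (\<Sum>m\<in>F. Cst (c m) * pp m)" "finite F"
      "\<And>m. m \<in> F \<Longrightarrow> Poly_Mapping.keys m \<subseteq> {..n} \<and> int (mdeg m) = int d" using pp_decomp[OF f(1,2)] by blast
    have "\<forall>m\<in>F. \<exists>g. g \<in> P n \<and> homog (int d - 1) g \<and> pp m - indet 0 * g \<in> I"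
    proof
      fix m assume "m \<in> F"
      then have "Poly_Mapping.keys m \<subseteq> {..n}" "mdeg m = d" using F(3)[of m] by auto
      then show "\<exists>g. g \<in> P n \<and> homog (int d - 1) g \<and> pp m - indet 0 * g \<in> I" using mon[of m d] f(3) by blast
    qed
    then obtain g where g: "\<And>m. m \<in> F \<Longrightarrow> g m \<in> P n \<and> homog (int d - 1) (g m) \<and> pp m - indet 0 * g m \<in> I"
      by metis
    have "f - indet 0 * (\<Sum>m\<in>F. Cst (c m) * g m) = (\<Sum>m\<in>F. Cst (c m) * (pp m - indet 0 * g m))"
      unfolding F(1) by (simp add: sum_distrib_left sum_subtractf algebra_simps)
    moreover have "\<dots> \<in> I" using g by (intro pidealD(8,9)[OF I_id]) auto
    moreover have "(\<Sum>m\<in>F. Cst (c m) * g m) \<in> P n" using g by (intro P_sum) auto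
    moreover have "homog (int d - 1) (\<Sum>m\<in>F. Cst (c m) * g m)" using g by (intro homog_sum homog_Cst_mult) auto
    ultimately show "\<exists>g\<in>P n. homog (int d - 1) g \<and> f - indet 0 * g \<in> I" by metis
  qed
qed

end

section \<open>Finite-dimensional spaces of polynomials, forms and dehomogenization\<close>

section \<open>Linear algebra\<close>

text \<open>The vector space is the whole polynomial type, in infinitely many variables. Finite
  dimension is therefore always expressed by an inclusion into the span of a finite set.\<close>

definition scl :: "'k::field \<Rightarrow> 'k mpoly \<Rightarrow> 'k mpoly" where "scl c f = Cst c * f"

interpretation pv: vector_space "scl :: 'k::field \<Rightarrow> 'k mpoly \<Rightarrow> 'k mpoly"
  by unfold_locales (simp_all add: scl_def Cst_simps algebra_simps)

interpretation pvp: vector_space_pair "scl :: 'k::field \<Rightarrow> 'k mpoly \<Rightarrow> 'k mpoly"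
  "scl :: 'k \<Rightarrow> 'k mpoly \<Rightarrow> 'k mpoly"
  by unfold_locales

abbreviation plinear :: "('k::field mpoly \<Rightarrow> 'k mpoly) \<Rightarrow> bool" where
  "plinear \<equiv> Vector_Spaces.linear scl scl"

lemma plinearI:
  "(\<And>f g. F (f + g) = F f + F g) \<Longrightarrow> (\<And>c f. F (Cst c * f) = Cst c * F f) \<Longrightarrow> plinear F"
  unfolding Vector_Spaces.linear_iff using pv.vector_space_axioms by (auto simp: scl_def)

lemma plinearD:
  assumes "plinear F"
  shows "F (f + g) = F f + F g" "F (f - g) = F f - F g" "F 0 = 0" "F (Cst c * f) = Cst c * F f"
    "F (sum h A) = (\<Sum>a\<in>A. F (h a))" "F (- f) = - F f"
  using pvp.linear_add[OF assms] pvp.linear_diff[OF assms] pvp.linear_0[OF assms]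
    pvp.linear_scale[OF assms] pvp.linear_sum[OF assms] pvp.linear_neg[OF assms]
  by (auto simp: scl_def)

lemma pideal_subspace: "pideal n J \<Longrightarrow> pv.subspace J"
  by (rule pv.subspaceI) (auto simp: scl_def intro: pidealD)

lemma P_subspace: "pv.subspace (P n)"
  by (rule pv.subspaceI) (auto simp: scl_def)

lemma (in vector_space) subspace_eq_span_card:
  assumes T: "finite T" and S: "independent S" "S \<subseteq> span T" "card T \<le> card S"
  shows "span S = span T"
proof -
  have fS: "finite S" using independent_span_bound[OF T S(1,2)] by simp
  have "t \<in> span S" if "t \<in> T" for t
  proof (rule ccontr)
    assume t: "t \<notin> span S"
    then have "independent (insert t S)" using S(1) independent_insertI by blast
    moreover have "insert t S \<subseteq> span T" using S(2) that span_base by blast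
    ultimately have "card (insert t S) \<le> card T" using independent_span_bound[OF T] by blast
    moreover have "t \<notin> S" using t span_base by blast
    ultimately show False using fS S(3) by simp
  qed
  then have "span T \<subseteq> span S" using span_minimal subspace_span by blast
  moreover have "span S \<subseteq> span T" using S(2) span_minimal subspace_span by blast
  ultimately show ?thesis by blast
qed

lemma (in vector_space) subspace_dim:
  assumes U: "subspace U" "U \<subseteq> span T" and T: "finite T"
  shows "\<exists>B. finite B \<and> independent B \<and> span B = U \<and> card B = dim U" "dim U \<le> card T"
    "independent T \<Longrightarrow> dim U = card T \<Longrightarrow> U = span T"
proof -
  obtain B where B: "B \<subseteq> U" "independent B" "U \<subseteq> span B" "card B = dim U" using basis_exists by blast
  have sp: "span B = U" using B U(1) span_minimal by blast
  have BT: "B \<subseteq> span T" using B(1) U(2) by blast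
  have fB: "finite B \<and> card B \<le> card T" using independent_span_bound[OF T B(2) BT] .
  show "\<exists>B. finite B \<and> independent B \<and> span B = U \<and> card B = dim U" using B sp fB by blast
  show "dim U \<le> card T" using fB B by simp
  show "dim U = card T \<Longrightarrow> U = span T" using subspace_eq_span_card[OF T B(2) BT] B(4) sp by simp
qed

lemma (in vector_space) subspace_dim_mono:
  assumes U: "subspace U" "subspace W" "U \<subseteq> W" "W \<subseteq> span T" and T: "finite T"
  shows "dim U \<le> dim W" "dim U = dim W \<Longrightarrow> U = W"
proof -
  obtain B where B: "finite B" "independent B" "span B = W" "card B = dim W"
    using subspace_dim(1)[OF U(2,4) T] by blast
  show "dim U \<le> dim W" using subspace_dim(2)[OF U(1), of B] B U(3) by simp
  show "dim U = dim W \<Longrightarrow> U = W" using subspace_dim(3)[OF U(1), of B] B U(3) by simp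
qed

lemma plinear_inj_dim:
  assumes F: "plinear F" and U: "pv.subspace U" "U \<subseteq> pv.span T" "finite T"
    and inj: "\<And>u. u \<in> U \<Longrightarrow> F u = 0 \<Longrightarrow> u = 0"
  shows "pv.dim (F ` U) = pv.dim U"
proof -
  obtain B where B: "finite B" "pv.independent B" "pv.span B = U" "card B = pv.dim U"
    using pv.subspace_dim(1)[OF U] by blast
  have io: "inj_on F (pv.span B)"
  proof (rule inj_onI)
    fix x y assume *: "x \<in> pv.span B" "y \<in> pv.span B" "F x = F y"
    then have "x - y \<in> U" using B(3) pv.subspace_diff[OF U(1)] by auto
    then show "x = y" using inj[of "x - y"] plinearD(2)[OF F] * by auto
  qed
  have "pv.independent (F ` B)" by (rule pvp.linear_independent_injective_image[OF F B(2) io])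
  moreover have "pv.span (F ` B) = F ` U" using pvp.linear_span_image[OF F, of B] B(3) by simp
  moreover have "card (F ` B) = card B"
    using card_image[OF inj_on_subset[OF io pv.span_superset]] .
  ultimately show ?thesis using B(4) pv.dim_span_eq_card_independent by metis
qed

lemma plinear_image_subspace: "plinear F \<Longrightarrow> pv.subspace U \<Longrightarrow> pv.subspace (F ` U)"
  using pvp.linear_subspace_image by blast

text \<open>The source of all inverses: it yields von Neumann regularity of the algebra and the dual
  basis of the trace form.\<close>

lemma plinear_inj_surj:
  assumes F: "plinear F" and U: "pv.subspace U" "U \<subseteq> pv.span T" "finite T"
    and inj: "\<And>u. u \<in> U \<Longrightarrow> F u = 0 \<Longrightarrow> u = 0" and into: "F ` U \<subseteq> U"
  shows "F ` U = U"
  using plinear_inj_dim[OF F U inj] pv.subspace_dim_mono(2)[OF plinear_image_subspace[OF F U(1)] U(1) into U(2,3)]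
  by blast

section \<open>Forms\<close>

definition form :: "nat \<Rightarrow> nat \<Rightarrow> 'k::field mpoly set" where
  "form n d = {f \<in> P n. homog (int d) f}"

definition mons :: "nat \<Rightarrow> nat \<Rightarrow> (nat \<Rightarrow>\<^sub>0 nat) set" where
  "mons n d = {m. Poly_Mapping.keys m \<subseteq> {..n} \<and> mdeg m = d}"

text \<open>Exponent vectors are read as lists of length n + 1 with sum d, to which the
  stars-and-bars count applies. Finiteness is then read off from the cardinality not being
  0.\<close>

lemma card_mons: "finite (mons n d)" "card (mons n d) = (n + d) choose n"
proof -
  define L where "L = {l::nat list. length l = Suc n \<and> sum_list l = d}"
  define F :: "(nat \<Rightarrow>\<^sub>0 nat) \<Rightarrow> nat list" where "F m = map (lkp m) [0..<Suc n]" for m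
  have sl: "sum_list (F m) = (\<Sum>i\<le>n. lkp m i)" for m
    unfolding F_def by (subst sum_list_distinct_conv_sum_set) (simp_all add: atLeast0LessThan lessThan_Suc_atMost del: upt_Suc)
  have bij: "bij_betw F (mons n d) L"
  proof (rule bij_betwI')
    fix m m' assume mm: "m \<in> mons n d" "m' \<in> mons n d"
    have "m = m'" if "F m = F m'"
    proof (rule poly_mapping_eqI)
      fix i
      show "lkp m i = lkp m' i"
      proof (cases "i \<le> n")
        case True
        then have "F m ! i = lkp m i" "F m' ! i = lkp m' i"
          unfolding F_def by (simp_all add: nth_append less_Suc_eq_le del: upt_Suc)
        then show ?thesis using that by simp
      next
        case False
        then show ?thesis using mm by (auto simp: mons_def in_keys_iff subset_iff) (metis neq0_conv)
      qed
    qed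
    then show "(F m = F m') = (m = m')" by blast
  next
    fix m assume "m \<in> mons n d"
    then show "F m \<in> L"
      unfolding L_def using sl[of m] mdeg_superset[of "{..n}" m] by (auto simp: mons_def F_def)
  next
    fix l assume l: "l \<in> L"
    let ?m = "Poly_Mapping.nth l"
    have len: "length l = Suc n" using l by (simp add: L_def)
    have kl: "Poly_Mapping.keys ?m \<subseteq> {..n}"
    proof
      fix i assume "i \<in> Poly_Mapping.keys ?m"
      then have "nth_default 0 l i \<noteq> 0" by (simp add: in_keys_iff del: keys_nth)
      then show "i \<in> {..n}" using len by (auto simp: nth_default_def split: if_splits)
    qed
    have Fm: "F ?m = l"
      unfolding F_def using len by (intro nth_equalityI) (auto simp: nth_default_def simp del: upt_Suc)
    have "mdeg ?m = d" using mdeg_superset[OF _ kl] sl[of ?m] Fm l by (simp add: L_def)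
    then have "?m \<in> mons n d" using kl unfolding mons_def by blast
    then show "\<exists>m\<in>mons n d. l = F m" using Fm by metis
  qed
  have cL: "card L = (d + Suc n - 1) choose d" unfolding L_def by (rule card_length_sum_list)
  then have "card L = (n + d) choose n" by (simp add: binomial_symmetric[of d "d + n"] add.commute)
  then show "card (mons n d) = (n + d) choose n" using bij_betw_same_card[OF bij] by simp
  moreover have "(n + d) choose n > 0" by simp
  ultimately show "finite (mons n d)" by (metis card.infinite less_irrefl)
qed

lemma form_subspace: "pv.subspace (form n d)"
  by (rule pv.subspaceI) (auto simp: scl_def form_def homog_add homog_Cst_mult)

lemma pp_form: "m \<in> mons n d \<Longrightarrow> pp m \<in> form n d"
  unfolding form_def mons_def using P_pp homog_pp[of m] by auto

lemma form_span: "(form n d :: 'k::field mpoly set) = pv.span (pp ` mons n d)"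
proof
  show "pv.span (pp ` mons n d) \<subseteq> (form n d :: 'k mpoly set)"
    by (rule pv.span_minimal[OF _ form_subspace]) (auto intro: pp_form)
  show "(form n d :: 'k mpoly set) \<subseteq> pv.span (pp ` mons n d)"
  proof
    fix f :: "'k mpoly" assume "f \<in> form n d"
    then have f: "f \<in> P n" "homog (int d) f" by (auto simp: form_def)
    obtain F c where F: "f = (\<Sum>m\<in>F. Cst (c m) * pp m)" "finite F"
      "\<And>m. m \<in> F \<Longrightarrow> Poly_Mapping.keys m \<subseteq> {..n} \<and> int (mdeg m) = int d" using pp_decomp[OF f] by blast
    have "(\<Sum>m\<in>F. scl (c m) (pp m)) \<in> pv.span (pp ` mons n d)"
      using F(3) by (intro pv.span_sum pv.span_scale pv.span_base) (auto simp: mons_def)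
    then show "f \<in> pv.span (pp ` mons n d)" using F(1) by (simp add: scl_def)
  qed
qed


lemma dim_form: "pv.dim (form n d :: 'k::field mpoly set) = (n + d) choose n"
proof -
  have inj: "inj_on (pp :: _ \<Rightarrow> 'k mpoly) (mons n d)"
    by (rule inj_onI) (metis lookup_single_eq lookup_single_not_eq zero_neq_one)
  have "pv.independent ((pp :: _ \<Rightarrow> 'k mpoly) ` mons n d)"
  proof (rule pv.independent_if_scalars_zero)
    show "finite ((pp :: _ \<Rightarrow> 'k mpoly) ` mons n d)" using card_mons(1) by blast
    fix f :: "'k mpoly \<Rightarrow> 'k" and x :: "'k mpoly"
    assume s: "(\<Sum>x\<in>pp ` mons n d. scl (f x) x) = 0" and x: "x \<in> pp ` mons n d"
    obtain m where m: "m \<in> mons n d" "x = pp m" using x by blast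
    have "(\<Sum>m'\<in>mons n d. scl (f (pp m')) (pp m')) = 0" using s by (simp add: sum.reindex[OF inj])
    then have "(\<Sum>m'\<in>mons n d. lkp (scl (f (pp m')) (pp m')) m) = 0"
      by (simp add: lookup_sum[symmetric])
    moreover have "lkp (scl (f (pp m')) (pp m')) m = (if m' = m then f (pp m) else 0)" for m'
      by (auto simp: scl_def lookup_Cst_mult lookup_single when_def)
    ultimately show "f x = 0" using m card_mons(1) by (simp add: sum.delta)
  qed
  then have "pv.dim (form n d :: 'k mpoly set) = card ((pp :: _ \<Rightarrow> 'k mpoly) ` mons n d)"
    unfolding form_span by (rule pv.dim_span_eq_card_independent)
  then show ?thesis using card_image[OF inj] card_mons(2) by simp
qed

lemma form_X0: "f \<in> form n d \<Longrightarrow> indet 0 * f \<in> form n (Suc d)"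
  using homog_mult[OF homog_indet, of "int d" f 0] by (auto simp: form_def add.commute)

lemma form_indet: "i \<le> n \<Longrightarrow> f \<in> form n d \<Longrightarrow> indet i * f \<in> form n (Suc d)"
  using homog_mult[OF homog_indet, of "int d" f i] by (auto simp: form_def add.commute)

lemma form_Suc_span:
  fixes f :: "'k::field mpoly"
  assumes "f \<in> form n (Suc d)"
  obtains g where "f = (\<Sum>i\<le>n. indet i * g i)" "\<And>i. g i \<in> form n d"
proof -
  let ?T = "{f :: 'k mpoly. \<exists>g. f = (\<Sum>i\<le>n. indet i * g i) \<and> (\<forall>i. g i \<in> form n d)}"
  have "f \<in> pv.span (pp ` mons n (Suc d))" using assms form_span by blast
  moreover have "pv.span (pp ` mons n (Suc d)) \<subseteq> ?T"
  proof (rule pv.span_minimal)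
    show "pp ` mons n (Suc d) \<subseteq> ?T"
    proof
      fix x :: "'k mpoly" assume "x \<in> pp ` mons n (Suc d)"
      then obtain m where m: "x = pp m" "m \<in> mons n (Suc d)" by blast
      then obtain i m' where i: "i \<le> n" "pp m = (indet i * pp m' :: 'k mpoly)" "mdeg m' = d"
        "Poly_Mapping.keys m' \<subseteq> {..n}"
        using pp_split_ex[of m d n] by (auto simp: mons_def)
      have "pp m = (\<Sum>j\<le>n. indet j * (if j = i then pp m' else 0) :: 'k mpoly)"
        using i by (simp add: sum.delta if_distrib cong: if_cong)
      moreover have "(if j = i then pp m' else 0) \<in> (form n d :: 'k mpoly set)" for j
        using i pp_form[of m' n d] pv.subspace_0[OF form_subspace] by (auto simp: mons_def)
      ultimately have "\<exists>g. pp m = (\<Sum>i\<le>n. indet i * g i :: 'k mpoly) \<and> (\<forall>i. g i \<in> form n d)"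
        by (intro exI[of _ "\<lambda>j. if j = i then pp m' else 0"]) blast
      then show "x \<in> ?T" using m(1) by blast
    qed
    show "pv.subspace ?T"
    proof (rule pv.subspaceI)
      show "0 \<in> ?T" using pv.subspace_0[OF form_subspace] by (auto intro!: exI[of _ "\<lambda>_. 0"])
    next
      fix x y assume "x \<in> ?T" "y \<in> ?T"
      then obtain g h where "x = (\<Sum>i\<le>n. indet i * g i)" "\<And>i. g i \<in> form n d"
        "y = (\<Sum>i\<le>n. indet i * h i)" "\<And>i. h i \<in> form n d" by blast
      then show "x + y \<in> ?T"
        by (auto simp: sum.distrib algebra_simps intro!: exI[of _ "\<lambda>i. g i + h i"] pv.subspace_add[OF form_subspace])
    next
      fix c x assume "x \<in> ?T"
      then obtain g where "x = (\<Sum>i\<le>n. indet i * g i)" "\<And>i. g i \<in> form n d" by blast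
      then show "scl c x \<in> ?T"
        by (auto simp: scl_def sum_distrib_left mult.left_commute
            intro!: exI[of _ "\<lambda>i. scl c (g i)"] pv.subspace_scale[OF form_subspace])
    qed
  qed
  ultimately show thesis using that by blast
qed

section \<open>Dehomogenization\<close>

definition degle :: "nat \<Rightarrow> 'k::field mpoly \<Rightarrow> bool" where
  "degle N f \<longleftrightarrow> (\<forall>m. lkp f m \<noteq> 0 \<longrightarrow> mdeg m \<le> N)"

lemma degle_ex: obtains N where "N \<ge> M" "degle N f"
proof -
  let ?N = "Max (insert M (mdeg ` Poly_Mapping.keys f))"
  have "degle ?N f" by (auto simp: degle_def in_keys_iff intro!: Max_ge)
  moreover have "?N \<ge> M" by simp
  ultimately show thesis using that by blast
qed

text \<open>Homogenization to a prescribed degree by powers of X_0. Components of degree above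
  \<open>N\<close> are dropped, so the comparison with \<open>f\<close> assumes
  \<open>degle N f\<close>.\<close>

definition hgz :: "nat \<Rightarrow> 'k::field mpoly \<Rightarrow> 'k mpoly" where
  "hgz N f = (\<Sum>i\<le>N. indet 0 ^ (N - i) * hcomp (int i) f)"

lemma degle_sum_hcomp: "degle N f \<Longrightarrow> (\<Sum>i\<le>N. hcomp (int i) f) = f"
  using sum_hcomp[of "int ` {..N}" f] by (simp add: sum.reindex degle_def in_keys_iff)

lemma hgz_form: "f \<in> P n \<Longrightarrow> hgz N f \<in> form n N"
proof -
  assume f: "f \<in> P n"
  have "homog (int N) (indet 0 ^ (N - i) * hcomp (int i) f)" if "i \<le> N" for i
    using homog_mult[OF homog_indet_power[of "N - i" 0] homog_hcomp[of "int i" f]] that by (simp add: of_nat_diff)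
  then show ?thesis unfolding form_def hgz_def using f by (auto intro!: P_sum homog_sum)
qed

text \<open>The dehomogenization \<open>X\<^sub>0 = 1\<close> is carried out in all \<open>n + 1\<close> variables, by adding
  \<open>X\<^sub>0 - 1\<close> to the ideal.\<close>

definition aff :: "nat \<Rightarrow> 'k::field mpoly set \<Rightarrow> 'k mpoly set" where
  "aff n J = {x + (indet 0 - 1) * c |x c. x \<in> J \<and> c \<in> P n}"

lemma affI: "x \<in> J \<Longrightarrow> c \<in> P n \<Longrightarrow> x + (indet 0 - 1) * c \<in> aff n J"
  unfolding aff_def by blast
lemma affE: "f \<in> aff n J \<Longrightarrow> \<exists>x c. f = x + (indet 0 - 1) * c \<and> x \<in> J \<and> c \<in> P n"
  unfolding aff_def by blast

lemma aff_pideal: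
  fixes J :: "'k::field mpoly set"
  assumes J: "pideal n J" shows "pideal n (aff n J)"
  unfolding pideal_def
proof (intro conjI ballI)
  note d = pidealD[OF J]
  show "aff n J \<subseteq> P n" using d(1) affE by fastforce
  show "0 \<in> aff n J" using affI[OF d(2) P_zero] by simp
  fix f assume "f \<in> aff n J"
  then obtain x c where *: "f = x + (indet 0 - 1) * c" "x \<in> J" "c \<in> P n" using affE by blast
  show "f + g \<in> aff n J" if g: "g \<in> aff n J" for g
  proof -
    obtain y e where **: "g = y + (indet 0 - 1) * e" "y \<in> J" "e \<in> P n" using affE[OF g] by blast
    have "f + g = (x + y) + (indet 0 - 1) * (c + e)" by (simp add: *(1) **(1) algebra_simps)
    then show ?thesis using affI[OF d(3)[OF *(2) **(2)] P_add[OF *(3) **(3)]] by metis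
  qed
  fix a :: "'k mpoly" assume a: "a \<in> P n"
  have "a * f = a * x + (indet 0 - 1) * (a * c)" by (simp add: *(1) algebra_simps)
  then show "a * f \<in> aff n J"
    using affI[OF d(4)[OF a *(2)] P_mult[OF a *(3)]] by metis
qed

lemma aff_super: "J \<subseteq> aff n J"
  using affI[of _ J 0] by auto

lemma aff_mono: "J \<subseteq> J' \<Longrightarrow> aff n J \<subseteq> aff n J'"
  unfolding aff_def by blast

lemma aff_X0: "pideal n J \<Longrightarrow> indet 0 - 1 \<in> aff n J"
  using affI[OF pidealD(2) P_one] by fastforce

lemma X0_power_minus_one:
  assumes J: "pideal n J" "indet 0 - 1 \<in> J" shows "1 - indet 0 ^ k \<in> J"
proof (induction k)
  case (Suc k)
  have "1 - indet 0 ^ Suc k = indet 0 * (1 - indet 0 ^ k) - (indet 0 - 1)" by (simp add: algebra_simps)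
  moreover have "\<dots> \<in> J" using pidealD(4)[OF J(1) P_indet[OF le0] Suc] J(2) by (rule pidealD(7)[OF J(1)])
  ultimately show ?case by metis
qed (use pidealD(2)[OF J(1)] in simp)

lemma hgz_cong:
  assumes J: "pideal n J" "indet 0 - 1 \<in> J" and f: "f \<in> P n" "degle N f"
  shows "f - hgz N f \<in> J"
proof -
  have "f - hgz N f = (\<Sum>i\<le>N. (1 - indet 0 ^ (N - i)) * hcomp (int i) f)"
    by (subst (1) degle_sum_hcomp[OF f(2), symmetric]) (simp add: hgz_def sum_subtractf algebra_simps)
  moreover have "\<dots> \<in> J"
    using f(1) by (intro pidealD(8)[OF J(1)] pidealD(5)[OF J(1)] X0_power_minus_one[OF J]) auto
  ultimately show ?thesis by simp
qed

text \<open>Write f = x + (X_0 - 1) c and compare components: f_i + c_i = X_0 c_(i-1) modulo J.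
  Below degree d all c_i lie in J, and c_(d+k) = - X_0^k f from there on. The components of c end
  somewhere, so some X_0^k f lies in J, and X_0 can be cancelled.\<close>

lemma aff_homog:
  assumes J: "homogeneous_ideal n J" and nzd: "\<And>f. f \<in> P n \<Longrightarrow> indet 0 * f \<in> J \<Longrightarrow> f \<in> J"
    and f: "f \<in> P n" "homog d f" "f \<in> aff n J"
  shows "f \<in> J"
proof -
  note p = pidealD[OF homogeneous_idealD(1)[OF J]]
  obtain x c where xc: "f = x + (indet 0 - 1) * c" "x \<in> J" "c \<in> P n" using affE[OF f(3)] by blast
  define h where "h i = hcomp i c" for i
  have hP: "h i \<in> P n" for i using xc by (simp add: h_def)
  have rel: "hcomp i f + h i - indet 0 * h (i - 1) \<in> J" for i
  proof -
    have "hcomp i f = hcomp i x + indet 0 * h (i - 1) - h i"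
      unfolding xc(1) left_diff_distrib hcomp_add hcomp_minus hcomp_mult_homog[OF homog_indet] h_def by simp
    then show ?thesis using homogeneous_idealD(2)[OF J xc(2), of i] by simp
  qed
  have low: "int k < d \<Longrightarrow> h (int k) \<in> J" for k
  proof (induction k)
    case 0
    then show ?case using rel[of 0] hcomp_other[OF f(2), of 0] hcomp_neg[of "-1" c] by (auto simp: h_def)
  next
    case (Suc k)
    then have "h (int k) \<in> J" by simp
    then have "indet 0 * h (int k) \<in> J" using p(4) by simp
    then show ?case using rel[of "int (Suc k)"] hcomp_other[OF f(2), of "int (Suc k)"] Suc.prems p(3) by fastforce
  qed
  have low': "h i \<in> J" if "i < d" for i
    using low[of "nat i"] that hcomp_neg[of i c] p(2) by (cases "i < 0") (auto simp: h_def)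
  have up: "indet 0 ^ k * f + h (d + int k) \<in> J" for k
  proof (induction k)
    case 0
    have "f + h d - indet 0 * h (d - 1) \<in> J" using rel[of d] hcomp_same[OF f(2)] by simp
    moreover have "indet 0 * h (d - 1) \<in> J" using p(4) low' by simp
    ultimately show ?case using p(3) by fastforce
  next
    case (Suc k)
    have "h (d + int (Suc k)) - indet 0 * h (d + int k) \<in> J"
      using rel[of "d + int (Suc k)"] hcomp_other[OF f(2), of "d + int (Suc k)"] by simp
    moreover have "indet 0 * (indet 0 ^ k * f + h (d + int k)) \<in> J" using p(4) Suc by simp
    ultimately have "(h (d + int (Suc k)) - indet 0 * h (d + int k)) + indet 0 * (indet 0 ^ k * f + h (d + int k)) \<in> J"
      by (rule p(3))
    then show ?case by (simp add: algebra_simps)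
  qed
  obtain N where N: "degle N c" using degle_ex by blast
  \<comment> \<open>The truncated difference yields a degree d + k above \<open>N\<close> whether or
    not d exceeds \<open>N\<close> already.\<close>
  have "h (d + int (nat (int N + 1 - d))) = 0"
    unfolding h_def using N
    by (intro poly_mapping_eqI) (fastforce simp: lookup_hcomp degle_def)
  then have "\<exists>k. indet 0 ^ k * f \<in> J" using up[of "nat (int N + 1 - d)"] by auto
  then obtain k where "indet 0 ^ k * f \<in> J" by blast
  then show ?thesis
  proof (induction k)
    case (Suc k)
    then show ?case using nzd[of "indet 0 ^ k * f"] f(1) by (simp add: mult.assoc)
  qed simp
qed

lemma aff_hgz:
  assumes J: "homogeneous_ideal n J" and nzd: "\<And>f. f \<in> P n \<Longrightarrow> indet 0 * f \<in> J \<Longrightarrow> f \<in> J"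
    and f: "f \<in> P n" "degle N f"
  shows "f \<in> aff n J \<longleftrightarrow> hgz N f \<in> J"
proof -
  note J' = homogeneous_idealD(1)[OF J]
  note A = aff_pideal[OF J'] aff_X0[OF J']
  have c: "f - hgz N f \<in> aff n J" by (rule hgz_cong[OF A f])
  have hf: "hgz N f \<in> P n" "homog (int N) (hgz N f)" using hgz_form[OF f(1)] by (auto simp: form_def)
  show ?thesis
  proof
    assume "f \<in> aff n J"
    then have "hgz N f \<in> aff n J" using pidealD(7)[OF A(1) _ c, of f] by simp
    then show "hgz N f \<in> J" using aff_homog[OF J nzd hf] by blast
  next
    assume "hgz N f \<in> J"
    then have "hgz N f \<in> aff n J" using aff_super by blast
    then show "f \<in> aff n J" using pidealD(3)[OF A(1) c] by fastforce
  qed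
qed

lemma Cst_sum: "Cst (sum F S) = (\<Sum>i\<in>S. Cst (F i))"
  by (induction S rule: infinite_finite_induct) (simp_all add: Cst_simps)

section \<open>Determinants modulo an ideal and the tensor square of the polynomial ring\<close>

section \<open>Determinants modulo an ideal\<close>

text \<open>The ideals in question are ideals of \<open>P n\<close> or \<open>QP n\<close>, whereas
  \<open>det\<close> is defined over the ambient ring type. Congruences therefore carry membership
  in the subring along.\<close>

locale ideal_in_subring =
  fixes A J :: "'r::comm_ring_1 set"
  assumes A_one: "1 \<in> A" and A_add: "x \<in> A \<Longrightarrow> y \<in> A \<Longrightarrow> x + y \<in> A"
    and A_mult: "x \<in> A \<Longrightarrow> y \<in> A \<Longrightarrow> x * y \<in> A" and A_uminus: "x \<in> A \<Longrightarrow> - x \<in> A"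
    and J_A: "J \<subseteq> A" and J_zero: "0 \<in> J" and J_add: "x \<in> J \<Longrightarrow> y \<in> J \<Longrightarrow> x + y \<in> J"
    and J_mult: "a \<in> A \<Longrightarrow> x \<in> J \<Longrightarrow> a * x \<in> J"
begin

lemma A_zero: "0 \<in> A" using J_A J_zero by blast
lemma A_diff: "x \<in> A \<Longrightarrow> y \<in> A \<Longrightarrow> x - y \<in> A"
  using A_add[of x "- y"] A_uminus[of y] by simp
lemma A_power: "x \<in> A \<Longrightarrow> x ^ k \<in> A"
  by (induction k) (auto simp: A_one A_mult)
lemma A_signof: "signof p \<in> A" using A_one A_uminus by (auto simp: sign_def)
lemma J_uminus: "x \<in> J \<Longrightarrow> - x \<in> J" using J_mult[OF A_uminus[OF A_one], of x] by simp
lemma J_diff: "x \<in> J \<Longrightarrow> y \<in> J \<Longrightarrow> x - y \<in> J" using J_add[of x "- y"] J_uminus[of y] by simp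
definition cg (infix \<open>\<doteq>\<close> 50) where "x \<doteq> y \<longleftrightarrow> x \<in> A \<and> y \<in> A \<and> x - y \<in> J"

lemma cg_refl: "x \<in> A \<Longrightarrow> x \<doteq> x" using J_zero by (simp add: cg_def)
lemma cg_sym: "x \<doteq> y \<Longrightarrow> y \<doteq> x" unfolding cg_def using J_uminus by (metis minus_diff_eq)
lemma cg_trans [trans]: "x \<doteq> y \<Longrightarrow> y \<doteq> z \<Longrightarrow> x \<doteq> z"
  unfolding cg_def using J_add by (metis diff_add_cancel add_diff_eq)
lemma cg_add: "x \<doteq> y \<Longrightarrow> x' \<doteq> y' \<Longrightarrow> x + x' \<doteq> y + y'"
  unfolding cg_def using A_add J_add[of "x - y" "x' - y'"] by (simp add: algebra_simps)
lemma cg_mult: "x \<doteq> y \<Longrightarrow> x' \<doteq> y' \<Longrightarrow> x * x' \<doteq> y * y'"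
proof -
  assume *: "x \<doteq> y" "x' \<doteq> y'"
  have "x * x' - y * y' = x' * (x - y) + y * (x' - y')" by (simp add: algebra_simps)
  moreover have "\<dots> \<in> J" using * by (intro J_add J_mult) (auto simp: cg_def)
  ultimately show ?thesis using * A_mult by (auto simp: cg_def)
qed
lemma cg_diff: "x \<doteq> y \<Longrightarrow> x' \<doteq> y' \<Longrightarrow> x - x' \<doteq> y - y'"
  unfolding cg_def using A_diff J_diff[of "x - y" "x' - y'"] by (simp add: algebra_simps)
lemma cg_sum: "(\<And>i. i \<in> S \<Longrightarrow> F i \<doteq> H i) \<Longrightarrow> sum F S \<doteq> sum H S"
  by (induction S rule: infinite_finite_induct) (auto simp: cg_refl A_zero cg_add)
lemma cg_prod: "(\<And>i. i \<in> S \<Longrightarrow> F i \<doteq> H i) \<Longrightarrow> prod F S \<doteq> prod H S"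
  by (induction S rule: infinite_finite_induct) (auto simp: cg_refl A_one cg_mult)
lemma cg_zero: "x \<doteq> 0 \<longleftrightarrow> x \<in> J" using J_A A_zero by (auto simp: cg_def)

lemma cg_det:
  assumes "\<And>i j. i < n \<Longrightarrow> j < n \<Longrightarrow> a i j \<doteq> b i j"
  shows "det (mat n n (\<lambda>(i, j). a i j)) \<doteq> det (mat n n (\<lambda>(i, j). b i j))"
  unfolding det_def'[OF mat_carrier]
proof (intro cg_sum cg_mult cg_refl A_signof cg_prod)
  fix p i assume "p \<in> {p. p permutes {0..<n}}" "i \<in> {0..<n}"
  then have "i < n" "p i < n" using permutes_in_image[of p "{0..<n}" i] by auto
  then show "mat n n (\<lambda>(i, j). a i j) $$ (i, p i) \<doteq> mat n n (\<lambda>(i, j). b i j) $$ (i, p i)"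
    using assms by simp
qed

lemma A_det:
  assumes "\<And>i j. i < n \<Longrightarrow> j < n \<Longrightarrow> a i j \<in> A"
  shows "det (mat n n (\<lambda>(i, j). a i j)) \<in> A"
  using cg_det[of n a a, OF cg_refl, OF assms] unfolding cg_def by blast

lemma cg_power_idem: "x * x \<doteq> x \<Longrightarrow> k > 0 \<Longrightarrow> x ^ k \<doteq> x"
proof (induction k)
  case (Suc k)
  then show ?case
    using cg_mult[of x x "x ^ k" x] cg_refl[of x] cg_trans[of "x * x ^ k" "x * x" x]
    by (cases "k = 0") (auto simp: cg_def)
qed simp

end

lemma smult_mat_fun: "c \<cdot>\<^sub>m mat n n (\<lambda>(i, j). a i j) = mat n n (\<lambda>(i, j). c * a i j)"
  by (rule eq_matI) auto

lemma det_mat_one: "det (mat n n (\<lambda>(i, j). if i = j then c else 0)) = (c::'a::comm_ring_1) ^ n"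
proof -
  have "mat n n (\<lambda>(i, j). if i = j then c else 0) = c \<cdot>\<^sub>m 1\<^sub>m n" by (rule eq_matI) auto
  then show ?thesis by simp
qed

text \<open>Pulling the factors out of the rows of the transpose leaves identical rows, and
  \<open>n \<ge> 2\<close> provides two of them.\<close>

lemma det_rank_one:
  assumes "n \<ge> 2"
  shows "det (mat n n (\<lambda>(l, i). w i * z l)) = (0::'a::comm_ring_1)"
proof -
  let ?v = "vec n z"
  have "det (mat n n (\<lambda>(l, i). w i * z l)) = det (transpose_mat (mat n n (\<lambda>(l, i). w i * z l)))"
    by (rule det_transpose[symmetric, of _ n]) simp
  also have "transpose_mat (mat n n (\<lambda>(l, i). w i * z l)) = mat\<^sub>r n n (\<lambda>i. w i \<cdot>\<^sub>v ?v)"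
    by (rule eq_matI) auto
  also have "det \<dots> = prod w {0..<n} * det (mat\<^sub>r n n (\<lambda>i. ?v))" by (rule det_rows_mul) auto
  also have "det (mat\<^sub>r n n (\<lambda>i. ?v)) = 0"
    by (rule det_identical_rows[of _ n 0 1]) (use assms in \<open>auto simp: row_mat_of_row_fun\<close>)
  finally show ?thesis by simp
qed

text \<open>The cofactors along column \<open>s\<close> do not see the entries of that column, so
  the Laplace expansion is linear in them.\<close>

lemma det_column_linear:
  fixes a :: "nat \<Rightarrow> nat \<Rightarrow> 'a::comm_ring_1"
  assumes s: "s < n" and a: "\<And>l. l < n \<Longrightarrow> a l s = (\<Sum>k\<in>S. c k * b l k)"
  shows "det (mat n n (\<lambda>(l, i). a l i)) =
    (\<Sum>k\<in>S. c k * det (mat n n (\<lambda>(l, i). if i = s then b l k else a l i)))"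
proof -
  let ?A = "mat n n (\<lambda>(l, i). a l i)"
  let ?B = "\<lambda>k. mat n n (\<lambda>(l, i). if i = s then b l k else a l i)"
  have cof: "cofactor (?B k) l s = cofactor ?A l s" if "l < n" for k l
    unfolding cofactor_def mat_delete_def
    by (rule arg_cong[of _ _ "\<lambda>x. _ * det x"], rule eq_matI) (use s that in auto)
  have "det ?A = (\<Sum>l<n. (\<Sum>k\<in>S. c k * b l k) * cofactor ?A l s)"
    using laplace_expansion_column[of ?A n s] s a by simp
  also have "\<dots> = (\<Sum>k\<in>S. c k * (\<Sum>l<n. b l k * cofactor ?A l s))"
    by (simp add: sum_distrib_right sum_distrib_left mult.assoc) (rule sum.swap)
  also have "\<dots> = (\<Sum>k\<in>S. c k * det (?B k))"
  proof (rule sum.cong[OF refl])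
    fix k
    have "det (?B k) = (\<Sum>l<n. ?B k $$ (l, s) * cofactor (?B k) l s)"
      by (rule laplace_expansion_column) (use s in auto)
    then show "c k * (\<Sum>l<n. b l k * cofactor ?A l s) = c k * det (?B k)" using s cof by simp
  qed
  finally show ?thesis .
qed

section \<open>Two sets of variables\<close>

text \<open>The tensor \<open>f \<otimes> g\<close>, that is \<open>f(X) g(Y)\<close>, is represented by \<open>cX f * cY g\<close>; contraction applies a
  functional to the second factor.\<close>

type_synonym 'k mpoly2 = "(nat \<Rightarrow>\<^sub>0 nat) \<Rightarrow>\<^sub>0 'k mpoly"

definition cX :: "'k::field mpoly \<Rightarrow> 'k mpoly2" where "cX f = Poly_Mapping.single 0 f"
definition cY :: "'k::field mpoly \<Rightarrow> 'k mpoly2" where "cY g = Poly_Mapping.map Cst g"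

lemma cX_simps: "cX (f + g) = cX f + cX g" "cX (f * g) = cX f * cX g" "cX 0 = 0" "cX 1 = 1"
  "cX (f - g) = cX f - cX g"
  by (simp_all add: cX_def single_add mult_single single_diff)

lemma cX_sum: "cX (sum F S) = (\<Sum>i\<in>S. cX (F i))"
  by (induction S rule: infinite_finite_induct) (auto simp: cX_simps)

lemma lookup_cY: "lkp (cY g) m = Cst (lkp g m)"
  by (simp add: cY_def map.rep_eq when_def Cst_simps)

lemma cY_simps: "cY (f + g) = cY f + cY g" "cY 0 = 0" "cY 1 = 1"
  by (intro poly_mapping_eqI; simp add: lookup_cY lookup_add Cst_simps lookup_one when_def)+

lemma cY_single: "cY (Poly_Mapping.single m c) = Poly_Mapping.single m (Cst c)"
  by (intro poly_mapping_eqI) (simp add: lookup_cY lookup_single when_def Cst_simps)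

definition contr :: "('k::field mpoly \<Rightarrow> 'k) \<Rightarrow> 'k mpoly2 \<Rightarrow> 'k mpoly" where
  "contr lam F = (\<Sum>m\<in>Poly_Mapping.keys F. lkp F m * Cst (lam (pp m)))"

lemma contr_superset:
  "finite S \<Longrightarrow> Poly_Mapping.keys F \<subseteq> S \<Longrightarrow> contr lam F = (\<Sum>m\<in>S. lkp F m * Cst (lam (pp m)))"
  unfolding contr_def by (rule sum.mono_neutral_left) (auto simp: in_keys_iff)

lemma contr_add: "contr lam (F + H) = contr lam F + contr lam H"
proof -
  let ?S = "Poly_Mapping.keys F \<union> Poly_Mapping.keys H"
  have "contr lam (F + H) = (\<Sum>m\<in>?S. lkp (F + H) m * Cst (lam (pp m)))"
    by (rule contr_superset) (simp_all add: keys_add)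
  moreover have "contr lam F = (\<Sum>m\<in>?S. lkp F m * Cst (lam (pp m)))" by (rule contr_superset) auto
  moreover have "contr lam H = (\<Sum>m\<in>?S. lkp H m * Cst (lam (pp m)))" by (rule contr_superset) auto
  ultimately show ?thesis by (simp add: lookup_add distrib_right sum.distrib)
qed

lemma contr_single: "contr lam (Poly_Mapping.single m f) = f * Cst (lam (pp m))"
  by (subst contr_superset[of "{m}"]) auto

lemma contr_zero [simp]: "contr lam 0 = 0" by (simp add: contr_def)

lemma contr_cX_mult: "contr lam (cX f * F) = f * contr lam F"
  by (induction F rule: pm_induct)
    (auto simp: contr_add contr_single cX_def mult_single algebra_simps)

definition lin :: "('k::field mpoly \<Rightarrow> 'k) \<Rightarrow> bool" where
  "lin lam \<longleftrightarrow> (\<forall>f g. lam (f + g) = lam f + lam g) \<and> (\<forall>c f. lam (Cst c * f) = c * lam f)"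

lemma linD:
  assumes "lin lam"
  shows "lam (f + g) = lam f + lam g" "lam (Cst c * f) = c * lam f" "lam 0 = 0"
    "lam (f - g) = lam f - lam g" "lam (sum F S) = (\<Sum>i\<in>S. lam (F i))"
proof -
  show 1: "lam (f + g) = lam f + lam g" for f g using assms by (simp add: lin_def)
  show 2: "lam (Cst c * f) = c * lam f" for f c using assms by (simp add: lin_def)
  show 0: "lam 0 = 0" using 2[of 0 0] by simp
  show "lam (f - g) = lam f - lam g" using 1[of "f - g" g] by simp
  show "lam (sum F S) = (\<Sum>i\<in>S. lam (F i))"
    by (induction S rule: infinite_finite_induct) (auto simp: 0 1)
qed

lemma lin_mult: "lin lam \<Longrightarrow> lin (\<lambda>h. lam (g * h))"
  by (simp add: lin_def distrib_left mult.left_commute[of g])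

text \<open>Factors in Y are absorbed into the functional. A condition imposed on the contractions
  with all functionals of a stable class is thus preserved by such factors.\<close>

lemma contr_cY_mult:
  assumes "lin lam" shows "contr lam (cY g * F) = contr (\<lambda>h. lam (g * h)) F"
proof (induction g rule: pm_induct)
  case zero
  then show ?case using linD(3)[OF assms] by (simp add: cY_simps contr_def Cst_simps)
next
  case (add g g')
  have "contr (\<lambda>h. lam ((g + g') * h)) F = contr (\<lambda>h. lam (g * h)) F + contr (\<lambda>h. lam (g' * h)) F"
    by (simp add: contr_def distrib_right linD(1)[OF assms] Cst_simps distrib_left sum.distrib)
  then show ?case using add by (simp add: cY_simps distrib_right contr_add)
next
  case (single m' c)
  show ?case
  proof (induction F rule: pm_induct)
    case (single m f)
    have "Poly_Mapping.single m' c * pp m = Cst c * pp (m' + m)"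
      by (simp add: Cst_def mult_single)
    then show ?case
      by (simp add: cY_single mult_single contr_single linD(2)[OF assms] Cst_simps algebra_simps)
  qed (simp_all add: contr_add distrib_left)
qed

lemma contr_sum: "contr lam (sum F S) = (\<Sum>i\<in>S. contr lam (F i))"
  by (induction S rule: infinite_finite_induct) (auto simp: contr_add)

lemma contr_cX_cY: "lin lam \<Longrightarrow> contr lam (cX f * cY g) = f * Cst (lam g)"
  using contr_cY_mult[of lam g 1] contr_single[of "\<lambda>h. lam (g * h)" 0 1] by (simp add: contr_cX_mult)

lemma contr_diff: "contr lam (F - H) = contr lam F - contr lam H"
  using contr_add[of lam "F - H" H] by simp

text \<open>The tensor square of \<open>P n\<close>, inside the polynomials in Y whose coefficients
  are polynomials in X. Generation by sums of pure tensors gives an induction that separates the two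
  factors.\<close>

inductive_set QP :: "nat \<Rightarrow> 'k::field mpoly2 set" for n where
  tens: "f \<in> P n \<Longrightarrow> g \<in> P n \<Longrightarrow> cX f * cY g \<in> QP n"
| add: "F \<in> QP n \<Longrightarrow> H \<in> QP n \<Longrightarrow> F + H \<in> QP n"


lemma QP_cX: "f \<in> P n \<Longrightarrow> cX f \<in> QP n"
  using tens[of f n 1] by (simp add: cY_simps)
lemma QP_cY: "g \<in> P n \<Longrightarrow> cY g \<in> QP n"
  using tens[of 1 n g] by (simp add: cX_simps)
lemma QP_zero: "0 \<in> QP n" using QP_cX[of 0 n] by (simp add: cX_simps)
lemma QP_one: "1 \<in> QP n" using QP_cX[of 1 n] by (simp add: cX_simps)
lemma QP_sum: "(\<And>i. i \<in> S \<Longrightarrow> F i \<in> QP n) \<Longrightarrow> sum F S \<in> QP n"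
  by (induction S rule: infinite_finite_induct) (auto simp: QP_zero add)
lemma cY_mult: "cY (f * g) = cY f * cY g"
proof (induction f rule: pm_induct)
  case (single m c)
  show ?case
    by (induction g rule: pm_induct) (auto simp: cY_simps cY_single mult_single distrib_left Cst_simps)
qed (auto simp: cY_simps distrib_right)
lemma QP_mult: "F \<in> QP n \<Longrightarrow> H \<in> QP n \<Longrightarrow> F * H \<in> QP n"
proof (induction F rule: QP.induct)
  case (tens f g)
  from tens(3) show ?case
  proof (induction H rule: QP.induct)
    case (tens f' g')
    have "cX f * cY g * (cX f' * cY g') = cX (f * f') * cY (g * g')"
      by (simp add: cX_simps cY_mult ac_simps)
    then show ?case using QP.tens[of "f * f'" n "g * g'"] tens \<open>f \<in> P n\<close> \<open>g \<in> P n\<close> by simp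
  qed (simp add: distrib_left add)
qed (simp add: distrib_right add)
lemma QP_uminus: "F \<in> QP n \<Longrightarrow> - F \<in> QP n"
  using QP_mult[OF QP_cX[of "-1" n], of F] by (simp add: cX_def single_uminus)

section \<open>Trace form and separability idempotent of a reduced finite-dimensional
  algebra\<close>

section \<open>Reduced finite-dimensional algebras\<close>

text \<open>\<open>nf\<close> is a linear projection with kernel \<open>Ia\<close>, so that the algebra \<open>P/Ia\<close> is identified with the
  span of \<open>B\<close>.\<close>

locale artin =
  fixes n :: nat and Ia :: "'k::field mpoly set" and nf :: "'k mpoly \<Rightarrow> 'k mpoly" and B :: "'k mpoly set"
  assumes Ia: "pideal n Ia" and nf_lin: "plinear nf"
    and nf_cong: "f \<in> P n \<Longrightarrow> f - nf f \<in> Ia" and nf_zero: "f \<in> Ia \<Longrightarrow> nf f = 0"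
    and nf_span: "nf f \<in> pv.span B" and C_P: "pv.span B \<subseteq> P n" and C_img: "pv.span B = nf ` P n"
    and fin_B: "finite B" and ind_B: "pv.independent B"
    and radical: "f \<in> P n \<Longrightarrow> f * f \<in> Ia \<Longrightarrow> f \<in> Ia"
begin

abbreviation "C \<equiv> pv.span B"
lemmas nfD = plinearD[OF nf_lin]
lemmas IaD = pidealD[OF Ia]

lemma nf_P [simp]: "nf f \<in> P n" using nf_span C_P by blast
lemma nf_zero_iff: "f \<in> P n \<Longrightarrow> nf f = 0 \<longleftrightarrow> f \<in> Ia"
  using nf_cong[of f] nf_zero[of f] by auto
lemma nf_eq_iff: "f \<in> P n \<Longrightarrow> g \<in> P n \<Longrightarrow> nf f = nf g \<longleftrightarrow> f - g \<in> Ia"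
  using nf_zero_iff[of "f - g"] nfD(2)[of f g] by simp
lemma nf_id: "c \<in> C \<Longrightarrow> nf c = c"
proof -
  assume "c \<in> C"
  then obtain f where f: "f \<in> P n" "c = nf f" using C_img by blast
  have "nf f - f \<in> Ia" using IaD(6)[OF nf_cong[OF f(1)]] by simp
  then show ?thesis using nf_eq_iff[OF nf_P f(1)] f(2) by blast
qed
lemma B_P: "b \<in> B \<Longrightarrow> b \<in> P n" using C_P pv.span_base by blast
lemma nf_mult: "f \<in> P n \<Longrightarrow> g \<in> P n \<Longrightarrow> nf (f * nf g) = nf (f * g)"
proof -
  assume fg: "f \<in> P n" "g \<in> P n"
  have "f * nf g - f * g = - (f * (g - nf g))" by (simp add: algebra_simps)
  then have "f * nf g - f * g \<in> Ia" using IaD(6)[OF IaD(4)[OF fg(1) nf_cong[OF fg(2)]]] by simp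
  then show ?thesis using nf_eq_iff[of "f * nf g" "f * g"] fg by simp
qed

lemma mult_lin: "plinear (\<lambda>g. nf (f * g))"
  by (rule plinearI) (simp_all add: distrib_left nfD mult.left_commute[of f])

lemma image_C: "f \<in> P n \<Longrightarrow> (\<lambda>g. nf (f * g)) ` C = (\<lambda>g. nf (f * g)) ` P n"
  unfolding C_img image_image using nf_mult by (intro image_cong) auto

text \<open>On its own image, multiplication by f is injective because the algebra is reduced: f (f
  c) = 0 forces (f c)^2 = 0. By finite dimension it is onto there, and f itself lies in the image,
  so f is a multiple of f^2.\<close>

lemma regular:
  assumes f: "f \<in> P n"
  obtains y where "y \<in> P n" "f - f * f * y \<in> Ia"
proof -
  let ?F = "\<lambda>g. nf (f * g)"
  let ?U = "?F ` C"
  have sub: "?U \<subseteq> C" using nf_span by blast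
  have U: "pv.subspace ?U" by (rule plinear_image_subspace[OF mult_lin pv.subspace_span])
  have inj: "u = 0" if u: "u \<in> ?U" "?F u = 0" for u
  proof -
    obtain c where c: "c \<in> P n" "u = nf (f * c)" using u(1) unfolding image_C[OF f] by blast
    have "f * u \<in> Ia" using u(2) nf_zero_iff[of "f * u"] f c by simp
    moreover have "nf (f * u) = nf (f * (f * c))" using nf_mult[OF f, of "f * c"] f c by simp
    ultimately have "f * (f * c) \<in> Ia" using nf_zero_iff[of "f * (f * c)"] f c u(2) by simp
    then have "c * (f * (f * c)) \<in> Ia" using IaD(4) c by blast
    then have "(f * c) * (f * c) \<in> Ia" by (simp add: ac_simps)
    then have "f * c \<in> Ia" using radical[of "f * c"] f c by simp
    then show "u = 0" using nf_zero c by simp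
  qed
  have into: "?F ` ?U \<subseteq> ?U" using sub by blast
  have eq: "?F ` ?U = ?U" by (rule plinear_inj_surj[OF mult_lin U sub fin_B inj into])
  have "nf f \<in> ?U" unfolding image_C[OF f] using image_eqI[of "nf f" ?F 1 "P n"] by simp
  then have "nf f \<in> ?F ` ?U" using eq by simp
  then obtain u where "u \<in> ?U" "nf f = ?F u" by blast
  moreover then obtain y where y: "y \<in> P n" "u = nf (f * y)" unfolding image_C[OF f] by blast
  ultimately have "nf f = nf (f * (f * y))" using nf_mult[OF f, of "f * y"] f by simp
  then have "f - f * (f * y) \<in> Ia" using nf_eq_iff[of f "f * (f * y)"] f y by simp
  then show thesis using that[OF y(1)] by (simp add: mult.assoc)
qed

text \<open>The trace of multiplication by \<open>f\<close>. The basis is a parameter because the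
  trace of an idempotent is read off in a basis adapted to its image, while everything else uses
  \<open>B\<close>.\<close>

definition tr :: "'k mpoly set \<Rightarrow> 'k mpoly \<Rightarrow> 'k" where
  "tr B' f = (\<Sum>b\<in>B'. pv.representation B' (nf (f * b)) b)"

lemma rep_sum:
  assumes "finite B'" "pv.independent B'" "c \<in> pv.span B'"
  shows "(\<Sum>b\<in>B'. Cst (pv.representation B' c b) * b) = c"
  using pv.sum_representation_eq[OF assms(2,3,1)] by (simp add: scl_def)

text \<open>The two base changes are moved past each other by swapping a double sum, as in tr(M N) =
  tr(N M).\<close>

lemma tr_indep:
  assumes B': "finite B'" "pv.independent B'" "pv.span B' = C"
    and B'': "finite B''" "pv.independent B''" "pv.span B'' = C" and f: "f \<in> P n"
  shows "tr B' f = tr B'' f"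
proof -
  let ?r = "pv.representation B'" and ?s = "pv.representation B''"
  let ?F = "\<lambda>g. nf (f * g)"
  have FC: "?F g \<in> C" for g by (rule nf_span)
  have lin_rep: "pv.representation D (\<Sum>i\<in>S. Cst (c i) * v i) b = (\<Sum>i\<in>S. c i * pv.representation D (v i) b)"
    if D: "pv.independent D" "pv.span D = C" and v: "\<And>i. i \<in> S \<Longrightarrow> v i \<in> C"
    for D S and c :: "'k mpoly \<Rightarrow> 'k" and v :: "'k mpoly \<Rightarrow> 'k mpoly" and b
  proof -
    have "pv.representation D (\<Sum>i\<in>S. scl (c i) (v i)) = (\<lambda>b. \<Sum>i\<in>S. pv.representation D (scl (c i) (v i)) b)"
      using D v by (intro pv.representation_sum) (auto intro: pv.span_scale)
    then show ?thesis using D v pv.representation_scale[OF D(1)] by (simp add: scl_def[symmetric])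
  qed
  have "tr B' f = (\<Sum>b\<in>B'. \<Sum>b''\<in>B''. ?s (?F b) b'' * ?r b'' b)"
    unfolding tr_def
  proof (rule sum.cong[OF refl])
    fix b assume "b \<in> B'"
    have "?r (?F b) b = ?r (\<Sum>b''\<in>B''. Cst (?s (?F b) b'') * b'') b"
      using rep_sum[OF B''(1,2), of "?F b"] FC B''(3) by simp
    also have "\<dots> = (\<Sum>b''\<in>B''. ?s (?F b) b'' * ?r b'' b)"
      using B'(2,3) B''(3) pv.span_base by (intro lin_rep) auto
    finally show "?r (?F b) b = (\<Sum>b''\<in>B''. ?s (?F b) b'' * ?r b'' b)" .
  qed
  also have "\<dots> = (\<Sum>b''\<in>B''. \<Sum>b\<in>B'. ?r b'' b * ?s (?F b) b'')"
    by (subst sum.swap) (simp add: mult.commute)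
  also have "\<dots> = tr B'' f"
    unfolding tr_def
  proof (rule sum.cong[OF refl])
    fix b'' assume b'': "b'' \<in> B''"
    have "b'' \<in> pv.span B'" using pv.span_base[OF b''] B'(3) B''(3) by simp
    then have "?F b'' = ?F (\<Sum>b\<in>B'. Cst (?r b'' b) * b)"
      by (simp only: rep_sum[OF B'(1,2)])
    also have "\<dots> = (\<Sum>b\<in>B'. Cst (?r b'' b) * ?F b)"
      by (simp only: plinearD(4,5)[OF mult_lin[of f]])
    finally have "?s (?F b'') b'' = ?s (\<Sum>b\<in>B'. Cst (?r b'' b) * ?F b) b''" by simp
    also have "\<dots> = (\<Sum>b\<in>B'. ?r b'' b * ?s (?F b) b'')"
      using B''(2,3) FC by (intro lin_rep) auto
    finally show "(\<Sum>b\<in>B'. ?r b'' b * ?s (?F b) b'') = ?s (?F b'') b''" by simp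
  qed
  finally show ?thesis .
qed

abbreviation Tr where "Tr \<equiv> tr B"
definition co where "co b f = pv.representation B (nf f) b"

lemma co_lin: "lin (co b)"
  unfolding lin_def co_def
  using pv.representation_add[OF ind_B nf_span nf_span] pv.representation_scale[OF ind_B nf_span]
  by (simp add: nfD scl_def)

lemma co_sum: "f \<in> P n \<Longrightarrow> f - (\<Sum>b\<in>B. Cst (co b f) * b) \<in> Ia"
  using rep_sum[OF fin_B ind_B nf_span[of f]] nf_cong[of f] by (simp add: co_def)

lemma co_B: "b \<in> B \<Longrightarrow> b' \<in> B \<Longrightarrow> co b' b = (if b = b' then 1 else 0)"
  using pv.representation_basis[OF ind_B, of b] nf_id[OF pv.span_base] by (auto simp: co_def)

lemma co_Ia: "f \<in> Ia \<Longrightarrow> co b f = 0"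
  using nf_zero[of f] by (simp add: co_def pv.representation_zero)

lemma Tr_eq: "Tr f = (\<Sum>b\<in>B. co b (f * b))" by (simp add: tr_def co_def)

lemma Tr_lin: "lin Tr"
proof -
  have "Tr (f + g) = Tr f + Tr g" for f g
    by (simp add: Tr_eq distrib_right linD(1)[OF co_lin] sum.distrib)
  moreover have "Tr (Cst c * f) = c * Tr f" for c f
    by (simp add: Tr_eq mult.assoc linD(2)[OF co_lin] sum_distrib_left)
  ultimately show ?thesis by (simp add: lin_def)
qed

lemma Tr_Ia: "f \<in> Ia \<Longrightarrow> Tr f = 0"
  unfolding Tr_eq using co_Ia IaD(5)[OF B_P] by (intro sum.neutral) auto

end

locale artin_sep = artin n Ia nf B
  for n :: nat and Ia :: "'k::field mpoly set" and nf :: "'k mpoly \<Rightarrow> 'k mpoly" and B :: "'k mpoly set" +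
  assumes char_B: "CHAR('k) = 0 \<or> CHAR('k) > card B"
begin

text \<open>In a basis extending one of the image of e, the trace counts the basis elements of the
  image. This rank is positive and at most \<open>card B\<close>, so it does not vanish in
  K.\<close>

lemma Tr_idempotent:
  assumes e: "e \<in> P n" "e * e - e \<in> Ia" "e \<notin> Ia"
  shows "Tr e \<noteq> 0"
proof -
  let ?F = "\<lambda>g. nf (e * g)"
  let ?U = "?F ` C"
  have sub: "?U \<subseteq> C" using nf_span by blast
  have U: "pv.subspace ?U" by (rule plinear_image_subspace[OF mult_lin pv.subspace_span])
  obtain B1 where B1: "finite B1" "pv.independent B1" "pv.span B1 = ?U"
    using pv.subspace_dim(1)[OF U sub fin_B] by blast
  have "B1 \<subseteq> C" using B1(3) sub pv.span_superset by blast
  then obtain B2 where B2: "B1 \<subseteq> B2" "B2 \<subseteq> C" "pv.independent B2" "C \<subseteq> pv.span B2"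
    using pv.maximal_independent_subset_extend[OF _ B1(2)] by blast
  have sp2: "pv.span B2 = C" using B2(2,4) pv.span_minimal[OF B2(2) pv.subspace_span] by blast
  have fin2: "finite B2" "card B2 \<le> card B" using pv.independent_span_bound[OF fin_B B2(3,2)] by auto
  have FU: "?F u = u" if u: "u \<in> ?U" for u
  proof -
    obtain c where c: "c \<in> P n" "u = nf (e * c)" using u unfolding image_C[OF e(1)] by blast
    have "e * (e * c) - e * c = (e * e - e) * c" by (simp add: algebra_simps)
    then have "e * (e * c) - e * c \<in> Ia" using IaD(5)[OF c(1) e(2)] by simp
    then have "nf (e * (e * c)) = nf (e * c)" using nf_eq_iff e c by simp
    then show ?thesis using nf_mult[OF e(1), of "e * c"] c e by simp
  qed
  have rep: "pv.representation B2 (?F b) b = (if b \<in> B1 then 1 else 0)" if b: "b \<in> B2" for b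
  proof (cases "b \<in> B1")
    case True
    then have "?F b = b" using FU B1(3) pv.span_base by metis
    then show ?thesis using True pv.representation_basis[OF B2(3) b] by simp
  next
    case False
    have "b \<in> C" using b B2(2) by blast
    then have "?F b \<in> pv.span B1" using B1(3) by blast
    then have "pv.representation B2 (?F b) = pv.representation B1 (?F b)"
      using pv.representation_extend[OF B2(3) _ B2(1)] by blast
    moreover have "pv.representation B1 (?F b) b = 0" using False pv.representation_ne_zero by blast
    ultimately show ?thesis using False by simp
  qed
  have "Tr e = tr B2 e" by (rule tr_indep[OF fin_B ind_B refl fin2(1) B2(3) sp2 e(1)])
  also have "\<dots> = (\<Sum>b\<in>B2. if b \<in> B1 then 1 else 0)" unfolding tr_def by (rule sum.cong[OF refl rep])
  also have "\<dots> = of_nat (card B1)"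
    using B2(1) fin2(1) by (simp add: sum.If_cases Int_absorb1)
  finally have T: "Tr e = of_nat (card B1)" .
  have "card B1 \<le> card B" using card_mono[OF fin2(1) B2(1)] fin2(2) by simp
  moreover have "B1 \<noteq> {}"
  proof
    assume "B1 = {}"
    then have "?F (nf 1) = 0" using B1(3) C_img by (auto simp: pv.span_empty)
    then have "nf e = 0" using nf_mult[OF e(1) P_one] by simp
    then show False using nf_zero_iff e by blast
  qed
  then have "card B1 > 0" using B1(1) by (simp add: card_gt_0_iff)
  ultimately have "(of_nat (card B1) :: 'k) \<noteq> 0"
    using char_B by (auto simp: of_nat_eq_0_iff_char_dvd dest: dvd_imp_le)
  then show ?thesis using T by simp
qed

text \<open>By regularity a non-zero f has a multiple f y that is a non-zero idempotent, and its
  trace is not 0.\<close>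

lemma Tr_nondeg:
  assumes f: "f \<in> P n" "\<And>g. g \<in> P n \<Longrightarrow> Tr (f * g) = 0"
  shows "f \<in> Ia"
proof (rule ccontr)
  assume nf: "f \<notin> Ia"
  obtain y where y: "y \<in> P n" "f - f * f * y \<in> Ia" using regular[OF f(1)] by blast
  have "(f * y) * (f * y) - f * y = - (y * (f - f * f * y))" by (simp add: algebra_simps)
  then have "(f * y) * (f * y) - f * y \<in> Ia" using IaD(6)[OF IaD(4)[OF y]] by simp
  moreover have "f * y \<notin> Ia"
  proof
    assume "f * y \<in> Ia"
    then have "f * (f * y) \<in> Ia" using IaD(4)[OF f(1)] by blast
    then have "(f - f * f * y) + f * (f * y) \<in> Ia" using IaD(3)[OF y(2)] by blast
    then show False using nf by (simp add: mult.assoc)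
  qed
  ultimately show False using Tr_idempotent[of "f * y"] f y by simp
qed

lemma Tr_nondeg_B:
  assumes f: "f \<in> P n" "\<And>b. b \<in> B \<Longrightarrow> Tr (f * b) = 0"
  shows "f \<in> Ia"
proof (rule Tr_nondeg[OF f(1)])
  fix g :: "'k mpoly" assume g: "g \<in> P n"
  have "f * g - f * (\<Sum>b\<in>B. Cst (co b g) * b) = f * (g - (\<Sum>b\<in>B. Cst (co b g) * b))"
    by (simp add: algebra_simps)
  then have "Tr (f * g) = Tr (f * (\<Sum>b\<in>B. Cst (co b g) * b))"
    using Tr_Ia[OF IaD(4)[OF f(1) co_sum[OF g]]]
      linD(4)[OF Tr_lin, of "f * g" "f * (\<Sum>b\<in>B. Cst (co b g) * b)"] by simp
  also have "f * (\<Sum>b\<in>B. Cst (co b g) * b) = (\<Sum>b\<in>B. Cst (co b g) * (f * b))"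
    by (simp add: sum_distrib_left mult.left_commute)
  also have "Tr \<dots> = 0" using f(2) by (simp add: linD[OF Tr_lin])
  finally show "Tr (f * g) = 0" .
qed

text \<open>Sending c to the combination of \<open>B\<close> with coefficients Tr(c b) is injective
  by non-degeneracy, hence onto. The preimages of the basis elements form the dual basis.\<close>

lemma dual_exists: "\<exists>v. \<forall>b\<in>B. v b \<in> P n \<and> (\<forall>b'\<in>B. Tr (v b * b') = (if b = b' then 1 else 0))"
proof -
  let ?F = "\<lambda>c. \<Sum>b\<in>B. Cst (Tr (c * b)) * b"
  have lin: "plinear ?F"
    by (rule plinearI) (simp_all add: distrib_right linD[OF Tr_lin] Cst_simps sum.distrib
        mult.assoc sum_distrib_left)
  have FC: "?F c \<in> C" for c
    unfolding scl_def[symmetric] by (intro pv.span_sum pv.span_scale pv.span_base)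
  have coF: "co b' (?F c) = Tr (c * b')" if "b' \<in> B" for b' c
  proof -
    have "co b' (?F c) = (\<Sum>b\<in>B. Tr (c * b) * co b' b)" by (simp add: linD[OF co_lin])
    also have "\<dots> = (\<Sum>b\<in>B. if b = b' then Tr (c * b') else 0)"
      using that by (intro sum.cong) (auto simp: co_B)
    finally show ?thesis using that fin_B by simp
  qed
  have inj: "c = 0" if c: "c \<in> C" "?F c = 0" for c
  proof -
    have "Tr (c * b) = 0" if "b \<in> B" for b using coF[OF that, of c] c(2) linD(3)[OF co_lin] by simp
    then have "c \<in> Ia" using Tr_nondeg_B[of c] c(1) C_P by blast
    then show "c = 0" using nf_zero nf_id[OF c(1)] by simp
  qed
  have eq: "?F ` C = C"
    by (rule plinear_inj_surj[OF lin pv.subspace_span order_refl fin_B inj]) (use FC in auto)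
  have "\<exists>w. w \<in> P n \<and> (\<forall>b'\<in>B. Tr (w * b') = (if b = b' then 1 else 0))" if b: "b \<in> B" for b
  proof -
    have "b \<in> ?F ` C" using eq pv.span_base[OF b] by simp
    then obtain w where w: "w \<in> C" "b = ?F w" by blast
    then have "Tr (w * b') = (if b = b' then 1 else 0)" if "b' \<in> B" for b'
      using coF[OF that, of w] co_B[OF b that] by simp
    then show ?thesis using w C_P by blast
  qed
  then show ?thesis by (intro bchoice) blast
qed

definition v where "v = (SOME v. \<forall>b\<in>B. v b \<in> P n \<and> (\<forall>b'\<in>B. Tr (v b * b') = (if b = b' then 1 else 0)))"

lemma v: "b \<in> B \<Longrightarrow> v b \<in> P n" "b \<in> B \<Longrightarrow> b' \<in> B \<Longrightarrow> Tr (v b * b') = (if b = b' then 1 else 0)"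
  using someI_ex[OF dual_exists] unfolding v_def[symmetric] by auto

lemma co_v: "f \<in> P n \<Longrightarrow> b \<in> B \<Longrightarrow> Tr (f * v b) = co b f"
proof -
  assume f: "f \<in> P n" and b: "b \<in> B"
  let ?s = "\<Sum>b\<in>B. Cst (co b f) * b"
  have "f * v b - ?s * v b = (f - ?s) * v b" by (simp add: algebra_simps)
  then have "Tr (f * v b) = Tr (?s * v b)"
    using Tr_Ia[OF IaD(5)[OF v(1)[OF b] co_sum[OF f]]] linD(4)[OF Tr_lin, of "f * v b" "?s * v b"] by simp
  also have "\<dots> = (\<Sum>b'\<in>B. co b' f * Tr (v b * b'))"
    by (simp add: mult.commute[of _ "v b"] sum_distrib_left linD(5,2)[OF Tr_lin] mult.left_commute[of "v b"])
  also have "\<dots> = (\<Sum>b'\<in>B. if b' = b then co b f else 0)"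
    using v(2)[OF b] by (intro sum.cong) auto
  finally show ?thesis using b fin_B by simp
qed

lemma v_sum: "f \<in> P n \<Longrightarrow> f - (\<Sum>b\<in>B. Cst (Tr (f * b)) * v b) \<in> Ia"
proof (rule Tr_nondeg_B)
  assume f: "f \<in> P n"
  let ?s = "\<Sum>b\<in>B. Cst (Tr (f * b)) * v b"
  show "f - ?s \<in> P n" using f v(1) by (intro P_diff P_sum P_mult) auto
  fix b assume b: "b \<in> B"
  have "Tr (?s * b) = (\<Sum>b'\<in>B. Tr (f * b') * Tr (v b' * b))"
    by (simp add: sum_distrib_right linD[OF Tr_lin] mult.assoc)
  also have "\<dots> = (\<Sum>b'\<in>B. if b' = b then Tr (f * b) else 0)"
    using v(2)[OF _ b] by (intro sum.cong) auto
  finally show "Tr ((f - ?s) * b) = 0" using b fin_B by (simp add: left_diff_distrib linD[OF Tr_lin])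
qed

text \<open>Tested against g, the trace of the sum times g is the sum of the diagonal coefficients
  of multiplication by g, that is Tr g. The meaning is that multiplying out the two factors of the
  separability idempotent gives 1.\<close>

lemma uv_one: "(\<Sum>b\<in>B. b * v b) - 1 \<in> Ia"
proof (rule Tr_nondeg)
  let ?s = "\<Sum>b\<in>B. b * v b"
  show "?s - 1 \<in> P n" using v(1) B_P by (intro P_diff P_sum P_mult) auto
  fix g :: "'k mpoly" assume g: "g \<in> P n"
  have "Tr (?s * g) = (\<Sum>b\<in>B. Tr ((b * v b) * g))"
    by (simp only: sum_distrib_right linD(5)[OF Tr_lin])
  also have "\<dots> = (\<Sum>b\<in>B. Tr ((g * b) * v b))" by (simp only: ac_simps)
  also have "\<dots> = (\<Sum>b\<in>B. co b (g * b))" using g B_P by (intro sum.cong co_v) auto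
  also have "\<dots> = Tr g" by (simp add: Tr_eq)
  finally have "Tr (?s * g) = Tr g" .
  moreover have "(?s - 1) * g = ?s * g - g" by (simp add: left_diff_distrib)
  ultimately show "Tr ((?s - 1) * g) = 0" by (simp only: linD(4)[OF Tr_lin] diff_self)
qed

end

context artin_sep
begin

definition Lam :: "('k mpoly \<Rightarrow> 'k) set" where
  "Lam = {lam. lin lam \<and> (\<forall>f\<in>Ia. lam f = 0)}"

lemma LamD: "lam \<in> Lam \<Longrightarrow> lin lam" "lam \<in> Lam \<Longrightarrow> f \<in> Ia \<Longrightarrow> lam f = 0"
  by (auto simp: Lam_def)

lemma Lam_mult: "lam \<in> Lam \<Longrightarrow> g \<in> P n \<Longrightarrow> (\<lambda>h. lam (g * h)) \<in> Lam"
  using lin_mult IaD(4) by (auto simp: Lam_def)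

lemma Lam_Tr: "c \<in> P n \<Longrightarrow> (\<lambda>h. Tr (c * h)) \<in> Lam"
  using lin_mult[OF Tr_lin] Tr_Ia IaD(4) by (auto simp: Lam_def)

text \<open>A tensor is judged by all its contractions. For \<open>W = Ia\<close> and tensors in
  \<open>QP n\<close> this describes those that vanish in the tensor square of the algebra; for
  larger \<open>W\<close> it records where the contractions of a determinant land.\<close>

definition LW :: "'k mpoly set \<Rightarrow> 'k mpoly2 set" where
  "LW W = {F. \<forall>lam\<in>Lam. contr lam F \<in> W}"

definition JJ :: "'k mpoly2 set" where "JJ = QP n \<inter> LW Ia"

lemma LW_cY: "F \<in> LW W \<Longrightarrow> g \<in> P n \<Longrightarrow> cY g * F \<in> LW W"
proof -
  assume *: "F \<in> LW W" "g \<in> P n"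
  have "contr lam (cY g * F) \<in> W" if "lam \<in> Lam" for lam
    using contr_cY_mult[OF LamD(1)[OF that]] Lam_mult[OF that *(2)] *(1) by (simp add: LW_def)
  then show ?thesis by (simp add: LW_def)
qed

lemma LW_sum: "pv.subspace W \<Longrightarrow> (\<And>i. i \<in> S \<Longrightarrow> F i \<in> LW W) \<Longrightarrow> sum F S \<in> LW W"
  unfolding LW_def by (auto simp: contr_sum intro: pv.subspace_sum)

lemma LW_cX: "pv.subspace W \<Longrightarrow> f \<in> W \<Longrightarrow> cX f \<in> LW W"
proof -
  assume W: "pv.subspace W" "f \<in> W"
  have "contr lam (cX f) \<in> W" if "lam \<in> Lam" for lam
    using pv.subspace_scale[OF W(1,2), of "lam 1"] contr_single[of lam 0 f]
    by (simp add: cX_def scl_def mult.commute)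
  then show ?thesis by (simp add: LW_def)
qed

lemma JJ_cX_mult: "f \<in> P n \<Longrightarrow> F \<in> LW Ia \<Longrightarrow> cX f * F \<in> LW Ia"
  unfolding LW_def using IaD(4) by (auto simp: contr_cX_mult)

lemma LW_add: "pv.subspace W \<Longrightarrow> F \<in> LW W \<Longrightarrow> H \<in> LW W \<Longrightarrow> F + H \<in> LW W"
  unfolding LW_def by (auto simp: contr_add intro: pv.subspace_add)

lemma QP_mult_LW: "F \<in> QP n \<Longrightarrow> H \<in> LW Ia \<Longrightarrow> F * H \<in> LW Ia"
proof (induction F rule: QP.induct)
  case (tens f g)
  have "cX f * (cY g * H) \<in> LW Ia" using tens JJ_cX_mult LW_cY by blast
  then show ?case by (simp add: mult.assoc)
qed (simp add: distrib_right LW_add pideal_subspace[OF Ia])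

sublocale T: ideal_in_subring "QP n" JJ
proof
  show "JJ \<subseteq> QP n" by (auto simp: JJ_def)
  show "0 \<in> JJ" using QP_zero IaD(2) by (auto simp: JJ_def LW_def)
  show "x + y \<in> JJ" if "x \<in> JJ" "y \<in> JJ" for x y
    using that add LW_add[OF pideal_subspace[OF Ia]] by (auto simp: JJ_def)
  show "a * x \<in> JJ" if "a \<in> QP n" "x \<in> JJ" for a x
    using that QP_mult QP_mult_LW by (auto simp: JJ_def)
qed (auto intro: QP_one QP.add QP_mult QP_uminus)

lemma contr_cg: "F \<in> QP n \<Longrightarrow> H \<in> QP n \<Longrightarrow> (\<And>lam. lam \<in> Lam \<Longrightarrow> contr lam F - contr lam H \<in> Ia) \<Longrightarrow> T.cg F H"
proof -
  assume *: "F \<in> QP n" "H \<in> QP n" "\<And>lam. lam \<in> Lam \<Longrightarrow> contr lam F - contr lam H \<in> Ia"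
  then have "F - H \<in> JJ" unfolding JJ_def LW_def by (auto simp: contr_diff T.A_diff)
  then show ?thesis using * by (simp add: T.cg_def)
qed

lemma cX_cg: "f \<in> P n \<Longrightarrow> g \<in> P n \<Longrightarrow> f - g \<in> Ia \<Longrightarrow> T.cg (cX f) (cX g)"
proof -
  assume *: "f \<in> P n" "g \<in> P n" "f - g \<in> Ia"
  then have "cX (f - g) \<in> JJ" using LW_cX[OF pideal_subspace[OF Ia]] by (auto simp: JJ_def intro: QP_cX)
  then show ?thesis using * by (simp add: T.cg_def cX_simps QP_cX)
qed

end

text \<open>The weights \<open>w i k\<close> of a column do not depend on the row, so the
  determinant expands column by column with the weights as factors. Contraction turns the weights
  into scalars, and W is closed under linear combinations.\<close>

lemma (in artin_sep) det_expansion: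
  assumes W: "pv.subspace W" and w: "\<And>i k. i < n \<Longrightarrow> k \<in> B \<Longrightarrow> w i k \<in> P n"
    and a: "\<And>\<kappa>. (\<And>i. i < n \<Longrightarrow> \<kappa> i \<in> B) \<Longrightarrow> det (mat n n (\<lambda>(l, i). a l i (\<kappa> i))) \<in> W"
  shows "det (mat n n (\<lambda>(l, i). \<Sum>k\<in>B. cX (a l i k) * cY (w i k))) \<in> LW W"
proof -
  \<comment> \<open>In \<open>?M s\<close> the first s columns are still sums, and
    \<open>\<kappa>\<close> has chosen one summand in each of the others. The induction starts with
    all columns chosen.\<close>
  let ?M = "\<lambda>s \<kappa>. mat n n (\<lambda>(l, i). if i < s then \<Sum>k\<in>B. cX (a l i k) * cY (w i k) else cX (a l i (\<kappa> i)))"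
  have "\<forall>\<kappa>. (\<forall>i<n. \<kappa> i \<in> B) \<longrightarrow> det (?M s \<kappa>) \<in> LW W" if "s \<le> n" for s
    using that
  proof (induction s)
    case 0
    interpret h: comm_ring_hom "cX :: 'k mpoly \<Rightarrow> 'k mpoly2"
      by unfold_locales (simp_all add: cX_simps)
    have "det (?M 0 \<kappa>) = cX (det (mat n n (\<lambda>(l, i). a l i (\<kappa> i))))" for \<kappa>
      unfolding h.hom_det[symmetric] by (rule arg_cong[of _ _ det], rule eq_matI) auto
    then show ?case using LW_cX[OF W a] by auto
  next
    case (Suc s)
    show ?case
    proof (intro allI impI)
      fix \<kappa> assume \<kappa>: "\<forall>i<n. \<kappa> i \<in> B"
      have s: "s < n" using Suc.prems by simp
      have "det (?M (Suc s) \<kappa>) = (\<Sum>k\<in>B. cY (w s k) * det (mat n n (\<lambda>(l, i). if i = s then cX (a l s k)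
          else if i < Suc s then \<Sum>k\<in>B. cX (a l i k) * cY (w i k) else cX (a l i (\<kappa> i)))))"
        by (rule det_column_linear[OF s]) (simp add: mult.commute)
      also have "\<dots> = (\<Sum>k\<in>B. cY (w s k) * det (?M s (\<kappa>(s := k))))"
        by (intro sum.cong refl arg_cong[of _ _ "\<lambda>x. _ * det x"] eq_matI) (auto simp: less_Suc_eq)
      also have "\<dots> \<in> LW W"
        using Suc \<kappa> s by (intro LW_sum[OF W] LW_cY w) auto
      finally show "det (?M (Suc s) \<kappa>) \<in> LW W" .
    qed
  qed
  from this[of n] show ?thesis
  proof -
    assume *: "n \<le> n \<Longrightarrow> \<forall>\<kappa>. (\<forall>i<n. \<kappa> i \<in> B) \<longrightarrow> det (?M n \<kappa>) \<in> LW W"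
    show ?thesis
    proof (cases "B = {} \<and> n > 0")
      \<comment> \<open>Without elements of \<open>B\<close> there is no choice
        \<open>\<kappa>\<close>, but then every column is an empty sum.\<close>
      case True
      then have "n > 0" by simp
      then have "det (mat n n (\<lambda>(l, i). \<Sum>k\<in>B. cX (a l i k) * cY (w i k))) = 0"
        using True laplace_expansion_column[of "mat n n (\<lambda>(l, i). 0 :: 'k mpoly2)" n 0]
        by (auto intro!: sum.neutral)
      then show ?thesis using pv.subspace_0[OF W] by (auto simp: LW_def)
    next
      case False
      then obtain b where "n = 0 \<or> b \<in> B" by (metis all_not_in_conv neq0_conv)
      then have "det (?M n (\<lambda>_. b)) \<in> LW W" using * by auto
      moreover have "?M n (\<lambda>_. b) = mat n n (\<lambda>(l, i). \<Sum>k\<in>B. cX (a l i k) * cY (w i k))"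
        by (rule eq_matI) auto
      ultimately show ?thesis by simp
    qed
  qed
qed

text \<open>\<open>G\<close> is the separability idempotent of the algebra; the polynomials \<open>h i k\<close> in the ideal are
  the coefficients of \<open>(X\<^sub>i - Y\<^sub>i) G\<close>, homogenized with the help of \<open>X\<^sub>0\<close>.\<close>

locale artin_lift = artin_sep n Ia nf B
  for n :: nat and Ia :: "'k::field mpoly set" and nf :: "'k mpoly \<Rightarrow> 'k mpoly" and B :: "'k mpoly set" +
  fixes u :: "'k mpoly \<Rightarrow> 'k mpoly"
  assumes u: "b \<in> B \<Longrightarrow> u b \<in> P n" "b \<in> B \<Longrightarrow> u b - b \<in> Ia" and X0: "indet 0 - 1 \<in> Ia"
begin

definition h :: "nat \<Rightarrow> 'k mpoly \<Rightarrow> 'k mpoly" where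
  "h i k = indet i * u k - indet 0 * (\<Sum>m\<in>B. Cst (Tr (indet i * v m * k)) * u m)"

definition G :: "'k mpoly2" where "G = (\<Sum>k\<in>B. cX (u k) * cY (v k))"
text \<open>\<open>Z l\<close> is the derivative of \<open>G\<close> by X_l, taken on the chosen
  lifts \<open>u\<close>; together with \<open>wt i\<close>, the function X_i - Y_i, it makes up the
  rank-one part of the matrix \<open>AA\<close>.\<close>

definition Z :: "nat \<Rightarrow> 'k mpoly2" where "Z l = (\<Sum>k\<in>B. cX (pdiff l (u k)) * cY (v k))"
definition wt :: "nat \<Rightarrow> 'k mpoly2" where "wt i = cX (indet i) - cY (indet i)"

lemma h_P: "i \<le> n \<Longrightarrow> k \<in> B \<Longrightarrow> h i k \<in> P n"
  unfolding h_def using u by (intro P_diff P_mult P_sum) auto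

lemma scl_cong: "f - g \<in> Ia \<Longrightarrow> Cst c * f - Cst c * g \<in> Ia"
  using IaD(9)[of "f - g" c] by (simp add: right_diff_distrib)

lemma sum_u: "(\<Sum>m\<in>B. Cst (c m) * u m) - (\<Sum>m\<in>B. Cst (c m) * m) \<in> Ia"
  unfolding sum_subtractf[symmetric] by (intro IaD(8) scl_cong u)

lemma IaT: "x - y \<in> Ia \<Longrightarrow> y - z \<in> Ia \<Longrightarrow> x - z \<in> Ia"
  using IaD(3)[of "x - y" "y - z"] by simp

lemma X0_cong: "f \<in> P n \<Longrightarrow> indet 0 * f - f \<in> Ia"
  using IaD(4)[OF _ X0, of f] by (simp add: algebra_simps)

text \<open>By duality Tr(X_i v_m k) is the coefficient of m in X_i k. So the subtracted sum is X_i
  k expanded in the basis, with X_0 counting as 1.\<close>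

lemma h_Ia:
  assumes i: "i \<le> n" and k: "k \<in> B" shows "h i k \<in> Ia"
proof -
  let ?s = "\<Sum>m\<in>B. Cst (Tr (indet i * v m * k)) * u m"
  let ?t = "\<Sum>m\<in>B. Cst (co m (indet i * k)) * m"
  have ik: "indet i * k \<in> P n" using i B_P[OF k] by simp
  have "Tr (indet i * v m * k) = co m (indet i * k)" if "m \<in> B" for m
    using co_v[OF ik that] by (simp add: ac_simps)
  then have st: "?s - ?t \<in> Ia" using sum_u[of "\<lambda>m. co m (indet i * k)"] by simp
  have sP: "?s \<in> P n" using u by (intro P_sum P_mult) auto
  have 1: "indet i * u k - indet i * k \<in> Ia"
    using IaD(4)[OF P_indet[OF i] u(2)[OF k]] by (simp add: right_diff_distrib)
  have 2: "indet i * k - ?t \<in> Ia" by (rule co_sum[OF ik])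
  have 3: "?t - ?s \<in> Ia" using IaD(6)[OF st] by simp
  have 4: "?s - indet 0 * ?s \<in> Ia" using IaD(6)[OF X0_cong[OF sP]] by simp
  show ?thesis unfolding h_def by (rule IaT[OF IaT[OF IaT[OF 1 2] 3] 4])
qed

lemma G_QP: "G \<in> QP n" unfolding G_def using u v by (intro QP_sum QP.tens) auto
lemma Z_QP: "Z l \<in> QP n" unfolding Z_def using u v by (intro QP_sum QP.tens) auto
lemma wt_QP: "i \<le> n \<Longrightarrow> wt i \<in> QP n" unfolding wt_def by (intro T.A_diff QP_cX QP_cY) auto

lemma contr_tensors:
  "lin lam \<Longrightarrow> contr lam (\<Sum>k\<in>B. cX (a k) * cY (w k)) = (\<Sum>k\<in>B. a k * Cst (lam (w k)))"
  by (simp add: contr_sum contr_cX_cY)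

lemma lam_v:
  assumes lam: "lam \<in> Lam" and g: "g \<in> P n"
  shows "lam g = (\<Sum>b\<in>B. Tr (g * b) * lam (v b))"
proof -
  have "lam (g - (\<Sum>b\<in>B. Cst (Tr (g * b)) * v b)) = 0" using LamD(2)[OF lam v_sum[OF g]] .
  then show ?thesis by (simp add: linD[OF LamD(1)[OF lam]])
qed

text \<open>Multiplication by g has transposed matrices in dual bases: expanding g v_k in the v_b
  and g b in the k involves the same numbers Tr(g v_k b). Contraction with a functional reduces the
  congruence to this identity.\<close>

lemma diag_G:
  assumes g: "g \<in> P n" shows "T.cg (cX g * G) (cY g * G)"
proof (rule contr_cg)
  show "cX g * G \<in> QP n" "cY g * G \<in> QP n" using g G_QP by (auto intro: QP_mult QP_cX QP_cY)
  fix lam assume lam: "lam \<in> Lam"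
  note ll = LamD(1)[OF lam]
  let ?x = "\<Sum>k\<in>B. Cst (lam (v k)) * u k" and ?y = "\<Sum>k\<in>B. Cst (lam (g * v k)) * u k"
  let ?x' = "\<Sum>k\<in>B. Cst (lam (v k)) * k" and ?y' = "\<Sum>k\<in>B. Cst (lam (g * v k)) * k"
  have cx: "contr lam (cX g * G) = g * ?x"
    unfolding contr_cX_mult G_def contr_tensors[OF ll] by (simp add: mult.commute)
  have cy: "contr lam (cY g * G) = ?y"
    unfolding contr_cY_mult[OF ll] G_def contr_tensors[OF lin_mult[OF ll]] by (simp add: mult.commute)
  have 1: "g * ?x - g * ?x' \<in> Ia" using IaD(4)[OF g sum_u] by (simp add: right_diff_distrib)
  have 2: "?y' - ?y \<in> Ia" using IaD(6)[OF sum_u] by (simp add: minus_diff_eq)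
  have "?y' = (\<Sum>k\<in>B. \<Sum>b\<in>B. Cst (Tr (g * v k * b) * lam (v b)) * k)"
  proof (rule sum.cong[OF refl])
    fix k assume k: "k \<in> B"
    have "lam (g * v k) = (\<Sum>b\<in>B. Tr (g * v k * b) * lam (v b))" using lam_v[OF lam] g v(1)[OF k] by simp
    then show "Cst (lam (g * v k)) * k = (\<Sum>b\<in>B. Cst (Tr (g * v k * b) * lam (v b)) * k)"
      by (simp add: Cst_sum sum_distrib_right)
  qed
  also have "\<dots> = (\<Sum>b\<in>B. \<Sum>k\<in>B. Cst (lam (v b)) * (Cst (co k (g * b)) * k))"
  proof (subst sum.swap, intro sum.cong refl)
    fix b k assume b: "b \<in> B" and k: "k \<in> B"
    have "Tr (g * v k * b) = co k (g * b)" using co_v[of "g * b" k] g B_P[OF b] k by (simp add: ac_simps)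
    then show "Cst (Tr (g * v k * b) * lam (v b)) * k = Cst (lam (v b)) * (Cst (co k (g * b)) * k)"
      by (simp add: Cst_simps ac_simps)
  qed
  finally have y': "?y' = (\<Sum>b\<in>B. Cst (lam (v b)) * (\<Sum>k\<in>B. Cst (co k (g * b)) * k))"
    by (simp only: sum_distrib_left)
  have "g * ?x' = (\<Sum>b\<in>B. Cst (lam (v b)) * (g * b))" by (simp add: sum_distrib_left mult.left_commute)
  then have "g * ?x' - ?y' = (\<Sum>b\<in>B. Cst (lam (v b)) * (g * b) - Cst (lam (v b)) * (\<Sum>k\<in>B. Cst (co k (g * b)) * k))"
    unfolding y' by (simp only: sum_subtractf)
  moreover have "\<dots> \<in> Ia" using g B_P by (intro IaD(8) scl_cong co_sum) auto
  ultimately have 3: "g * ?x' - ?y' \<in> Ia" by metis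
  show "contr lam (cX g * G) - contr lam (cY g * G) \<in> Ia"
    unfolding cx cy by (rule IaT[OF IaT[OF 1 3] 2])
qed

lemma wt_G: "i \<le> n \<Longrightarrow> T.cg (wt i * G) 0"
  using T.cg_diff[OF diag_G[OF P_indet, of i] T.cg_refl[of "cY (indet i) * G"]] QP_mult[OF QP_cY G_QP, of "indet i"]
  by (simp add: wt_def left_diff_distrib)

text \<open>In the product, each v_k standing before the second G may be moved to the first set of
  variables by \<open>diag_G\<close>, where the sum of the u_k v_k is 1.\<close>

lemma G_idem: "T.cg (G * G) G"
proof -
  have "G * G = (\<Sum>k\<in>B. cX (u k) * (cY (v k) * G))"
    by (subst (1) G_def) (simp add: sum_distrib_right mult.assoc)
  also have "T.cg \<dots> (\<Sum>k\<in>B. cX (u k) * (cX (v k) * G))"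
    using u v by (intro T.cg_sum T.cg_mult T.cg_refl QP_cX T.cg_sym[OF diag_G]) auto
  also have "(\<Sum>k\<in>B. cX (u k) * (cX (v k) * G)) = cX (\<Sum>k\<in>B. u k * v k) * G"
    by (simp add: sum_distrib_right mult.assoc cX_sum cX_simps)
  also have "T.cg \<dots> (cX 1 * G)"
  proof (intro T.cg_mult T.cg_refl G_QP cX_cg)
    show "(\<Sum>k\<in>B. u k * v k) \<in> P n" using u v by (intro P_sum P_mult) auto
    have "(\<Sum>k\<in>B. u k * v k) - (\<Sum>k\<in>B. k * v k) = (\<Sum>k\<in>B. (u k - k) * v k)"
      by (simp add: sum_subtractf left_diff_distrib)
    also have "\<dots> \<in> Ia" using u v by (intro IaD(8) IaD(5)) auto
    finally show "(\<Sum>k\<in>B. u k * v k) - 1 \<in> Ia" using IaT uv_one by blast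
  qed simp
  finally show ?thesis by (simp add: cX_simps)
qed

text \<open>The coefficients of column \<open>i\<close> with respect to the v_k are the gradients of
  the relations \<open>h (Suc i) k\<close>, so the determinant contracts to combinations of Jacobian
  determinants of such relations. Indices are shifted by one since X_0 has no row.\<close>

definition AA :: "nat \<Rightarrow> nat \<Rightarrow> 'k mpoly2" where
  "AA l i = (\<Sum>k\<in>B. cX (pdiff (Suc l) (h (Suc i) k)) * cY (v k))"

lemma pdiff_h: "pdiff (Suc l) (h (Suc i) k) =
  (if l = i then u k else 0) + indet (Suc i) * pdiff (Suc l) (u k)
   - indet 0 * (\<Sum>m\<in>B. Cst (Tr (indet (Suc i) * v m * k)) * pdiff (Suc l) (u m))"
  by (simp add: h_def pdiff_diff pdiff_mult[of _ "indet j" for j] pdiff_sum pdiff_Cst_mult pdiff_indet)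

text \<open>The product rule for (X_i - Y_i) G: X_i contributes G on the diagonal of the matrix, the
  rest multiplies the derivative of G. The X_0 in the relations has derivative 0 in these directions
  and is 1 modulo \<open>Ia\<close>.\<close>

lemma AA_cg:
  assumes "l < n" "i < n"
  shows "T.cg (AA l i) ((if l = i then G else 0) + wt (Suc i) * Z (Suc l))"
proof (rule contr_cg)
  have hk: "h (Suc i) k \<in> P n" if "k \<in> B" for k using h_P[OF _ that] assms by simp
  show "AA l i \<in> QP n" unfolding AA_def using hk v by (intro QP_sum QP.tens) auto
  show "(if l = i then G else 0) + wt (Suc i) * Z (Suc l) \<in> QP n"
    using assms G_QP QP_zero wt_QP[of "Suc i"] Z_QP by (auto intro!: QP.add QP_mult)
  fix lam assume lam: "lam \<in> Lam"
  note ll = LamD(1)[OF lam]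
  let ?d = "\<lambda>k. pdiff (Suc l) (u k)"
  let ?c = "\<lambda>m. \<Sum>k\<in>B. Tr (indet (Suc i) * v m * k) * lam (v k)"
  have c: "lam (indet (Suc i) * v m) = ?c m" if "m \<in> B" for m
    using lam_v[OF lam, of "indet (Suc i) * v m"] assms v(1)[OF that] by simp
  let ?D = "\<Sum>m\<in>B. ?d m * Cst (lam (indet (Suc i) * v m))"
  have DP: "?D \<in> P n" using u by (intro P_sum P_mult) auto
  have "contr lam (AA l i) = (\<Sum>k\<in>B. (if l = i then u k else 0) * Cst (lam (v k)))
      + indet (Suc i) * (\<Sum>k\<in>B. ?d k * Cst (lam (v k)))
      - (\<Sum>k\<in>B. indet 0 * (\<Sum>m\<in>B. Cst (Tr (indet (Suc i) * v m * k)) * ?d m) * Cst (lam (v k)))"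
    unfolding AA_def contr_tensors[OF ll] pdiff_h
    by (simp add: algebra_simps sum.distrib sum_subtractf sum_distrib_left)
  also have "(\<Sum>k\<in>B. indet 0 * (\<Sum>m\<in>B. Cst (Tr (indet (Suc i) * v m * k)) * ?d m) * Cst (lam (v k)))
      = indet 0 * (\<Sum>k\<in>B. \<Sum>m\<in>B. ?d m * Cst (Tr (indet (Suc i) * v m * k) * lam (v k)))"
    by (simp add: sum_distrib_left sum_distrib_right Cst_simps ac_simps)
  also have "(\<Sum>k\<in>B. \<Sum>m\<in>B. ?d m * Cst (Tr (indet (Suc i) * v m * k) * lam (v k))) = ?D"
    by (subst sum.swap) (simp add: c Cst_sum sum_distrib_left)
  finally have 1: "contr lam (AA l i) = (\<Sum>k\<in>B. (if l = i then u k else 0) * Cst (lam (v k)))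
      + indet (Suc i) * (\<Sum>k\<in>B. ?d k * Cst (lam (v k))) - indet 0 * ?D" .
  have 2: "contr lam ((if l = i then G else 0) + wt (Suc i) * Z (Suc l)) =
     (\<Sum>k\<in>B. (if l = i then u k else 0) * Cst (lam (v k)))
      + indet (Suc i) * (\<Sum>k\<in>B. ?d k * Cst (lam (v k))) - ?D"
    unfolding wt_def left_diff_distrib contr_add contr_diff contr_cX_mult contr_cY_mult[OF ll]
      Z_def G_def contr_tensors[OF ll] contr_tensors[OF lin_mult[OF ll]]
    by (simp add: contr_tensors[OF ll])
  show "contr lam (AA l i) - contr lam ((if l = i then G else 0) + wt (Suc i) * Z (Suc l)) \<in> Ia"
    unfolding 1 2 using IaD(6)[OF X0_cong[OF DP]] by (simp add: algebra_simps)
qed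

lemma AA_QP: "l < n \<Longrightarrow> i < n \<Longrightarrow> AA l i \<in> QP n"
  using AA_cg unfolding T.cg_def by blast

lemma G_AA:
  assumes "l < n" "i < n" shows "T.cg (G * AA l i) (if l = i then G else 0)"
proof -
  have "T.cg (G * AA l i) (G * ((if l = i then G else 0) + wt (Suc i) * Z (Suc l)))"
    by (intro T.cg_mult T.cg_refl G_QP AA_cg assms)
  also have "G * ((if l = i then G else 0) + wt (Suc i) * Z (Suc l)) =
     (if l = i then G * G else 0) + (wt (Suc i) * G) * Z (Suc l)" by (simp add: algebra_simps)
  also have "T.cg \<dots> ((if l = i then G else 0) + 0 * Z (Suc l))"
    using assms G_idem T.cg_refl[OF QP_zero]
    by (intro T.cg_add T.cg_mult wt_G T.cg_refl Z_QP) auto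
  finally show ?thesis by simp
qed

lemma G_pow: "k > 0 \<Longrightarrow> T.cg (G ^ k) G"
  by (rule T.cg_power_idem[OF G_idem])

text \<open>The congruence is checked after multiplication by G and by 1 - G. Each is idempotent, so
  its n-th power may be put in its place, which distributes one factor to every entry of the
  matrix.\<close>

lemma det_AA:
  assumes n: "n \<ge> 2"
  shows "T.cg (det (mat n n (\<lambda>(l, i). AA l i))) G"
proof -
  let ?A = "mat n n (\<lambda>(l, i). AA l i)"
  have dQ: "det ?A \<in> QP n" by (rule T.A_det) (rule AA_QP)
  have n0: "n > 0" using n by simp
  have "T.cg (G * det ?A) (G ^ n * det ?A)"
    by (intro T.cg_mult T.cg_refl dQ T.cg_sym[OF G_pow[OF n0]])
  also have "G ^ n * det ?A = det (mat n n (\<lambda>(l, i). G * AA l i))"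
    using det_smult[of G ?A] by (simp add: smult_mat_fun)
  also have "T.cg \<dots> (det (mat n n (\<lambda>(l, i). if l = i then G else 0)))"
    by (rule T.cg_det) (rule G_AA)
  also have "det (mat n n (\<lambda>(l, i). if l = i then G else 0)) = G ^ n" by (rule det_mat_one)
  also have "T.cg \<dots> G" by (rule G_pow[OF n0])
  finally have 1: "T.cg (G * det ?A) G" .
  let ?E = "1 - G"
  have EQ: "?E \<in> QP n" by (intro T.A_diff QP_one G_QP)
  have EG: "T.cg (?E * G) 0"
    using T.cg_diff[OF T.cg_refl[OF G_QP] G_idem] by (simp add: left_diff_distrib)
  have Ei: "T.cg (?E * ?E) ?E"
    using T.cg_diff[OF T.cg_refl[OF EQ] EG] by (simp add: algebra_simps)
  have EA: "T.cg (?E * AA l i) (wt (Suc i) * Z (Suc l))" if "l < n" "i < n" for l i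
  proof -
    have "T.cg (?E * AA l i) (?E * ((if l = i then G else 0) + wt (Suc i) * Z (Suc l)))"
      by (intro T.cg_mult T.cg_refl EQ AA_cg that)
    also have "?E * ((if l = i then G else 0) + wt (Suc i) * Z (Suc l)) =
       (if l = i then ?E * G else 0) + (wt (Suc i) * Z (Suc l) - (wt (Suc i) * G) * Z (Suc l))"
      by (simp add: algebra_simps)
    also have "T.cg \<dots> (0 + (wt (Suc i) * Z (Suc l) - 0 * Z (Suc l)))"
      using that EG T.cg_refl[OF QP_zero] wt_QP[of "Suc i"]
      by (intro T.cg_add T.cg_diff T.cg_mult wt_G T.cg_refl Z_QP) (auto intro!: QP_mult Z_QP)
    finally show ?thesis by simp
  qed
  have "T.cg (?E * det ?A) (?E ^ n * det ?A)"
    by (intro T.cg_mult T.cg_refl dQ T.cg_sym[OF T.cg_power_idem[OF Ei n0]])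
  also have "?E ^ n * det ?A = det (mat n n (\<lambda>(l, i). ?E * AA l i))"
    using det_smult[of ?E ?A] by (simp add: smult_mat_fun)
  also have "T.cg \<dots> (det (mat n n (\<lambda>(l, i). wt (Suc i) * Z (Suc l))))"
    by (rule T.cg_det) (rule EA)
  also have "det (mat n n (\<lambda>(l, i). wt (Suc i) * Z (Suc l))) = 0" by (rule det_rank_one[OF n])
  finally have 2: "T.cg (?E * det ?A) 0" .
  show ?thesis using T.cg_add[OF 1 2] by (simp add: algebra_simps)
qed

lemma contr_G: "c \<in> P n \<Longrightarrow> contr (\<lambda>h. Tr (c * h)) G - c \<in> Ia"
proof -
  assume c: "c \<in> P n"
  have "contr (\<lambda>h. Tr (c * h)) G = (\<Sum>k\<in>B. Cst (co k c) * u k)"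
    unfolding G_def contr_tensors[OF LamD(1)[OF Lam_Tr[OF c]]] using co_v[OF c] by (simp add: mult.commute)
  moreover have "(\<Sum>k\<in>B. Cst (co k c) * k) - c \<in> Ia" using IaD(6)[OF co_sum[OF c]] by simp
  ultimately show ?thesis using IaT[OF sum_u] by simp
qed

text \<open>\<open>W\<close> contains \<open>Ia\<close>, so it is a condition on classes: up to an
  element of \<open>Ia\<close>, c is a contraction of the determinant, and that contraction lies in
  \<open>W\<close> by multilinearity.\<close>

theorem minors_span:
  assumes n: "n \<ge> 2" and W: "pv.subspace W" "Ia \<subseteq> W"
    and minors: "\<And>\<kappa>. (\<And>i. i < n \<Longrightarrow> \<kappa> i \<in> B) \<Longrightarrow>
      det (mat n n (\<lambda>(l, i). pdiff (Suc l) (h (Suc i) (\<kappa> i)))) \<in> W"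
    and c: "c \<in> P n"
  shows "c \<in> W"
proof -
  let ?lam = "\<lambda>h. Tr (c * h)"
  let ?A = "mat n n (\<lambda>(l, i). AA l i)"
  have "det ?A \<in> LW W"
    unfolding AA_def by (rule det_expansion[OF W(1) v(1) minors])
  then have 1: "contr ?lam (det ?A) \<in> W" using Lam_Tr[OF c] by (simp add: LW_def)
  have "contr ?lam (det ?A - G) \<in> Ia"
    using det_AA[OF n, unfolded T.cg_def] Lam_Tr[OF c] by (auto simp: JJ_def LW_def)
  then have "contr ?lam (det ?A) - c \<in> Ia" using IaT[OF _ contr_G[OF c]] by (simp add: contr_diff)
  then have "contr ?lam (det ?A) - (contr ?lam (det ?A) - c) \<in> W"
    using pv.subspace_diff[OF W(1) 1] W(2) by blast
  then show ?thesis by simp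
qed

text \<open>Put the gradient of f into column \<open>i0\<close>. Times G, the other columns become
  those of G times the identity, so by Cramer's rule the determinant is the entry \<open>i0\<close>
  of the gradient times G^n. Contraction with the trace then turns G into 1.\<close>

theorem gradient_minor:
  assumes f: "f \<in> P n" and i0: "i0 < n"
    and minors: "\<And>\<kappa>. (\<And>i. i < n \<Longrightarrow> \<kappa> i \<in> B) \<Longrightarrow>
      det (mat n n (\<lambda>(l, i). pdiff (Suc l) (if i = i0 then f else h (Suc i) (\<kappa> i)))) \<in> Ia"
  shows "pdiff (Suc i0) f \<in> Ia"
proof (cases "B = {}")
  case True
  have "nf (pdiff (Suc i0) f) = 0" using nf_span[of "pdiff (Suc i0) f"] True by (simp add: pv.span_empty)
  then show ?thesis using nf_zero_iff f by simp
next
  case False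
  then obtain b0 where b0: "b0 \<in> B" by blast
  \<comment> \<open>In column \<open>i0\<close> all weight sits on one basis element, so that the
    sum over \<open>B\<close> contributes the gradient exactly once.\<close>
  let ?w = "\<lambda>i k. if i = i0 then (if k = b0 then 1 else 0) else v k"
  let ?a = "\<lambda>l i k. pdiff (Suc l) (if i = i0 then f else h (Suc i) k)"
  let ?D = "mat n n (\<lambda>(l, i). if i = i0 then cX (pdiff (Suc l) f) else AA l i)"
  have "det (mat n n (\<lambda>(l, i). \<Sum>k\<in>B. cX (?a l i k) * cY (?w i k))) \<in> LW Ia"
  proof (rule det_expansion[OF pideal_subspace[OF Ia]])
    show "?w i k \<in> P n" if "i < n" "k \<in> B" for i k using v(1)[OF that(2)] by simp
    show "det (mat n n (\<lambda>(l, i). ?a l i (\<kappa> i))) \<in> Ia" if "\<And>i. i < n \<Longrightarrow> \<kappa> i \<in> B" for \<kappa>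
      using minors[OF that] by simp
  qed
  moreover have "mat n n (\<lambda>(l, i). \<Sum>k\<in>B. cX (?a l i k) * cY (?w i k)) = ?D"
  proof (rule eq_matI, simp_all, intro conjI impI)
    fix l
    have "(\<Sum>k\<in>B. cX (pdiff (Suc l) f) * cY (if k = b0 then 1 else 0)) =
        (\<Sum>k\<in>B. if k = b0 then cX (pdiff (Suc l) f) else 0)"
      by (intro sum.cong) (auto simp: cY_simps)
    then show "(\<Sum>k\<in>B. cX (pdiff (Suc l) f) * cY (if k = b0 then 1 else 0)) = cX (pdiff (Suc l) f)"
      using b0 fin_B by simp
  qed (simp add: AA_def)
  ultimately have DL: "det ?D \<in> LW Ia" by simp
  have DQ: "det ?D \<in> QP n" by (rule T.A_det) (use f AA_QP in \<open>auto intro: QP_cX\<close>)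
  have DJ: "T.cg (det ?D) 0" unfolding T.cg_zero using DL DQ by (simp add: JJ_def)
  have n0: "n > 0" using i0 by simp
  let ?x = "vec n (\<lambda>l. cX (pdiff (Suc l) f))"
  let ?GI = "mat n n (\<lambda>(l, i). if l = i then G else 0)"
  let ?R = "mat n n (\<lambda>(l, i). if i = i0 then G * cX (pdiff (Suc l) f) else if l = i then G else 0)"
  have "T.cg (G ^ n * det ?D) (G ^ n * 0)"
    using DJ G_QP by (intro T.cg_mult T.cg_refl T.A_power) auto
  then have 1: "T.cg 0 (G ^ n * det ?D)" using T.cg_sym by simp
  also have "G ^ n * det ?D = det (mat n n (\<lambda>(l, i). G * (if i = i0 then cX (pdiff (Suc l) f) else AA l i)))"
    using det_smult[of G ?D] by (simp add: smult_mat_fun)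
  also have "T.cg \<dots> (det ?R)"
  proof (rule T.cg_det)
    fix l i assume li: "l < n" "i < n"
    show "T.cg (G * (if i = i0 then cX (pdiff (Suc l) f) else AA l i))
        (if i = i0 then G * cX (pdiff (Suc l) f) else if l = i then G else 0)"
      using G_AA[OF li] T.cg_refl[OF QP_mult[OF G_QP QP_cX[OF P_pdiff[OF f, of "Suc l"]]]] by simp
  qed
  also have "?R = replace_col ?GI (?GI *\<^sub>v ?x) i0"
  proof (rule eq_matI)
    fix l i assume "l < dim_row (replace_col ?GI (?GI *\<^sub>v ?x) i0)" "i < dim_col (replace_col ?GI (?GI *\<^sub>v ?x) i0)"
    then have li: "l < n" "i < n" by (auto simp: replace_col_def)
    have "(\<Sum>j = 0..<n. (if l = j then G else 0) * cX (pdiff (Suc j) f)) =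
        (\<Sum>j = 0..<n. if j = l then G * cX (pdiff (Suc l) f) else 0)"
      by (intro sum.cong) auto
    then have "(?GI *\<^sub>v ?x) $ l = G * cX (pdiff (Suc l) f)"
      using li by (simp add: scalar_prod_def)
    then show "?R $$ (l, i) = replace_col ?GI (?GI *\<^sub>v ?x) i0 $$ (l, i)" using li by (simp add: replace_col_def)
  qed (auto simp: replace_col_def)
  also have "det (replace_col ?GI (?GI *\<^sub>v ?x) i0) = ?x $ i0 * det ?GI"
    by (rule cramer_lemma_mat) (use i0 in auto)
  also have "\<dots> = cX (pdiff (Suc i0) f) * G ^ n" using i0 by (simp add: det_mat_one)
  also have "T.cg \<dots> (cX (pdiff (Suc i0) f) * G)"
    using f by (intro T.cg_mult T.cg_refl QP_cX G_pow[OF n0]) auto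
  finally have "cX (pdiff (Suc i0) f) * G \<in> JJ" using T.cg_zero T.cg_sym by blast
  then have c: "pdiff (Suc i0) f * contr (\<lambda>h. Tr (1 * h)) G \<in> Ia"
    using Lam_Tr[OF P_one] by (auto simp: JJ_def LW_def contr_cX_mult)
  have "pdiff (Suc i0) f * (contr (\<lambda>h. Tr (1 * h)) G - 1) \<in> Ia"
    using IaD(4)[OF P_pdiff[OF f] contr_G[OF P_one]] .
  then have "pdiff (Suc i0) f * contr (\<lambda>h. Tr (1 * h)) G - pdiff (Suc i0) f \<in> Ia"
    by (simp only: right_diff_distrib mult_1_right)
  from IaD(7)[OF c this] show ?thesis by simp
qed

end

section \<open>The algebra S of the scheme and its filtration by degree\<close>

section \<open>The affine coordinate ring\<close>

context zdim
begin

definition Ia where "Ia = aff n I"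

lemma Ia_id: "pideal n Ia" and I_Ia: "I \<subseteq> Ia" and X0_Ia: "indet 0 - 1 \<in> Ia"
  unfolding Ia_def by (rule aff_pideal[OF I_id], rule aff_super, rule aff_X0[OF I_id])

lemma form_Ia: "f \<in> form n d \<Longrightarrow> f \<in> Ia \<longleftrightarrow> f \<in> I"
  using aff_homog[OF I_hom X0_nzd] I_Ia unfolding Ia_def form_def by blast

lemma pt_nzd: "q \<in> pts \<Longrightarrow> f \<in> P n \<Longrightarrow> indet 0 * f \<in> q \<Longrightarrow> f \<in> q"
  using ptsD(5,6) P_indet[OF le0] by blast

lemma form_aff_pt: "q \<in> pts \<Longrightarrow> f \<in> form n d \<Longrightarrow> f \<in> aff n q \<longleftrightarrow> f \<in> q"
  using aff_homog[OF ptsD(1) pt_nzd] aff_super unfolding form_def by blast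

lemma aff_pt_id: "q \<in> pts \<Longrightarrow> pideal n (aff n q)"
  using aff_pideal ptsD(2) by blast

lemma aff_pt_hgz: "q \<in> pts \<Longrightarrow> f \<in> P n \<Longrightarrow> degle N f \<Longrightarrow> f \<in> aff n q \<longleftrightarrow> hgz N f \<in> q"
  using aff_hgz[OF ptsD(1) pt_nzd] by blast

lemma aff_pt_super: "q \<in> pts \<Longrightarrow> Ia \<subseteq> aff n q"
  unfolding Ia_def by (rule aff_mono[OF ptsD(4)])

text \<open>Homogenization carries the description of I by its points over to the affine
  ideals.\<close>

lemma Ia_iff: "f \<in> P n \<Longrightarrow> f \<in> Ia \<longleftrightarrow> (\<forall>q\<in>pts. f \<in> aff n q)"
proof
  assume "f \<in> Ia" then show "\<forall>q\<in>pts. f \<in> aff n q" using aff_pt_super by blast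
next
  assume f: "f \<in> P n" "\<forall>q\<in>pts. f \<in> aff n q"
  obtain N where N: "degle N f" using degle_ex by blast
  have "hgz N f \<in> I"
    using f aff_pt_hgz[OF _ f(1) N] hgz_form[OF f(1), of N] unfolding I_eq form_def by auto
  then show "f \<in> Ia" unfolding Ia_def using aff_hgz[OF I_hom X0_nzd f(1) N] by blast
qed

text \<open>The product f g agrees modulo X_0 - 1 with the product of the homogenizations. That
  product is a form, so it lies in q itself, and primality of q applies.\<close>

lemma aff_pt_prime:
  assumes q: "q \<in> pts" and f: "f \<in> P n" "g \<in> P n" "f * g \<in> aff n q"
  shows "f \<in> aff n q \<or> g \<in> aff n q"
proof -
  note a = aff_pt_id[OF q] aff_X0[OF ptsD(2)[OF q]]
  obtain N where N: "degle N f" using degle_ex by blast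
  obtain M where M: "degle M g" using degle_ex by blast
  have "hgz N f * hgz M g - f * g = (hgz N f - f) * hgz M g + f * (hgz M g - g)"
    by (simp add: algebra_simps)
  moreover have "\<dots> \<in> aff n q"
    using pidealD(6)[OF a(1) hgz_cong[OF a f(1) N]] pidealD(6)[OF a(1) hgz_cong[OF a f(2) M]]
      f hgz_form[OF f(2), of M]
    by (intro pidealD(3)[OF a(1)] pidealD(4)[OF a(1)] pidealD(5)[OF a(1)]) (auto simp: form_def)
  ultimately have "hgz N f * hgz M g \<in> aff n q" using pidealD(3)[OF a(1) _ f(3)] by (metis diff_add_cancel)
  moreover have fm: "hgz N f * hgz M g \<in> form n (N + M)"
    using hgz_form[OF f(1), of N] hgz_form[OF f(2), of M] homog_mult unfolding form_def by fastforce
  ultimately have "hgz N f * hgz M g \<in> q" using form_aff_pt[OF q fm] by blast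
  then have "hgz N f \<in> q \<or> hgz M g \<in> q"
    using ptsD(5)[OF q] hgz_form[OF f(1), of N] hgz_form[OF f(2), of M] unfolding form_def by blast
  then show ?thesis using aff_pt_hgz[OF q f(1) N] aff_pt_hgz[OF q f(2) M] by blast
qed

lemma one_notin_aff: "q \<in> pts \<Longrightarrow> 1 \<notin> aff n q"
  using form_aff_pt[of q 1 0] ptsD(3) by (auto simp: form_def)

lemma one_notin_Ia: "1 \<notin> Ia"
  using form_Ia[of 1 0] one_notin by (auto simp: form_def)

lemma Ia_radical: "f \<in> P n \<Longrightarrow> f * f \<in> Ia \<Longrightarrow> f \<in> Ia"
  using aff_pt_prime[of _ f f] Ia_iff[of f] Ia_iff[of "f * f"] by auto

lemma X0_cg: "f \<in> P n \<Longrightarrow> indet 0 * f - f \<in> Ia"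
  using pidealD(5)[OF Ia_id _ X0_Ia, of f] by (simp add: left_diff_distrib)

lemma cg_trans: "x - y \<in> Ia \<Longrightarrow> y - z \<in> Ia \<Longrightarrow> x - z \<in> Ia"
  using pidealD(3)[OF Ia_id, of "x - y" "y - z"] by simp

text \<open>Any class in S is represented by a form of large degree; by \<open>stabilization\<close>
  factors X_0, which are 1 in S, can be split off until degree D is reached. Forms of a single
  degree therefore fill S, which makes it finite-dimensional.\<close>

lemma form_generates:
  obtains D where "\<And>f. f \<in> P n \<Longrightarrow> \<exists>g\<in>form n D. f - g \<in> Ia"
proof -
  obtain D where D: "\<And>f d. f \<in> P n \<Longrightarrow> homog (int d) f \<Longrightarrow> d > D \<Longrightarrow>
    \<exists>g\<in>P n. homog (int d - 1) g \<and> f - indet 0 * g \<in> I" using stabilization by blast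
  have red: "f \<in> form n (D + k) \<Longrightarrow> \<exists>g\<in>form n D. f - g \<in> Ia" for k f
  proof (induction k arbitrary: f)
    case 0
    then show ?case using pidealD(2)[OF Ia_id] by (auto intro!: bexI[of _ f])
  next
    case (Suc k)
    then obtain g where g: "g \<in> P n" "homog (int (D + Suc k) - 1) g" "f - indet 0 * g \<in> I"
      using D[of f "D + Suc k"] by (auto simp: form_def)
    have "g \<in> form n (D + k)" using g(1,2) by (simp add: form_def)
    then obtain g' where g': "g' \<in> form n D" "g - g' \<in> Ia" using Suc.IH by blast
    have "f - indet 0 * g \<in> Ia" using g(3) I_Ia by blast
    then have "f - g \<in> Ia" using cg_trans X0_cg[OF g(1)] by blast
    then show ?case using g' cg_trans by blast
  qed
  show thesis
  proof (rule that)
    fix f :: "'k mpoly" assume f: "f \<in> P n"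
    obtain N where N: "N \<ge> D" "degle N f" using degle_ex by blast
    have "hgz N f \<in> form n (D + (N - D))" using hgz_form[OF f, of N] N(1) by simp
    then obtain g where g: "g \<in> form n D" "hgz N f - g \<in> Ia" using red by blast
    have "f - hgz N f \<in> Ia" by (rule hgz_cong[OF Ia_id X0_Ia f N(2)])
    then show "\<exists>g\<in>form n D. f - g \<in> Ia" using g cg_trans by blast
  qed
qed

text \<open>A basis of \<open>Ia\<close> is extended to one of \<open>P n\<close>; the projection
  kills the former and fixes the added elements, which form \<open>B\<close>. The latter lie in the
  span of the images of the monomials of one fixed degree, hence are finitely many.\<close>

lemma artin_exists: "\<exists>nf B. artin n Ia nf B"
proof -
  obtain B0 where B0: "B0 \<subseteq> Ia" "pv.independent B0" "Ia \<subseteq> pv.span B0"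
    by (rule pv.maximal_independent_subset[of Ia])
  have "B0 \<subseteq> P n" using B0(1) pidealD(1)[OF Ia_id] by blast
  then obtain B1 where B1: "B0 \<subseteq> B1" "B1 \<subseteq> P n" "pv.independent B1" "P n \<subseteq> pv.span B1"
    by (rule pv.maximal_independent_subset_extend[OF _ B0(2)])
  define g where "g b = (if b \<in> B0 then 0 else b)" for b
  define nf where "nf = pvp.construct B1 g"
  define B where "B = B1 - B0"
  have lin: "plinear nf" unfolding nf_def by (rule pvp.linear_construct[OF B1(3)])
  have nfb: "nf b = g b" if "b \<in> B1" for b
    unfolding nf_def by (rule pvp.construct_basis[OF B1(3) that])
  have "g ` B1 \<subseteq> pv.span B"
    unfolding g_def B_def by (auto intro: pv.span_base pv.span_zero)
  then have "pv.span (g ` B1) \<subseteq> pv.span B" using pv.span_minimal pv.subspace_span by blast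
  then have nf_span: "nf f \<in> pv.span B" for f
    using pvp.range_construct_eq_span[OF B1(3), of g] unfolding nf_def by blast
  have BP: "B \<subseteq> P n" using B1(2) by (auto simp: B_def)
  have CP: "pv.span B \<subseteq> P n" by (rule pv.span_minimal[OF BP P_subspace])
  note l = plinearD[OF lin]
  note idl = pidealD[OF Ia_id]
  have zero: "nf f = 0" if "f \<in> Ia" for f
  proof -
    have "pv.span B0 \<subseteq> {x. nf x = 0}"
      by (rule pv.span_minimal) (use nfb B1(1) in \<open>auto simp: g_def l scl_def intro!: pv.subspaceI\<close>)
    then show ?thesis using that B0(3) by blast
  qed
  have cong: "f - nf f \<in> Ia" if "f \<in> P n" for f
  proof -
    have "pv.span B1 \<subseteq> {x. x - nf x \<in> Ia}"
    proof (rule pv.span_minimal)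
      show "B1 \<subseteq> {x. x - nf x \<in> Ia}" using nfb B0(1) idl(2) by (auto simp: g_def)
      show "pv.subspace {x. x - nf x \<in> Ia}"
      proof (rule pv.subspaceI; clarify)
        show "0 - nf 0 \<in> Ia" using idl(2) l by simp
        show "x + y - nf (x + y) \<in> Ia" if "x - nf x \<in> Ia" "y - nf y \<in> Ia" for x y
          using idl(3)[OF that] by (simp add: l algebra_simps)
        show "scl c x - nf (scl c x) \<in> Ia" if "x - nf x \<in> Ia" for c x
          using idl(9)[OF that, of c] by (simp add: l scl_def right_diff_distrib)
      qed
    qed
    then show ?thesis using that B1(4) by blast
  qed
  have idem: "nf c = c" if "c \<in> pv.span B" for c
  proof -
    have "pv.span B \<subseteq> {x. nf x = x}"
      by (rule pv.span_minimal) (use nfb in \<open>auto simp: B_def g_def l scl_def intro!: pv.subspaceI\<close>)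
    then show ?thesis using that by blast
  qed
  have img: "pv.span B = nf ` P n"
  proof
    show "nf ` P n \<subseteq> pv.span B" using nf_span by blast
    show "pv.span B \<subseteq> nf ` P n"
    proof
      fix c assume c: "c \<in> pv.span B"
      show "c \<in> nf ` P n" by (rule image_eqI[of c nf c]) (use idem[OF c] c CP in auto)
    qed
  qed
  have indB: "pv.independent B" using pv.independent_mono[OF B1(3)] by (auto simp: B_def)
  obtain D where D: "\<And>f. f \<in> P n \<Longrightarrow> \<exists>g\<in>form n D. f - g \<in> Ia" using form_generates by blast
  have BS: "B \<subseteq> pv.span (nf ` pp ` mons n D)"
  proof
    fix b assume b: "b \<in> B"
    then obtain g' where g': "g' \<in> form n D" "b - g' \<in> Ia" using D BP by blast
    have "nf b = nf g'" using zero[OF g'(2)] l(2)[of b g'] by simp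
    moreover have "nf b = b" using idem b pv.span_base by blast
    moreover have "nf g' \<in> nf ` pv.span (pp ` mons n D)" using g'(1) form_span by blast
    ultimately show "b \<in> pv.span (nf ` pp ` mons n D)" using pvp.linear_span_image[OF lin] by metis
  qed
  then have finB: "finite B"
    using pv.independent_span_bound[OF finite_imageI[OF finite_imageI[OF card_mons(1)]] indB BS] by simp
  have "artin n Ia nf B"
    by (rule artin.intro[OF Ia_id lin cong zero nf_span CP img finB indB Ia_radical])
  then show ?thesis by blast
qed

definition nf where "nf = fst (SOME p. artin n Ia (fst p) (snd p))"
definition B where "B = snd (SOME p. artin n Ia (fst p) (snd p))"

sublocale artin n Ia nf B
proof -
  have "\<exists>p. artin n Ia (fst p) (snd p)" using artin_exists by auto
  then show "artin n Ia nf B" unfolding nf_def B_def by (rule someI_ex)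
qed

section \<open>The degree filtration\<close>

definition V where "V i = nf ` form n i"

lemma V_subspace: "pv.subspace (V i)" unfolding V_def by (rule plinear_image_subspace[OF nf_lin form_subspace])
lemma V_C: "V i \<subseteq> C" unfolding V_def using nf_span by blast
lemma form_P: "f \<in> form n i \<Longrightarrow> f \<in> P n" by (simp add: form_def)

lemma V_iff: "f \<in> P n \<Longrightarrow> nf f \<in> V i \<longleftrightarrow> (\<exists>g\<in>form n i. f - g \<in> Ia)"
  unfolding V_def using nf_eq_iff[of f] form_P by blast

lemma V_Suc: "V i \<subseteq> V (Suc i)"
proof
  fix x assume "x \<in> V i"
  then obtain g where g: "g \<in> form n i" "x = nf g" by (auto simp: V_def)
  have "nf (indet 0 * g) = nf g" using nf_eq_iff[of "indet 0 * g" g] X0_cg[of g] form_P[OF g(1)] by simp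
  then show "x \<in> V (Suc i)" using form_X0[OF g(1)] g(2) unfolding V_def by (metis imageI)
qed

lemma V_mono: "i \<le> j \<Longrightarrow> V i \<subseteq> V j"
  by (rule lift_Suc_mono_le[of V]) (use V_Suc in auto)

text \<open>A form of degree i + 2 is a combination of the X_j with coefficients of degree i + 1,
  and these coefficients can be replaced by forms of degree i.\<close>

lemma V_stable: "V i = V (Suc i) \<Longrightarrow> V (Suc i) = V (Suc (Suc i))"
proof
  assume eq: "V i = V (Suc i)"
  show "V (Suc (Suc i)) \<subseteq> V (Suc i)"
  proof
    fix x assume "x \<in> V (Suc (Suc i))"
    then obtain f where f: "f \<in> form n (Suc (Suc i))" "x = nf f" by (auto simp: V_def)
    obtain g where g: "f = (\<Sum>j\<le>n. indet j * g j)" "\<And>j. g j \<in> form n (Suc i)" using form_Suc_span[OF f(1)] by blast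
    have "\<exists>h\<in>form n i. g j - h \<in> Ia" for j
      using V_iff[OF form_P[OF g(2)], of j i] eq g(2)[of j] unfolding V_def by blast
    then obtain h where h: "\<And>j. h j \<in> form n i" "\<And>j. g j - h j \<in> Ia" by metis
    let ?h = "\<Sum>j\<le>n. indet j * h j"
    have "?h \<in> form n (Suc i)" by (intro pv.subspace_sum[OF form_subspace] form_indet h(1)) auto
    moreover have "f - ?h = (\<Sum>j\<le>n. indet j * (g j - h j))" by (simp add: g(1) sum_subtractf right_diff_distrib)
    moreover have "\<dots> \<in> Ia" using h(2) by (intro IaD(8) IaD(4)) auto
    ultimately show "x \<in> V (Suc i)" using V_iff[OF form_P[OF f(1)], of "Suc i"] f(2) by metis
  qed
qed (rule V_Suc)

lemma V_full: "\<exists>i. V i = C"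
proof -
  obtain D where D: "\<And>f. f \<in> P n \<Longrightarrow> \<exists>g\<in>form n D. f - g \<in> Ia" using form_generates by blast
  have "nf f \<in> V D" if "f \<in> P n" for f using V_iff[OF that, of D] D[OF that] by blast
  then have "C \<subseteq> V D" unfolding C_img by blast
  then show ?thesis using V_C by blast
qed

definition r where "r = (LEAST i. V i = C)"

lemma V_r: "r \<le> i \<Longrightarrow> V i = C"
proof -
  assume "r \<le> i"
  moreover have "V r = C" unfolding r_def using V_full by (rule LeastI_ex)
  ultimately show ?thesis using V_mono V_C by blast
qed

lemma V_less_r: "i < r \<Longrightarrow> V i \<noteq> C"
  unfolding r_def by (rule not_less_Least)

lemma V_strict: "i < r \<Longrightarrow> V i \<noteq> V (Suc i)"
proof
  assume i: "i < r" "V i = V (Suc i)"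
  have "V (i + k) = V (i + Suc k)" for k
  proof (induction k)
    case (Suc k) then show ?case using V_stable[of "i + k"] by simp
  qed (use i(2) in simp)
  then have "V (i + k) = V i" for k by (induction k) auto
  then have "V r = V i" using i(1) by (metis le_add_diff_inverse less_imp_le)
  then show False using V_r[of r] V_less_r[OF i(1)] by simp
qed

abbreviation "d \<equiv> card B"

lemma dim_C: "pv.dim C = d" by (rule pv.dim_span_eq_card_independent[OF ind_B])
lemma dim_V_le: "pv.dim (V i) \<le> d" using pv.subspace_dim(2)[OF V_subspace V_C fin_B] .
lemma dim_V_eq: "pv.dim (V i) = d \<longleftrightarrow> r \<le> i"
  using pv.subspace_dim(3)[OF V_subspace V_C fin_B ind_B, of i] V_less_r[of i] V_r[of i] dim_C by (metis not_le)

text \<open>Dimensions start at 1 and grow strictly up to r. The resulting bound r < d keeps the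
  exponents in forms of degree at most r below a positive characteristic.\<close>

lemma dim_V_ge: "i \<le> r \<Longrightarrow> i + 1 \<le> pv.dim (V i)"
proof (induction i)
  case 0
  have "pv.dim (V 0) \<noteq> 0"
  proof
    assume 0: "pv.dim (V 0) = 0"
    obtain T where "finite T" "pv.independent T" "pv.span T = V 0" "card T = pv.dim (V 0)"
      using pv.subspace_dim(1)[OF V_subspace V_C fin_B] by blast
    then have "V 0 = {0}" using 0 by (simp add: pv.span_empty)
    moreover have "nf 1 \<in> V 0" unfolding V_def by (intro imageI) (simp add: form_def)
    ultimately show False using nf_zero_iff[of 1] one_notin_Ia by simp
  qed
  then show ?case by simp
next
  case (Suc i)
  have "pv.dim (V i) \<noteq> pv.dim (V (Suc i))"
    using pv.subspace_dim_mono(2)[OF V_subspace V_subspace V_Suc V_C fin_B, of i] V_strict[of i] Suc.prems by auto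
  then have "pv.dim (V i) < pv.dim (V (Suc i))"
    using pv.subspace_dim_mono(1)[OF V_subspace V_subspace V_Suc V_C fin_B, of i] by simp
  then show ?case using Suc by simp
qed

lemma r_less_d: "r < d" using dim_V_ge[of r] dim_V_le[of r] by simp

text \<open>A form that is 0 in S lies in I, so without such forms all monomials of degree i stay
  independent in S.\<close>

lemma dim_V_form: assumes "\<And>f. f \<in> I \<Longrightarrow> f \<in> form n i \<Longrightarrow> f = 0"
  shows "pv.dim (V i) = (n + i) choose n"
proof -
  have "pv.dim (nf ` form n i) = pv.dim (form n i :: 'k mpoly set)"
  proof (rule plinear_inj_dim[OF nf_lin form_subspace])
    show "form n i \<subseteq> (pv.span (pp ` mons n i) :: 'k mpoly set)" using form_span by blast
    show "finite (pp ` mons n i :: 'k mpoly set)" using card_mons(1) by blast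
    fix f assume f: "f \<in> form n i" "nf f = 0"
    then have "f \<in> Ia" using nf_zero_iff form_P by blast
    then show "f = 0" using assms form_Ia[OF f(1)] f(1) by blast
  qed
  then show ?thesis unfolding V_def by (simp add: dim_form)
qed

end

section \<open>Transfer of ring structure and dimension along surjections from the polynomial
  ring\<close>

section \<open>Quotients of the polynomial ring\<close>

text \<open>The coordinate ring, S, the local rings and the residue fields are all presented in this
  way, with a known kernel \<open>N\<close>. Computations in them then take place with
  polynomials.\<close>

locale poly_quot =
  fixes n :: nat and A (structure) and \<pi> :: "'k::field mpoly \<Rightarrow> 'a" and N :: "'k mpoly set"
  assumes surj: "carrier A = \<pi> ` P n"
    and hom_add: "f \<in> P n \<Longrightarrow> g \<in> P n \<Longrightarrow> \<pi> f \<oplus> \<pi> g = \<pi> (f + g)"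
    and hom_mult: "f \<in> P n \<Longrightarrow> g \<in> P n \<Longrightarrow> \<pi> f \<otimes> \<pi> g = \<pi> (f * g)"
    and hom_one: "\<one> = \<pi> 1" and hom_zero: "\<zero> = \<pi> 0"
    and ker: "f \<in> P n \<Longrightarrow> g \<in> P n \<Longrightarrow> \<pi> f = \<pi> g \<longleftrightarrow> f - g \<in> N"
begin

lemma cring_A: "cring A"
proof (rule cringI)
  show "abelian_group A"
  proof (rule abelian_groupI)
    fix x assume "x \<in> carrier A"
    then obtain f where f: "f \<in> P n" "x = \<pi> f" by (auto simp: surj)
    have "\<pi> (- f) \<oplus> x = \<zero>" using f hom_add[of "- f" f] by (simp add: hom_zero)
    then show "\<exists>y\<in>carrier A. y \<oplus> x = \<zero>" using f by (intro bexI[of _ "\<pi> (- f)"]) (simp_all add: surj)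
  next
    fix x y z assume "x \<in> carrier A" "y \<in> carrier A" "z \<in> carrier A"
    then show "x \<oplus> y \<oplus> z = x \<oplus> (y \<oplus> z)" by (auto simp: surj hom_add add.assoc)
  next
    fix x y assume "x \<in> carrier A" "y \<in> carrier A"
    then show "x \<oplus> y = y \<oplus> x" "x \<oplus> y \<in> carrier A" by (auto simp: surj hom_add add.commute)
  qed (auto simp: surj hom_zero hom_add)
  show "comm_monoid A"
  proof (rule comm_monoidI)
    fix x y z assume "x \<in> carrier A" "y \<in> carrier A" "z \<in> carrier A"
    then show "x \<otimes> y \<otimes> z = x \<otimes> (y \<otimes> z)" by (auto simp: surj hom_mult mult.assoc)
  next
    fix x y assume "x \<in> carrier A" "y \<in> carrier A"
    then show "x \<otimes> y = y \<otimes> x" "x \<otimes> y \<in> carrier A" by (auto simp: surj hom_mult mult.commute)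
  qed (auto simp: surj hom_one hom_mult)
  fix x y z assume "x \<in> carrier A" "y \<in> carrier A" "z \<in> carrier A"
  then show "(x \<oplus> y) \<otimes> z = x \<otimes> z \<oplus> y \<otimes> z" by (auto simp: surj hom_mult hom_add distrib_right)
qed

lemma ring_A: "ring A" using cring_A cring.axioms(1) by blast

lemma a_inv_A: "f \<in> P n \<Longrightarrow> \<ominus> \<pi> f = \<pi> (- f)"
  using abelian_group.minus_equality[OF ring.is_abelian_group[OF ring_A], of "\<pi> (- f)" "\<pi> f"]
    hom_add[of "- f" f] surj by (auto simp: hom_zero)

lemma a_minus_A: "f \<in> P n \<Longrightarrow> g \<in> P n \<Longrightarrow> \<pi> f \<ominus> \<pi> g = \<pi> (f - g)"
  using hom_add[of f "- g"] by (simp add: a_minus_def a_inv_A)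

lemma in_carrier: "f \<in> P n \<Longrightarrow> \<pi> f \<in> carrier A" by (simp add: surj)

lemma zero_iff: "f \<in> P n \<Longrightarrow> \<pi> f = \<zero> \<longleftrightarrow> f \<in> N"
  using ker[of f 0] by (simp add: hom_zero)

lemma hom_finsum: "finite S \<Longrightarrow> (\<And>i. i \<in> S \<Longrightarrow> F i \<in> P n) \<Longrightarrow> finsum A (\<lambda>i. \<pi> (F i)) S = \<pi> (sum F S)"
proof (induction S rule: finite_induct)
  case empty
  then show ?case using abelian_monoid.finsum_empty[of A] ring.is_abelian_group[OF ring_A]
    by (simp add: abelian_group_def hom_zero)
next
  case (insert x S)
  interpret ring A by (rule ring_A)
  have "finsum A (\<lambda>i. \<pi> (F i)) (insert x S) = \<pi> (F x) \<oplus> finsum A (\<lambda>i. \<pi> (F i)) S"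
    using insert by (intro finsum_insert) (auto simp: in_carrier)
  then show ?case using insert hom_add[of "F x" "sum F S"] P_sum[of S F n] by simp
qed

abbreviation "K \<equiv> range (\<lambda>c. \<pi> (Cst c))"

lemma subfield_K:
  assumes "1 \<notin> N" shows "subfield K A"
proof -
  interpret cring A by (rule cring_A)
  have Kc: "K \<subseteq> carrier A" by (auto simp: surj)
  have sub: "subring K A"
  proof (rule subringI[OF Kc])
    show "\<one> \<in> K" using hom_one Cst_simps(2) by (metis rangeI)
    fix x assume "x \<in> K"
    then obtain c where "x = \<pi> (Cst c)" by blast
    moreover have "- Cst c = (Cst (- c) :: 'k mpoly)" by (simp add: Cst_def single_uminus)
    ultimately show "\<ominus> x \<in> K" using a_inv_A[of "Cst c"] by auto
  next
    fix x y assume "x \<in> K" "y \<in> K"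
    then obtain c c' where *: "x = \<pi> (Cst c)" "y = \<pi> (Cst c')" by blast
    show "x \<otimes> y \<in> K" using * hom_mult[of "Cst c" "Cst c'"] Cst_simps(4)[of c c'] by (metis P_Cst rangeI)
    show "x \<oplus> y \<in> K" using * hom_add[of "Cst c" "Cst c'"] Cst_simps(3)[of c c'] by (metis P_Cst rangeI)
  qed
  have nz: "\<one> \<noteq> \<zero>" using zero_iff[of 1] assms hom_one by simp
  show ?thesis
  proof (rule subfieldI[OF subcringI'[OF sub]])
    show "Units (A\<lparr>carrier := K\<rparr>) = K - {\<zero>}"
    proof
      show "Units (A\<lparr>carrier := K\<rparr>) \<subseteq> K - {\<zero>}"
      proof
        fix x assume "x \<in> Units (A\<lparr>carrier := K\<rparr>)"
        then obtain y where x: "x \<in> K" "y \<in> K" "y \<otimes> x = \<one>" by (auto simp: Units_def)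
        then have "y \<in> carrier A" using Kc by blast
        then have "x \<noteq> \<zero>" using x(3) nz by auto
        then show "x \<in> K - {\<zero>}" using x by simp
      qed
      show "K - {\<zero>} \<subseteq> Units (A\<lparr>carrier := K\<rparr>)"
      proof
        fix x assume x: "x \<in> K - {\<zero>}"
        then obtain c where c: "x = \<pi> (Cst c)" by blast
        then have "c \<noteq> 0" using x hom_zero by (auto simp: Cst_simps)
        then have "x \<otimes> \<pi> (Cst (1 / c)) = \<one>" "\<pi> (Cst (1 / c)) \<otimes> x = \<one>"
          using c hom_mult[of "Cst c" "Cst (1 / c)"] hom_mult[of "Cst (1 / c)" "Cst c"]
          by (simp_all add: hom_one Cst_simps(4)[symmetric] Cst_simps(2))
        then show "x \<in> Units (A\<lparr>carrier := K\<rparr>)" using x unfolding Units_def by auto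
      qed
    qed
  qed
qed

text \<open>On \<open>U\<close> the map \<open>\<tau>\<close> has the same kernel as
  \<open>\<pi>\<close>, so a basis of its image carries over to A through preimages. The induction
  follows the recursion of \<open>Span\<close> along a list.\<close>

lemma Span_list:
  assumes U: "pv.subspace U" "U \<subseteq> P n" and \<tau>: "plinear \<tau>" "\<And>f. f \<in> U \<Longrightarrow> \<tau> f = 0 \<longleftrightarrow> f \<in> N"
    and w: "\<And>b. b \<in> set bs \<Longrightarrow> w b \<in> U \<and> \<tau> (w b) = b"
    and bs: "distinct bs" "pv.independent (set bs)"
  shows "ring.Span A K (map (\<lambda>b. \<pi> (w b)) bs) = \<pi> ` {f \<in> U. \<tau> f \<in> pv.span (set bs)}
    \<and> ring.independent A K (map (\<lambda>b. \<pi> (w b)) bs)"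
  using w bs
proof (induction bs)
  case Nil
  interpret ring A by (rule ring_A)
  have "\<pi> f = \<pi> 0" if "f \<in> U" "\<tau> f = 0" for f
    using that U(2) \<tau>(2)[OF that(1)] ker[of f 0] by auto
  moreover have "0 \<in> U" "\<tau> 0 = 0" using pv.subspace_0[OF U(1)] plinearD(3)[OF \<tau>(1)] by auto
  ultimately have "\<pi> ` {f \<in> U. \<tau> f = 0} = {\<pi> 0}" by blast
  then show ?case by (simp add: pv.span_empty hom_zero)
next
  case (Cons b bs)
  interpret ring A by (rule ring_A)
  let ?E = "Span K (map (\<lambda>b. \<pi> (w b)) bs)"
  have IH: "?E = \<pi> ` {f \<in> U. \<tau> f \<in> pv.span (set bs)}" "independent K (map (\<lambda>b. \<pi> (w b)) bs)"
    using Cons pv.independent_mono[of "set (b # bs)" "set bs"] by auto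
  have wb: "w b \<in> U" "\<tau> (w b) = b" "w b \<in> P n" using Cons.prems U(2) by auto
  have "Span K (map (\<lambda>b. \<pi> (w b)) (b # bs)) = line_extension K (\<pi> (w b)) ?E" by simp
  also have "\<dots> = \<pi> ` {f \<in> U. \<tau> f \<in> pv.span (set (b # bs))}"
  proof (intro Set.set_eqI iffI)
    fix x assume "x \<in> line_extension K (\<pi> (w b)) ?E"
    then obtain c g where x: "x = \<pi> (Cst c) \<otimes> \<pi> (w b) \<oplus> \<pi> g" "g \<in> U" "\<tau> g \<in> pv.span (set bs)"
      unfolding line_extension_mem_iff IH(1) by blast
    let ?f = "Cst c * w b + g"
    have "x = \<pi> ?f" using x U(2) wb by (simp add: hom_mult hom_add subset_iff)
    moreover have "?f \<in> U" using x(2) wb(1) pv.subspace_add[OF U(1)] pv.subspace_scale[OF U(1)] by (simp add: scl_def)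
    moreover have "\<tau> ?f = scl c b + \<tau> g" using plinearD[OF \<tau>(1)] wb(2) by (simp add: scl_def)
    moreover have "\<dots> \<in> pv.span (set (b # bs))"
    proof (rule pv.span_add[OF pv.span_scale[OF pv.span_base]])
      show "\<tau> g \<in> pv.span (set (b # bs))" using x(3) pv.span_mono[of "set bs" "set (b # bs)"] by auto
    qed simp
    ultimately show "x \<in> \<pi> ` {f \<in> U. \<tau> f \<in> pv.span (set (b # bs))}" by auto
  next
    fix x assume "x \<in> \<pi> ` {f \<in> U. \<tau> f \<in> pv.span (set (b # bs))}"
    then obtain f where f: "x = \<pi> f" "f \<in> U" "\<tau> f \<in> pv.span (insert b (set bs))" by auto
    then obtain c where c: "\<tau> f - scl c b \<in> pv.span (set bs)" unfolding pv.span_insert by blast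
    let ?g = "f - Cst c * w b"
    have g: "?g \<in> U" using f(2) wb(1) pv.subspace_diff[OF U(1)] pv.subspace_scale[OF U(1)] by (simp add: scl_def)
    have "\<tau> ?g \<in> pv.span (set bs)" using c wb(2) plinearD[OF \<tau>(1)] by (simp add: scl_def)
    then have "\<pi> ?g \<in> ?E" using g IH(1) by auto
    moreover have "x = \<pi> (Cst c) \<otimes> \<pi> (w b) \<oplus> \<pi> ?g"
      using f wb g U(2) by (simp add: hom_mult hom_add subset_iff)
    ultimately show "x \<in> line_extension K (\<pi> (w b)) ?E" unfolding line_extension_mem_iff by blast
  qed
  finally have sp: "Span K (map (\<lambda>b. \<pi> (w b)) (b # bs)) = \<pi> ` {f \<in> U. \<tau> f \<in> pv.span (set (b # bs))}" .
  have "\<pi> (w b) \<notin> ?E"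
  proof
    assume "\<pi> (w b) \<in> ?E"
    then obtain f where f: "\<pi> (w b) = \<pi> f" "f \<in> U" "\<tau> f \<in> pv.span (set bs)" unfolding IH(1) by blast
    then have "w b - f \<in> N" "w b - f \<in> U" using ker[of "w b" f] wb U(2) pv.subspace_diff[OF U(1)] by auto
    then have "\<tau> f = b" using \<tau>(2)[of "w b - f"] plinearD(2)[OF \<tau>(1)] wb(2) by simp
    then have "b \<in> pv.span (set bs)" using f(3) by simp
    then show False using Cons.prems(2,3) by (simp add: pv.independent_insert)
  qed
  then have "independent K (map (\<lambda>b. \<pi> (w b)) (b # bs))"
    using IH(2) wb(3) by (auto intro!: li_Cons simp: in_carrier)
  then show ?case using sp by blast
qed

text \<open>This turns the dimension over the image of K into a dimension of a space of polynomials.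
  The map \<open>\<tau>\<close> will be \<open>nf\<close>, or multiplication by an idempotent
  followed by \<open>nf\<close>.\<close>

theorem basis_and_kdim:
  assumes N: "1 \<notin> N" and U: "pv.subspace U" "U \<subseteq> P n"
    and \<tau>: "plinear \<tau>" "\<And>f. f \<in> U \<Longrightarrow> \<tau> f = 0 \<longleftrightarrow> f \<in> N" and T: "\<tau> ` U \<subseteq> pv.span T" "finite T"
  shows "\<exists>Us. set Us \<subseteq> \<pi> ` U \<and> ring.independent A K Us \<and> ring.Span A K Us = \<pi> ` U"
    and "kdim A (\<lambda>c. \<pi> (Cst c)) (\<pi> ` U) = pv.dim (\<tau> ` U)"
proof -
  interpret ring A by (rule ring_A)
  have S: "pv.subspace (\<tau> ` U)" by (rule plinear_image_subspace[OF \<tau>(1) U(1)])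
  obtain D where D: "finite D" "pv.independent D" "pv.span D = \<tau> ` U" "card D = pv.dim (\<tau> ` U)"
    using pv.subspace_dim(1)[OF S T] by blast
  obtain bs where bs: "set bs = D" "distinct bs" using finite_distinct_list[OF D(1)] by blast
  have "D \<subseteq> \<tau> ` U" using pv.span_superset[of D] D(3) by simp
  then have "\<forall>b\<in>D. \<exists>f. f \<in> U \<and> \<tau> f = b" by auto
  then obtain w where w: "\<And>b. b \<in> D \<Longrightarrow> w b \<in> U \<and> \<tau> (w b) = b" by metis
  let ?Us = "map (\<lambda>b. \<pi> (w b)) bs"
  have *: "Span K ?Us = \<pi> ` {f \<in> U. \<tau> f \<in> pv.span (set bs)} \<and> independent K ?Us"
    by (rule Span_list[OF U \<tau>]) (use w bs D(2) in auto)
  moreover have "{f \<in> U. \<tau> f \<in> pv.span (set bs)} = U" using D(3) bs(1) by auto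
  ultimately have **: "Span K ?Us = \<pi> ` U" "independent K ?Us" by auto
  moreover have "set ?Us \<subseteq> \<pi> ` U" using w bs(1) by auto
  ultimately show "\<exists>Us. set Us \<subseteq> \<pi> ` U \<and> independent K Us \<and> Span K Us = \<pi> ` U" by blast
  have "dimension (length ?Us) K (\<pi> ` U)" using dimension_independent[OF **(2)] **(1) by simp
  then have "dim K (\<pi> ` U) = length ?Us" using dimI[OF subfield_K[OF N]] by (simp add: over_def)
  then show "kdim A (\<lambda>c. \<pi> (Cst c)) (\<pi> ` U) = pv.dim (\<tau> ` U)"
    unfolding kdim_def using D(4) bs distinct_card[OF bs(2)] by simp
qed

end

lemma poly_quot_Quot:
  fixes \<pi> :: "'k::field mpoly \<Rightarrow> 'a"
  assumes "poly_quot n A \<pi> N" and J: "ideal J A"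
  shows "poly_quot n (A Quot J) (\<lambda>f. J +>\<^bsub>A\<^esub> \<pi> f) {f \<in> P n. \<pi> f \<in> J}"
proof -
  interpret poly_quot n A \<pi> N by fact
  interpret J: ideal J A by fact
  note h = J.rcos_ring_hom
  show ?thesis
  proof
    show "carrier (A Quot J) = (\<lambda>f. J +>\<^bsub>A\<^esub> \<pi> f) ` P n"
      by (auto simp: FactRing_def A_RCOSETS_def' surj)
    fix f g :: "'k mpoly" assume fg: "f \<in> P n" "g \<in> P n"
    show "(J +>\<^bsub>A\<^esub> \<pi> f) \<oplus>\<^bsub>A Quot J\<^esub> (J +>\<^bsub>A\<^esub> \<pi> g) = J +>\<^bsub>A\<^esub> \<pi> (f + g)"
      using ring_hom_add[OF h, of "\<pi> f" "\<pi> g"] fg by (simp add: in_carrier hom_add)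
    show "(J +>\<^bsub>A\<^esub> \<pi> f) \<otimes>\<^bsub>A Quot J\<^esub> (J +>\<^bsub>A\<^esub> \<pi> g) = J +>\<^bsub>A\<^esub> \<pi> (f * g)"
      using ring_hom_mult[OF h, of "\<pi> f" "\<pi> g"] fg by (simp add: in_carrier hom_mult)
    show "(J +>\<^bsub>A\<^esub> \<pi> f = J +>\<^bsub>A\<^esub> \<pi> g) \<longleftrightarrow> f - g \<in> {f \<in> P n. \<pi> f \<in> J}"
      using ring.quotient_eq_iff_same_a_r_cos[OF ring_A J, of "\<pi> f" "\<pi> g"] fg
      by (simp add: a_minus_A in_carrier)
  next
    show "\<one>\<^bsub>A Quot J\<^esub> = J +>\<^bsub>A\<^esub> \<pi> 1" by (simp add: FactRing_def hom_one)
    show "\<zero>\<^bsub>A Quot J\<^esub> = J +>\<^bsub>A\<^esub> \<pi> 0"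
      using ring.a_rcos_zero[OF ring_A J, of "\<pi> 0"] additive_subgroup.zero_closed[OF J.additive_subgroup_axioms]
      by (simp add: FactRing_def hom_zero)
  qed
qed

lemma poly_quot_mpoly_ring: "poly_quot n (mpoly_ring n) (\<lambda>f. f) {0}"
  by unfold_locales auto

lemma (in poly_quot) image_ideal:
  assumes "pideal n T" shows "ideal (\<pi> ` T) A"
proof -
  note d = pidealD[OF assms]
  interpret ring A by (rule ring_A)
  show ?thesis
  proof (rule idealI[OF ring_A])
    show "subgroup (\<pi> ` T) (add_monoid A)"
    proof (rule group.subgroupI)
      show "group (add_monoid A)" by (rule a_group)
      show "\<pi> ` T \<subseteq> carrier (add_monoid A)" using d(1) surj by auto
      show "\<pi> ` T \<noteq> {}" using d(2) by blast
      fix a b assume "a \<in> \<pi> ` T" "b \<in> \<pi> ` T"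
      then obtain f g where *: "f \<in> T" "g \<in> T" "a = \<pi> f" "b = \<pi> g" by blast
      have "\<ominus> a \<in> \<pi> ` T" using * a_inv_A[OF d(1)[OF *(1)]] d(6) by auto
      then show "inv\<^bsub>add_monoid A\<^esub> a \<in> \<pi> ` T" by (simp add: a_inv_def)
      show "a \<otimes>\<^bsub>add_monoid A\<^esub> b \<in> \<pi> ` T" using * hom_add[OF d(1)[OF *(1)] d(1)[OF *(2)]] d(3) by auto
    qed
    fix a x assume a: "a \<in> \<pi> ` T" and x: "x \<in> carrier A"
    then obtain f g where *: "f \<in> T" "g \<in> P n" "a = \<pi> f" "x = \<pi> g" using surj by blast
    show "x \<otimes> a \<in> \<pi> ` T" using * hom_mult[OF *(2) d(1)[OF *(1)]] d(4) by auto
    show "a \<otimes> x \<in> \<pi> ` T" using * hom_mult[OF d(1)[OF *(1)] *(2)] d(5) by auto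
  qed
qed

lemma (in poly_quot) Idl_image:
  assumes S: "S \<subseteq> P n" and N: "pideal n N"
  shows "Idl\<^bsub>A\<^esub> (\<pi> ` S) = \<pi> ` (Idl\<^bsub>mpoly_ring n\<^esub> (S \<union> N))"
proof -
  have SN: "S \<union> N \<subseteq> P n" using S pidealD(1)[OF N] by blast
  note i = Idl_eq(1,2)[OF SN]
  interpret ring A by (rule ring_A)
  have Sc: "\<pi> ` S \<subseteq> carrier A" using S surj by blast
  show ?thesis
  proof
    show "Idl\<^bsub>A\<^esub> (\<pi> ` S) \<subseteq> \<pi> ` (Idl\<^bsub>mpoly_ring n\<^esub> (S \<union> N))"
      by (rule genideal_minimal[OF image_ideal[OF i(1)]]) (use i(2) in auto)
    have id: "ideal (Idl\<^bsub>A\<^esub> (\<pi> ` S)) A" by (rule genideal_ideal[OF Sc])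
    interpret Q: ideal "Idl\<^bsub>A\<^esub> (\<pi> ` S)" A by (rule id)
    let ?T = "{f \<in> P n. \<pi> f \<in> Idl\<^bsub>A\<^esub> (\<pi> ` S)}"
    have "pideal n ?T"
      unfolding pideal_def
    proof (intro conjI ballI)
      show "0 \<in> ?T" using Q.zero_closed by (simp add: hom_zero)
      fix f assume f: "f \<in> ?T"
      show "f + g \<in> ?T" if g: "g \<in> ?T" for g
      proof -
        have fg: "f \<in> P n" "g \<in> P n" using f g by auto
        have "\<pi> f \<oplus> \<pi> g \<in> Idl\<^bsub>A\<^esub> (\<pi> ` S)"
          by (rule additive_subgroup.a_closed[OF Q.additive_subgroup_axioms]) (use f g in auto)
        then show ?thesis unfolding hom_add[OF fg] using fg by simp
      qed
      show "a * f \<in> ?T" if a: "a \<in> P n" for a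
      proof -
        have f': "f \<in> P n" using f by auto
        have "\<pi> a \<otimes> \<pi> f \<in> Idl\<^bsub>A\<^esub> (\<pi> ` S)"
          by (rule Q.I_l_closed) (use f in_carrier[OF a] in auto)
        then show ?thesis unfolding hom_mult[OF a f'] using a f' by simp
      qed
    qed blast
    moreover have "S \<union> N \<subseteq> ?T"
      using genideal_self[OF Sc] S pidealD(1)[OF N] zero_iff Q.zero_closed by fastforce
    ultimately have "Idl\<^bsub>mpoly_ring n\<^esub> (S \<union> N) \<subseteq> ?T" using Idl_eq(3)[OF SN] by blast
    then show "\<pi> ` (Idl\<^bsub>mpoly_ring n\<^esub> (S \<union> N)) \<subseteq> Idl\<^bsub>A\<^esub> (\<pi> ` S)" by blast
  qed
qed

context zdim
begin

lemma poly_quot_coord: "poly_quot n (coord_ring n I) (coord n I) I"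
proof -
  have "{f \<in> P n. f \<in> I} = I" using pidealD(1)[OF I_id] by blast
  then show ?thesis
    using poly_quot_Quot[OF poly_quot_mpoly_ring, of I n] I_id ideal_iff[of I n]
    unfolding coord_ring_def coord_def[abs_def] by simp
qed

sublocale R: poly_quot n "coord_ring n I" "coord n I" I by (rule poly_quot_coord)

lemma affine_ideal_eq: "affine_ideal n I = coord n I ` Ia"
proof -
  have S: "{indet 0 - 1} \<subseteq> (P n :: 'k mpoly set)" by simp
  have SI: "{indet 0 - 1} \<union> I \<subseteq> P n" using S pidealD(1)[OF I_id] by blast
  have "affine_ideal n I = Idl\<^bsub>coord_ring n I\<^esub> (coord n I ` {indet 0 - 1})"
    unfolding affine_ideal_def by (simp add: R.hom_one R.a_minus_A)
  also have "\<dots> = coord n I ` (Idl\<^bsub>mpoly_ring n\<^esub> ({indet 0 - 1} \<union> I))"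
    by (rule R.Idl_image[OF S I_id])
  also have "Idl\<^bsub>mpoly_ring n\<^esub> ({indet 0 - 1} \<union> I) = Ia"
  proof
    show "Idl\<^bsub>mpoly_ring n\<^esub> ({indet 0 - 1} \<union> I) \<subseteq> Ia"
      using Idl_eq(3)[OF SI Ia_id] X0_Ia I_Ia by blast
    note d = pidealD[OF Idl_eq(1)[OF SI]] and s = Idl_eq(2)[OF SI]
    show "Ia \<subseteq> Idl\<^bsub>mpoly_ring n\<^esub> ({indet 0 - 1} \<union> I)"
    proof
      fix f assume "f \<in> Ia"
      then obtain x c where *: "f = x + (indet 0 - 1) * c" "x \<in> I" "c \<in> P n" unfolding Ia_def using affE by blast
      have "x \<in> Idl\<^bsub>mpoly_ring n\<^esub> ({indet 0 - 1} \<union> I)" using *(2) s by blast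
      moreover have "indet 0 - 1 \<in> Idl\<^bsub>mpoly_ring n\<^esub> ({indet 0 - 1} \<union> I)" using s by blast
      ultimately show "f \<in> Idl\<^bsub>mpoly_ring n\<^esub> ({indet 0 - 1} \<union> I)" unfolding *(1) using *(3) d(3) d(5) by blast
    qed
  qed
  finally show ?thesis .
qed

definition \<delta> where "\<delta> f = deh n I (coord n I f)"

lemma poly_quot_affine: "poly_quot n (affine_ring n I) \<delta> Ia"
proof -
  have "{f \<in> P n. coord n I f \<in> affine_ideal n I} = Ia"
  proof (intro Set.set_eqI iffI)
    fix f assume f: "f \<in> {f \<in> P n. coord n I f \<in> affine_ideal n I}"
    then obtain g where g: "g \<in> Ia" "coord n I f = coord n I g" unfolding affine_ideal_eq by blast
    then have "f - g \<in> Ia" using R.ker[of f g] f pidealD(1)[OF Ia_id] I_Ia by auto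
    then show "f \<in> Ia" using pidealD(3)[OF Ia_id _ g(1)] by fastforce
  qed (auto simp: affine_ideal_eq dest: pidealD(1)[OF Ia_id])
  then show ?thesis
    using poly_quot_Quot[OF poly_quot_coord R.image_ideal[OF Ia_id]]
    unfolding affine_ring_def \<delta>_def[abs_def] deh_def affine_ideal_eq by simp
qed

sublocale S: poly_quot n "affine_ring n I" \<delta> Ia by (rule poly_quot_affine)

definition forms :: "int \<Rightarrow> 'k mpoly set" where "forms i = {f \<in> P n. homog i f}"

lemma forms_nat: "forms (int k) = form n k" by (simp add: forms_def form_def)
lemma forms_neg: "i < 0 \<Longrightarrow> forms i = {0}" using homog_neg by (auto simp: forms_def)
lemma forms_subspace: "pv.subspace (forms i)"
  by (rule pv.subspaceI) (auto simp: scl_def forms_def homog_add homog_Cst_mult)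
lemma forms_Ia: "f \<in> forms i \<Longrightarrow> f \<in> Ia \<longleftrightarrow> f \<in> I"
  using aff_homog[OF I_hom X0_nzd] I_Ia unfolding Ia_def forms_def by blast

text \<open>On forms of one degree, lying in \<open>I\<close> and lying in \<open>Ia\<close> mean
  the same, so graded parts can be measured inside S by \<open>nf\<close>.\<close>

lemma HF_eq:
  assumes T: "pideal n T" "I \<subseteq> T"
  shows "HF n I (coord n I ` T) i = pv.dim (nf ` (T \<inter> forms i))"
proof -
  have "coord n I ` T \<inter> graded_part n I i = coord n I ` (T \<inter> forms i)"
  proof
    show "coord n I ` T \<inter> graded_part n I i \<subseteq> coord n I ` (T \<inter> forms i)"
    proof
      fix x assume "x \<in> coord n I ` T \<inter> graded_part n I i"
      then obtain f g where fg: "f \<in> T" "x = coord n I f" "g \<in> forms i" "x = coord n I g"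
        by (auto simp: graded_part_def forms_def)
      then have "g - f \<in> T" using R.ker[of g f] pidealD(1)[OF T(1)] T(2) by (auto simp: forms_def)
      then have "g \<in> T" using pidealD(3)[OF T(1) _ fg(1)] by fastforce
      then show "x \<in> coord n I ` (T \<inter> forms i)" using fg by blast
    qed
  qed (auto simp: graded_part_def forms_def)
  moreover have "kdim (coord_ring n I) (\<lambda>c. coord n I (Cst c)) (coord n I ` (T \<inter> forms i)) =
      pv.dim (nf ` (T \<inter> forms i))"
  proof (rule R.basis_and_kdim(2)[OF one_notin _ _ nf_lin _ _ fin_B])
    show "pv.subspace (T \<inter> forms i)"
      by (rule pv.subspace_inter[OF pideal_subspace[OF T(1)] forms_subspace])
    show "T \<inter> forms i \<subseteq> P n" by (auto simp: forms_def)
    show "nf f = 0 \<longleftrightarrow> f \<in> I" if "f \<in> T \<inter> forms i" for f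
      using that nf_zero_iff[of f] forms_Ia[of f i] by (auto simp: forms_def)
    show "nf ` (T \<inter> forms i) \<subseteq> C" using nf_span by blast
  qed
  ultimately show ?thesis by (simp add: HF_def)
qed

lemma dim_zero: "pv.dim {0} = 0"
  using pv.dim_le_card[of "{0}" "{}"] by (simp add: pv.span_empty)

lemma HFX_eq: "HFX n I (int k) = pv.dim (V k)" "i < 0 \<Longrightarrow> HFX n I i = 0"
proof -
  have P: "pideal n (P n)" by (auto simp: pideal_def)
  have *: "HFX n I i = pv.dim (nf ` forms i)" for i
  proof -
    have 1: "P n \<inter> forms i = forms i" by (auto simp: forms_def)
    have 2: "I \<subseteq> P n" using pidealD(1)[OF I_id] by blast
    show ?thesis unfolding HFX_def R.surj HF_eq[OF P 2] 1 ..
  qed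
  show "HFX n I (int k) = pv.dim (V k)" by (simp add: * forms_nat V_def)
  show "i < 0 \<Longrightarrow> HFX n I i = 0" by (simp add: * forms_neg nfD dim_zero)
qed

end

section \<open>Decomposition of S into the local rings of the points\<close>

section \<open>Idempotents and local rings\<close>

context zdim
begin

text \<open>Points are incomparable, so each other point contains an element outside q, and some
  component of it is still outside q. The product of these finitely many forms stays outside the
  prime q.\<close>

lemma separating_form:
  assumes q: "q \<in> pts"
  obtains h where "h \<in> P n" "\<exists>d. homog d h" "h \<notin> q" "\<And>q'. q' \<in> pts \<Longrightarrow> q' \<noteq> q \<Longrightarrow> h \<in> q'"
proof -
  have single: "\<exists>h\<in>P n. (\<exists>d. homog d h) \<and> h \<notin> q \<and> h \<in> q'" if q': "q' \<in> pts" "q' \<noteq> q" for q'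
  proof -
    have "\<not> q' \<subseteq> q" using pts_max[OF q'(1) q] q'(2) by blast
    then obtain f where f: "f \<in> q'" "f \<notin> q" by blast
    have "\<exists>i. hcomp i f \<notin> q"
    proof (rule ccontr)
      assume "\<not> ?thesis"
      then have "(\<Sum>i\<in>hdegs f. hcomp i f) \<in> q" by (intro pidealD(8)[OF ptsD(2)[OF q]]) auto
      then show False using f(2) by (simp add: sum_hcomp')
    qed
    then obtain i where "hcomp i f \<notin> q" by blast
    moreover have "hcomp i f \<in> q'" by (rule homogeneous_idealD(2)[OF ptsD(1)[OF q'(1)] f(1)])
    moreover have "hcomp i f \<in> P n" using pidealD(1)[OF ptsD(2)[OF q'(1)] f(1)] by simp
    ultimately show ?thesis using homog_hcomp by blast
  qed
  have "\<exists>h\<in>P n. (\<exists>d. homog d h) \<and> h \<notin> q \<and> (\<forall>q'\<in>S. h \<in> q')" if "finite S" "S \<subseteq> pts - {q}" for S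
    using that
  proof (induction S rule: finite_induct)
    case empty
    then show ?case using ptsD(3)[OF q] homog_one P_one by blast
  next
    case (insert q' S)
    then obtain h d where h: "h \<in> P n" "homog d h" "h \<notin> q" "\<forall>q'\<in>S. h \<in> q'" by blast
    have q': "q' \<in> pts" "q' \<noteq> q" using insert.prems by auto
    obtain k e where k: "k \<in> P n" "homog e k" "k \<notin> q" "k \<in> q'" using single[OF q'] by blast
    have "h * k \<notin> q" using ptsD(5)[OF q h(1) k(1)] h(3) k(3) by blast
    moreover have "h * k \<in> q'" using pidealD(4)[OF ptsD(2)[OF q'(1)] h(1) k(4)] .
    moreover have "h * k \<in> p" if "p \<in> S" for p
      using pidealD(5)[OF ptsD(2) k(1)] h(4) that insert.prems by blast
    ultimately show ?case using h(1) k(1) homog_mult[OF h(2) k(2)] by (intro bexI[of _ "h * k"]) auto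
  qed
  from this[of "pts - {q}"] show thesis using that fin by auto
qed

text \<open>By regularity f (1 - f y) is 0 in S; modulo the prime \<open>aff n q\<close> the factor
  f is not 0, so 1 - f y is.\<close>

lemma aff_inverse:
  assumes q: "q \<in> pts" and f: "f \<in> P n" "f \<notin> aff n q"
  obtains y where "y \<in> P n" "f * y - 1 \<in> aff n q"
proof -
  obtain y where y: "y \<in> P n" "f - f * f * y \<in> Ia" using regular[OF f(1)] by blast
  have "f * (1 - f * y) = f - f * f * y" by (simp add: algebra_simps)
  then have "f * (1 - f * y) \<in> aff n q" using y(2) aff_pt_super[OF q] by auto
  then have "1 - f * y \<in> aff n q" using aff_pt_prime[OF q f(1), of "1 - f * y"] f y(1) by auto
  then have "f * y - 1 \<in> aff n q" using pidealD(6)[OF aff_pt_id[OF q]] by (metis minus_diff_eq)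
  then show thesis using that y(1) by blast
qed

text \<open>A separating form, multiplied by its inverse at q, is 1 at q and 0 at all other
  points.\<close>

lemma idempotent_exists:
  assumes q: "q \<in> pts"
  shows "\<exists>e. e \<in> P n \<and> (\<forall>q'\<in>pts. q' \<noteq> q \<longrightarrow> e \<in> aff n q') \<and> 1 - e \<in> aff n q"
proof -
  obtain h where h: "h \<in> P n" "\<exists>d. homog d h" "h \<notin> q" "\<And>q'. q' \<in> pts \<Longrightarrow> q' \<noteq> q \<Longrightarrow> h \<in> q'"
    using separating_form[OF q] by blast
  obtain d where d: "homog d h" using h(2) by blast
  have nq: "h \<notin> aff n q" using aff_homog[OF ptsD(1)[OF q] pt_nzd[OF q] h(1) d] h(3) by blast
  obtain y where y: "y \<in> P n" "h * y - 1 \<in> aff n q" using aff_inverse[OF q h(1) nq] by blast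
  have "1 - h * y \<in> aff n q" using pidealD(6)[OF aff_pt_id[OF q] y(2)] by simp
  moreover have "h * y \<in> aff n q'" if "q' \<in> pts" "q' \<noteq> q" for q'
    using pidealD(5)[OF aff_pt_id[OF that(1)] y(1)] h(4)[OF that] aff_super by blast
  ultimately show ?thesis using h(1) y(1) by (intro exI[of _ "h * y"]) auto
qed

definition e where "e q = (SOME e. e \<in> P n \<and> (\<forall>q'\<in>pts. q' \<noteq> q \<longrightarrow> e \<in> aff n q') \<and> 1 - e \<in> aff n q)"

lemma e: assumes "q \<in> pts"
  shows "e q \<in> P n" "q' \<in> pts \<Longrightarrow> q' \<noteq> q \<Longrightarrow> e q \<in> aff n q'" "1 - e q \<in> aff n q"
  using someI_ex[OF idempotent_exists[OF assms]] unfolding e_def[symmetric] by auto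

lemma e_mult_Ia: assumes q: "q \<in> pts" and f: "f \<in> P n" shows "e q * f \<in> Ia \<longleftrightarrow> f \<in> aff n q"
proof
  assume "e q * f \<in> Ia"
  then have "e q * f \<in> aff n q" using aff_pt_super[OF q] by blast
  moreover have "(1 - e q) * f \<in> aff n q" by (rule pidealD(5)[OF aff_pt_id[OF q] f e(3)[OF q]])
  ultimately have "e q * f + (1 - e q) * f \<in> aff n q" by (rule pidealD(3)[OF aff_pt_id[OF q]])
  then show "f \<in> aff n q" by (simp add: algebra_simps)
next
  assume fq: "f \<in> aff n q"
  have "e q * f \<in> aff n q'" if q': "q' \<in> pts" for q'
  proof (cases "q' = q")
    case True then show ?thesis using pidealD(4)[OF aff_pt_id[OF q] e(1)[OF q] fq] by simp
  next
    case False then show ?thesis using pidealD(5)[OF aff_pt_id[OF q'] f e(2)[OF q q']] by blast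
  qed
  then show "e q * f \<in> Ia" using Ia_iff[of "e q * f"] f e(1)[OF q] by simp
qed

lemma e_mult_other: assumes "q \<in> pts" "q' \<in> pts" "q' \<noteq> q" shows "e q * e q' \<in> Ia"
  using e_mult_Ia[OF assms(1) e(1)[OF assms(2)]] e(2)[OF assms(2,1)] assms(3) by blast

lemma e_idem: assumes "q \<in> pts" shows "e q * e q - e q \<in> Ia"
proof -
  have "e q - 1 \<in> aff n q" using pidealD(6)[OF aff_pt_id[OF assms] e(3)[OF assms]] by simp
  then have "e q * (e q - 1) \<in> Ia" using e_mult_Ia[OF assms, of "e q - 1"] e(1)[OF assms] by simp
  then show ?thesis by (simp add: algebra_simps)
qed

lemma e_sum: "1 - (\<Sum>q\<in>pts. e q) \<in> Ia"
proof -
  have eP: "(\<Sum>q\<in>pts. e q) \<in> P n" using e(1) by (intro P_sum) auto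
  have "1 - (\<Sum>q\<in>pts. e q) \<in> aff n p" if p: "p \<in> pts" for p
  proof -
    have "(\<Sum>q\<in>pts. e q) = e p + (\<Sum>q\<in>pts - {p}. e q)" using fin p by (simp add: sum.remove)
    moreover have "(\<Sum>q\<in>pts - {p}. e q) \<in> aff n p"
      using e(2) p by (intro pidealD(8)[OF aff_pt_id[OF p]]) auto
    ultimately show ?thesis using pidealD(7)[OF aff_pt_id[OF p] e(3)[OF p]] by (simp add: diff_diff_eq)
  qed
  then show ?thesis using Ia_iff[of "1 - (\<Sum>q\<in>pts. e q)"] eP by simp
qed

text \<open>The component of S at q, realized among the normal forms; its dimension will be that of
  the local ring at q.\<close>

definition Uq where "Uq q = (\<lambda>f. nf (e q * f)) ` P n"

lemma Uq_subspace: "pv.subspace (Uq q)" and Uq_C: "Uq q \<subseteq> C"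
  unfolding Uq_def using plinear_image_subspace[OF mult_lin P_subspace] nf_span by auto

lemma Uq_proj:
  assumes q: "q \<in> pts" "q' \<in> pts" and u: "u \<in> Uq q'"
  shows "nf (e q * u) = (if q = q' then u else 0)"
proof -
  obtain f where f: "f \<in> P n" "u = nf (e q' * f)" using u by (auto simp: Uq_def)
  have nfu: "nf (e q * u) = nf (e q * (e q' * f))" using nf_mult[of "e q" "e q' * f"] f e(1)[OF q(1)] e(1)[OF q(2)] by simp
  show ?thesis
  proof (cases "q = q'")
    case True
    have "(e q * e q - e q) * f \<in> Ia" by (rule IaD(5)[OF f(1) e_idem[OF q(1)]])
    then have "e q * (e q * f) - e q * f \<in> Ia" by (simp add: algebra_simps)
    then have "nf (e q * (e q * f)) = nf (e q * f)" using nf_eq_iff f e(1)[OF q(1)] by simp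
    then show ?thesis using True nfu f by simp
  next
    case False
    have "e q * e q' * f \<in> Ia" using IaD(5)[OF f(1) e_mult_other[OF q]] False by simp
    then show ?thesis using False nfu nf_zero by (simp add: mult.assoc)
  qed
qed

text \<open>Multiplication by \<open>e q\<close> isolates one component, so bases of the components
  are disjoint and jointly independent. They span because the idempotents sum to 1.\<close>

lemma sum_dim_Uq: "(\<Sum>q\<in>pts. pv.dim (Uq q)) = d"
proof -
  have "\<exists>D. finite D \<and> pv.independent D \<and> pv.span D = Uq q \<and> card D = pv.dim (Uq q)" for q
    by (rule pv.subspace_dim(1)[OF Uq_subspace Uq_C fin_B])
  then obtain D where D: "\<And>q. finite (D q)" "\<And>q. pv.independent (D q)" "\<And>q. pv.span (D q) = Uq q"
    "\<And>q. card (D q) = pv.dim (Uq q)" by metis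
  have DU: "b \<in> D q \<Longrightarrow> b \<in> Uq q" for b q using D(3)[of q] pv.span_base by blast
  have D0: "0 \<notin> D q" for q using D(2)[of q] pv.dependent_zero by blast
  have disj: "D q \<inter> D q' = {}" if "q \<in> pts" "q' \<in> pts" "q \<noteq> q'" for q q'
  proof (rule ccontr)
    assume "D q \<inter> D q' \<noteq> {}"
    then obtain b where b: "b \<in> D q" "b \<in> D q'" by blast
    have "b = 0" using Uq_proj[OF that(1,1) DU[OF b(1)]] Uq_proj[OF that(1,2) DU[OF b(2)]] that(3) by simp
    then show False using D0 b by blast
  qed
  let ?D = "\<Union>q\<in>pts. D q"
  have finD: "finite ?D" using fin D(1) by blast
  have card: "card ?D = (\<Sum>q\<in>pts. card (D q))"
    using fin D(1) disj by (intro card_UN_disjoint) auto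
  have ind: "pv.independent ?D"
  proof (rule pv.independent_if_scalars_zero[OF finD])
    fix f x assume s: "(\<Sum>x\<in>?D. scl (f x) x) = 0" and x: "x \<in> ?D"
    then obtain q where q: "q \<in> pts" "x \<in> D q" by blast
    have "0 = nf (e q * (\<Sum>x\<in>?D. Cst (f x) * x))" using s by (simp add: scl_def nfD)
    also have "\<dots> = (\<Sum>x\<in>?D. Cst (f x) * nf (e q * x))"
      by (simp only: plinearD(4,5)[OF mult_lin[of "e q"]])
    also have "\<dots> = (\<Sum>x\<in>?D. if x \<in> D q then scl (f x) x else 0)"
    proof (rule sum.cong[OF refl])
      fix y assume "y \<in> ?D"
      then obtain q' where q': "q' \<in> pts" "y \<in> D q'" by blast
      have "y \<in> D q \<longleftrightarrow> q = q'" using disj[OF q(1) q'(1)] q'(2) by blast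
      then show "Cst (f y) * nf (e q * y) = (if y \<in> D q then scl (f y) y else 0)"
        using Uq_proj[OF q(1) q'(1) DU[OF q'(2)]] by (simp add: scl_def)
    qed
    also have "\<dots> = (\<Sum>x\<in>D q. scl (f x) x)"
      using finD q(1) by (subst sum.inter_restrict[symmetric]) (auto intro!: sum.cong)
    finally have "(\<Sum>x\<in>D q. scl (f x) x) = 0" by simp
    then show "f x = 0" using D(2)[of q, unfolded pv.dependent_finite[OF D(1)]] q(2) by blast
  qed
  have "C \<subseteq> pv.span ?D"
  proof
    fix c assume c: "c \<in> C"
    then have cP: "c \<in> P n" using C_P by blast
    have "(1 - (\<Sum>q\<in>pts. e q)) * c \<in> Ia" by (rule IaD(5)[OF cP e_sum])
    then have "c - (\<Sum>q\<in>pts. e q * c) \<in> Ia" by (simp add: left_diff_distrib sum_distrib_right)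
    then have "nf (c - (\<Sum>q\<in>pts. e q * c)) = 0" by (rule nf_zero)
    then have "c = (\<Sum>q\<in>pts. nf (e q * c))" using nf_id[OF c] by (simp add: nfD)
    moreover have "nf (e q * c) \<in> pv.span ?D" if "q \<in> pts" for q
    proof -
      have "nf (e q * c) \<in> pv.span (D q)" using D(3) cP by (auto simp: Uq_def)
      then show ?thesis using pv.span_mono[of "D q" ?D] that by blast
    qed
    ultimately show "c \<in> pv.span ?D" using pv.span_sum[of pts "\<lambda>q. nf (e q * c)" ?D] by simp
  qed
  moreover have "pv.span ?D \<subseteq> C"
    by (rule pv.span_minimal[OF _ pv.subspace_span]) (use DU Uq_C in blast)
  ultimately have "pv.span ?D = C" by blast
  then have "card ?D = pv.dim C" using pv.dim_span_eq_card_independent[OF ind] by metis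
  then show ?thesis using card D(4) dim_C by simp
qed

end

text \<open>\<open>J\<close> is either \<open>I\<close> or the ideal of a subscheme. Since the scheme is reduced, its local ring at \<open>q\<close>
  does not depend on \<open>J\<close>: it is the field \<open>P/aff n q\<close>.\<close>

locale zdim_point = zdim n I for n :: nat and I :: "'k::field mpoly set" +
  fixes J q :: "'k mpoly set"
  assumes q: "q \<in> pts" and J: "pideal n J" "I \<subseteq> J" "J \<subseteq> q"
begin

sublocale hp: hprime n J q
  by (rule hprime.intro[OF J(1) ptsD(7)[OF q]])

sublocale Q: ideal_in_subring "P n" "aff n q"
proof -
  note d = pidealD[OF aff_pt_id[OF q]]
  show "ideal_in_subring (P n) (aff n q)" by unfold_locales (use d in auto)
qed

text \<open>A separating form at q multiplies an element of q into all points, hence into I. So the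
  numerators vanishing in the local ring are exactly those in q, whichever \<open>J\<close> between
  I and q is taken.\<close>

lemma fraction_zero_iff:
  assumes x: "x \<in> P n" shows "(\<exists>h\<in>hp.dens. h * x \<in> J) \<longleftrightarrow> x \<in> q"
proof
  assume "\<exists>h\<in>hp.dens. h * x \<in> J"
  then obtain h where h: "h \<in> P n" "h \<notin> q" "h * x \<in> q" using J(3) by (auto simp: hp.dens_def)
  then show "x \<in> q" using ptsD(5)[OF q h(1) x] by blast
next
  assume xq: "x \<in> q"
  obtain h where h: "h \<in> P n" "\<exists>d. homog d h" "h \<notin> q" "\<And>q'. q' \<in> pts \<Longrightarrow> q' \<noteq> q \<Longrightarrow> h \<in> q'"
    using separating_form[OF q] by blast
  have "h * x \<in> q'" if "q' \<in> pts" for q'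
    using pidealD(4)[OF ptsD(2)[OF q] h(1) xq] pidealD(5)[OF ptsD(2)[OF that] x h(4)[OF that]] by blast
  then have "h * x \<in> J" using I_eq[of "h * x"] h(1) x J(2) by auto
  then show "\<exists>h\<in>hp.dens. h * x \<in> J" using h by (auto simp: hp.dens_def)
qed

lemma homog_aff: "f \<in> P n \<Longrightarrow> homog i f \<Longrightarrow> f \<in> aff n q \<longleftrightarrow> f \<in> q"
  using aff_homog[OF ptsD(1)[OF q] pt_nzd[OF q]] aff_super by blast

lemma hfrac_eq_iff:
  assumes "(f, g) \<in> hfracs n q" "(f', g') \<in> hfracs n q"
  shows "hfrac n J q f g = hfrac n J q f' g' \<longleftrightarrow> f * g' - f' * g \<in> aff n q"
proof -
  obtain a b where *: "homog a f" "homog a g" "homog b f'" "homog b g'" "f \<in> P n" "g \<in> P n" "f' \<in> P n" "g' \<in> P n"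
    using assms by (auto simp: hp.hfracs_iff)
  have "homog (a + b) (f * g' - f' * g)"
    using homog_diff[OF homog_mult[OF *(1,4)] homog_mult[OF *(2,3), unfolded mult.commute[of g]]] .
  then show ?thesis
    unfolding hp.hfrac_eq_iff[OF assms] hp.eqv_def
    using fraction_zero_iff[of "f * g' - f' * g"] homog_aff[of "f * g' - f' * g" "a + b"] * by simp
qed

text \<open>The fraction f/1 for a polynomial that need not be homogeneous: its homogenization over
  the matching power of X_0. The least degree is only a choice; \<open>loc_eqI\<close> admits any
  fraction congruent to f modulo \<open>aff n q\<close>.\<close>

definition loc where "loc f = (let N = (LEAST N. degle N f) in hfrac n J q (hgz N f) (indet 0 ^ N))"

lemma X0_power_cg: "Q.cg (indet 0 ^ k) 1"
  using pidealD(6)[OF aff_pt_id[OF q] X0_power_minus_one[OF aff_pt_id[OF q] aff_X0[OF ptsD(2)[OF q]], of k]]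
  by (simp add: Q.cg_def)

lemma hgz_cg:
  assumes "f \<in> P n" "degle N f" shows "Q.cg (hgz N f) f"
proof (rule Q.cg_sym)
  show "Q.cg f (hgz N f)"
    using hgz_cong[OF aff_pt_id[OF q] aff_X0[OF ptsD(2)[OF q]] assms] hgz_form[OF assms(1), of N] assms(1)
    by (simp add: Q.cg_def form_def)
qed

lemma hgz_hfracs: "f \<in> P n \<Longrightarrow> (hgz N f, indet 0 ^ N) \<in> hfracs n q"
  unfolding hp.hfracs_iff using hgz_form[of f n N] X0_power_notin[OF q, of N] homog_indet_power
  by (auto simp: form_def)

lemma loc_least: "f \<in> P n \<Longrightarrow> \<exists>N. degle N f \<and> loc f = hfrac n J q (hgz N f) (indet 0 ^ N)"
proof -
  obtain M where "degle M f" using degle_ex by blast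
  then have "degle (LEAST N. degle N f) f" by (rule LeastI)
  then show ?thesis unfolding loc_def Let_def by blast
qed

lemma loc_eqI:
  assumes f: "f \<in> P n" and FG: "(F, G) \<in> hfracs n q" and cg: "Q.cg F (f * G)"
  shows "loc f = hfrac n J q F G"
proof -
  obtain N where N: "degle N f" "loc f = hfrac n J q (hgz N f) (indet 0 ^ N)" using loc_least[OF f] by blast
  have G: "G \<in> P n" "F \<in> P n" using FG by (auto simp: hp.hfracs_iff)
  have "Q.cg (hgz N f * G) (f * G)" by (intro Q.cg_mult hgz_cg f N(1) Q.cg_refl G)
  also have "Q.cg (f * G) F" by (rule Q.cg_sym[OF cg])
  also have "Q.cg F (F * indet 0 ^ N)"
    using Q.cg_mult[OF Q.cg_refl[OF G(2)] Q.cg_sym[OF X0_power_cg[of N]]] by simp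
  finally show ?thesis unfolding N(2) hfrac_eq_iff[OF hgz_hfracs[OF f] FG] by (simp add: Q.cg_def)
qed

lemma loc_eq_iff:
  assumes f: "f \<in> P n" "g \<in> P n" shows "loc f = loc g \<longleftrightarrow> f - g \<in> aff n q"
proof -
  obtain N where N: "degle N f" "loc f = hfrac n J q (hgz N f) (indet 0 ^ N)" using loc_least[OF f(1)] by blast
  obtain M where M: "degle M g" "loc g = hfrac n J q (hgz M g) (indet 0 ^ M)" using loc_least[OF f(2)] by blast
  have "Q.cg (hgz N f * indet 0 ^ M - hgz M g * indet 0 ^ N) (f * 1 - g * 1)"
    by (intro Q.cg_diff Q.cg_mult hgz_cg X0_power_cg f N M)
  then have "hgz N f * indet 0 ^ M - hgz M g * indet 0 ^ N - (f - g) \<in> aff n q" by (simp add: Q.cg_def)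
  then have "hgz N f * indet 0 ^ M - hgz M g * indet 0 ^ N \<in> aff n q \<longleftrightarrow> f - g \<in> aff n q"
    using Q.J_diff[of "hgz N f * indet 0 ^ M - hgz M g * indet 0 ^ N" "hgz N f * indet 0 ^ M - hgz M g * indet 0 ^ N - (f - g)"]
      Q.J_add[of "hgz N f * indet 0 ^ M - hgz M g * indet 0 ^ N - (f - g)" "f - g"] by auto
  then show ?thesis unfolding N(2) M(2) hfrac_eq_iff[OF hgz_hfracs[OF f(1)] hgz_hfracs[OF f(2)]] .
qed

text \<open>Denominators are invertible modulo \<open>aff n q\<close>, so every fraction already
  comes from a polynomial.\<close>

lemma loc_frac:
  assumes FG: "(F, G) \<in> hfracs n q" obtains f where "f \<in> P n" "loc f = hfrac n J q F G" "Q.cg F (f * G)"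
proof -
  have G: "F \<in> P n" "G \<in> P n" "G \<notin> q" using FG by (auto simp: hp.hfracs_iff)
  obtain i where i: "homog i G" using FG by (auto simp: hp.hfracs_iff)
  have "G \<notin> aff n q" using homog_aff[OF G(2) i] G(3) by blast
  then obtain y where y: "y \<in> P n" "G * y - 1 \<in> aff n q" using aff_inverse[OF q G(2)] by blast
  then have "Q.cg (G * y) 1" using G by (simp add: Q.cg_def)
  then have "Q.cg (F * (G * y)) (F * 1)" by (intro Q.cg_mult Q.cg_refl G)
  then have *: "Q.cg F (F * y * G)" using Q.cg_sym by (simp add: ac_simps)
  show thesis by (rule that[OF _ loc_eqI[OF _ FG *] *]) (use G y in auto)
qed

lemma loc_rep:
  assumes "f \<in> P n" obtains F G where "(F, G) \<in> hfracs n q" "loc f = hfrac n J q F G" "Q.cg F (f * G)"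
proof -
  obtain N where N: "degle N f" "loc f = hfrac n J q (hgz N f) (indet 0 ^ N)" using loc_least[OF assms] by blast
  have "Q.cg (f * indet 0 ^ N) (f * 1)" by (intro Q.cg_mult Q.cg_refl assms X0_power_cg)
  then have "Q.cg (hgz N f) (f * indet 0 ^ N)"
    using Q.cg_trans[OF hgz_cg[OF assms N(1)]] Q.cg_sym by simp
  then show thesis using that[OF hgz_hfracs[OF assms] N(2)] by blast
qed

lemma poly_quot_local: "poly_quot n (local_ring n J q) loc (aff n q)"
proof
  show "carrier (local_ring n J q) = loc ` P n"
  proof
    show "carrier (local_ring n J q) \<subseteq> loc ` P n"
    proof
      fix x assume "x \<in> carrier (local_ring n J q)"
      then obtain F G where FG: "(F, G) \<in> hfracs n q" "x = hfrac n J q F G" by (auto simp: local_ring_def)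
      obtain f where "f \<in> P n" "loc f = hfrac n J q F G" using loc_frac[OF FG(1)] by blast
      then show "x \<in> loc ` P n" using FG(2) by (intro image_eqI[of _ _ f]) auto
    qed
    show "loc ` P n \<subseteq> carrier (local_ring n J q)"
    proof
      fix x assume "x \<in> loc ` P n"
      then obtain f where f: "f \<in> P n" "x = loc f" by blast
      obtain F G where "(F, G) \<in> hfracs n q" "loc f = hfrac n J q F G" using loc_rep[OF f(1)] by blast
      then show "x \<in> carrier (local_ring n J q)" using f(2) by (auto simp: local_ring_def)
    qed
  qed
  fix f g :: "'k mpoly" assume f: "f \<in> P n" and g: "g \<in> P n"
  show "loc f = loc g \<longleftrightarrow> f - g \<in> aff n q" by (rule loc_eq_iff[OF f g])
  obtain F G where FG: "(F, G) \<in> hfracs n q" "loc f = hfrac n J q F G" "Q.cg F (f * G)" using loc_rep[OF f] by blast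
  obtain F' G' where FG': "(F', G') \<in> hfracs n q" "loc g = hfrac n J q F' G'" "Q.cg F' (g * G')" using loc_rep[OF g] by blast
  have P: "F \<in> P n" "G \<in> P n" "F' \<in> P n" "G' \<in> P n" using FG(1) FG'(1) by (auto simp: hp.hfracs_iff)
  have "Q.cg (F * F') ((f * G) * (g * G'))" by (rule Q.cg_mult[OF FG(3) FG'(3)])
  then have "Q.cg (F * F') (f * g * (G * G'))" by (simp add: ac_simps)
  then have "loc (f * g) = hfrac n J q (F * F') (G * G')"
    using loc_eqI[OF _ hp.hfracs_mult[OF FG(1) FG'(1)]] f g by simp
  then show "loc f \<otimes>\<^bsub>local_ring n J q\<^esub> loc g = loc (f * g)" using hp.local_mult[OF FG(1) FG'(1)] FG(2) FG'(2) by simp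
  have "Q.cg (F * G' + F' * G) ((f * G) * G' + (g * G') * G)"
    by (intro Q.cg_add Q.cg_mult FG(3) FG'(3) Q.cg_refl P)
  then have "Q.cg (F * G' + F' * G) ((f + g) * (G * G'))" by (simp add: algebra_simps)
  then have "loc (f + g) = hfrac n J q (F * G' + F' * G) (G * G')"
    using loc_eqI[OF _ hp.hfracs_add[OF FG(1) FG'(1)]] f g by simp
  then show "loc f \<oplus>\<^bsub>local_ring n J q\<^esub> loc g = loc (f + g)" using hp.local_add[OF FG(1) FG'(1)] FG(2) FG'(2) by simp
next
  show "\<one>\<^bsub>local_ring n J q\<^esub> = loc 1"
    using loc_eqI[OF P_one hp.hfracs_one] Q.cg_refl[of 1] by (simp add: local_ring_def)
  show "\<zero>\<^bsub>local_ring n J q\<^esub> = loc 0"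
    using loc_eqI[OF P_zero hp.hfracs_zero_one] Q.cg_refl[of 0] by (simp add: local_ring_def)
qed

sublocale L: poly_quot n "local_ring n J q" loc "aff n q" by (rule poly_quot_local)

lemma loc_homog:
  assumes "f \<in> P n" "homog (int i) f" shows "hfrac n J q f (indet 0 ^ i) = loc f"
proof (rule loc_eqI[symmetric])
  show "(f, indet 0 ^ i) \<in> hfracs n q"
    unfolding hp.hfracs_iff using assms X0_power_notin[OF q, of i] homog_indet_power by auto
  show "Q.cg f (f * indet 0 ^ i)"
    using Q.cg_mult[OF Q.cg_refl[OF assms(1)] Q.cg_sym[OF X0_power_cg[of i]]] by simp
qed (rule assms)

lemma local_const_eq: "local_const n J q c = loc (Cst c)"
  using loc_homog[of "Cst c" 0] by (simp add: local_const_def)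

lemma one_notin_aff_q: "1 \<notin> aff n q" by (rule one_notin_aff[OF q])

lemma e_kernel: "f \<in> P n \<Longrightarrow> nf (e q * f) = 0 \<longleftrightarrow> f \<in> aff n q"
  using nf_zero_iff[of "e q * f"] e_mult_Ia[OF q, of f] e(1)[OF q] by simp

lemma kdim_local: "kdim (local_ring n J q) (local_const n J q) (carrier (local_ring n J q)) = pv.dim (Uq q)"
  unfolding L.surj local_const_eq[abs_def] Uq_def
  by (rule L.basis_and_kdim(2)[OF one_notin_aff_q P_subspace order_refl mult_lin e_kernel _ fin_B])
    (use nf_span in auto)

text \<open>A fraction with numerator in q is 0, so the local ring is a field, its own residue field
  and its own socle.\<close>

lemma local_max_eq: "local_max n J q = {\<zero>\<^bsub>local_ring n J q\<^esub>}"
proof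
  show "local_max n J q \<subseteq> {\<zero>\<^bsub>local_ring n J q\<^esub>}"
  proof
    fix x assume "x \<in> local_max n J q"
    then obtain f g where fg: "(f, g) \<in> hfracs n q" "f \<in> q" "x = hfrac n J q f g" by (auto simp: local_max_def)
    have "f * 1 - 0 * g \<in> aff n q" using fg(2) aff_super by auto
    then show "x \<in> {\<zero>\<^bsub>local_ring n J q\<^esub>}"
      using hfrac_eq_iff[OF fg(1) hp.hfracs_zero_one] fg(3) by (simp add: local_ring_def)
  qed
  have "\<zero>\<^bsub>local_ring n J q\<^esub> = hfrac n J q 0 1" by (simp add: local_ring_def)
  moreover have "0 \<in> q" using pidealD(2)[OF ptsD(2)[OF q]] .
  ultimately show "{\<zero>\<^bsub>local_ring n J q\<^esub>} \<subseteq> local_max n J q"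
    using hp.hfracs_zero_one by (auto simp: local_max_def)
qed

definition res where "res f = residue_class n J q (loc f)"

lemma poly_quot_residue: "poly_quot n (residue_field n J q) res (aff n q)"
proof -
  interpret ring "local_ring n J q" by (rule L.ring_A)
  have "{f \<in> P n. loc f \<in> {\<zero>\<^bsub>local_ring n J q\<^esub>}} = aff n q"
    using L.zero_iff pidealD(1)[OF aff_pt_id[OF q]] by blast
  then show ?thesis
    using poly_quot_Quot[OF poly_quot_local zeroideal]
    unfolding residue_field_def local_max_eq res_def[abs_def] residue_class_def by simp
qed

sublocale F: poly_quot n "residue_field n J q" res "aff n q" by (rule poly_quot_residue)

lemma residue_const_eq: "residue_const n J q c = res (Cst c)"
  by (simp add: residue_const_def res_def local_const_eq)

lemma residue_degree_eq: "residue_degree n J q = pv.dim (Uq q)"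
  unfolding residue_degree_def F.surj residue_const_eq[abs_def] Uq_def
  by (rule F.basis_and_kdim(2)[OF one_notin_aff_q P_subspace order_refl mult_lin e_kernel _ fin_B])
    (use nf_span in auto)

lemma residue_basis_exists: "\<exists>es. residue_basis n J q es"
proof -
  obtain Us where Us: "set Us \<subseteq> res ` P n" "ring.independent (residue_field n J q) F.K Us"
    "ring.Span (residue_field n J q) F.K Us = res ` P n"
    using F.basis_and_kdim(1)[OF one_notin_aff_q P_subspace order_refl mult_lin e_kernel _ fin_B] nf_span
    by (metis image_subsetI)
  have "\<exists>fs. set fs \<subseteq> P n \<and> Us = map res fs" using Us(1)
  proof (induction Us)
    case (Cons a Us)
    then obtain fs f where "set fs \<subseteq> P n" "Us = map res fs" "f \<in> P n" "a = res f" by auto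
    then show ?case by (intro exI[of _ "f # fs"]) auto
  qed simp
  then obtain fs where fs: "set fs \<subseteq> P n" "Us = map res fs" by blast
  have "map (residue_class n J q) (map loc fs) = Us" by (simp add: fs(2) res_def)
  moreover have "set (map loc fs) \<subseteq> carrier (local_ring n J q)" using fs(1) L.in_carrier by auto
  ultimately have "residue_basis n J q (map loc fs)"
    unfolding residue_basis_def using Us(2,3) by (simp add: residue_const_eq[abs_def] F.surj)
  then show ?thesis by blast
qed

end

context zdim
begin

lemma zdim_pointI: "q \<in> pts \<Longrightarrow> zdim_point n I I q"
  using I_id ptsD(4) by unfold_locales auto

theorem scheme_degree_eq: "scheme_degree n I = d"
proof -
  have "kdim (local_ring n I q) (local_const n I q) (carrier (local_ring n I q)) = pv.dim (Uq q)" if "q \<in> pts" for q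
    by (rule zdim_point.kdim_local[OF zdim_pointI[OF that]])
  then show ?thesis unfolding scheme_degree_def using sum_dim_Uq by simp
qed

theorem regularity_index_eq: "regularity_index n I = int r"
  unfolding regularity_index_def scheme_degree_eq
proof (rule Least_equality)
  show "\<forall>j\<ge>int r. HFX n I j = d"
  proof (intro allI impI)
    fix j assume "int r \<le> j"
    then obtain k where "j = int k" "r \<le> k" by (metis nat_int nat_mono nonneg_int_cases of_nat_0_le_iff order_trans)
    then show "HFX n I j = d" using HFX_eq(1)[of k] dim_V_eq[of k] by simp
  qed
  fix i assume i: "\<forall>j\<ge>i. HFX n I j = d"
  show "int r \<le> i"
  proof (rule ccontr)
    assume "\<not> int r \<le> i"
    then have lt: "i < int r" by simp
    then have "r > 0 \<or> i < 0" by auto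
    show False
    proof (cases "r = 0")
      \<comment> \<open>For r = 0 the degree to contradict is -1, where the Hilbert function is 0
        while d is positive.\<close>
      case True
      then have "HFX n I (-1) = d" using i lt by auto
      then show False using HFX_eq(2)[of "-1"] r_less_d by simp
    next
      case False
      then have "HFX n I (int (r - 1)) = d" using i lt by auto
      then have "pv.dim (V (r - 1)) = d" unfolding HFX_eq(1) .
      then have "r \<le> r - 1" unfolding dim_V_eq .
      then show False using False by linarith
    qed
  qed
qed

end

section \<open>The Kaehler different, its Hilbert function and generic position\<close>

section \<open>The Kaehler different\<close>

lemma homog_det:
  assumes "\<And>i j. i < n \<Longrightarrow> j < n \<Longrightarrow> homog (D j) (a i j)"
  shows "homog (\<Sum>j<n. D j) (det (mat n n (\<lambda>(i, j). a i j)) :: 'k::field mpoly)"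
  unfolding det_col[OF mat_carrier]
proof (rule homog_sum)
  fix p assume "p \<in> {p. p permutes {0..<n}}"
  then have p: "p permutes {0..<n}" by simp
  have "homog (\<Sum>j<n. D j) (\<Prod>j<n. mat n n (\<lambda>(i, j). a i j) $$ (p j, j))"
  proof (rule homog_prod)
    fix j assume "j \<in> {..<n}"
    moreover then have "p j < n" using permutes_in_image[OF p, of j] by simp
    ultimately show "homog (D j) (mat n n (\<lambda>(i, j). a i j) $$ (p j, j))" using assms by simp
  qed
  then show "homog (\<Sum>j<n. D j) (signof p * (\<Prod>j<n. mat n n (\<lambda>(i, j). a i j) $$ (p j, j)))"
    by (auto simp: sign_def intro: homog_uminus)
qed

lemma det_permute_columns:
  fixes a :: "nat \<Rightarrow> nat \<Rightarrow> 'a::comm_ring_1"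
  assumes p: "p permutes {0..<n}"
  shows "det (mat n n (\<lambda>(l, i). a l (p i))) = signof p * det (mat n n (\<lambda>(l, i). a l i))"
proof -
  let ?A = "mat n n (\<lambda>(l, i). a l i)"
  have "det (mat n n (\<lambda>(l, i). a l (p i))) = det (transpose_mat (mat n n (\<lambda>(l, i). a l (p i))))"
    by (rule det_transpose[symmetric, of _ n]) simp
  also have "transpose_mat (mat n n (\<lambda>(l, i). a l (p i))) = mat n n (\<lambda>(i, j). transpose_mat ?A $$ (p i, j))"
    by (rule eq_matI) (use permutes_in_image[OF p] in auto)
  also have "det \<dots> = signof p * det (transpose_mat ?A)"
    by (rule det_permute_rows[OF _ p]) simp
  also have "det (transpose_mat ?A) = det ?A" by (rule det_transpose[of _ n]) simp
  finally show ?thesis .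
qed

text \<open>The minors in \<open>jacobian_minors\<close> use increasing column choices; an arbitrary
  injective choice is brought into that form at the cost of a sign.\<close>

lemma sorting_permutation:
  fixes \<phi> :: "nat \<Rightarrow> nat"
  assumes inj: "inj_on \<phi> {..<n}"
  obtains p where "p permutes {0..<n}" "strict_mono_on {..<n} (\<phi> \<circ> p)"
proof -
  define S where "S = \<phi> ` {..<n}"
  define js where "js k = sorted_list_of_set S ! k" for k
  have S: "finite S" "card S = n" using card_image[OF inj] by (auto simp: S_def)
  have len: "length (sorted_list_of_set S) = n" using S by simp
  have js: "bij_betw js {..<n} S"
    unfolding js_def using bij_betw_nth[OF distinct_sorted_list_of_set[of S], of "{..<n}" S] len S(1) by simp
  have bij\<phi>: "bij_betw \<phi> {..<n} S" using inj by (simp add: bij_betw_def S_def)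
  define p where "p k = (if k < n then inv_into {..<n} \<phi> (js k) else k)" for k
  have "bij_betw (\<lambda>k. inv_into {..<n} \<phi> (js k)) {..<n} {..<n}"
    using bij_betw_trans[OF js bij_betw_inv_into[OF bij\<phi>]] by (simp add: o_def)
  then have "bij_betw p {..<n} {..<n}" by (subst bij_betw_cong[of _ p]) (auto simp: p_def)
  then have "p permutes {0..<n}" by (intro bij_imp_permutes) (auto simp: p_def atLeast0LessThan)
  moreover have \<phi>p: "\<phi> (p k) = js k" if "k < n" for k
  proof -
    have "js k \<in> \<phi> ` {..<n}" using js that by (auto simp: bij_betw_def S_def)
    then show ?thesis using that by (simp add: p_def f_inv_into_f)
  qed
  have "strict_mono_on {..<n} (\<phi> \<circ> p)"
  proof (rule strict_mono_onI)
    fix i j assume "i \<in> {..<n}" "j \<in> {..<n}" "i < j"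
    then show "(\<phi> \<circ> p) i < (\<phi> \<circ> p) j"
      using \<phi>p[of i] \<phi>p[of j] sorted_wrt_nth_less[OF strict_sorted_list_of_set[of S], of i j] len
      by (simp add: js_def)
  qed
  ultimately show thesis using that by blast
qed

locale kaehler = zdim n I for n :: nat and I :: "'k::field mpoly set" +
  fixes Fs :: "'k mpoly list"
  assumes n2: "n \<ge> 2" and char: "CHAR('k) = 0 \<or> CHAR('k) > scheme_degree n I"
    and gens: "homogeneous_generators n Fs I"
begin

sublocale artin_sep n Ia nf B
  by unfold_locales (use char scheme_degree_eq in simp)

lemma Fs_P: "set Fs \<subseteq> P n" and Fs_homog: "F \<in> set Fs \<Longrightarrow> \<exists>d. homog d F"
  and Fs_I: "I = Idl\<^bsub>mpoly_ring n\<^esub> (set Fs)"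
  using gens by (auto simp: homogeneous_generators_def)

definition lift where "lift b = (SOME f. f \<in> form n r \<and> f - b \<in> Ia)"

lemma lift: assumes "b \<in> B" shows "lift b \<in> form n r" "lift b - b \<in> Ia"
proof -
  have "b \<in> V r" using V_r[of r] pv.span_base[OF assms] by simp
  then obtain f where "f \<in> form n r" "b = nf f" by (auto simp: V_def)
  moreover then have "f - b \<in> Ia" using nf_cong form_P by blast
  ultimately have "\<exists>f. f \<in> form n r \<and> f - b \<in> Ia" by blast
  from someI_ex[OF this] show "lift b \<in> form n r" "lift b - b \<in> Ia" unfolding lift_def by auto
qed

sublocale artin_lift n Ia nf B lift
  using lift form_P X0_Ia by unfold_locales auto

lemma h_form: "i \<le> n \<Longrightarrow> k \<in> B \<Longrightarrow> h i k \<in> form n (Suc r)"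
  unfolding h_def scl_def[symmetric]
  by (intro pv.subspace_diff[OF form_subspace] form_indet form_X0 pv.subspace_sum[OF form_subspace]
      pv.subspace_scale[OF form_subspace] lift(1))

lemma h_I: "i \<le> n \<Longrightarrow> k \<in> B \<Longrightarrow> h i k \<in> I"
  using h_Ia form_Ia[OF h_form] by blast

abbreviation jac :: "(nat \<Rightarrow> 'k mpoly) \<Rightarrow> 'k mpoly" where
  "jac H \<equiv> det (mat n n (\<lambda>(l, i). pdiff (Suc l) (H i)))"

text \<open>The preimage of the Kaehler different in the polynomial ring.\<close>

definition T where "T = Idl\<^bsub>mpoly_ring n\<^esub> (jacobian_minors n Fs \<union> I)"

lemma det_P:
  fixes a :: "nat \<Rightarrow> nat \<Rightarrow> 'k mpoly"
  assumes "\<And>i j. i < n \<Longrightarrow> j < n \<Longrightarrow> a i j \<in> P n"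
  shows "det (mat n n (\<lambda>(i, j). a i j)) \<in> P n"
proof -
  interpret ideal_in_subring "P n :: 'k mpoly set" "{0}" by unfold_locales auto
  show ?thesis by (rule A_det) (rule assms)
qed

lemma minors_P: "jacobian_minors n Fs \<subseteq> P n"
proof
  fix x assume "x \<in> jacobian_minors n Fs"
  then obtain js where js: "x = jac (\<lambda>k. Fs ! js k)" "js ` {..<n} \<subseteq> {..<length Fs}"
    unfolding jacobian_minors_def by blast
  have "Fs ! js j \<in> P n" if "j < n" for j
  proof -
    have "js j < length Fs" using js(2) that by auto
    then show ?thesis using Fs_P nth_mem by blast
  qed
  then show "x \<in> P n" unfolding js(1) by (intro det_P P_pdiff)
qed

lemma T_id: "pideal n T" and I_T: "I \<subseteq> T" and minors_T: "jacobian_minors n Fs \<subseteq> T"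
proof -
  have "jacobian_minors n Fs \<union> I \<subseteq> P n" using minors_P pidealD(1)[OF I_id] by blast
  from Idl_eq(1,2)[OF this] show "pideal n T" "I \<subseteq> T" "jacobian_minors n Fs \<subseteq> T" by (auto simp: T_def)
qed

lemma kaehler_eq: "kaehler_different n I Fs = coord n I ` T"
  unfolding kaehler_different_def T_def by (rule R.Idl_image[OF minors_P I_id])

text \<open>A repeated generator gives two equal columns and determinant 0; distinct positions are
  sorted, which changes at most the sign.\<close>

lemma jac_Fs: assumes H: "\<And>k. k < n \<Longrightarrow> H k \<in> set Fs" shows "jac H \<in> T"
proof -
  have "\<exists>j. j < length Fs \<and> H k = Fs ! j" if "k < n" for k
    using H[OF that] by (auto simp: in_set_conv_nth)
  then obtain \<phi> where \<phi>: "\<And>k. k < n \<Longrightarrow> \<phi> k < length Fs \<and> H k = Fs ! \<phi> k" by metis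
  have eq: "jac H = det (mat n n (\<lambda>(l, i). pdiff (Suc l) (Fs ! \<phi> i)))"
    by (rule arg_cong[of _ _ det], rule eq_matI) (use \<phi> in auto)
  show ?thesis
  proof (cases "inj_on \<phi> {..<n}")
    case False
    then obtain i j where ij: "i < n" "j < n" "i \<noteq> j" "\<phi> i = \<phi> j" by (auto simp: inj_on_def)
    have "jac H = 0" unfolding eq
      by (rule det_identical_columns[of _ n i j]) (use ij in \<open>auto simp: col_def intro!: eq_vecI\<close>)
    then show ?thesis using pidealD(2)[OF T_id] by simp
  next
    case True
    obtain p where p: "p permutes {0..<n}" "strict_mono_on {..<n} (\<phi> \<circ> p)"
      using sorting_permutation[OF True] by blast
    let ?D = "det (mat n n (\<lambda>(l, i). pdiff (Suc l) (Fs ! (\<phi> \<circ> p) i)))"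
    have "(\<phi> \<circ> p) ` {..<n} \<subseteq> {..<length Fs}"
      using \<phi> permutes_in_image[OF p(1)] by auto
    then have "?D \<in> T" using minors_T p(2) unfolding jacobian_minors_def by blast
    moreover have "?D = signof p * jac H"
      unfolding eq using det_permute_columns[OF p(1), of "\<lambda>l i. pdiff (Suc l) (Fs ! \<phi> i)"] by simp
    moreover have "(signof p :: 'k mpoly) = 1 \<or> (signof p :: 'k mpoly) = -1" by (auto simp: sign_def)
    ultimately have "jac H = ?D \<or> jac H = - ?D" by auto
    then show ?thesis using \<open>?D \<in> T\<close> pidealD(6)[OF T_id] by auto
  qed
qed

text \<open>Columns are freed from the generators one at a time. With the other columns fixed, the x
  in I whose determinant lies in T form an ideal: replacing x by a x multiplies the determinant by a
  and adds, by the product rule, a multiple of x, which lies in I and so in T.\<close>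

lemma jac_T: assumes H: "\<And>k. k < n \<Longrightarrow> H k \<in> I" shows "jac H \<in> T"
proof -
  note d = pidealD[OF T_id]
  have "\<forall>H. (\<forall>k<s. H k \<in> I) \<and> (\<forall>k. s \<le> k \<and> k < n \<longrightarrow> H k \<in> set Fs) \<longrightarrow> jac H \<in> T" if "s \<le> n" for s
    using that
  proof (induction s)
    case 0
    then show ?case using jac_Fs by auto
  next
    case (Suc s)
    then have s: "s < n" by simp
    have FI: "set Fs \<subseteq> I" using Idl_eq(2)[OF Fs_P] Fs_I by blast
    show ?case
    proof (intro allI impI)
      fix H assume H: "(\<forall>k<Suc s. H k \<in> I) \<and> (\<forall>k. Suc s \<le> k \<and> k < n \<longrightarrow> H k \<in> set Fs)"
      have HI: "H k \<in> I" if "k < n" for k using H FI that by (cases "k < Suc s") auto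
      have HP: "H k \<in> P n" if "k < n" for k using pidealD(1)[OF I_id HI[OF that]] .
      define M where "M x = mat n n (\<lambda>(l, i). pdiff (Suc l) ((H(s := x)) i))" for x
      \<comment> \<open>Cofactors along column \<open>s\<close> do not involve its entries, so they
        may be computed with 0 in that column.\<close>
      define c where "c l = cofactor (M 0) l s" for l
      have cP: "c l \<in> P n" for l
      proof -
        have "det (mat_delete (M 0) l s) \<in> P n"
        proof -
          interpret ideal_in_subring "P n :: 'k mpoly set" "{0}" by unfold_locales auto
          have "mat_delete (M 0) l s = mat (n - 1) (n - 1)
            (\<lambda>(i, j). pdiff (Suc (if i < l then i else Suc i)) ((H(s := 0)) (if j < s then j else Suc j)))"
            unfolding mat_delete_def M_def by (rule eq_matI) (auto simp: s)
          moreover have "det \<dots> \<in> P n"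
            by (rule A_det) (use HP s in \<open>auto intro!: P_pdiff\<close>)
          ultimately show ?thesis by simp
        qed
        moreover have "(-1) ^ (l + s) \<in> (P n :: 'k mpoly set)" by (intro P_power P_uminus P_one)
        ultimately show ?thesis unfolding c_def cofactor_def by (rule P_mult[rotated])
      qed
      have cof: "cofactor (M x) l s = c l" if "l < n" for x l
        unfolding c_def cofactor_def mat_delete_def
        by (rule arg_cong[of _ _ "\<lambda>x. _ * det x"], rule eq_matI) (use s that in \<open>auto simp: M_def\<close>)
      have detM: "det (M x) = (\<Sum>l<n. pdiff (Suc l) x * c l)" for x
      proof -
        have "det (M x) = (\<Sum>l<n. M x $$ (l, s) * cofactor (M x) l s)"
          by (rule laplace_expansion_column) (use s in \<open>auto simp: M_def\<close>)
        then show ?thesis using cof s by (simp add: M_def)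
      qed
      let ?L = "{x \<in> I. det (M x) \<in> T}"
      have "pideal n ?L"
        unfolding pideal_def
      proof (intro conjI ballI)
        show "?L \<subseteq> P n" using pidealD(1)[OF I_id] by blast
        show "0 \<in> ?L" using pidealD(2)[OF I_id] d(2) by (simp add: detM)
        fix x assume x: "x \<in> ?L"
        show "x + y \<in> ?L" if "y \<in> ?L" for y
          using x that pidealD(3)[OF I_id, of x y] d(3)[of "det (M x)" "det (M y)"]
          by (simp add: detM pdiff_add distrib_right sum.distrib)
        fix a :: "'k mpoly" assume a: "a \<in> P n"
        have "det (M (a * x)) = a * det (M x) + x * (\<Sum>l<n. pdiff (Suc l) a * c l)"
          by (simp add: detM pdiff_mult distrib_right sum.distrib sum_distrib_left mult.assoc)
        moreover have "x * (\<Sum>l<n. pdiff (Suc l) a * c l) \<in> T"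
          using x a cP I_T by (intro d(5) P_sum P_mult P_pdiff) auto
        moreover have "a * det (M x) \<in> T" using d(4)[OF a] x by blast
        ultimately show "a * x \<in> ?L" using d(3) pidealD(4)[OF I_id a] x by auto
      qed
      moreover have "set Fs \<subseteq> ?L"
      proof
        fix F assume F: "F \<in> set Fs"
        have "jac (H(s := F)) \<in> T" using Suc.IH s H F by (auto simp: less_Suc_eq)
        then show "F \<in> ?L" using F FI by (auto simp: M_def)
      qed
      ultimately have "I \<subseteq> ?L" using Idl_eq(3)[OF Fs_P] Fs_I by blast
      then have "det (M (H s)) \<in> T" using HI[OF s] by blast
      then show "jac H \<in> T" by (simp add: M_def)
    qed
  qed
  from this[OF order_refl, THEN spec, of H] have "(\<forall>k<n. H k \<in> I) \<Longrightarrow> jac H \<in> T" by (meson not_le)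
  then show ?thesis using H by blast
qed

definition no_small_forms where "no_small_forms \<longleftrightarrow> (\<forall>k\<le>r. \<forall>f\<in>I. f \<in> form n k \<longrightarrow> f = 0)"

definition different_HF where
  "different_HF \<longleftrightarrow> (\<forall>i::int. pv.dim (nf ` (T \<inter> forms i)) = (if i < int (n * r) then 0 else d))"

lemma HF_kaehler: "HF n I (kaehler_different n I Fs) i = pv.dim (nf ` (T \<inter> forms i))"
  unfolding kaehler_eq by (rule HF_eq[OF T_id I_T])

text \<open>The polynomials whose components in degrees below n r lie in I form an ideal, so it
  suffices to look at the generators of T.\<close>

lemma T_low:
  assumes A: no_small_forms and f: "f \<in> T" "i < int (n * r)"
  shows "hcomp i f \<in> I"
proof -
  let ?L = "{f \<in> P n. \<forall>i<int (n * r). hcomp i f \<in> I}"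
  have SI: "jacobian_minors n Fs \<union> I \<subseteq> P n" using minors_P pidealD(1)[OF I_id] by blast
  have "pideal n ?L"
    unfolding pideal_def
  proof (intro conjI ballI)
    show "0 \<in> ?L" using pidealD(2)[OF I_id] by simp
    fix x assume x: "x \<in> ?L"
    show "x + y \<in> ?L" if "y \<in> ?L" for y using x that pidealD(3)[OF I_id] by (simp add: hcomp_add)
    fix a :: "'k mpoly" assume a: "a \<in> P n"
    have "hcomp i (a * x) \<in> I" if "i < int (n * r)" for i
    proof -
      have "hcomp i (a * x) = (\<Sum>j\<in>hdegs a. hcomp j a * hcomp (i - j) x)"
        by (subst (1) sum_hcomp'[of a, symmetric])
          (simp add: sum_distrib_right hcomp_sum hcomp_mult_homog[OF homog_hcomp])
      moreover have "hcomp j a * hcomp (i - j) x \<in> I" if j: "j \<in> hdegs a" for j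
        using hdegs_nonneg[OF j] x a \<open>i < int (n * r)\<close> by (intro pidealD(4)[OF I_id]) auto
      ultimately show ?thesis using pidealD(8)[OF I_id, of "hdegs a"] by simp
    qed
    then show "a * x \<in> ?L" using a x by simp
  qed blast
  moreover have "I \<subseteq> ?L" using pidealD(1)[OF I_id] I_hc by blast
  moreover have "jacobian_minors n Fs \<subseteq> ?L"
  proof
    fix x assume xm: "x \<in> jacobian_minors n Fs"
    then obtain js where js: "x = jac (\<lambda>k. Fs ! js k)" "js ` {..<n} \<subseteq> {..<length Fs}"
      unfolding jacobian_minors_def by blast
    have "\<exists>D. D \<ge> int (Suc r) \<and> homog D (Fs ! js k)" if k: "k < n" for k
    proof -
      have mem: "Fs ! js k \<in> set Fs" using js(2) k by (intro nth_mem) auto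
      then obtain D where D: "homog D (Fs ! js k)" using Fs_homog by blast
      have FI: "Fs ! js k \<in> I" using Idl_eq(2)[OF Fs_P] Fs_I mem by blast
      show ?thesis
      proof (cases "Fs ! js k = 0")
        \<comment> \<open>The zero polynomial is homogeneous of every degree and may count as a form
          of degree r + 1.\<close>
        case True then show ?thesis by auto
      next
        case False
        then have "D \<ge> 0" using homog_neg[OF D] by force
        have "\<not> D \<le> int r"
        proof
          assume "D \<le> int r"
          then have "nat D \<le> r" "Fs ! js k \<in> form n (nat D)"
            using D \<open>D \<ge> 0\<close> pidealD(1)[OF I_id FI] by (auto simp: form_def)
          then show False using A FI False unfolding no_small_forms_def by blast
        qed
        then show ?thesis using D by (intro exI[of _ D]) auto
      qed
    qed
    then obtain D where D: "\<And>k. k < n \<Longrightarrow> D k \<ge> int (Suc r) \<and> homog (D k) (Fs ! js k)" by metis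
    have hx: "homog (\<Sum>k<n. D k - 1) x"
      unfolding js(1) by (rule homog_det) (use D homog_pdiff in auto)
    have "(\<Sum>k<n. int r) \<le> (\<Sum>k<n. D k - 1)" using D by (intro sum_mono) force
    then have "int (n * r) \<le> (\<Sum>k<n. D k - 1)" by simp
    then have "hcomp i x = 0" if "i < int (n * r)" for i using hcomp_other[OF hx, of i] that by simp
    then show "x \<in> ?L" using xm minors_P pidealD(2)[OF I_id] by auto
  qed
  ultimately have "T \<subseteq> ?L" unfolding T_def using Idl_eq(3)[OF SI] by blast
  then show ?thesis using f by blast
qed

lemma homog_jac: "(\<And>i. i < n \<Longrightarrow> homog (D i) (H i)) \<Longrightarrow> homog (\<Sum>i<n. D i - 1) (jac H)"
  by (rule homog_det) (rule homog_pdiff)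

lemma T_forms_subspace: "pv.subspace (nf ` (T \<inter> forms i))"
  by (intro plinear_image_subspace[OF nf_lin] pv.subspace_inter pideal_subspace[OF T_id] forms_subspace)

text \<open>In degree n r the minors of the relations \<open>h\<close> fill S, and multiplication by
  powers of X_0 carries this to higher degrees. Condition (A) concerns only what happens below n
  r.\<close>

lemma T_high:
  assumes "i \<ge> int (n * r)" shows "nf ` (T \<inter> forms i) = C"
proof -
  have base: "nf ` (T \<inter> form n (n * r)) = C"
  proof -
    \<comment> \<open>The target space is pulled back along \<open>nf\<close>, so that it contains
      \<open>Ia\<close> and \<open>minors_span\<close> applies to polynomials.\<close>
    let ?W = "{f. nf f \<in> nf ` (T \<inter> form n (n * r))}"
    have sub: "pv.subspace (nf ` (T \<inter> form n (n * r)))" using T_forms_subspace[of "int (n * r)"] by (simp only: forms_nat)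
    have W: "pv.subspace ?W"
    proof (rule pv.subspaceI)
      show "0 \<in> ?W" using pv.subspace_0[OF sub] by (simp add: nfD)
    next
      fix x y assume "x \<in> ?W" "y \<in> ?W"
      then show "x + y \<in> ?W" using pv.subspace_add[OF sub, of "nf x" "nf y"] by (simp add: nfD)
    next
      fix c x assume "x \<in> ?W"
      then show "scl c x \<in> ?W" using pv.subspace_scale[OF sub, of "nf x" c] by (simp add: scl_def nfD)
    qed
    have IaW: "Ia \<subseteq> ?W" using nf_zero pv.subspace_0[OF sub] by auto
    have "c \<in> ?W" if "c \<in> P n" for c
    proof (rule minors_span[OF n2 W IaW _ that])
      fix \<kappa> :: "nat \<Rightarrow> 'k mpoly" assume \<kappa>: "\<And>i. i < n \<Longrightarrow> \<kappa> i \<in> B"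
      let ?H = "\<lambda>i. h (Suc i) (\<kappa> i)"
      have 1: "jac ?H \<in> T" by (rule jac_T) (use h_I \<kappa> in auto)
      have "homog (int (Suc r)) (?H i)" if "i < n" for i using h_form[OF _ \<kappa>[OF that], of "Suc i"] that by (simp add: form_def)
      then have "homog (\<Sum>i<n. int (Suc r) - 1) (jac ?H)" by (rule homog_jac)
      then have "jac ?H \<in> form n (n * r)" using pidealD(1)[OF T_id 1] by (simp add: form_def)
      then show "jac ?H \<in> ?W" using 1 by blast
    qed
    then have "C \<subseteq> nf ` (T \<inter> form n (n * r))" unfolding C_img by blast
    then show ?thesis using nf_span by blast
  qed
  have "i = int (n * r + nat (i - int (n * r)))" using assms by simp
  then obtain k where k: "i = int (n * r + k)" by blast
  have "C \<subseteq> nf ` (T \<inter> forms i)"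
  proof
    fix c assume "c \<in> C"
    then obtain f where f: "f \<in> T" "f \<in> form n (n * r)" "c = nf f" using base by blast
    have fP: "f \<in> P n" by (rule form_P[OF f(2)])
    have 1: "indet 0 ^ k * f \<in> T" by (rule pidealD(4)[OF T_id _ f(1)]) simp
    have 2: "indet 0 ^ k * f \<in> forms i"
      using homog_mult[OF homog_indet_power[of k 0], of "int (n * r)" f] f(2) fP
      by (simp add: forms_def form_def k add.commute)
    have "(1 - indet 0 ^ k) * f \<in> Ia" by (rule IaD(5)[OF fP X0_power_minus_one[OF Ia_id X0_Ia]])
    then have "f - indet 0 ^ k * f \<in> Ia" by (simp add: left_diff_distrib)
    then have "nf f = nf (indet 0 ^ k * f)" using nf_eq_iff[OF fP, of "indet 0 ^ k * f"] fP by simp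
    then show "c \<in> nf ` (T \<inter> forms i)" using 1 2 f(3) by blast
  qed
  then show ?thesis using nf_span by blast
qed

lemma no_small_forms_imp: "no_small_forms \<Longrightarrow> different_HF"
  unfolding different_HF_def
proof (intro allI)
  fix i assume A: no_small_forms
  show "pv.dim (nf ` (T \<inter> forms i)) = (if i < int (n * r) then 0 else d)"
  proof (cases "i < int (n * r)")
    case True
    have z: "nf f = 0" if "f \<in> T \<inter> forms i" for f
      using T_low[OF A _ True, of f] that hcomp_same[of i f] I_Ia nf_zero by (auto simp: forms_def)
    have "0 \<in> T \<inter> forms i" using pidealD(2)[OF T_id] by (simp add: forms_def)
    then have "0 \<in> nf ` (T \<inter> forms i)" using z by (metis imageI)
    then have "nf ` (T \<inter> forms i) = {0}" using z by (intro equalityI subsetI) (elim imageE, simp, simp)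
    then show ?thesis using True dim_zero by simp
  next
    case False
    then have "nf ` (T \<inter> forms i) = C" using T_high[of i] by simp
    then show ?thesis using False dim_C by metis
  qed
qed

text \<open>Derivatives lying in I have degree k - 1 and vanish by minimality of k. Exponents are at
  most k <= r < d, so a non-zero exponent is non-zero in K; hence f is a constant times X_0^k. As
  X_0 is a non-zerodivisor modulo I, this would put 1 into I.\<close>

lemma gradient_nonzero:
  assumes f: "f \<in> I" "f \<in> form n k" "f \<noteq> 0" and k: "k \<le> r"
    and min: "\<And>g k'. k' < k \<Longrightarrow> g \<in> I \<Longrightarrow> g \<in> form n k' \<Longrightarrow> g = 0"
  shows "\<exists>i<n. pdiff (Suc i) f \<notin> Ia"
proof (rule ccontr)
  assume "\<not> ?thesis"
  then have dI: "pdiff (Suc i) f \<in> Ia" if "i < n" for i using that by blast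
  have fP: "f \<in> P n" by (rule form_P[OF f(2)])
  have d0: "pdiff (Suc i) f = 0" if i: "i < n" for i
  proof (cases "k = 0")
    case True
    then show ?thesis using homog_pdiff[of 0 f "Suc i"] f(2) homog_neg[of "-1"] by (simp add: form_def)
  next
    case False
    then have fm: "pdiff (Suc i) f \<in> form n (k - 1)"
      using homog_pdiff[of "int k" f "Suc i"] f(2) by (simp add: form_def of_nat_diff)
    then have "pdiff (Suc i) f \<in> I" using form_Ia[OF fm] dI[OF i] by blast
    then show ?thesis using min[OF _ _ fm] False by simp
  qed
  have m0: "m = Poly_Mapping.single 0 k" if m: "lkp f m \<noteq> 0" for m
  proof -
    have km: "Poly_Mapping.keys m \<subseteq> {..n}" "mdeg m = k" using fP f(2) m by (auto simp: P_iff form_def homog_iff)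
    have mi: "lkp m i = 0" if "i \<noteq> 0" for i
    proof (rule ccontr)
      assume nz: "lkp m i \<noteq> 0"
      then have "i \<le> n" using km(1) by (auto simp: in_keys_iff subset_iff)
      then have "pdiff i f = 0" using d0[of "i - 1"] that by simp
      then have "lkp (pdiff i f) (m - Poly_Mapping.single i 1) = 0" by simp
      moreover have "m - Poly_Mapping.single i 1 + Poly_Mapping.single i 1 = m"
        using nz by (intro poly_mapping_eqI) (auto simp: lookup_add lookup_minus lookup_single when_def)
      moreover have "lkp (m - Poly_Mapping.single i 1) i + 1 = lkp m i" using nz by (simp add: lookup_minus)
      ultimately have "of_nat (lkp m i) * lkp f m = 0" unfolding lookup_pdiff by metis
      then have "(of_nat (lkp m i) :: 'k) = 0" using m by simp
      then have "CHAR('k) dvd lkp m i" by (simp add: of_nat_eq_0_iff_char_dvd)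
      moreover have "lkp m i \<le> k" using lookup_le_mdeg[of m i] km(2) by simp
      ultimately show False using char_B k r_less_d nz by (auto dest: dvd_imp_le)
    qed
    show ?thesis
    proof (rule poly_mapping_eqI)
      fix i
      have "mdeg m = (\<Sum>i\<in>{0}. lkp m i)" by (rule mdeg_superset) (use mi in \<open>auto simp: in_keys_iff\<close>)
      then show "lkp m i = lkp (Poly_Mapping.single 0 k) i" using mi[of i] km(2) by (auto simp: lookup_single when_def)
    qed
  qed
  let ?c = "lkp f (Poly_Mapping.single 0 k)"
  have feq: "f = indet 0 ^ k * Cst ?c"
  proof (rule poly_mapping_eqI)
    fix m
    show "lkp f m = lkp (indet 0 ^ k * Cst ?c) m"
      using m0[of m] by (auto simp: indet_power_eq Cst_def mult_single lookup_single when_def)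
  qed
  have "?c \<noteq> 0" using feq f(3) by (auto simp: Cst_simps)
  have "indet 0 ^ j * Cst ?c \<in> I \<Longrightarrow> Cst ?c \<in> I" for j
  proof (induction j)
    case (Suc j)
    then show ?case using X0_nzd[of "indet 0 ^ j * Cst ?c"] by (simp add: mult.assoc)
  qed simp
  then have "Cst ?c \<in> I" using f(1) feq by metis
  then have "Cst (1 / ?c) * Cst ?c \<in> I" by (rule pidealD(9)[OF I_id])
  moreover have "Cst (1 / ?c) * Cst ?c = (1 :: 'k mpoly)"
    using \<open>?c \<noteq> 0\<close> by (simp add: Cst_simps(4)[symmetric] Cst_simps(2))
  ultimately show False using one_notin by simp
qed

lemma different_HF_imp: "different_HF \<Longrightarrow> no_small_forms"
proof (rule ccontr)
  assume HF: different_HF and "\<not> no_small_forms"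
  then have ex: "\<exists>k. k \<le> r \<and> (\<exists>f\<in>I. f \<in> form n k \<and> f \<noteq> 0)" unfolding no_small_forms_def by blast
  define k where "k = (LEAST k. k \<le> r \<and> (\<exists>f\<in>I. f \<in> form n k \<and> f \<noteq> 0))"
  have k: "k \<le> r \<and> (\<exists>f\<in>I. f \<in> form n k \<and> f \<noteq> 0)" unfolding k_def by (rule LeastI_ex[OF ex])
  then obtain f where f: "f \<in> I" "f \<in> form n k" "f \<noteq> 0" by blast
  have min: "g = 0" if "k' < k" "g \<in> I" "g \<in> form n k'" for g k'
    using not_less_Least[of k' "\<lambda>k. k \<le> r \<and> (\<exists>f\<in>I. f \<in> form n k \<and> f \<noteq> 0)"] that k unfolding k_def[symmetric] by auto
  have kr: "k \<le> r" using k by blast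
  have "\<exists>i<n. pdiff (Suc i) f \<notin> Ia" by (rule gradient_nonzero[OF f kr]) (rule min)
  then obtain i0 where i0: "i0 < n" "pdiff (Suc i0) f \<notin> Ia" by blast
  obtain \<kappa> where \<kappa>: "\<And>i. i < n \<Longrightarrow> \<kappa> i \<in> B" "jac (\<lambda>i. if i = i0 then f else h (Suc i) (\<kappa> i)) \<notin> Ia"
    using gradient_minor[OF form_P[OF f(2)] i0(1)] i0(2) by blast
  let ?H = "\<lambda>i. if i = i0 then f else h (Suc i) (\<kappa> i)"
  \<comment> \<open>The column of f contributes degree k - 1 < r and each other column r. The total
    is below n r, where (b) leaves no room for a minor that is non-zero in S.\<close>
  let ?D = "\<Sum>i<n. (if i = i0 then int k else int (Suc r)) - 1"
  have 1: "jac ?H \<in> T" by (rule jac_T) (use h_I \<kappa>(1) f(1) in auto)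
  have "homog (if i = i0 then int k else int (Suc r)) (?H i)" if "i < n" for i
    using h_form[OF _ \<kappa>(1)[OF that], of "Suc i"] f(2) that by (simp add: form_def)
  then have "homog ?D (jac ?H)" by (rule homog_jac)
  then have 2: "jac ?H \<in> T \<inter> forms ?D" using 1 pidealD(1)[OF T_id 1] by (simp add: forms_def)
  have "?D < (\<Sum>i<n. int r)"
    using i0(1) k by (intro sum_strict_mono_ex1) (auto intro!: bexI[of _ i0])
  then have "?D < int (n * r)" by simp
  then have dim0: "pv.dim (nf ` (T \<inter> forms ?D)) = 0" using HF unfolding different_HF_def by simp
  have "nf ` (T \<inter> forms ?D) \<subseteq> C" using nf_span by blast
  then obtain E where E: "finite E" "pv.span E = nf ` (T \<inter> forms ?D)" "card E = pv.dim (nf ` (T \<inter> forms ?D))"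
    using pv.subspace_dim(1)[OF T_forms_subspace _ fin_B] by metis
  then have "E = {}" using dim0 by simp
  then have "nf (jac ?H) = 0" using E(2) 2 by (auto simp: pv.span_empty)
  moreover have "jac ?H \<in> P n" using pidealD(1)[OF T_id 1] .
  ultimately show False using \<kappa>(2) nf_zero_iff by blast
qed

lemma binomial_less: "(n + k) choose n < (n + Suc k) choose n"
proof -
  obtain n' where n': "n = Suc n'" using n2 by (cases n) auto
  have "(n + Suc k) choose n = ((n + k) choose n') + ((n + k) choose n)" unfolding n' by simp
  moreover have "(n + k) choose n' > 0" unfolding n' by (simp add: zero_less_binomial_iff)
  ultimately show ?thesis by simp
qed

lemma binomial_mono': "k \<le> k' \<Longrightarrow> (n + k) choose n \<le> (n + k') choose n"
  by (rule lift_Suc_mono_le[of "\<lambda>k. (n + k) choose n"]) (rule less_imp_le[OF binomial_less])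

text \<open>Under (A), dim V_k is the number of monomials for k <= r, and for k = r it is d. In
  degree r + 1 there are more monomials than d, so the initial degree is r + 1. Conversely, for
  initial degree a the two conditions give dim V_(a-1) = d, hence r < a.\<close>

theorem generic_iff:
  "generic_position n I \<and> scheme_degree n I = (n + initial_degree I - 1) choose n \<longleftrightarrow> no_small_forms"
proof
  assume A: no_small_forms
  have dimV: "pv.dim (V k) = (n + k) choose n" if "k \<le> r" for k
    by (rule dim_V_form) (use A that in \<open>auto simp: no_small_forms_def\<close>)
  have dr: "d = (n + r) choose n" using dimV[of r] dim_V_eq[of r] by simp
  have ex: "\<exists>f\<in>I. f \<in> form n (Suc r) \<and> f \<noteq> 0"
  proof (rule ccontr)
    assume "\<not> ?thesis"
    then have "pv.dim (V (Suc r)) = (n + Suc r) choose n" by (intro dim_V_form) blast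
    then show False using dim_V_le[of "Suc r"] dr binomial_less[of r] by simp
  qed
  have "initial_degree I = Suc r"
    unfolding initial_degree_def
  proof (rule Least_equality)
    show "\<exists>f\<in>I. f \<noteq> 0 \<and> homog (int (Suc r)) f" using ex by (auto simp: form_def)
    fix k assume "\<exists>f\<in>I. f \<noteq> 0 \<and> homog (int k) f"
    then obtain f where "f \<in> I" "f \<noteq> 0" "homog (int k) f" by blast
    then have "f \<in> I" "f \<noteq> 0" "f \<in> form n k" using pidealD(1)[OF I_id] by (auto simp: form_def)
    then show "Suc r \<le> k" using A unfolding no_small_forms_def by (metis not_less_eq_eq)
  qed
  moreover have "generic_position n I"
    unfolding generic_position_def
  proof
    fix i :: int
    show "HFX n I i = min (scheme_degree n I) (nat (int n + i) choose n)"
    proof (cases "i < 0")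
      case True
      then have "nat (int n + i) < n" using n2 by auto
      then show ?thesis using HFX_eq(2)[OF True] by (simp add: binomial_eq_0)
    next
      case False
      then obtain k where k: "i = int k" using zero_le_imp_eq_int[of i] by auto
      have nk: "nat (int n + int k) = n + k" by auto
      show ?thesis
      proof (cases "k \<le> r")
        case True
        have "(n + k) choose n \<le> d" using dimV[OF True] dim_V_le[of k] by simp
        then show ?thesis unfolding nk scheme_degree_eq k HFX_eq(1) dimV[OF True] by simp
      next
        case False
        then have "pv.dim (V k) = d" using dim_V_eq[of k] by simp
        moreover have "d \<le> (n + k) choose n" using binomial_mono'[of r k] dr False by simp
        ultimately show ?thesis unfolding nk scheme_degree_eq k HFX_eq(1) by simp
      qed
    qed
  qed
  ultimately show "generic_position n I \<and> scheme_degree n I = (n + initial_degree I - 1) choose n"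
    using dr scheme_degree_eq by simp
next
  assume a: "generic_position n I \<and> scheme_degree n I = (n + initial_degree I - 1) choose n"
  let ?a = "initial_degree I"
  \<comment> \<open>For initial degree 0 the binomial coefficient is 0, but d > 0. Afterwards the
    subtraction of 1 is not truncated.\<close>
  have "?a \<noteq> 0"
  proof
    assume "?a = 0"
    then have "d = 0" using a scheme_degree_eq n2 by simp
    then show False using r_less_d by simp
  qed
  then obtain a' where a': "?a = Suc a'" by (cases ?a) auto
  have "HFX n I (int a') = min d (nat (int n + int a') choose n)"
    using a scheme_degree_eq unfolding generic_position_def by metis
  also have "nat (int n + int a') = n + a'" by auto
  also have "(n + a') choose n = d" using a scheme_degree_eq a' by simp
  finally have "pv.dim (V a') = d" by (simp add: HFX_eq)
  then have ra: "r \<le> a'" using dim_V_eq by blast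
  show no_small_forms
    unfolding no_small_forms_def
  proof (intro allI impI ballI)
    fix k f assume k: "k \<le> r" and f: "f \<in> I" "f \<in> form n k"
    show "f = 0"
    proof (rule ccontr)
      assume "f \<noteq> 0"
      then have "\<exists>f\<in>I. f \<noteq> 0 \<and> homog (int k) f" using f by (auto simp: form_def)
      then have "?a \<le> k" unfolding initial_degree_def by (rule Least_le)
      then show False using a' ra k by simp
    qed
  qed
qed

end

section \<open>The conductor and the ideals x_0^m S[x_0]\<close>

section \<open>The conductor\<close>

lemma (in poly_quot) Span_subset:
  assumes U: "pv.subspace U" "U \<subseteq> P n" and "set Us \<subseteq> \<pi> ` U"
  shows "ring.Span A K Us \<subseteq> \<pi> ` U"
  using assms(3)
proof (induction Us)
  case Nil
  interpret ring A by (rule ring_A)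
  show ?case using pv.subspace_0[OF U(1)] hom_zero by auto
next
  case (Cons a Us)
  interpret ring A by (rule ring_A)
  show ?case
  proof
    fix x assume "x \<in> Span K (a # Us)"
    then have "x \<in> line_extension K a (Span K Us)" by simp
    then obtain c y where x: "x = \<pi> (Cst c) \<otimes> a \<oplus> y" "y \<in> Span K Us" unfolding line_extension_mem_iff by blast
    obtain f g where fg: "f \<in> U" "a = \<pi> f" "g \<in> U" "y = \<pi> g" using Cons x(2) by auto
    have "x = \<pi> (Cst c * f + g)" using x fg U(2) by (simp add: hom_mult hom_add subset_iff)
    moreover have "Cst c * f + g \<in> U"
      using pv.subspace_add[OF U(1) pv.subspace_scale[OF U(1) fg(1), of c] fg(3)] by (simp add: scl_def)
    ultimately show "x \<in> \<pi> ` U" by blast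
  qed
qed

context zdim
begin

abbreviation "S \<equiv> affine_ring n I"

lemma coord_mem: "f \<in> P n \<Longrightarrow> g \<in> coord n I f \<longleftrightarrow> g \<in> P n \<and> g - f \<in> I"
  unfolding coord_def a_r_coset_def' mpoly_ring_simps
  using pidealD(1)[OF I_id] by (auto intro!: bexI[of _ "g - f"])

lemma emb_coord: assumes f: "f \<in> P n" shows "emb n I (coord n I f) = (\<lambda>i. \<delta> (hcomp i f))"
proof -
  have "(\<lambda>g i. deh n I (coord n I (hcomp i g))) ` coord n I f = {\<lambda>i. \<delta> (hcomp i f)}"
  proof -
    have "(\<lambda>i. \<delta> (hcomp i g)) = (\<lambda>i. \<delta> (hcomp i f))" if "g \<in> coord n I f" for g
    proof
      fix i
      have g: "g \<in> P n" "g - f \<in> I" using that coord_mem[OF f] by auto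
      have "hcomp i g - hcomp i f \<in> Ia" using I_hc[OF g(2), of i] I_Ia by (auto simp: hcomp_minus)
      then show "\<delta> (hcomp i g) = \<delta> (hcomp i f)" using S.ker[of "hcomp i g" "hcomp i f"] f g by simp
    qed
    moreover have "f \<in> coord n I f" using coord_mem[OF f] f pidealD(2)[OF I_id] by simp
    ultimately show ?thesis unfolding \<delta>_def[symmetric] by blast
  qed
  then show ?thesis unfolding emb_def by simp
qed

lemma Qh_carrier: "\<phi> \<in> carrier (Qh n I) \<longleftrightarrow> range \<phi> \<subseteq> carrier S \<and> finite {i. \<phi> i \<noteq> \<zero>\<^bsub>S\<^esub>}"
  by (simp add: Qh_def laurent_ring_def)

lemma Remb_simps: "monoid.mult (Remb n I) = monoid.mult (Qh n I)" "add (Remb n I) = add (Qh n I)"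
  by (simp_all add: Remb_def)

text \<open>Zero coefficients receive the representative 0, so that the sum over the support in
  \<open>Qh_mult\<close> can be simplified at the level of polynomials.\<close>

lemma Qh_rep:
  assumes "\<phi> \<in> carrier (Qh n I)"
  shows "\<exists>F. \<forall>i. F i \<in> P n \<and> \<phi> i = \<delta> (F i) \<and> (\<phi> i = \<zero>\<^bsub>S\<^esub> \<longrightarrow> F i = 0)"
proof -
  have "\<exists>f. f \<in> P n \<and> \<phi> i = \<delta> f \<and> (\<phi> i = \<zero>\<^bsub>S\<^esub> \<longrightarrow> f = 0)" for i
  proof (cases "\<phi> i = \<zero>\<^bsub>S\<^esub>")
    case True then show ?thesis using S.hom_zero by (intro exI[of _ 0]) simp
  next
    case False
    have "\<phi> i \<in> \<delta> ` P n" using assms S.surj unfolding Qh_carrier by blast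
    then show ?thesis using False by blast
  qed
  then show ?thesis by metis
qed

lemma Qh_mult:
  assumes \<phi>: "\<phi> \<in> carrier (Qh n I)" and F: "\<And>i. F i \<in> P n" "\<And>i. \<phi> i = \<delta> (F i)"
    and G: "\<And>i. G i \<in> P n" "\<And>i. \<psi> i = \<delta> (G i)"
  shows "(\<phi> \<otimes>\<^bsub>Qh n I\<^esub> \<psi>) k = \<delta> (\<Sum>i | \<phi> i \<noteq> \<zero>\<^bsub>S\<^esub>. F i * G (k - i))"
proof -
  have "(\<phi> \<otimes>\<^bsub>Qh n I\<^esub> \<psi>) k = finsum S (\<lambda>i. \<phi> i \<otimes>\<^bsub>S\<^esub> \<psi> (k - i)) {i. \<phi> i \<noteq> \<zero>\<^bsub>S\<^esub>}"
    by (simp add: Qh_def laurent_ring_def)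
  also have "(\<lambda>i. \<phi> i \<otimes>\<^bsub>S\<^esub> \<psi> (k - i)) = (\<lambda>i. \<delta> (F i * G (k - i)))"
    using F G by (simp add: S.hom_mult)
  also have "finsum S \<dots> {i. \<phi> i \<noteq> \<zero>\<^bsub>S\<^esub>} = \<delta> (\<Sum>i | \<phi> i \<noteq> \<zero>\<^bsub>S\<^esub>. F i * G (k - i))"
    by (rule S.hom_finsum) (use \<phi> F(1) G(1) in \<open>auto simp: Qh_carrier\<close>)
  finally show ?thesis .
qed

lemma monom_carrier: "f \<in> P n \<Longrightarrow> laurent_monom S (\<delta> f) j \<in> carrier (Qh n I)"
proof -
  assume f: "f \<in> P n"
  have "{i. laurent_monom S (\<delta> f) j i \<noteq> \<zero>\<^bsub>S\<^esub>} \<subseteq> {j}" by (auto simp: laurent_monom_def)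
  then have "finite {i. laurent_monom S (\<delta> f) j i \<noteq> \<zero>\<^bsub>S\<^esub>}" using finite_subset by blast
  then show ?thesis unfolding Qh_carrier using f S.in_carrier[OF P_zero] S.in_carrier[OF f]
    by (auto simp: laurent_monom_def S.hom_zero)
qed

lemma mult_monom:
  assumes \<phi>: "\<phi> \<in> carrier (Qh n I)" and f: "f \<in> P n"
  shows "(\<phi> \<otimes>\<^bsub>Qh n I\<^esub> laurent_monom S (\<delta> f) j) k = \<phi> (k - j) \<otimes>\<^bsub>S\<^esub> \<delta> f"
proof -
  obtain F where F: "\<And>i. F i \<in> P n" "\<And>i. \<phi> i = \<delta> (F i)" "\<And>i. \<phi> i = \<zero>\<^bsub>S\<^esub> \<Longrightarrow> F i = 0"
    using Qh_rep[OF \<phi>] by metis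
  let ?G = "\<lambda>i. if i = j then f else 0"
  have G: "?G i \<in> P n" "laurent_monom S (\<delta> f) j i = \<delta> (?G i)" for i
    using f S.hom_zero by (auto simp: laurent_monom_def)
  have "(\<phi> \<otimes>\<^bsub>Qh n I\<^esub> laurent_monom S (\<delta> f) j) k = \<delta> (\<Sum>i | \<phi> i \<noteq> \<zero>\<^bsub>S\<^esub>. F i * ?G (k - i))"
    by (rule Qh_mult[OF \<phi> F(1,2) G])
  also have "(\<Sum>i | \<phi> i \<noteq> \<zero>\<^bsub>S\<^esub>. F i * ?G (k - i)) = (\<Sum>i | \<phi> i \<noteq> \<zero>\<^bsub>S\<^esub>. if i = k - j then F (k - j) * f else 0)"
    by (rule sum.cong) auto
  also have "\<dots> = F (k - j) * f"
    using \<phi> F(3)[of "k - j"] by (auto simp: Qh_carrier sum.delta)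
  finally have "(\<phi> \<otimes>\<^bsub>Qh n I\<^esub> laurent_monom S (\<delta> f) j) k = \<delta> (F (k - j) * f)" .
  then show ?thesis unfolding F(2)[of "k - j"] S.hom_mult[OF F(1) f] .
qed

text \<open>This is x_0^m S[x_0], the shape that the conductor of a CB-scheme and its powers
  take.\<close>

definition Tail :: "nat \<Rightarrow> (int \<Rightarrow> 'k mpoly set set) set" where
  "Tail m = {\<phi> \<in> carrier (Qh n I). \<forall>i<int m. \<phi> i = \<zero>\<^bsub>S\<^esub>}"

lemma Rtilde_eq: "Rtilde n I = Tail 0" by (simp add: Rtilde_def Tail_def)

lemma Tail_mult:
  assumes "\<phi> \<in> Tail a" "\<psi> \<in> Tail b" shows "\<phi> \<otimes>\<^bsub>Qh n I\<^esub> \<psi> \<in> Tail (a + b)"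
proof -
  have c: "\<phi> \<in> carrier (Qh n I)" "\<psi> \<in> carrier (Qh n I)" using assms by (auto simp: Tail_def)
  obtain F where F: "\<And>i. F i \<in> P n" "\<And>i. \<phi> i = \<delta> (F i)" "\<And>i. \<phi> i = \<zero>\<^bsub>S\<^esub> \<Longrightarrow> F i = 0"
    using Qh_rep[OF c(1)] by metis
  obtain G where G: "\<And>i. G i \<in> P n" "\<And>i. \<psi> i = \<delta> (G i)" "\<And>i. \<psi> i = \<zero>\<^bsub>S\<^esub> \<Longrightarrow> G i = 0"
    using Qh_rep[OF c(2)] by metis
  note m = Qh_mult[OF c(1) F(1,2) G(1,2)]
  have z: "(\<phi> \<otimes>\<^bsub>Qh n I\<^esub> \<psi>) k = \<zero>\<^bsub>S\<^esub>" if "\<And>i. \<phi> i \<noteq> \<zero>\<^bsub>S\<^esub> \<Longrightarrow> \<psi> (k - i) = \<zero>\<^bsub>S\<^esub>" for k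
  proof -
    have "(\<Sum>i | \<phi> i \<noteq> \<zero>\<^bsub>S\<^esub>. F i * G (k - i)) = 0" using that G(3) by (intro sum.neutral) auto
    then show ?thesis unfolding m by (simp add: S.hom_zero)
  qed
  have "range (\<phi> \<otimes>\<^bsub>Qh n I\<^esub> \<psi>) \<subseteq> carrier S"
    using F(1) G(1) by (auto simp: m intro!: S.in_carrier P_sum)
  moreover have "finite {k. (\<phi> \<otimes>\<^bsub>Qh n I\<^esub> \<psi>) k \<noteq> \<zero>\<^bsub>S\<^esub>}"
  proof (rule finite_subset)
    show "finite ((\<lambda>(i, j). i + j) ` ({i. \<phi> i \<noteq> \<zero>\<^bsub>S\<^esub>} \<times> {i. \<psi> i \<noteq> \<zero>\<^bsub>S\<^esub>}))"
      using c by (auto simp: Qh_carrier)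
    show "{k. (\<phi> \<otimes>\<^bsub>Qh n I\<^esub> \<psi>) k \<noteq> \<zero>\<^bsub>S\<^esub>} \<subseteq> (\<lambda>(i, j). i + j) ` ({i. \<phi> i \<noteq> \<zero>\<^bsub>S\<^esub>} \<times> {i. \<psi> i \<noteq> \<zero>\<^bsub>S\<^esub>})"
    proof
      fix k assume "k \<in> {k. (\<phi> \<otimes>\<^bsub>Qh n I\<^esub> \<psi>) k \<noteq> \<zero>\<^bsub>S\<^esub>}"
      then obtain i where "\<phi> i \<noteq> \<zero>\<^bsub>S\<^esub>" "\<psi> (k - i) \<noteq> \<zero>\<^bsub>S\<^esub>" using z[of k] by blast
      then show "k \<in> (\<lambda>(i, j). i + j) ` ({i. \<phi> i \<noteq> \<zero>\<^bsub>S\<^esub>} \<times> {i. \<psi> i \<noteq> \<zero>\<^bsub>S\<^esub>})"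
        by (intro image_eqI[of _ _ "(i, k - i)"]) auto
    qed
  qed
  moreover have "(\<phi> \<otimes>\<^bsub>Qh n I\<^esub> \<psi>) k = \<zero>\<^bsub>S\<^esub>" if "k < int (a + b)" for k
  proof (rule z)
    fix i assume "\<phi> i \<noteq> \<zero>\<^bsub>S\<^esub>"
    then have "int a \<le> i" using assms(1) unfolding Tail_def by (auto simp: not_less[symmetric])
    then have "k - i < int b" using that by simp
    then show "\<psi> (k - i) = \<zero>\<^bsub>S\<^esub>" using assms(2) by (auto simp: Tail_def)
  qed
  ultimately show ?thesis by (simp add: Tail_def Qh_carrier)
qed

lemma Tail_add: "\<phi> \<in> Tail a \<Longrightarrow> \<psi> \<in> Tail a \<Longrightarrow> \<phi> \<oplus>\<^bsub>Qh n I\<^esub> \<psi> \<in> Tail a"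
proof -
  assume *: "\<phi> \<in> Tail a" "\<psi> \<in> Tail a"
  interpret SR: ring S by (rule S.ring_A)
  have e: "(\<phi> \<oplus>\<^bsub>Qh n I\<^esub> \<psi>) = (\<lambda>i. \<phi> i \<oplus>\<^bsub>S\<^esub> \<psi> i)" by (simp add: Qh_def laurent_ring_def)
  have "{i. \<phi> i \<oplus>\<^bsub>S\<^esub> \<psi> i \<noteq> \<zero>\<^bsub>S\<^esub>} \<subseteq> {i. \<phi> i \<noteq> \<zero>\<^bsub>S\<^esub>} \<union> {i. \<psi> i \<noteq> \<zero>\<^bsub>S\<^esub>}" by auto
  moreover have "finite ({i. \<phi> i \<noteq> \<zero>\<^bsub>S\<^esub>} \<union> {i. \<psi> i \<noteq> \<zero>\<^bsub>S\<^esub>})" using * by (auto simp: Tail_def Qh_carrier)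
  ultimately have f: "finite {i. \<phi> i \<oplus>\<^bsub>S\<^esub> \<psi> i \<noteq> \<zero>\<^bsub>S\<^esub>}" by (rule finite_subset)
  have "\<phi> i \<in> carrier S" "\<psi> i \<in> carrier S" for i using * unfolding Tail_def Qh_carrier by blast+
  then show ?thesis using * f unfolding Tail_def Qh_carrier e by auto
qed

text \<open>Coefficients in \<open>Tail\<close> are arbitrary elements of S, so an element of
  \<open>Tail (a + b)\<close> can be shifted down by b and is then a single product with x_0^b,
  which lies in J.\<close>

lemma ideal_prod_Tail:
  assumes J: "J \<subseteq> Tail b" "laurent_monom S (\<delta> 1) (int b) \<in> J"
  shows "ideal_prod (Remb n I) (Tail a) J = Tail (a + b)"
proof
  show "ideal_prod (Remb n I) (Tail a) J \<subseteq> Tail (a + b)"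
  proof
    fix x assume "x \<in> ideal_prod (Remb n I) (Tail a) J"
    then show "x \<in> Tail (a + b)"
      by (induction rule: ideal_prod.induct) (use J(1) Tail_mult Tail_add in \<open>auto simp: Remb_simps\<close>)
  qed
  show "Tail (a + b) \<subseteq> ideal_prod (Remb n I) (Tail a) J"
  proof
    fix \<phi> assume \<phi>: "\<phi> \<in> Tail (a + b)"
    let ?\<psi> = "\<lambda>i. \<phi> (i + int b)"
    have c: "\<phi> i \<in> carrier S" for i using \<phi> unfolding Tail_def Qh_carrier by blast
    have "finite ((\<lambda>i. i - int b) ` {i. \<phi> i \<noteq> \<zero>\<^bsub>S\<^esub>})" using \<phi> by (auto simp: Tail_def Qh_carrier)
    moreover have "{i. ?\<psi> i \<noteq> \<zero>\<^bsub>S\<^esub>} \<subseteq> (\<lambda>i. i - int b) ` {i. \<phi> i \<noteq> \<zero>\<^bsub>S\<^esub>}"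
    proof
      fix i assume "i \<in> {i. ?\<psi> i \<noteq> \<zero>\<^bsub>S\<^esub>}"
      then show "i \<in> (\<lambda>i. i - int b) ` {i. \<phi> i \<noteq> \<zero>\<^bsub>S\<^esub>}" by (intro image_eqI[of _ _ "i + int b"]) auto
    qed
    ultimately have "finite {i. ?\<psi> i \<noteq> \<zero>\<^bsub>S\<^esub>}" using finite_subset by blast
    then have \<psi>: "?\<psi> \<in> Tail a" using \<phi> c by (auto simp: Tail_def Qh_carrier)
    interpret SR: cring S by (rule S.cring_A)
    have "\<phi> = ?\<psi> \<otimes>\<^bsub>Qh n I\<^esub> laurent_monom S (\<delta> 1) (int b)"
    proof
      fix k
      have "?\<psi> \<in> carrier (Qh n I)" using \<psi> by (simp add: Tail_def)
      then show "\<phi> k = (?\<psi> \<otimes>\<^bsub>Qh n I\<^esub> laurent_monom S (\<delta> 1) (int b)) k"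
        using mult_monom[of ?\<psi> 1 "int b" k] c[of k] SR.r_one[of "\<phi> k"] by (simp add: S.hom_one)
    qed
    then show "\<phi> \<in> ideal_prod (Remb n I) (Tail a) J"
      using ideal_prod.prod[OF \<psi> J(2), of "Remb n I"] by (simp add: Remb_simps)
  qed
qed

lemma Remb_iff:
  "\<phi> \<in> carrier (Remb n I) \<longleftrightarrow> finite {i. \<phi> i \<noteq> \<zero>\<^bsub>S\<^esub>} \<and> (\<forall>i. \<phi> i \<in> \<delta> ` forms i)"
proof -
  have car: "carrier (Remb n I) = (\<lambda>f i. \<delta> (hcomp i f)) ` P n"
    unfolding Remb_def by (auto simp: R.surj emb_coord image_image intro!: image_cong)
  show ?thesis
  proof
    assume "\<phi> \<in> carrier (Remb n I)"
    then obtain f where f: "f \<in> P n" "\<phi> = (\<lambda>i. \<delta> (hcomp i f))" unfolding car by blast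
    have "{i. \<phi> i \<noteq> \<zero>\<^bsub>S\<^esub>} \<subseteq> hdegs f"
    proof (rule subsetI, rule ccontr)
      fix i assume "i \<in> {i. \<phi> i \<noteq> \<zero>\<^bsub>S\<^esub>}" "i \<notin> hdegs f"
      then show False using hcomp_outside[of i f] S.hom_zero f(2) by simp
    qed
    then have "finite {i. \<phi> i \<noteq> \<zero>\<^bsub>S\<^esub>}" using finite_subset finite_hdegs by blast
    moreover have "\<phi> i \<in> \<delta> ` forms i" for i using f by (auto simp: forms_def)
    ultimately show "finite {i. \<phi> i \<noteq> \<zero>\<^bsub>S\<^esub>} \<and> (\<forall>i. \<phi> i \<in> \<delta> ` forms i)" by blast
  next
    assume \<phi>: "finite {i. \<phi> i \<noteq> \<zero>\<^bsub>S\<^esub>} \<and> (\<forall>i. \<phi> i \<in> \<delta> ` forms i)"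
    then have "\<forall>i. \<exists>f. f \<in> forms i \<and> \<phi> i = \<delta> f" by blast
    then obtain F where F: "\<And>i. F i \<in> forms i \<and> \<phi> i = \<delta> (F i)" by metis
    let ?D = "{i. \<phi> i \<noteq> \<zero>\<^bsub>S\<^esub>}"
    let ?f = "\<Sum>i\<in>?D. F i"
    have hc: "hcomp j ?f = (if j \<in> ?D then F j else 0)" for j
    proof -
      have "hcomp j (F i) = (if i = j then F j else 0)" for i
        using F[of i] hcomp_homog[of i "F i" j] by (auto simp: forms_def)
      then have "hcomp j ?f = (\<Sum>i\<in>?D. if i = j then F j else 0)" by (simp only: hcomp_sum)
      then show ?thesis using \<phi> by (simp add: sum.delta)
    qed
    have "\<phi> = (\<lambda>i. \<delta> (hcomp i ?f))"
    proof
      fix i show "\<phi> i = \<delta> (hcomp i ?f)" unfolding hc using F[of i] S.hom_zero by auto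
    qed
    moreover have "?f \<in> P n" using F by (intro P_sum) (auto simp: forms_def)
    ultimately show "\<phi> \<in> carrier (Remb n I)" unfolding car by blast
  qed
qed

lemma Remb_Tail: "carrier (Remb n I) \<subseteq> Tail 0"
proof
  fix \<phi> assume "\<phi> \<in> carrier (Remb n I)"
  then have \<phi>: "finite {i. \<phi> i \<noteq> \<zero>\<^bsub>S\<^esub>}" "\<And>i. \<phi> i \<in> \<delta> ` forms i" by (auto simp: Remb_iff)
  have "\<phi> i \<in> carrier S" for i using \<phi>(2)[of i] by (auto simp: forms_def S.surj)
  moreover have "\<phi> i = \<zero>\<^bsub>S\<^esub>" if "i < 0" for i using \<phi>(2)[of i] forms_neg[OF that] S.hom_zero by simp
  ultimately show "\<phi> \<in> Tail 0" using \<phi>(1) by (auto simp: Tail_def Qh_carrier)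
qed

lemma monom_Remb: "f \<in> P n \<Longrightarrow> laurent_monom S (\<delta> f) i \<in> carrier (Remb n I) \<longleftrightarrow> \<delta> f \<in> \<delta> ` forms i"
proof -
  assume f: "f \<in> P n"
  have "finite {j. laurent_monom S (\<delta> f) i j \<noteq> \<zero>\<^bsub>S\<^esub>}" using monom_carrier[OF f] by (simp add: Qh_carrier)
  moreover have "\<zero>\<^bsub>S\<^esub> \<in> \<delta> ` forms j" for j using S.hom_zero by (auto simp: forms_def)
  ultimately show ?thesis unfolding Remb_iff by (auto simp: laurent_monom_def)
qed

lemma \<delta>_forms: "f \<in> P n \<Longrightarrow> \<delta> f \<in> \<delta> ` forms i \<longleftrightarrow> (\<exists>g\<in>forms i. f - g \<in> Ia)"
  using S.ker[of f] by (auto simp: forms_def)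

lemma \<delta>_form: "f \<in> P n \<Longrightarrow> \<delta> f \<in> \<delta> ` forms (int i) \<longleftrightarrow> nf f \<in> V i"
  using \<delta>_forms[of f "int i"] V_iff[of f i] by (simp only: forms_nat)

theorem ideal_power_Tail: "k > 0 \<Longrightarrow> ideal_power (Remb n I) (Tail r) k = Tail (k * r)"
proof (induction k)
  case (Suc k)
  show ?case
  proof (cases "k = 0")
    \<comment> \<open>The recursion of \<open>ideal_power\<close> begins with R rather than with
      S[x_0]. The first product is still \<open>Tail r\<close>, because R lies in S[x_0] and
      contains 1 = x_0^0.\<close>
    case True
    have "laurent_monom S (\<delta> 1) (int 0) \<in> carrier (Remb n I)"
      using monom_Remb[OF P_one, of 0] by (auto simp: forms_def)
    from ideal_prod_Tail[OF Remb_Tail this, of r] show ?thesis by (simp add: ideal_power_def True)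
  next
    case False
    then have IH: "ideal_power (Remb n I) (Tail r) k = Tail (k * r)" using Suc by simp
    have "laurent_monom S (\<delta> 1) (int (k * r)) \<in> Tail (k * r)"
      using monom_carrier[OF P_one] by (simp add: Tail_def laurent_monom_def)
    from ideal_prod_Tail[OF order_refl this, of r] show ?thesis
      using IH by (simp add: ideal_power_def)
  qed
qed simp

definition large_degree where "large_degree q \<longleftrightarrow> (\<exists>f\<in>P n. nf (e q * f) \<notin> V (r - 1))"

text \<open>From degree r on, every element of S is represented by forms, so \<open>Tail r\<close>
  lies in the conductor. Conversely, a non-zero coefficient in degree i < r is invertible at some
  point q; multiplying by elements of S in degree 0 would bring any element of the component at q
  into V_i.\<close>

theorem conductor_eq:
  assumes CB: "\<And>q. q \<in> pts \<Longrightarrow> large_degree q"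
  shows "conductor n I = Tail r"
proof
  show "Tail r \<subseteq> conductor n I"
  proof
    fix \<phi> assume \<phi>: "\<phi> \<in> Tail r"
    have "\<phi> \<otimes>\<^bsub>Qh n I\<^esub> \<psi> \<in> carrier (Remb n I)" if "\<psi> \<in> Rtilde n I" for \<psi>
    proof -
      let ?p = "\<phi> \<otimes>\<^bsub>Qh n I\<^esub> \<psi>"
      have p: "?p \<in> Tail r" using Tail_mult[OF \<phi>, of \<psi> 0] that by (simp add: Rtilde_eq)
      have "?p i \<in> \<delta> ` forms i" for i
      proof (cases "i < int r")
        case True
        then have "?p i = \<zero>\<^bsub>S\<^esub>" using p by (simp add: Tail_def)
        then show ?thesis using S.hom_zero by (auto simp: forms_def)
      next
        case False
        have "?p i \<in> carrier S" using p unfolding Tail_def Qh_carrier by blast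
        then obtain f where f: "f \<in> P n" "?p i = \<delta> f" using S.surj by blast
        have i: "i = int (nat i)" "r \<le> nat i" using False by auto
        have "nf f \<in> V (nat i)" using V_r[OF i(2)] nf_span by simp
        then show ?thesis using \<delta>_form[OF f(1), of "nat i"] f(2) i(1) by simp
      qed
      moreover have "finite {i. ?p i \<noteq> \<zero>\<^bsub>S\<^esub>}" using p by (simp add: Tail_def Qh_carrier)
      ultimately show ?thesis by (simp add: Remb_iff)
    qed
    then show "\<phi> \<in> conductor n I" using \<phi> by (simp add: conductor_def Tail_def)
  qed
  show "conductor n I \<subseteq> Tail r"
  proof
    fix \<phi> assume "\<phi> \<in> conductor n I"
    then have \<phi>: "\<phi> \<in> carrier (Qh n I)" "\<And>\<psi>. \<psi> \<in> Rtilde n I \<Longrightarrow> \<phi> \<otimes>\<^bsub>Qh n I\<^esub> \<psi> \<in> carrier (Remb n I)"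
      by (auto simp: conductor_def)
    have "\<phi> i = \<zero>\<^bsub>S\<^esub>" if i: "i < int r" for i
    proof (rule ccontr)
      assume nz: "\<phi> i \<noteq> \<zero>\<^bsub>S\<^esub>"
      have "\<phi> i \<in> carrier S" using \<phi>(1) unfolding Qh_carrier by blast
      then obtain F where F: "F \<in> P n" "\<phi> i = \<delta> F" using S.surj by blast
      have "F \<notin> Ia" using nz F S.zero_iff by auto
      then obtain q where q: "q \<in> pts" "F \<notin> aff n q" using Ia_iff[OF F(1)] by blast
      obtain y where y: "y \<in> P n" "F * y - 1 \<in> aff n q" using aff_inverse[OF q(1) F(1) q(2)] by blast
      obtain f where f: "f \<in> P n" "nf (e q * f) \<notin> V (r - 1)" using CB[OF q(1)] by (auto simp: large_degree_def)
      \<comment> \<open>\<open>y\<close> inverts the coefficient at q and \<open>e q\<close> removes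
        the other points, so the coefficient times \<open>?g\<close> is \<open>e q * f\<close> in
        S.\<close>
      let ?g = "y * (e q * f)"
      have gP: "?g \<in> P n" using y f e(1)[OF q(1)] by simp
      have "laurent_monom S (\<delta> ?g) 0 \<in> Rtilde n I"
        using monom_carrier[OF gP, of 0] by (simp add: Rtilde_def laurent_monom_def)
      then have "(\<phi> \<otimes>\<^bsub>Qh n I\<^esub> laurent_monom S (\<delta> ?g) 0) i \<in> \<delta> ` forms i" using \<phi>(2) unfolding Remb_iff by blast
      then have "\<delta> (F * ?g) \<in> \<delta> ` forms i" using mult_monom[OF \<phi>(1) gP, of 0 i] F gP by (simp add: S.hom_mult)
      then obtain g where g: "g \<in> forms i" "F * ?g - g \<in> Ia" using \<delta>_forms[of "F * ?g" i] F gP by auto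
      have "(F * y - 1) * f \<in> aff n q" by (rule pidealD(5)[OF aff_pt_id[OF q(1)] f(1) y(2)])
      then have "e q * ((F * y - 1) * f) \<in> Ia" using e_mult_Ia[OF q(1), of "(F * y - 1) * f"] F y f by simp
      moreover have "e q * ((F * y - 1) * f) = F * ?g - e q * f" by (simp add: algebra_simps)
      ultimately have "e q * f - F * ?g \<in> Ia" using IaD(6) by (metis minus_diff_eq)
      then have ef: "e q * f - g \<in> Ia" using cg_trans g(2) by blast
      have "nf (e q * f) \<in> V (r - 1)"
      proof (cases "i < 0")
        case True
        then have "e q * f \<in> Ia" using ef g(1) forms_neg by auto
        then show ?thesis using nf_zero pv.subspace_0[OF V_subspace] by simp
      next
        case False
        then have "g \<in> form n (nat i)" using g(1) forms_nat[of "nat i"] by simp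
        then have "nf (e q * f) \<in> V (nat i)" using V_iff[of "e q * f" "nat i"] ef f e(1)[OF q(1)] by auto
        moreover have "nat i \<le> r - 1" using i False by linarith
        ultimately show ?thesis using V_mono by blast
      qed
      then show False using f(2) by simp
    qed
    then show "\<phi> \<in> Tail r" using \<phi>(1) by (simp add: Tail_def)
  qed
qed

lemma emb_image: "T \<subseteq> P n \<Longrightarrow> emb n I ` coord n I ` T = (\<lambda>f i. \<delta> (hcomp i f)) ` T"
  unfolding image_image by (intro image_cong) (auto simp: emb_coord)

end

context kaehler
begin

text \<open>By \<open>T_high\<close> both conditions hold in degrees at least n r in any case. What
  remains on either side is that the different vanishes in lower degrees.\<close>

theorem emb_different_iff: "emb n I ` kaehler_different n I Fs = Tail (n * r) \<longleftrightarrow> different_HF"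
proof -
  have TP: "T \<subseteq> P n" using pidealD(1)[OF T_id] by blast
  have em: "emb n I ` kaehler_different n I Fs = (\<lambda>f i. \<delta> (hcomp i f)) ` T"
    unfolding kaehler_eq by (rule emb_image[OF TP])
  show ?thesis
  proof
    assume eq: "emb n I ` kaehler_different n I Fs = Tail (n * r)"
    show different_HF
      unfolding different_HF_def
    proof
      fix i
      show "pv.dim (nf ` (T \<inter> forms i)) = (if i < int (n * r) then 0 else d)"
      proof (cases "i < int (n * r)")
        case True
        have z: "nf f = 0" if f: "f \<in> T \<inter> forms i" for f
        proof -
          have "(\<lambda>i. \<delta> (hcomp i f)) \<in> Tail (n * r)" using eq em f by blast
          then have "\<delta> (hcomp i f) = \<zero>\<^bsub>S\<^esub>" using True by (simp add: Tail_def)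
          moreover have "hcomp i f = f" "f \<in> P n" using f hcomp_same by (auto simp: forms_def)
          ultimately show ?thesis using S.zero_iff nf_zero by simp
        qed
        have "0 \<in> T \<inter> forms i" using pidealD(2)[OF T_id] by (simp add: forms_def)
        then have "0 \<in> nf ` (T \<inter> forms i)" using z by (metis imageI)
        then have "nf ` (T \<inter> forms i) = {0}" using z by (intro equalityI subsetI) (elim imageE, simp, simp)
        then show ?thesis using True dim_zero by simp
      next
        case False
        then have "nf ` (T \<inter> forms i) = C" using T_high[of i] by simp
        then show ?thesis using False dim_C by metis
      qed
    qed
  next
    assume HF: different_HF
    show "emb n I ` kaehler_different n I Fs = Tail (n * r)"
      unfolding em
    proof
      show "(\<lambda>f i. \<delta> (hcomp i f)) ` T \<subseteq> Tail (n * r)"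
      proof
        fix \<phi> assume "\<phi> \<in> (\<lambda>f i. \<delta> (hcomp i f)) ` T"
        then obtain f where f: "f \<in> T" "\<phi> = (\<lambda>i. \<delta> (hcomp i f))" by blast
        have fP: "f \<in> P n" using f TP by blast
        have "\<phi> = emb n I (coord n I f)" using emb_coord[OF fP] f(2) by simp
        then have "\<phi> \<in> carrier (Remb n I)" using fP by (simp add: Remb_def R.surj)
        then have "\<phi> \<in> carrier (Qh n I)" using Remb_Tail by (auto simp: Tail_def)
        moreover have "\<phi> i = \<zero>\<^bsub>S\<^esub>" if "i < int (n * r)" for i
        proof -
          have "hcomp i f \<in> Ia" using T_low[OF different_HF_imp[OF HF] f(1) that] I_Ia by blast
          then show ?thesis using S.zero_iff fP f(2) by simp
        qed
        ultimately show "\<phi> \<in> Tail (n * r)" by (simp add: Tail_def)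
      qed
      show "Tail (n * r) \<subseteq> (\<lambda>f i. \<delta> (hcomp i f)) ` T"
      proof
        fix \<phi> assume \<phi>: "\<phi> \<in> Tail (n * r)"
        have "\<exists>f. f \<in> T \<inter> forms i \<and> \<phi> i = \<delta> f" for i
        proof (cases "i < int (n * r)")
          case True
          then have "\<phi> i = \<delta> 0" using \<phi> S.hom_zero by (simp add: Tail_def)
          then show ?thesis using pidealD(2)[OF T_id] by (auto simp: forms_def intro!: exI[of _ 0])
        next
          case False
          have "\<phi> i \<in> carrier S" using \<phi> unfolding Tail_def Qh_carrier by blast
          then obtain g where g: "g \<in> P n" "\<phi> i = \<delta> g" using S.surj by blast
          have "nf g \<in> nf ` (T \<inter> forms i)" using T_high[of i] False nf_span by simp
          then obtain f where f: "f \<in> T \<inter> forms i" "nf g = nf f" by blast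
          then have "\<delta> g = \<delta> f" using S.ker[OF g(1), of f] nf_eq_iff[OF g(1), of f] TP by auto
          then show ?thesis using f g by metis
        qed
        then obtain F where F: "\<And>i. F i \<in> T \<inter> forms i \<and> \<phi> i = \<delta> (F i)" by metis
        let ?D = "{i. \<phi> i \<noteq> \<zero>\<^bsub>S\<^esub>}"
        let ?f = "\<Sum>i\<in>?D. F i"
        have finD: "finite ?D" using \<phi> by (simp add: Tail_def Qh_carrier)
        have hc: "hcomp j ?f = (if j \<in> ?D then F j else 0)" for j
        proof -
          have "hcomp j (F i) = (if i = j then F j else 0)" for i
            using F[of i] hcomp_homog[of i "F i" j] by (auto simp: forms_def)
          then have "hcomp j ?f = (\<Sum>i\<in>?D. if i = j then F j else 0)" by (simp only: hcomp_sum)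
          then show ?thesis using finD by (simp add: sum.delta)
        qed
        have "\<phi> = (\<lambda>i. \<delta> (hcomp i ?f))"
        proof
          fix i show "\<phi> i = \<delta> (hcomp i ?f)" unfolding hc using F[of i] S.hom_zero by auto
        qed
        moreover have "?f \<in> T" using F by (intro pidealD(8)[OF T_id]) auto
        ultimately show "\<phi> \<in> (\<lambda>f i. \<delta> (hcomp i f)) ` T" by blast
      qed
    qed
  qed
qed

text \<open>Otherwise the component of \<open>S\<close> at \<open>q\<close> lifts to a space \<open>W\<close> of forms of degree \<open>r - 1\<close>, and the absence
  of relations of degree \<open>r\<close> turns multiplication by \<open>X\<^sub>1\<close> into an endomorphism of \<open>W\<close>: every \<open>g \<in> W\<close>
  satisfies \<open>X\<^sub>1\<^sup>k g \<in> X\<^sub>0\<^sup>k W\<close> for all \<open>k\<close>, hence vanishes.\<close>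

lemma no_small_forms_large_degree:
  assumes A: no_small_forms and q: "q \<in> pts" and r: "r > 0"
  shows "large_degree q"
proof (rule ccontr)
  assume "\<not> ?thesis"
  then have all: "nf (e q * f) \<in> V (r - 1)" if "f \<in> P n" for f using that by (auto simp: large_degree_def)
  let ?W = "{g \<in> form n (r - 1). \<exists>f\<in>P n. g - e q * f \<in> Ia}"
  have W: "\<exists>g\<in>?W. g - e q * f \<in> Ia" if f: "f \<in> P n" for f
  proof -
    obtain g where g: "g \<in> form n (r - 1)" "e q * f - g \<in> Ia"
      using all[OF f] V_iff[of "e q * f"] f e(1)[OF q] by auto
    then have "g - e q * f \<in> Ia" using IaD(6)[OF g(2)] by simp
    then show ?thesis using g(1) f by blast
  qed
  have step: "\<exists>g'\<in>?W. indet 1 * g = indet 0 * g'" if gW: "g \<in> ?W" for g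
  proof -
    obtain f where g: "g \<in> form n (r - 1)" "f \<in> P n" "g - e q * f \<in> Ia" using gW by blast
    have 1: "(1::nat) \<le> n" using n2 by simp
    obtain g' where g': "g' \<in> ?W" "g' - e q * (indet 1 * f) \<in> Ia" using W[of "indet 1 * f"] g(2) 1 by auto
    have "indet 1 * (g - e q * f) \<in> Ia" using IaD(4)[OF P_indet[OF 1] g(3)] .
    then have a: "indet 1 * g - e q * (indet 1 * f) \<in> Ia" by (simp add: algebra_simps)
    have g'f: "g' \<in> form n (r - 1)" using g'(1) by blast
    have b: "e q * (indet 1 * f) - g' \<in> Ia" using IaD(6)[OF g'(2)] by simp
    have c: "g' - indet 0 * g' \<in> Ia" using IaD(6)[OF X0_cg[OF form_P[OF g'f]]] by simp
    have Ia: "indet 1 * g - indet 0 * g' \<in> Ia" by (rule cg_trans[OF cg_trans[OF a b] c])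
    have fm: "indet 1 * g - indet 0 * g' \<in> form n r"
      using pv.subspace_diff[OF form_subspace form_indet[OF 1 g(1)] form_X0[OF g'f]] r by simp
    then have "indet 1 * g - indet 0 * g' \<in> I" using Ia form_Ia by blast
    then have "indet 1 * g - indet 0 * g' = 0" using A fm unfolding no_small_forms_def by blast
    then show ?thesis using g'(1) by auto
  qed
  have iter: "\<exists>g'\<in>?W. indet 1 ^ k * g = indet 0 ^ k * g'" if gW: "g \<in> ?W" for g k
  proof (induction k)
    case 0
    show ?case using gW by (intro bexI[of _ g]) auto
  next
    case (Suc k)
    then obtain g' where g': "g' \<in> ?W" "indet 1 ^ k * g = indet 0 ^ k * g'" by blast
    obtain g'' where g'': "g'' \<in> ?W" "indet 1 * g' = indet 0 * g''" using step[OF g'(1)] by blast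
    have "indet 1 ^ Suc k * g = indet 1 * (indet 1 ^ k * g)" by (simp add: mult.assoc)
    also have "\<dots> = indet 0 ^ k * (indet 1 * g')" unfolding g'(2) by (simp add: mult.left_commute)
    also have "\<dots> = indet 0 ^ Suc k * g''" unfolding g''(2) by (simp add: ac_simps)
    finally show ?case using g''(1) by blast
  qed
  obtain g where g: "g \<in> ?W" "g - e q * 1 \<in> Ia" using W[OF P_one] by blast
  have "g \<noteq> 0"
  proof
    assume "g = 0"
    then have "e q \<in> Ia" using IaD(6)[OF g(2)] by simp
    then have "e q \<in> aff n q" using aff_pt_super[OF q] by blast
    then have "e q + (1 - e q) \<in> aff n q" using pidealD(3)[OF aff_pt_id[OF q] _ e(3)[OF q]] by blast
    then show False using one_notin_aff[OF q] by simp
  qed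
  then obtain m where m: "lkp g m \<noteq> 0" by (metis lookup_zero poly_mapping_eqI)
  have gf: "g \<in> form n (r - 1)" using g(1) by blast
  have mdeg: "mdeg m = r - 1" using gf m by (auto simp: form_def homog_iff)
  \<comment> \<open>The exponent r exceeds the degree r - 1 of g: the left side contains X_1^r m for
    the monomial m of g, whose X_0-exponent is below r, while the right side is divisible by
    X_0^r.\<close>
  obtain g' where g': "indet 1 ^ r * g = indet 0 ^ r * g'" using iter[OF g(1), of r] by blast
  have lk: "lkp (pp a * f) (a + b) = lkp f b" for a b :: "nat \<Rightarrow>\<^sub>0 nat" and f :: "'k mpoly"
    by (induction f rule: pm_induct) (auto simp: distrib_left lookup_add mult_single lookup_single when_def)
  have lk0: "lkp (pp (Poly_Mapping.single i k) * f) b = 0" if "lkp b i < k" for i k b and f :: "'k mpoly"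
  proof (induction f rule: pm_induct)
    case (single m' c)
    have "Poly_Mapping.single i k + m' \<noteq> b" using that by (auto simp: lookup_add)
    then show ?case by (simp add: mult_single lookup_single when_def)
  qed (auto simp: distrib_left lookup_add)
  have "lkp (indet 1 ^ r * g) (Poly_Mapping.single 1 r + m) \<noteq> 0"
    unfolding indet_power_eq lk using m .
  moreover have "lkp (indet 0 ^ r * g') (Poly_Mapping.single 1 r + m) = 0"
  proof -
    have "lkp (Poly_Mapping.single 1 r + m) 0 = lkp m 0" by (simp add: lookup_add lookup_single)
    also have "\<dots> < r" using lookup_le_mdeg[of m 0] mdeg r by simp
    finally show ?thesis unfolding indet_power_eq by (rule lk0)
  qed
  ultimately show False using g' by simp
qed

end

section \<open>Degrees of points, the Cayley-Bacharach property and the equivalences\<close>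

section \<open>Cayley-Bacharach schemes\<close>

context zdim
begin

abbreviation lo :: "'k mpoly set \<Rightarrow> 'k mpoly \<Rightarrow> ('k mpoly \<times> 'k mpoly) set" where
  "lo q \<equiv> zdim_point.loc n I q"

text \<open>An element of S is a set of cosets of I, and \<open>germ\<close> ranges over the
  polynomials in all of them. Together these are just one coset of \<open>Ia\<close>.\<close>

lemma Union_\<delta>: assumes f: "f \<in> P n" shows "\<Union> (\<delta> f) = {g \<in> P n. g - f \<in> Ia}"
proof -
  have "\<delta> f = (\<lambda>a. coord n I (a + f)) ` Ia"
    unfolding \<delta>_def deh_def a_r_coset_def' affine_ideal_eq
    using R.hom_add[OF pidealD(1)[OF Ia_id] f] by auto
  then have 1: "\<Union> (\<delta> f) = (\<Union>a\<in>Ia. coord n I (a + f))" by simp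
  show ?thesis
    unfolding 1
  proof (intro Set.set_eqI iffI)
    fix g assume "g \<in> (\<Union>a\<in>Ia. coord n I (a + f))"
    then obtain a where a: "a \<in> Ia" "g \<in> coord n I (a + f)" by blast
    then have g: "g \<in> P n" "g - (a + f) \<in> I" using coord_mem[of "a + f" g] f pidealD(1)[OF Ia_id] by auto
    have "g - (a + f) \<in> Ia" using g(2) I_Ia by blast
    then have "(g - (a + f)) + a \<in> Ia" using pidealD(3)[OF Ia_id _ a(1)] by blast
    then show "g \<in> {g \<in> P n. g - f \<in> Ia}" using g(1) by simp
  next
    fix g assume g: "g \<in> {g \<in> P n. g - f \<in> Ia}"
    then have "g \<in> coord n I ((g - f) + f)" using coord_mem[of g g] pidealD(2)[OF I_id] by simp
    then show "g \<in> (\<Union>a\<in>Ia. coord n I (a + f))" using g by blast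
  qed
qed

text \<open>The quotient of a component by its power of X_0 is the local image of that component,
  and these images add up to that of the whole polynomial; its class modulo \<open>Ia\<close>
  determines the result.\<close>

lemma germ_\<delta>: assumes q: "q \<in> pts" and f: "f \<in> P n" shows "germ n I q (\<delta> f) = lo q f"
proof -
  interpret L: zdim_point n I I q by (rule zdim_pointI[OF q])
  have val: "finsum (local_ring n I q) (\<lambda>i. hfrac n I q (hcomp (int i) g) (indet 0 ^ i)) (mdeg ` Poly_Mapping.keys g)
      = lo q g" if g: "g \<in> P n" for g
  proof -
    have "(\<lambda>i. hfrac n I q (hcomp (int i) g) (indet 0 ^ i)) = (\<lambda>i. lo q (hcomp (int i) g))"
      using g L.loc_homog[OF P_hcomp homog_hcomp] by (intro ext) simp
    moreover have "finsum (local_ring n I q) (\<lambda>i. lo q (hcomp (int i) g)) (mdeg ` Poly_Mapping.keys g)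
        = lo q (\<Sum>i\<in>mdeg ` Poly_Mapping.keys g. hcomp (int i) g)"
      by (rule L.L.hom_finsum) (use g in auto)
    moreover have "(\<Sum>i\<in>mdeg ` Poly_Mapping.keys g. hcomp (int i) g) = (\<Sum>i\<in>int ` mdeg ` Poly_Mapping.keys g. hcomp i g)"
      by (simp add: sum.reindex)
    moreover have "\<dots> = g" by (rule sum_hcomp) auto
    ultimately show ?thesis by simp
  qed
  have "lo q g = lo q f" if "g \<in> P n" "g - f \<in> Ia" for g
    using L.loc_eq_iff[OF that(1) f] aff_pt_super[OF q] that(2) by blast
  then have "(\<lambda>g. finsum (local_ring n I q) (\<lambda>i. hfrac n I q (hcomp (int i) g) (indet 0 ^ i)) (mdeg ` Poly_Mapping.keys g)) `
      {g \<in> P n. g - f \<in> Ia} = (\<lambda>g. lo q f) ` {g \<in> P n. g - f \<in> Ia}"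
    using val by (intro image_cong) auto
  moreover have "f \<in> {g \<in> P n. g - f \<in> Ia}" using f pidealD(2)[OF Ia_id] by simp
  ultimately have "(\<lambda>g. finsum (local_ring n I q) (\<lambda>i. hfrac n I q (hcomp (int i) g) (indet 0 ^ i)) (mdeg ` Poly_Mapping.keys g)) `
      {g \<in> P n. g - f \<in> Ia} = {lo q f}" by blast
  then show ?thesis unfolding germ_def Union_\<delta>[OF f] by simp
qed

text \<open>Germs at all points determine an element of S, so the one with germ a at q and 0
  elsewhere is the class of \<open>e q * f\<close>. Its least degree is where it enters the
  filtration \<open>V\<close>.\<close>

lemma mu_loc:
  assumes q: "q \<in> pts" and f: "f \<in> P n"
  shows "mu n I q (lo q f) = (LEAST i. nf (e q * f) \<in> V i)"
proof -
  have efP: "e q * f \<in> P n" using e(1)[OF q] f by simp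
  have germs: "(\<forall>q'\<in>pts. germ n I q' (\<delta> g) = (if q' = q then lo q f else \<zero>\<^bsub>local_ring n I q'\<^esub>)) \<longleftrightarrow> \<delta> g = \<delta> (e q * f)"
    if g: "g \<in> P n" for g
  proof -
    have "germ n I q' (\<delta> g) = (if q' = q then lo q f else \<zero>\<^bsub>local_ring n I q'\<^esub>) \<longleftrightarrow> g - e q * f \<in> aff n q'"
      if q': "q' \<in> pts" for q'
    proof -
      interpret L: zdim_point n I I q' by (rule zdim_pointI[OF q'])
      have "(if q' = q then lo q f else \<zero>\<^bsub>local_ring n I q'\<^esub>) = lo q' (e q * f)"
      proof (cases "q' = q")
        case True
        have "(1 - e q) * f \<in> aff n q" by (rule pidealD(5)[OF aff_pt_id[OF q] f e(3)[OF q]])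
        then have "f - e q * f \<in> aff n q" by (simp add: left_diff_distrib)
        then show ?thesis using L.loc_eq_iff[OF f efP] True by simp
      next
        case False
        have "e q * f \<in> aff n q'" by (rule pidealD(5)[OF aff_pt_id[OF q'] f e(2)[OF q q' False]])
        then show ?thesis using L.L.zero_iff[OF efP] False by simp
      qed
      then show ?thesis using germ_\<delta>[OF q' g] L.loc_eq_iff[OF g efP] by simp
    qed
    then have "(\<forall>q'\<in>pts. germ n I q' (\<delta> g) = (if q' = q then lo q f else \<zero>\<^bsub>local_ring n I q'\<^esub>)) \<longleftrightarrow>
        (\<forall>q'\<in>pts. g - e q * f \<in> aff n q')" by (intro ball_cong refl)
    then show ?thesis using S.ker[OF g efP] Ia_iff[of "g - e q * f"] g efP by simp
  qed
  have "(\<exists>s\<in>carrier S. (\<forall>q'\<in>pts. germ n I q' s = (if q' = q then lo q f else \<zero>\<^bsub>local_ring n I q'\<^esub>)) \<and>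
      laurent_monom S s (int i) \<in> carrier (Remb n I)) \<longleftrightarrow> nf (e q * f) \<in> V i" (is "?l \<longleftrightarrow> ?r") for i
  proof
    assume ?l
    then obtain g where g: "g \<in> P n" "\<forall>q'\<in>pts. germ n I q' (\<delta> g) = (if q' = q then lo q f else \<zero>\<^bsub>local_ring n I q'\<^esub>)"
      "laurent_monom S (\<delta> g) (int i) \<in> carrier (Remb n I)" unfolding S.surj by blast
    have "\<delta> g = \<delta> (e q * f)" using germs[OF g(1)] g(2) by blast
    then have "laurent_monom S (\<delta> (e q * f)) (int i) \<in> carrier (Remb n I)" using g(3) by simp
    then show ?r using monom_Remb[OF efP] \<delta>_form[OF efP] by blast
  next
    assume ?r
    then have "laurent_monom S (\<delta> (e q * f)) (int i) \<in> carrier (Remb n I)"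
      using monom_Remb[OF efP] \<delta>_form[OF efP] by blast
    moreover have "\<forall>q'\<in>pts. germ n I q' (\<delta> (e q * f)) = (if q' = q then lo q f else \<zero>\<^bsub>local_ring n I q'\<^esub>)"
      using germs[OF efP] by blast
    ultimately show ?l using S.in_carrier[OF efP] by blast
  qed
  then show ?thesis unfolding mu_def by presburger
qed

text \<open>This turns out to be the degree of the point q in the scheme; it mentions neither a
  subscheme nor a residue basis.\<close>

definition component_degree where
  "component_degree q = (LEAST i. \<forall>f\<in>P n. nf (e q * f) \<in> V i)"

lemma component_degree: "f \<in> P n \<Longrightarrow> nf (e q * f) \<in> V (component_degree q)"
  and component_degree_le: "component_degree q \<le> r"
proof -
  have "\<forall>f\<in>P n. nf (e q * f) \<in> V r" using V_r[of r] nf_span by blast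
  then have "\<forall>f\<in>P n. nf (e q * f) \<in> V (component_degree q)" "component_degree q \<le> r"
    unfolding component_degree_def by (rule LeastI, rule Least_le)
  then show "f \<in> P n \<Longrightarrow> nf (e q * f) \<in> V (component_degree q)" "component_degree q \<le> r" by blast+
qed

lemma large_degree_iff: assumes "r > 0" shows "large_degree q \<longleftrightarrow> component_degree q = r"
proof
  assume "large_degree q"
  then obtain f where f: "f \<in> P n" "nf (e q * f) \<notin> V (r - 1)" by (auto simp: large_degree_def)
  show "component_degree q = r"
  proof (rule ccontr)
    assume "component_degree q \<noteq> r"
    then have "component_degree q \<le> r - 1" using component_degree_le[of q] by simp
    then show False using V_mono component_degree[OF f(1)] f(2) by blast
  qed
next
  assume c: "component_degree q = r"
  show "large_degree q"
  proof (rule ccontr)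
    assume "\<not> ?thesis"
    then have "\<forall>f\<in>P n. nf (e q * f) \<in> V (r - 1)" by (auto simp: large_degree_def)
    then have "component_degree q \<le> r - 1" unfolding component_degree_def by (rule Least_le)
    then show False using c assms by simp
  qed
qed

text \<open>The socle generator is a unit of the field \<open>\<O>\<^bsub>X,q\<^esub>\<close>, so its multiples by a residue basis
  span the whole component at \<open>q\<close>.\<close>

lemma mu_subscheme_eq:
  assumes q: "q \<in> pts" and m: "mu_subscheme n I q J m" shows "m = component_degree q"
proof -
  interpret L: zdim_point n I I q by (rule zdim_pointI[OF q])
  obtain s es where s: "socle_generator n I q J s" and es: "residue_basis n I q es"
    and m: "m = Max ((\<lambda>a. mu n I q (a \<otimes>\<^bsub>local_ring n I q\<^esub> s)) ` set es)"
    using m by (auto simp: mu_subscheme_def)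
  have "s \<in> carrier (local_ring n I q)" "s \<noteq> \<zero>\<^bsub>local_ring n I q\<^esub>"
    using s by (auto simp: socle_generator_def socle_def)
  then obtain c where c: "c \<in> P n" "s = lo q c" "c \<notin> aff n q" unfolding L.L.surj using L.L.zero_iff by blast
  obtain y where y: "y \<in> P n" "c * y - 1 \<in> aff n q" using aff_inverse[OF q c(1,3)] by blast
  define \<nu> where "\<nu> g = (LEAST i. nf (e q * g) \<in> V i)" for g
  have \<nu>: "nf (e q * g) \<in> V (\<nu> g)" "\<nu> g \<le> component_degree q" if g: "g \<in> P n" for g
  proof -
    show "nf (e q * g) \<in> V (\<nu> g)" unfolding \<nu>_def by (rule LeastI) (rule component_degree[OF g])
    show "\<nu> g \<le> component_degree q" unfolding \<nu>_def by (rule Least_le) (rule component_degree[OF g])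
  qed
  have mu: "mu n I q (lo q g \<otimes>\<^bsub>local_ring n I q\<^esub> s) = \<nu> (g * c)" if g: "g \<in> P n" for g
    using mu_loc[OF q, of "g * c"] L.L.hom_mult[OF g c(1)] g c by (simp add: \<nu>_def)
  have esc: "\<exists>g\<in>P n. a = lo q g" if "a \<in> set es" for a
    using es that L.L.surj unfolding residue_basis_def by blast
  have span: "ring.Span (residue_field n I q) L.F.K (map (residue_class n I q) es) = carrier (residue_field n I q)"
    using es unfolding residue_basis_def L.residue_const_eq[abs_def] by blast
  have ne: "es \<noteq> []"
  proof
    assume "es = []"
    then have "carrier (residue_field n I q) = {\<zero>\<^bsub>residue_field n I q\<^esub>}"
      using span ring.Span.simps(1)[OF L.F.ring_A] by simp
    then have "L.res 1 = \<zero>\<^bsub>residue_field n I q\<^esub>" using L.F.in_carrier[OF P_one] by simp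
    then show False using L.F.zero_iff[OF P_one] one_notin_aff[OF q] by simp
  qed
  have le: "m \<le> component_degree q"
  proof -
    have "mu n I q (a \<otimes>\<^bsub>local_ring n I q\<^esub> s) \<le> component_degree q" if a: "a \<in> set es" for a
    proof -
      obtain g where g: "g \<in> P n" "a = lo q g" using esc[OF a] by blast
      show ?thesis unfolding g(2) mu[OF g(1)] by (rule \<nu>(2)) (use g(1) c(1) in simp)
    qed
    then show ?thesis unfolding m using ne by simp
  qed
  let ?W = "{f \<in> P n. nf (e q * (f * c)) \<in> V m}"
  have Wsub: "pv.subspace ?W"
  proof (rule pv.subspaceI)
    show "0 \<in> ?W" using pv.subspace_0[OF V_subspace] by (simp add: nfD)
  next
    fix f g assume "f \<in> ?W" "g \<in> ?W"
    then show "f + g \<in> ?W" using pv.subspace_add[OF V_subspace, of "nf (e q * (f * c))" m "nf (e q * (g * c))"]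
      by (simp add: distrib_right distrib_left nfD)
  next
    fix a f assume f: "f \<in> ?W"
    have "e q * (Cst a * f * c) = Cst a * (e q * (f * c))" by (simp add: ac_simps)
    then have "nf (e q * (Cst a * f * c)) = Cst a * nf (e q * (f * c))" by (simp only: nfD)
    then show "scl a f \<in> ?W" using f pv.subspace_scale[OF V_subspace, of "nf (e q * (f * c))" m a]
      by (simp add: scl_def nfD)
  qed
  have "set (map (residue_class n I q) es) \<subseteq> L.res ` ?W"
  proof
    fix x assume "x \<in> set (map (residue_class n I q) es)"
    then obtain a where a: "a \<in> set es" "x = residue_class n I q a" by auto
    obtain g where g: "g \<in> P n" "a = lo q g" using esc[OF a(1)] by blast
    have "mu n I q (a \<otimes>\<^bsub>local_ring n I q\<^esub> s) \<le> m" unfolding m using a(1) by (intro Max_ge) auto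
    then have le: "\<nu> (g * c) \<le> m" using mu[OF g(1)] g(2) by simp
    have "nf (e q * (g * c)) \<in> V m"
      by (rule subsetD[OF V_mono[OF le] \<nu>(1)[OF P_mult[OF g(1) c(1)]]])
    then have "g \<in> ?W" using g(1) by simp
    moreover have "x = L.res g" using a(2) g(2) by (simp only: L.res_def)
    ultimately show "x \<in> L.res ` ?W" by (intro image_eqI)
  qed
  then have "carrier (residue_field n I q) \<subseteq> L.res ` ?W"
    unfolding span[symmetric] by (intro L.F.Span_subset[OF Wsub]) auto
  then have W: "L.res ` P n \<subseteq> L.res ` ?W" unfolding L.F.surj .
  have "nf (e q * f) \<in> V m" if f: "f \<in> P n" for f
  proof -
    \<comment> \<open>As c y is 1 at q, the value of f there is that of (f y) c. The factor f y is
      exchanged for a representative \<open>w\<close> in \<open>?W\<close> of the same residue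
      class.\<close>
    have "L.res (f * y) \<in> L.res ` ?W" by (rule subsetD[OF W imageI[OF P_mult[OF f y(1)]]])
    then obtain w where w: "w \<in> ?W" "L.res (f * y) = L.res w" by blast
    have wP: "w \<in> P n" using w(1) by blast
    have "f * y - w \<in> aff n q" using L.F.ker[of "f * y" w] w(2) f y(1) wP by simp
    then have 1: "(f * y - w) * c \<in> aff n q" by (rule pidealD(5)[OF aff_pt_id[OF q] c(1)])
    have 2: "f * (c * y - 1) \<in> aff n q" by (rule pidealD(4)[OF aff_pt_id[OF q] f y(2)])
    have "(f * y - w) * c - f * (c * y - 1) = f - w * c" by (simp add: algebra_simps)
    then have "f - w * c \<in> aff n q" using pidealD(7)[OF aff_pt_id[OF q] 1 2] by simp
    then have "e q * (f - w * c) \<in> Ia" using e_mult_Ia[OF q, of "f - w * c"] f wP c(1) by simp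
    then have "nf (e q * f - e q * (w * c)) = 0" using nf_zero by (simp add: right_diff_distrib)
    then have "nf (e q * f) = nf (e q * (w * c))" by (simp add: nfD)
    then show ?thesis using w(1) by simp
  qed
  then have "component_degree q \<le> m" unfolding component_degree_def by (intro Least_le) blast
  then show ?thesis using le by simp
qed

text \<open>The ideal of the scheme without the point q. Since the local ring at q is a field,
  removing q altogether is what a maximal subscheme at q does there.\<close>

definition others :: "'k mpoly set \<Rightarrow> 'k mpoly set" where
  "others q = {f \<in> P n. \<forall>q'\<in>pts - {q}. f \<in> q'}"

lemma others_hom: "homogeneous_ideal n (others q)" and I_others: "I \<subseteq> others q"
proof -
  have d: "pideal n q'" if "q' \<in> pts - {q}" for q' using ptsD(2) that by blast
  have "pideal n (others q)"
    unfolding pideal_def others_def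
    by (auto intro: pidealD(2)[OF d] pidealD(3)[OF d] pidealD(4)[OF d])
  moreover have "hcomp i f \<in> others q" if "f \<in> others q" for f i
    using that homogeneous_idealD(2)[OF ptsD(1)] by (auto simp: others_def)
  ultimately show "homogeneous_ideal n (others q)" by (simp add: homogeneous_ideal_iff)
  show "I \<subseteq> others q" using I_eq by (auto simp: others_def)
qed

lemmas others_id = homogeneous_idealD(1)[OF others_hom]

lemma others_zpt: "q' \<in> pts \<Longrightarrow> q' \<noteq> q \<Longrightarrow> zdim_point n I (others q) q'"
  using others_id I_others by unfold_locales (auto simp: others_def)

lemma others_proj: "proj_subscheme n (others q)"
  unfolding proj_subscheme_def
proof (intro conjI ballI impI others_hom)
  fix f assume f: "f \<in> P n" "\<forall>i\<le>n. indet i * f \<in> others q"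
  then have "indet 0 * f \<in> others q" by simp
  then show "f \<in> others q" using f(1) pt_nzd by (auto simp: others_def)
qed

lemma others_sep: assumes "q \<in> pts" obtains h where "h \<in> others q" "h \<in> P n - q" "\<exists>d. homog d h"
proof -
  obtain h where h: "h \<in> P n" "\<exists>d. homog d h" "h \<notin> q" "\<And>q'. q' \<in> pts \<Longrightarrow> q' \<noteq> q \<Longrightarrow> h \<in> q'"
    using separating_form[OF assms] by blast
  show thesis by (rule that[of h]) (use h in \<open>auto simp: others_def\<close>)
qed

lemma others_points: assumes q: "q \<in> pts" shows "closed_points n (others q) = pts - {q}"
proof -
  have "points n (others q) = pts - {q}"
  proof
    show "points n (others q) \<subseteq> pts - {q}"
    proof
      fix p assume p: "p \<in> points n (others q)"
      then have "p \<in> points n I" using I_others unfolding points_def by blast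
      then have "p \<in> pts" by (simp only: pts_eq)
      moreover have "others q \<subseteq> p" using pointsD(4)[OF p] .
      moreover obtain h where "h \<in> others q" "h \<in> P n - q" using others_sep[OF q] by metis
      ultimately have "p \<noteq> q" by blast
      with \<open>p \<in> pts\<close> show "p \<in> pts - {q}" by blast
    qed
    show "pts - {q} \<subseteq> points n (others q)"
    proof
      fix p assume p: "p \<in> pts - {q}"
      then have "p \<in> points n I" by (simp only: pts_eq) blast
      moreover have "others q \<subseteq> p" using p by (auto simp: others_def)
      ultimately show "p \<in> points n (others q)" unfolding points_def by blast
    qed
  qed
  then show ?thesis using pts_max unfolding closed_points_def[of n "others q"] by blast
qed

text \<open>A separating form lies in the ideal but outside q, so it kills every numerator. All
  fractions are equivalent, and the local ring of the subscheme at q is zero.\<close>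

lemma hfrac_others:
  assumes q: "q \<in> pts" and fg: "(f, g) \<in> hfracs n q" shows "hfrac n (others q) q f g = hfracs n q"
proof -
  obtain h where h: "h \<in> others q" "h \<in> P n - q" "\<exists>d. homog d h" using others_sep[OF q] by blast
  have "h * (f * g' - f' * g) \<in> others q" if "(f', g') \<in> hfracs n q" for f' g'
    using that fg by (intro pidealD(5)[OF others_id _ h(1)]) (auto simp: hfracs_def)
  then show ?thesis unfolding hfrac_def using h by auto
qed

lemma restrict_others_eq:
  assumes q: "q \<in> pts" and a: "a \<in> carrier (local_ring n I q)"
  shows "restrict_germ n (others q) q a = hfracs n q"
proof -
  interpret L: zdim_point n I I q by (rule zdim_pointI[OF q])
  obtain f g where fg: "(f, g) \<in> hfracs n q" "a = hfrac n I q f g" using a by (auto simp: local_ring_def)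
  have sub: "a \<subseteq> hfracs n q" using fg(2) by (auto simp: hfrac_def)
  have "(f, g) \<in> a" using L.hp.hfrac_self[OF fg(1)] fg(2) by simp
  moreover have "hfrac n (others q) q f' g' = hfracs n q" if "(f', g') \<in> a" for f' g'
    using hfrac_others[OF q] sub that by blast
  ultimately show ?thesis unfolding restrict_germ_def by blast
qed

text \<open>At another point both local rings are \<open>P n\<close> modulo the same ideal
  \<open>aff n q'\<close>, and restriction matches the images of a polynomial.\<close>

lemma restrict_others_iso:
  assumes q': "q' \<in> pts" "q' \<noteq> q"
  shows "restrict_germ n (others q) q' \<in> ring_iso (local_ring n I q') (local_ring n (others q) q')"
proof -
  interpret L: zdim_point n I I q' by (rule zdim_pointI[OF q'(1)])
  interpret M: zdim_point n I "others q" q' by (rule others_zpt[OF q'])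
  have rs: "restrict_germ n (others q) q' (L.loc f) = M.loc f" if f: "f \<in> P n" for f
  proof -
    obtain F G where FG: "(F, G) \<in> hfracs n q'" "L.loc f = hfrac n I q' F G" "L.Q.cg F (f * G)"
      using L.loc_rep[OF f] by blast
    have Mf: "M.loc f = hfrac n (others q) q' F G" by (rule M.loc_eqI[OF f FG(1,3)])
    have "hfrac n (others q) q' a b = M.loc f" if ab: "(a, b) \<in> L.loc f" for a b
    proof -
      have h: "(a, b) \<in> hfracs n q'" "L.hp.eqv F G a b" using ab unfolding FG(2) L.hp.hfrac_eq by auto
      then have "hfrac n I q' F G = hfrac n I q' a b" using L.hp.hfrac_eq_iff[OF FG(1) h(1)] by blast
      then have "F * b - a * G \<in> aff n q'" using L.hfrac_eq_iff[OF FG(1) h(1)] by blast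
      then show ?thesis unfolding Mf using M.hfrac_eq_iff[OF FG(1) h(1)] by simp
    qed
    moreover have "(F, G) \<in> L.loc f" unfolding FG(2) by (rule L.hp.hfrac_self[OF FG(1)])
    ultimately show ?thesis unfolding restrict_germ_def by blast
  qed
  show ?thesis
  proof (rule ring_iso_memI)
    fix x assume "x \<in> carrier (local_ring n I q')"
    then obtain f where f: "f \<in> P n" "x = L.loc f" unfolding L.L.surj by blast
    show "restrict_germ n (others q) q' x \<in> carrier (local_ring n (others q) q')"
      using f rs M.L.in_carrier by simp
    fix y assume "y \<in> carrier (local_ring n I q')"
    then obtain g where g: "g \<in> P n" "y = L.loc g" unfolding L.L.surj by blast
    show "restrict_germ n (others q) q' (x \<otimes>\<^bsub>local_ring n I q'\<^esub> y) =
        restrict_germ n (others q) q' x \<otimes>\<^bsub>local_ring n (others q) q'\<^esub> restrict_germ n (others q) q' y"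
      using f g by (simp add: rs L.L.hom_mult M.L.hom_mult)
    show "restrict_germ n (others q) q' (x \<oplus>\<^bsub>local_ring n I q'\<^esub> y) =
        restrict_germ n (others q) q' x \<oplus>\<^bsub>local_ring n (others q) q'\<^esub> restrict_germ n (others q) q' y"
      using f g by (simp add: rs L.L.hom_add M.L.hom_add)
  next
    show "restrict_germ n (others q) q' \<one>\<^bsub>local_ring n I q'\<^esub> = \<one>\<^bsub>local_ring n (others q) q'\<^esub>"
      unfolding L.L.hom_one M.L.hom_one by (rule rs[OF P_one])
    have "inj_on (restrict_germ n (others q) q') (L.loc ` P n)"
    proof (rule inj_onI)
      fix x y assume "x \<in> L.loc ` P n" "y \<in> L.loc ` P n"
        and eq: "restrict_germ n (others q) q' x = restrict_germ n (others q) q' y"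
      then obtain f g where fg: "f \<in> P n" "x = L.loc f" "g \<in> P n" "y = L.loc g" by blast
      then have "M.loc f = M.loc g" using eq rs by simp
      then show "x = y" using fg L.loc_eq_iff M.loc_eq_iff by simp
    qed
    moreover have "restrict_germ n (others q) q' ` L.loc ` P n = M.loc ` P n"
      unfolding image_image by (intro image_cong rs refl)
    ultimately show "bij_betw (restrict_germ n (others q) q') (carrier (local_ring n I q')) (carrier (local_ring n (others q) q'))"
      unfolding L.L.surj M.L.surj bij_betw_def by blast
  qed
qed

text \<open>Removing q drops the dimension of its component from the degree, and this dimension is
  the residue degree because the local ring is a field.\<close>

lemma maximal_others: assumes q: "q \<in> pts" shows "maximal_subscheme n I q (others q)"
  unfolding maximal_subscheme_def
proof (intro conjI ballI impI others_proj I_others)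
  interpret L: zdim_point n I I q by (rule zdim_pointI[OF q])
  show "restrict_germ n (others q) q \<notin> ring_iso (local_ring n I q) (local_ring n (others q) q)"
  proof
    assume "restrict_germ n (others q) q \<in> ring_iso (local_ring n I q) (local_ring n (others q) q)"
    then have "inj_on (restrict_germ n (others q) q) (carrier (local_ring n I q))"
      using ring_iso_memE(5) bij_betw_imp_inj_on by blast
    then have "L.loc 1 = L.loc 0"
      using restrict_others_eq[OF q] L.L.in_carrier[OF P_one] L.L.in_carrier[OF P_zero] by (metis inj_onD)
    then show False using L.loc_eq_iff[OF P_one P_zero] one_notin_aff[OF q] by simp
  qed
  show "restrict_germ n (others q) q' \<in> ring_iso (local_ring n I q') (local_ring n (others q) q')"
    if "q' \<in> pts" "q' \<noteq> q" for q'
    by (rule restrict_others_iso[OF that])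
  have "scheme_degree n (others q) = (\<Sum>q'\<in>pts - {q}. pv.dim (Uq q'))"
    unfolding scheme_degree_def others_points[OF q]
    using zdim_point.kdim_local[OF others_zpt] by (intro sum.cong) auto
  then show "scheme_degree n (others q) + residue_degree n I q = scheme_degree n I"
    unfolding scheme_degree_eq L.residue_degree_eq sum_dim_Uq[symmetric] using fin q by (simp add: sum.remove)
qed

text \<open>Restriction at q goes to the zero ring, so its kernel is the whole field, generated by
  1; the maximal ideal is 0, so 1 is in the socle.\<close>

lemma socle_others:
  assumes q: "q \<in> pts" shows "socle_generator n I q (others q) \<one>\<^bsub>local_ring n I q\<^esub>"
proof -
  interpret L: zdim_point n I I q by (rule zdim_pointI[OF q])
  interpret LR: cring "local_ring n I q" by (rule L.L.cring_A)
  have "\<zero>\<^bsub>local_ring n (others q) q\<^esub> = hfracs n q"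
    using hfrac_others[OF q L.hp.hfracs_zero_one] by (simp add: local_ring_def)
  then have "a_kernel (local_ring n I q) (local_ring n (others q) q) (restrict_germ n (others q) q) = carrier (local_ring n I q)"
    unfolding a_kernel_def' using restrict_others_eq[OF q] by blast
  moreover have "PIdl\<^bsub>local_ring n I q\<^esub> \<one>\<^bsub>local_ring n I q\<^esub> = carrier (local_ring n I q)"
  proof -
    have "PIdl\<^bsub>local_ring n I q\<^esub> \<one>\<^bsub>local_ring n I q\<^esub> = (\<lambda>x. x \<otimes>\<^bsub>local_ring n I q\<^esub> \<one>\<^bsub>local_ring n I q\<^esub>) ` carrier (local_ring n I q)"
      unfolding cgenideal_def by blast
    also have "\<dots> = (\<lambda>x. x) ` carrier (local_ring n I q)" by (intro image_cong) auto
    finally show ?thesis by simp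
  qed
  moreover have "\<one>\<^bsub>local_ring n I q\<^esub> \<noteq> \<zero>\<^bsub>local_ring n I q\<^esub>"
    using L.L.zero_iff[OF P_one] one_notin_aff[OF q] L.L.hom_one by simp
  moreover have "\<one>\<^bsub>local_ring n I q\<^esub> \<in> socle n I q" unfolding socle_def L.local_max_eq by simp
  ultimately show ?thesis by (simp add: socle_generator_def)
qed

text \<open>By \<open>mu_subscheme_eq\<close> every maximal subscheme at q yields the same number,
  and \<open>others q\<close> shows that one exists.\<close>

lemma point_degree_eq: assumes q: "q \<in> pts" shows "point_degree n I q = component_degree q"
  unfolding point_degree_def
proof (rule Least_equality)
  obtain es where es: "residue_basis n I q es" using zdim_point.residue_basis_exists[OF zdim_pointI[OF q]] by blast
  let ?m = "Max ((\<lambda>a. mu n I q (a \<otimes>\<^bsub>local_ring n I q\<^esub> \<one>\<^bsub>local_ring n I q\<^esub>)) ` set es)"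
  have m: "mu_subscheme n I q (others q) ?m"
    unfolding mu_subscheme_def using socle_others[OF q] es by blast
  show "\<exists>J. maximal_subscheme n I q J \<and> mu_subscheme n I q J (component_degree q)"
    using maximal_others[OF q] m mu_subscheme_eq[OF q m] by metis
  show "component_degree q \<le> m" if "\<exists>J. maximal_subscheme n I q J \<and> mu_subscheme n I q J m" for m
    using that mu_subscheme_eq[OF q] by blast
qed

theorem CB_iff: assumes "r > 0" shows "CB_scheme n I \<longleftrightarrow> (\<forall>q\<in>pts. large_degree q)"
  unfolding CB_scheme_def regularity_index_eq using point_degree_eq large_degree_iff[OF assms] by simp

text \<open>V_0 is spanned by the class of 1, so its dimension cannot reach d >= 2.\<close>

lemma r_pos: assumes "d \<ge> 2" shows "r > 0"
proof (rule ccontr)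
  assume "\<not> r > 0"
  then have "pv.dim (V 0) = d" using dim_V_eq[of 0] by simp
  moreover have "pv.dim (V 0) \<le> card (nf ` pp ` mons n 0)"
  proof (rule pv.dim_le_card)
    show "V 0 \<subseteq> pv.span (nf ` pp ` mons n 0)"
      unfolding V_def form_span pvp.linear_span_image[OF nf_lin] ..
    show "finite (nf ` pp ` mons n 0)" using card_mons(1)[of n 0] by simp
  qed
  moreover have "card (nf ` pp ` mons n 0) \<le> 1"
    by (rule order_trans[OF card_image_le order_trans[OF card_image_le]]) (use card_mons[of n 0] in simp_all)
  ultimately show False using assms by simp
qed

end

theorem proposition3p4:
  fixes n :: nat and I :: "'k::field mpoly set" and Fs :: "'k mpoly list"
  assumes n_ge_2: "n \<ge> 2"
    and scheme: "proj_subscheme n I"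
    and dim_0: "zero_dimensional n I"
    and reduced: "reduced_scheme n I"
    and degree: "scheme_degree n I \<ge> 2"
    and char_K: "CHAR('k) = 0 \<or> CHAR('k) > scheme_degree n I"
    and hyperplane: "\<forall>q\<in>closed_points n I. indet 0 \<notin> q"
    and generators: "homogeneous_generators n Fs I"
  shows
    "((generic_position n I \<and> scheme_degree n I = (n + initial_degree I - 1) choose n)
      \<longleftrightarrow>
      (\<forall>i::int. HF n I (kaehler_different n I Fs) i =
         (if i < int n * regularity_index n I then 0 else scheme_degree n I)))
     \<and>
     ((\<forall>i::int. HF n I (kaehler_different n I Fs) i =
         (if i < int n * regularity_index n I then 0 else scheme_degree n I))
      \<longleftrightarrow>
      (CB_scheme n I \<and>
       emb n I ` kaehler_different n I Fs = ideal_power (Remb n I) (conductor n I) n))"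
proof -
  \<comment> \<open>Over infinitely many points the sum that defines the degree would be 0.\<close>
  have fin: "finite (closed_points n I)"
  proof (rule ccontr)
    assume "infinite (closed_points n I)"
    then show False using degree by (simp add: scheme_degree_def)
  qed
  interpret zdim n I by (rule zdim.intro[OF scheme dim_0 reduced hyperplane fin])
  interpret kaehler n I Fs by unfold_locales (fact n_ge_2 char_K generators)+
  have b: "(\<forall>i::int. HF n I (kaehler_different n I Fs) i =
      (if i < int n * regularity_index n I then 0 else scheme_degree n I)) \<longleftrightarrow> different_HF"
    unfolding different_HF_def HF_kaehler regularity_index_eq scheme_degree_eq by simp
  have r: "r > 0" using r_pos degree scheme_degree_eq by simp
  have A: "no_small_forms \<longleftrightarrow> different_HF" using no_small_forms_imp different_HF_imp by blast
  \<comment> \<open>The CB property matters here: if the component of S at some q lay in V_(r-1),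
    the conductor would also contain x_0^(r-1) times that component.\<close>
  have power: "ideal_power (Remb n I) (conductor n I) n = Tail (n * r)" if "CB_scheme n I"
    using conductor_eq ideal_power_Tail[of n] that n_ge_2 unfolding CB_iff[OF r] by simp
  have "different_HF \<longleftrightarrow> CB_scheme n I \<and>
      emb n I ` kaehler_different n I Fs = ideal_power (Remb n I) (conductor n I) n"
  proof
    assume HF: different_HF
    then have "CB_scheme n I" unfolding CB_iff[OF r] using no_small_forms_large_degree[OF _ _ r] A by blast
    then show "CB_scheme n I \<and> emb n I ` kaehler_different n I Fs = ideal_power (Remb n I) (conductor n I) n"
      using power emb_different_iff HF by simp
  next
    assume "CB_scheme n I \<and> emb n I ` kaehler_different n I Fs = ideal_power (Remb n I) (conductor n I) n"
    then show different_HF using power emb_different_iff by simp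
  qed
  then show ?thesis unfolding b generic_iff A by blast
qed

end
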